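(* Let $p$ be a Dini-smooth boundary point of a planar domain $D\subset\mathbb C$. Then there exists a neighborhood $U_0$ of $p$ such that for any neighborhoods $V\subset\subset U\subset U_0$ of $p$ with $D_U$ connected, one may find $C>0$ such that $$0\le k_{D_U}(z,w)-c_D(z,w)\le C|z-w|\left(|z-w|+\delta_D(z)^{1/2}\delta_D(w)^{1/2}\right),\quad z,w\in D_V.$$
   Context: $D_U:=D\cap U$. $V\subset\subset U$ means that $V$ is relatively compact in $U$. $\mathbb D$ is the unit disc; $\mathcal O(X,Y)$ is the set of holomorphic maps from $X$ to $Y$; $\delta_D(z)$ is the Euclidean distance from $z\in D$ to $\mathbb C\setminus D$. The Kobayashi–Royden (pseudo)metric is $\kappa_D(z;X)=\inf\{|\alpha|:\exists\varphi\in\mathcal O(\mathbb D,D):\varphi(0)=z,\ \alpha\varphi'(0)=X\}$, and the Kobayashi (pseudo)distance is $k_D(x,y)=\inf_\sigma\int_a^b\kappa_D(\sigma(t);\sigma'(t))\,dt$, the infimum being over all absolutely continuous curves $\sigma:[a,b]\to D$ with $\sigma(a)=x$, $\sigma(b)=y$. The Carathéodory distance is $c_D(z,w):=\sup\{\tanh^{-1}\alpha:\alpha\in[0,1)\text{ and }\exists f\in\mathcal O(D,\mathbb D):f(z)=0,f(w)=\alpha\}$. A boundary point $p$ of $D$ is Dini-smooth if, near $p$, $\partial D$ is a Dini-smooth curve bounding $D$ on one side, i.e. a regular $\mathcal C^1$ curve whose parametrization has a Dini-continuous derivative (modulus of continuity $\omega$ with $\int_0^1\omega(t)\,dt/t<\infty$).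 *)

theory Defs
  imports "HOL-Complex_Analysis.Complex_Analysis"
begin

definition holo_maps :: "complex set \<Rightarrow> complex set \<Rightarrow> (complex \<Rightarrow> complex) set" where
  "holo_maps X Y = {f. f holomorphic_on X \<and> f ` X \<subseteq> Y}"

definition kobayashi_metric :: "complex set \<Rightarrow> complex \<Rightarrow> complex \<Rightarrow> real" where
  "kobayashi_metric D z X =
     Inf {norm \<alpha> | \<alpha>. \<exists>\<phi>\<in>holo_maps (ball 0 1) D. \<phi> 0 = z \<and> \<alpha> * deriv \<phi> 0 = X}"

text \<open>Epsilon-delta absolute continuity on \<open>[a, b]\<close>; the finite families of non-overlapping
  closed subintervals are the divisions of subsets of \<open>[a, b]\<close>.\<close>
definition absolutely_continuous_curve :: "real \<Rightarrow> real \<Rightarrow> (real \<Rightarrow> complex) \<Rightarrow> bool" where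
  "absolutely_continuous_curve a b \<sigma> \<longleftrightarrow>
     (\<forall>\<epsilon>>0. \<exists>\<delta>>0. \<forall>d S. d division_of S \<and> S \<subseteq> {a..b} \<and> (\<Sum>K\<in>d. Sup K - Inf K) < \<delta>
        \<longrightarrow> (\<Sum>K\<in>d. dist (\<sigma> (Sup K)) (\<sigma> (Inf K))) < \<epsilon>)"

text \<open>The derivative of an absolutely continuous curve exists almost everywhere, so the
  unspecified value of \<^const>\<open>vector_derivative\<close> elsewhere does not matter.\<close>
definition kobayashi_length :: "complex set \<Rightarrow> real \<Rightarrow> real \<Rightarrow> (real \<Rightarrow> complex) \<Rightarrow> ennreal" where
  "kobayashi_length D a b \<sigma> =
     (\<integral>\<^sup>+t\<in>{a..b}. ennreal (kobayashi_metric D (\<sigma> t) (vector_derivative \<sigma> (at t within {a..b})))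
        \<partial>lebesgue)"

text \<open>Points of a domain are joined by curves of finite length, so that on a domain
  \<^const>\<open>enn2real\<close> does not lose information.\<close>
definition kobayashi_dist :: "complex set \<Rightarrow> complex \<Rightarrow> complex \<Rightarrow> real" where
  "kobayashi_dist D x y =
     enn2real (Inf {kobayashi_length D a b \<sigma> | a b \<sigma>.
       a < b \<and> absolutely_continuous_curve a b \<sigma> \<and> \<sigma> ` {a..b} \<subseteq> D \<and> \<sigma> a = x \<and> \<sigma> b = y})"

text \<open>On a domain the supremum is over a set that contains 0 and is bounded above (by the
  Kobayashi distance).\<close>
definition caratheodory_dist :: "complex set \<Rightarrow> complex \<Rightarrow> complex \<Rightarrow> real" where
  "caratheodory_dist D z w =
     Sup {artanh \<alpha> | \<alpha> :: real. \<alpha> \<in> {0..<1} \<and>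
       (\<exists>f\<in>holo_maps D (ball 0 1). f z = 0 \<and> f w = complex_of_real \<alpha>)}"

definition boundary_dist :: "complex set \<Rightarrow> complex \<Rightarrow> real" where
  "boundary_dist D z = infdist z (- D)"

definition modulus_of_continuity :: "real set \<Rightarrow> (real \<Rightarrow> complex) \<Rightarrow> real \<Rightarrow> ennreal" where
  "modulus_of_continuity S f t =
     (SUP (x, y) \<in> {(x, y). x \<in> S \<and> y \<in> S \<and> dist x y \<le> t}. ennreal (dist (f x) (f y)))"

text \<open>Dini continuity includes uniform continuity: if the modulus of continuity, which is
  monotone, does not tend to 0 at 0, then the integral is infinite.\<close>
definition dini_continuous_on :: "real set \<Rightarrow> (real \<Rightarrow> complex) \<Rightarrow> bool" where
  "dini_continuous_on S f \<longleftrightarrow>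
     (\<integral>\<^sup>+t\<in>{0<..1}. modulus_of_continuity S f t / ennreal t \<partial>lborel) < \<infinity>"

text \<open>Inside a neighbourhood \<open>N\<close> of \<open>p\<close> the boundary of \<open>D\<close> is a simple regular arc \<open>\<gamma>\<close> through
  \<open>p\<close> with Dini-continuous derivative. The last conjunct says that \<open>D\<close> lies on exactly one side
  of the arc: \<open>\<i> * \<gamma>' t\<close> is the left normal, and reversing \<open>\<gamma>\<close> exchanges left and right, so
  having \<open>D\<close> on the left is no restriction.\<close>
definition dini_smooth_boundary_point :: "complex set \<Rightarrow> complex \<Rightarrow> bool" where
  "dini_smooth_boundary_point D p \<longleftrightarrow>
     (\<exists>N \<gamma> \<gamma>'. open N \<and> p \<in> N \<and> arc \<gamma> \<and> p \<in> \<gamma> ` {0<..<1} \<and>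
        frontier D \<inter> N = path_image \<gamma> \<inter> N \<and>
        (\<forall>t\<in>{0..1}. (\<gamma> has_vector_derivative \<gamma>' t) (at t within {0..1}) \<and> \<gamma>' t \<noteq> 0) \<and>
        dini_continuous_on {0..1} \<gamma>' \<and>
        (\<forall>t\<in>{0<..<1}. \<gamma> t \<in> N \<longrightarrow>
           (\<exists>e>0. \<forall>s\<in>{0<..<e}.
              \<gamma> t + of_real s * (\<i> * \<gamma>' t) \<in> D \<and> \<gamma> t - of_real s * (\<i> * \<gamma>' t) \<notin> D)))"

definition relatively_compact_in :: "complex set \<Rightarrow> complex set \<Rightarrow> bool" where
  "relatively_compact_in V U \<longleftrightarrow> compact (closure V) \<and> closure V \<subseteq> U"

end

theory Submission imports Defs begin

text \<open>A conformal map from a Dini-smooth boundary piece of a domain onto a half-disc is bi-Lipschitz up to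
  the boundary. Such a map is available even when \<open>D\<close> is not simply connected: there is
  a compact set \<open>K\<close>, disjoint from \<open>D\<close> and equal to the complement of \<open>D\<close> near \<open>p\<close>, whose
  complement in the sphere is simply connected. The Riemann map \<open>\<Psi>\<close> of that complement is defined on all of \<open>D\<close>,
  so it bounds the Caratheodory distance of \<open>D\<close> from below by the hyperbolic distance \<open>h\<close> of the images in
  the half-plane. Conversely, a localization argument in the half-plane, pulled back by \<open>\<Psi>\<close>, bounds the
  Kobayashi distance of \<open>D \<inter> U\<close> from above by \<open>h\<close> plus an error of the required size, because two
  points of a half-disc are joined inside it by a curve whose length exceeds \<open>h\<close> only to second
  order. The bounds on \<open>\<Psi>'\<close> come from barriers at each boundary point: explicit
  holomorphic maps \<open>F w = w * exp (P w)\<close> of the half-plane that bend its boundary by an angle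
  summable over the dyadic scales.\<close>

section \<open>Absolutely continuous curves\<close>

text \<open>The half-disc has an explicit Riemann map, and its hyperbolic distance exceeds
  \<open>hdist x y\<close> by at most |x - y| |x - cnj y|. As |x - cnj y| \<le> |x - y| + 2 sqrt (Im
  x * Im y), this is the right-hand side of the theorem read in the chart. The distance h enters the
  lower bound for the Caratheodory distance and the upper bound for the Kobayashi distance with the
  same coefficient 1 and cancels, so the bi-Lipschitz constant affects only the error. Two obstacles
  shape the rest. Curves are merely absolutely continuous, so even 0 \<le> k - c needs the
  fundamental theorem of calculus for them; it comes from total variation, Stieltjes measures and
  Radon-Nikodym. And the bounds on \<Psi>' must be uniform over boundary points: one barrier F
  serves all of them after translation and rotation, and \<Psi> is normalised at infinity, where all
  barriers take the same value. The factor 2 between the slopes c / 200 and c / 100 and the shift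
  from j to j + 1 leave room for distortion and for a change of dyadic level.\<close>

lemma division_of_real_element:
  fixes d :: "real set set"
  assumes "d division_of S" "K \<in> d"
  shows "Inf K \<le> Sup K" "K = {Inf K..Sup K}" "K \<subseteq> S"
proof -
  obtain l u where K: "K = cbox l u" "K \<noteq> {}"
    using division_ofD(3,4)[OF assms] by blast
  then have "l \<le> u" by auto
  then show "Inf K \<le> Sup K" "K = {Inf K..Sup K}" using K by auto
  show "K \<subseteq> S" using division_ofD(2)[OF assms] .
qed

text \<open>Each \<open>{p K..q K}\<close> stays in its own \<open>K\<close>, so the new intervals
  keep disjoint interiors; after dropping degenerate ones the interiors are nonempty, the passage to
  the new intervals is injective, and sums can be reindexed. An arbitrary \<psi> vanishing on the
  diagonal lets one division serve for sums of lengths and for sums of increments.\<close>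

lemma division_of_shrink:
  fixes d :: "real set set" and p q :: "real set \<Rightarrow> real"
  assumes d: "d division_of S" and le: "\<And>K. K \<in> d \<Longrightarrow> p K \<le> q K"
    and sub: "\<And>K. K \<in> d \<Longrightarrow> p K < q K \<Longrightarrow> {p K..q K} \<subseteq> K \<inter> T"
  obtains d' where "d' division_of (\<Union>d')" "\<Union>d' \<subseteq> T"
    "\<And>\<psi>::real\<Rightarrow>real\<Rightarrow>real. (\<And>x. \<psi> x x = 0) \<Longrightarrow> (\<Sum>K\<in>d'. \<psi> (Inf K) (Sup K)) = (\<Sum>K\<in>d. \<psi> (p K) (q K))"
proof -
  define e where "e = {K\<in>d. p K < q K}"
  define r where "r K = {p K..q K}" for K
  have fin: "finite d" using d by auto
  have int: "interior (r K) \<inter> interior (r K') = {}" if "K \<in> e" "K' \<in> e" "K \<noteq> K'" for K K'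
  proof -
    have "r K \<subseteq> K" "r K' \<subseteq> K'" using sub that by (auto simp: e_def r_def)
    then have "interior (r K) \<subseteq> interior K" "interior (r K') \<subseteq> interior K'" using interior_mono by blast+
    moreover have "interior K \<inter> interior K' = {}" using division_ofD(5)[OF d] that by (auto simp: e_def)
    ultimately show ?thesis by blast
  qed
  have ne: "interior (r K) \<noteq> {}" if "K \<in> e" for K using that by (auto simp: e_def r_def)
  have inj: "inj_on r e"
    by (rule inj_onI) (metis int ne Int_absorb)
  show thesis
  proof
    show "(r ` e) division_of \<Union>(r ` e)"
    proof (rule division_ofI)
      show "finite (r ` e)" using fin by (auto simp: e_def)
      fix K assume "K \<in> r ` e"
      then show "K \<subseteq> \<Union>(r ` e)" "K \<noteq> {}" "\<exists>a b. K = cbox a b" by (auto simp: r_def e_def)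
      fix K' assume "K' \<in> r ` e" "K \<noteq> K'"
      then show "interior K \<inter> interior K' = {}" using \<open>K \<in> r ` e\<close> int by blast
    qed auto
    show "\<Union>(r ` e) \<subseteq> T" using sub by (auto simp: r_def e_def)
    fix \<psi> :: "real \<Rightarrow> real \<Rightarrow> real" assume 0: "\<And>x. \<psi> x x = 0"
    have "(\<Sum>K\<in>r ` e. \<psi> (Inf K) (Sup K)) = (\<Sum>K\<in>e. \<psi> (p K) (q K))"
      by (subst sum.reindex[OF inj]) (auto intro!: sum.cong simp: r_def e_def)
    also have "\<dots> = (\<Sum>K\<in>d. \<psi> (p K) (q K))"
      by (rule sum.mono_neutral_left) (use fin le 0 in \<open>auto simp: e_def, (metis order.order_iff_strict)\<close>)
    finally show "(\<Sum>K\<in>r ` e. \<psi> (Inf K) (Sup K)) = (\<Sum>K\<in>d. \<psi> (p K) (q K))" .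
  qed
qed

section \<open>Total variation of an absolutely continuous curve\<close>

definition variation_sums :: "(real \<Rightarrow> complex) \<Rightarrow> real \<Rightarrow> real \<Rightarrow> real set" where
  "variation_sums f x y = {\<Sum>K\<in>d. dist (f (Sup K)) (f (Inf K)) | d S. d division_of S \<and> S \<subseteq> {x..y}}"

definition variation :: "(real \<Rightarrow> complex) \<Rightarrow> real \<Rightarrow> real \<Rightarrow> real" where
  "variation f x y = Sup (variation_sums f x y)"

lemma variation_sumsI:
  "d division_of S \<Longrightarrow> S \<subseteq> {x..y} \<Longrightarrow> (\<Sum>K\<in>d. dist (f (Sup K)) (f (Inf K))) \<in> variation_sums f x y"
  unfolding variation_sums_def by (intro CollectI exI conjI) (rule refl)

lemma variation_sumsE:
  assumes "s \<in> variation_sums f x y"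
  obtains d S where "d division_of S" "S \<subseteq> {x..y}" "s = (\<Sum>K\<in>d. dist (f (Sup K)) (f (Inf K)))"
  using assms unfolding variation_sums_def by (elim CollectE exE conjE)

lemma variation_sums_zero: "0 \<in> variation_sums f x y"
  unfolding variation_sums_def by (rule CollectI, intro exI[of _ "{}"] exI[of _ "{}"]) auto

text \<open>Every interval is cut at m by \<open>min m\<close> and \<open>max m\<close>. The
  increment of f over an interval is the sum of the increments over the two clamped pieces, and a
  piece on the wrong side of m degenerates to a point with increment 0.\<close>

lemma variation_sums_split:
  assumes "s \<in> variation_sums f x y" "x \<le> m" "m \<le> y"
  obtains s1 s2 where "s1 \<in> variation_sums f x m" "s2 \<in> variation_sums f m y" "s \<le> s1 + s2"
proof -
  obtain d S where d: "d division_of S" "S \<subseteq> {x..y}" and s: "s = (\<Sum>K\<in>d. dist (f (Sup K)) (f (Inf K)))"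
    by (rule variation_sumsE[OF assms(1)])
  note el = division_of_real_element[OF d(1)]
  obtain d1 where d1: "d1 division_of (\<Union>d1)" "\<Union>d1 \<subseteq> {x..m}" and s1:
    "\<And>\<psi>::real\<Rightarrow>real\<Rightarrow>real. (\<And>x. \<psi> x x = 0) \<Longrightarrow> (\<Sum>K\<in>d1. \<psi> (Inf K) (Sup K)) = (\<Sum>K\<in>d. \<psi> (min m (Inf K)) (min m (Sup K)))"
  proof (rule division_of_shrink[OF d(1), of "\<lambda>K. min m (Inf K)" "\<lambda>K. min m (Sup K)" "{x..m}"])
    fix K assume K: "K \<in> d"
    show "min m (Inf K) \<le> min m (Sup K)" using el(1)[OF K] by auto
    have "K \<subseteq> {x..y}" using el(3)[OF K] d(2) by blast
    then have "x \<le> Inf K" using el(1,2)[OF K] by (metis atLeastAtMost_iff order_refl subsetD)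
    moreover assume "min m (Inf K) < min m (Sup K)"
    ultimately show "{min m (Inf K)..min m (Sup K)} \<subseteq> K \<inter> {x..m}" 
      by (subst el(2)[OF K]) (auto simp: min_def split: if_splits)
  qed blast
  obtain d2 where d2: "d2 division_of (\<Union>d2)" "\<Union>d2 \<subseteq> {m..y}" and s2:
    "\<And>\<psi>::real\<Rightarrow>real\<Rightarrow>real. (\<And>x. \<psi> x x = 0) \<Longrightarrow> (\<Sum>K\<in>d2. \<psi> (Inf K) (Sup K)) = (\<Sum>K\<in>d. \<psi> (max m (Inf K)) (max m (Sup K)))"
  proof (rule division_of_shrink[OF d(1), of "\<lambda>K. max m (Inf K)" "\<lambda>K. max m (Sup K)" "{m..y}"])
    fix K assume K: "K \<in> d"
    show "max m (Inf K) \<le> max m (Sup K)" using el(1)[OF K] by auto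
    have "K \<subseteq> {x..y}" using el(3)[OF K] d(2) by blast
    then have "Sup K \<le> y" using el(1,2)[OF K] by (metis atLeastAtMost_iff order_refl subsetD)
    moreover assume "max m (Inf K) < max m (Sup K)"
    ultimately show "{max m (Inf K)..max m (Sup K)} \<subseteq> K \<inter> {m..y}" 
      by (subst el(2)[OF K]) (auto simp: max_def split: if_splits)
  qed blast
  let ?\<psi> = "\<lambda>x y. dist (f y) (f x)"
  have "s \<le> (\<Sum>K\<in>d. dist (f (min m (Sup K))) (f (min m (Inf K))) + dist (f (max m (Sup K))) (f (max m (Inf K))))"
    unfolding s
  proof (rule sum_mono)
    fix K assume "K \<in> d"
    have "f (Sup K) - f (Inf K) = (f (min m (Sup K)) - f (min m (Inf K))) + (f (max m (Sup K)) - f (max m (Inf K)))"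
      by (auto simp: min_def max_def)
    then show "dist (f (Sup K)) (f (Inf K)) \<le> dist (f (min m (Sup K))) (f (min m (Inf K))) + dist (f (max m (Sup K))) (f (max m (Inf K)))"
      unfolding dist_norm by (metis norm_triangle_ineq)
  qed
  also have "\<dots> = (\<Sum>K\<in>d1. dist (f (Sup K)) (f (Inf K))) + (\<Sum>K\<in>d2. dist (f (Sup K)) (f (Inf K)))"
    using s1[of ?\<psi>] s2[of ?\<psi>] by (simp add: sum.distrib)
  finally have le: "s \<le> (\<Sum>K\<in>d1. dist (f (Sup K)) (f (Inf K))) + (\<Sum>K\<in>d2. dist (f (Sup K)) (f (Inf K)))" .
  have "(\<Sum>K\<in>d1. dist (f (Sup K)) (f (Inf K))) \<in> variation_sums f x m"
    by (rule variation_sumsI[OF d1])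
  moreover have "(\<Sum>K\<in>d2. dist (f (Sup K)) (f (Inf K))) \<in> variation_sums f m y"
    by (rule variation_sumsI[OF d2])
  ultimately show thesis using le by (rule that)
qed

lemma absolutely_continuous_curveD:
  assumes "absolutely_continuous_curve a b f" "\<epsilon> > 0"
  obtains \<delta> where "\<delta> > 0" "\<And>d S. d division_of S \<Longrightarrow> S \<subseteq> {a..b} \<Longrightarrow> (\<Sum>K\<in>d. Sup K - Inf K) < \<delta> \<Longrightarrow>
      (\<Sum>K\<in>d. dist (f (Sup K)) (f (Inf K))) < \<epsilon>"
proof -
  have "\<exists>\<delta>>0. \<forall>d S. d division_of S \<and> S \<subseteq> {a..b} \<and> (\<Sum>K\<in>d. Sup K - Inf K) < \<delta> \<longrightarrow>
      (\<Sum>K\<in>d. dist (f (Sup K)) (f (Inf K))) < \<epsilon>"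
    using assms unfolding absolutely_continuous_curve_def by simp
  then obtain \<delta> where "\<delta> > 0" and \<delta>: "\<forall>d S. d division_of S \<and> S \<subseteq> {a..b} \<and> (\<Sum>K\<in>d. Sup K - Inf K) < \<delta> \<longrightarrow>
      (\<Sum>K\<in>d. dist (f (Sup K)) (f (Inf K))) < \<epsilon>"
    by (elim exE conjE)
  then show thesis by (intro that[of \<delta>]) auto
qed

lemma division_of_real_length:
  fixes d :: "real set set"
  assumes "d division_of S" "S \<subseteq> {x..y}" "x \<le> y"
  shows "(\<Sum>K\<in>d. Sup K - Inf K) \<le> y - x"
proof -
  have "(\<Sum>K\<in>d. Sup K - Inf K) = (\<Sum>K\<in>d. measure lborel K)"
    by (rule sum.cong, simp) (metis division_of_real_element(1,2)[OF assms(1)] content_real)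
  also have "\<dots> \<le> measure lborel (cbox x y)"
    using subadditive_content_division[of d S x y] assms by simp
  finally show ?thesis using assms by simp
qed

text \<open>Bisection: on intervals shorter than the \<delta> belonging to \<epsilon> = 1 all
  variation sums are at most 1, and boundedness passes from two adjacent intervals to their
  union.\<close>

lemma absolutely_continuous_curve_bounded_variation:
  assumes ac: "absolutely_continuous_curve a b f" and "a \<le> b"
  shows "bdd_above (variation_sums f a b)"
proof -
  obtain \<delta> where \<delta>: "\<delta> > 0" "\<And>d S. d division_of S \<Longrightarrow> S \<subseteq> {a..b} \<Longrightarrow> (\<Sum>K\<in>d. Sup K - Inf K) < \<delta> \<Longrightarrow>
      (\<Sum>K\<in>d. dist (f (Sup K)) (f (Inf K))) < 1"
    using absolutely_continuous_curveD[OF ac, of 1] by auto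
  have "a \<le> a \<longrightarrow> b \<le> b \<longrightarrow> bdd_above (variation_sums f a b)"
    using \<open>a \<le> b\<close>
  proof (induction rule: Bolzano[where P="\<lambda>x y. a \<le> x \<longrightarrow> y \<le> b \<longrightarrow> bdd_above (variation_sums f x y)", consumes 1, case_names trans local])
    case (trans x m y)
    show ?case
    proof (intro impI)
      assume "a \<le> x" "y \<le> b"
      then obtain B1 B2 where "\<And>s. s \<in> variation_sums f x m \<Longrightarrow> s \<le> B1" "\<And>s. s \<in> variation_sums f m y \<Longrightarrow> s \<le> B2"
        using trans by (auto simp: bdd_above_def)
      then have "s \<le> B1 + B2" if "s \<in> variation_sums f x y" for s
        using variation_sums_split[OF that trans(3,4)] by (metis add_mono order_trans)
      then show "bdd_above (variation_sums f x y)" by (auto simp: bdd_above_def)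
    qed
  next
    case (local x)
    show ?case
    proof (intro exI[of _ \<delta>] conjI allI impI)
      fix c d assume 1: "c \<le> x \<and> x \<le> d \<and> d - c < \<delta>" and 2: "a \<le> c" "d \<le> b"
      have "s \<le> 1" if sv: "s \<in> variation_sums f c d" for s
      proof -
        obtain D S where d: "D division_of S" "S \<subseteq> {c..d}" and s: "s = (\<Sum>K\<in>D. dist (f (Sup K)) (f (Inf K)))"
          by (rule variation_sumsE[OF sv])
        have "(\<Sum>K\<in>D. Sup K - Inf K) < \<delta>" using division_of_real_length[OF d] 1 by auto
        then show ?thesis using \<delta>(2)[OF d(1)] d 2 s by fastforce
      qed
      then show "bdd_above (variation_sums f c d)" by (auto simp: bdd_above_def)
    qed (use \<delta> in auto)
  qed
  then show ?thesis by auto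
qed

lemma variation_sums_mono: "x' \<le> x \<Longrightarrow> y \<le> y' \<Longrightarrow> variation_sums f x y \<subseteq> variation_sums f x' y'"
  unfolding variation_sums_def by (intro Collect_mono impI, elim exE conjE, intro exI conjI, assumption+) force

text \<open>Any division inside {a..x} can be enlarged by the single interval {x..y}.\<close>

lemma variation_diff_ge:
  assumes ac: "absolutely_continuous_curve a b f" and xy: "a \<le> x" "x \<le> y" "y \<le> b"
  shows "dist (f x) (f y) \<le> variation f a y - variation f a x"
proof (cases "x = y")
  case False
  then have "x < y" using xy by auto
  have bd: "bdd_above (variation_sums f a z)" if "z \<le> b" for z
    by (rule bdd_above_mono[OF absolutely_continuous_curve_bounded_variation[OF ac] variation_sums_mono])
      (use that xy in auto)
  have "variation f a x \<le> variation f a y - dist (f x) (f y)"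
    unfolding variation_def[of f a x]
  proof (rule cSup_least)
    fix s assume sv: "s \<in> variation_sums f a x"
    obtain d S where d: "d division_of S" "S \<subseteq> {a..x}" and s: "s = (\<Sum>K\<in>d. dist (f (Sup K)) (f (Inf K)))"
      by (rule variation_sumsE[OF sv])
    have nin: "{x..y} \<notin> d"
      using division_of_real_element(3)[OF d(1), of "{x..y}"] d(2) \<open>x < y\<close>
      by (metis atLeastAtMost_iff less_imp_le not_le order_refl subset_iff)
    have dv: "(insert {x..y} d) division_of ({x..y} \<union> S)"
    proof -
      have "interior {x..y} \<inter> interior S = {}"
        using interior_mono[OF d(2)] by auto
      then show ?thesis
        using division_disjoint_union[of "{{x..y}}" "{x..y}" d S] d(1) division_of_self[of x y] \<open>x < y\<close>
        by simp
    qed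
    have "(\<Sum>K\<in>insert {x..y} d. dist (f (Sup K)) (f (Inf K))) \<in> variation_sums f a y"
      by (rule variation_sumsI[OF dv]) (use d(2) xy in auto)
    then have "(\<Sum>K\<in>insert {x..y} d. dist (f (Sup K)) (f (Inf K))) \<le> variation f a y"
      unfolding variation_def using bd xy by (intro cSup_upper) auto
    moreover have "finite d" using d by auto
    ultimately show "s \<le> variation f a y - dist (f x) (f y)"
      using nin s \<open>x < y\<close> by (simp add: dist_commute)
  qed (use variation_sums_zero in blast)
  then show ?thesis by simp
qed simp

text \<open>Cutting at x bounds the variation up to y by the variation up to x plus a variation sum
  over {x..y}. The slack \<eta> allows a concrete division to be extracted although the supremum
  need not be attained.\<close>

lemma variation_diff_less:
  assumes ac: "absolutely_continuous_curve a b f" and xy: "a \<le> x" "x \<le> y" "y \<le> b" and "\<eta> > 0"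
  shows "\<exists>s\<in>variation_sums f x y. variation f a y - variation f a x < s + \<eta>"
proof (rule ccontr)
  assume c: "\<not> ?thesis"
  have bd: "bdd_above (variation_sums f a z)" if "z \<le> b" for z
    by (rule bdd_above_mono[OF absolutely_continuous_curve_bounded_variation[OF ac] variation_sums_mono])
      (use that xy in auto)
  have le: "s \<le> variation f a y - variation f a x - \<eta>" if sv: "s \<in> variation_sums f x y" for s
    using c sv by force
  have "variation f a y \<le> variation f a x + (variation f a y - variation f a x - \<eta>)"
    unfolding variation_def[of f a y]
  proof (rule cSup_least)
    fix s assume "s \<in> variation_sums f a y"
    then obtain s1 s2 where s: "s1 \<in> variation_sums f a x" "s2 \<in> variation_sums f x y" "s \<le> s1 + s2"
      using variation_sums_split xy by metis
    have "s1 \<le> variation f a x" unfolding variation_def using bd s xy by (intro cSup_upper) auto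
    then show "s \<le> variation f a x + (Sup (variation_sums f a y) - variation f a x - \<eta>)"
      using s le[OF s(2)] unfolding variation_def by linarith
  qed (use variation_sums_zero in blast)
  then show False using \<open>\<eta> > 0\<close> by auto
qed

text \<open>Replacing each interval of a division by a nearly optimal division of it does not
  increase the total length, so the \<delta> that controls the increments of f also controls those
  of its variation.\<close>

lemma absolutely_continuous_variation:
  assumes ac: "absolutely_continuous_curve a b f" and "a \<le> b"
  shows "absolutely_continuous_curve a b (\<lambda>x. of_real (variation f a x))"
  unfolding absolutely_continuous_curve_def
proof (intro allI impI)
  fix \<epsilon> :: real assume "\<epsilon> > 0"
  obtain \<delta> where \<delta>: "\<delta> > 0" "\<And>d S. d division_of S \<Longrightarrow> S \<subseteq> {a..b} \<Longrightarrow> (\<Sum>K\<in>d. Sup K - Inf K) < \<delta> \<Longrightarrow>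
      (\<Sum>K\<in>d. dist (f (Sup K)) (f (Inf K))) < \<epsilon>/2"
    using absolutely_continuous_curveD[OF ac, of "\<epsilon>/2"] \<open>\<epsilon> > 0\<close> by auto
  show "\<exists>\<delta>>0. \<forall>d S. d division_of S \<and> S \<subseteq> {a..b} \<and> (\<Sum>K\<in>d. Sup K - Inf K) < \<delta> \<longrightarrow>
       (\<Sum>K\<in>d. dist (complex_of_real (variation f a (Sup K))) (complex_of_real (variation f a (Inf K)))) < \<epsilon>"
  proof (intro exI[of _ \<delta>] conjI allI impI, fact)
    fix d S assume "d division_of S \<and> S \<subseteq> {a..b} \<and> (\<Sum>K\<in>d. Sup K - Inf K) < \<delta>"
    then have d: "d division_of S" "S \<subseteq> {a..b}" "(\<Sum>K\<in>d. Sup K - Inf K) < \<delta>" by auto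
    note el = division_of_real_element[OF d(1)]
    have fin: "finite d" using d by auto
    \<comment> \<open>The \<open>card d\<close> slacks add up to at most \<epsilon>/2; adding 1 in
      the denominator covers the empty division.\<close>
    define \<eta> where "\<eta> = \<epsilon> / (2 * (card d + 1))"
    have "\<eta> > 0" using \<open>\<epsilon> > 0\<close> by (simp add: \<eta>_def)
    have rng: "a \<le> Inf K" "Sup K \<le> b" if "K \<in> d" for K
      using el[OF that] d(2) by (metis atLeastAtMost_iff order_refl subset_iff)+
    have "\<exists>e. e division_of (\<Union>e) \<and> \<Union>e \<subseteq> K \<and>
        variation f a (Sup K) - variation f a (Inf K) < (\<Sum>L\<in>e. dist (f (Sup L)) (f (Inf L))) + \<eta>" if Kd: "K \<in> d" for K
    proof -
      obtain s where s: "s \<in> variation_sums f (Inf K) (Sup K)" "variation f a (Sup K) - variation f a (Inf K) < s + \<eta>"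
        using variation_diff_less[OF ac rng(1)[OF Kd] el(1)[OF Kd] rng(2)[OF Kd] \<open>\<eta> > 0\<close>] by blast
      obtain e S where "e division_of S" "S \<subseteq> {Inf K..Sup K}" "s = (\<Sum>L\<in>e. dist (f (Sup L)) (f (Inf L)))"
        by (rule variation_sumsE[OF s(1)])
      then show ?thesis using s(2) el(2)[OF Kd] by (metis division_ofD(6))
    qed
    then obtain e where e: "\<And>K. K \<in> d \<Longrightarrow> e K division_of (\<Union>(e K))" "\<And>K. K \<in> d \<Longrightarrow> \<Union>(e K) \<subseteq> K"
      and ev: "\<And>K. K \<in> d \<Longrightarrow> variation f a (Sup K) - variation f a (Inf K) < (\<Sum>L\<in>e K. dist (f (Sup L)) (f (Inf L))) + \<eta>"
      by metis
    \<comment> \<open>Degenerate intervals are removed because one endpoint, as a point interval,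
      could occur in the refinements of two adjacent intervals and the union would not be
      disjoint.\<close>
    define E where "E = (\<Union>K\<in>d. {L \<in> e K. Inf L < Sup L})"
    have inti: "interior L \<inter> interior L' = {}" if "K \<in> d" "K' \<in> d" "L \<in> e K" "L' \<in> e K'" "K \<noteq> K'" for K K' L L'
    proof -
      have "L \<subseteq> K" "L' \<subseteq> K'" using e(2) that by auto
      then have "interior L \<subseteq> interior K" "interior L' \<subseteq> interior K'" using interior_mono by blast+
      then show ?thesis using division_ofD(5)[OF d(1) that(1,2,5)] by blast
    qed
    have neL: "interior L \<noteq> {}" if "K \<in> d" "L \<in> e K" "Inf L < Sup L" for K L
      using division_of_real_element(2)[OF e(1)[OF that(1)] that(2)] that(3) 
      by (metis dense interior_atLeastAtMost_real greaterThanLessThan_iff empty_iff)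
    have dj: "\<forall>K\<in>d. \<forall>K'\<in>d. K \<noteq> K' \<longrightarrow> {L \<in> e K. Inf L < Sup L} \<inter> {L \<in> e K'. Inf L < Sup L} = {}"
    proof (intro ballI impI, rule ccontr)
      fix K K' assume K: "K \<in> d" "K' \<in> d" "K \<noteq> K'" and "{L \<in> e K. Inf L < Sup L} \<inter> {L \<in> e K'. Inf L < Sup L} \<noteq> {}"
      then obtain L where L: "L \<in> e K" "L \<in> e K'" "Inf L < Sup L" by blast
      show False using inti[OF K(1,2) L(1,2) K(3)] neL[OF K(1) L(1,3)] by simp
    qed
    have finE: "finite (e K)" if "K \<in> d" for K using e(1)[OF that] by auto
    have E: "E division_of (\<Union>E)"
    proof (rule division_ofI)
      show "finite E" using fin finE by (auto simp: E_def)
      fix L assume L: "L \<in> E"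
      then obtain K where K: "K \<in> d" "L \<in> e K" by (auto simp: E_def)
      show "L \<noteq> {}" "\<exists>a b. L = cbox a b" using division_ofD(3,4)[OF e(1)[OF K(1)] K(2)] by auto
      show "L \<subseteq> \<Union>E" using L by auto
      fix L' assume "L' \<in> E" "L \<noteq> L'"
      then obtain K' where K': "K' \<in> d" "L' \<in> e K'" by (auto simp: E_def)
      show "interior L \<inter> interior L' = {}"
      proof (cases "K = K'")
        case True
        then show ?thesis using division_ofD(5)[OF e(1)[OF K(1)] K(2), of L'] K' \<open>L \<noteq> L'\<close> by auto
      next
        case False then show ?thesis using inti K K' by blast
      qed
    qed auto
    have sumE: "(\<Sum>L\<in>E. \<psi> (Inf L) (Sup L)) = (\<Sum>K\<in>d. \<Sum>L\<in>e K. \<psi> (Inf L) (Sup L))" if 0: "\<And>x. \<psi> x x = 0" for \<psi> :: "real\<Rightarrow>real\<Rightarrow>real"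
    proof -
      have "(\<Sum>L\<in>E. \<psi> (Inf L) (Sup L)) = (\<Sum>K\<in>d. \<Sum>L\<in>{L \<in> e K. Inf L < Sup L}. \<psi> (Inf L) (Sup L))"
        unfolding E_def by (rule sum.UNION_disjoint) (use fin finE dj in auto)
      also have "\<dots> = (\<Sum>K\<in>d. \<Sum>L\<in>e K. \<psi> (Inf L) (Sup L))"
      proof (rule sum.cong[OF refl], rule sum.mono_neutral_left)
        fix K assume K: "K \<in> d"
        show "\<forall>L\<in>e K - {L \<in> e K. Inf L < Sup L}. \<psi> (Inf L) (Sup L) = 0"
          using division_of_real_element(1)[OF e(1)[OF K]] 0 by (auto, metis order.order_iff_strict)
      qed (use finE in auto)
      finally show ?thesis .
    qed
    have "(\<Sum>L\<in>E. Sup L - Inf L) = (\<Sum>K\<in>d. \<Sum>L\<in>e K. Sup L - Inf L)"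
      using sumE[of "\<lambda>x y. y - x"] by simp
    also have "\<dots> \<le> (\<Sum>K\<in>d. Sup K - Inf K)"
      by (rule sum_mono, rule division_of_real_length[OF e(1)]) (use e(2) el in auto)
    finally have "(\<Sum>L\<in>E. dist (f (Sup L)) (f (Inf L))) < \<epsilon>/2"
      using \<delta>(2)[OF E] e(2) el(3) d by (force simp: E_def)
    have "(\<Sum>K\<in>d. dist (complex_of_real (variation f a (Sup K))) (complex_of_real (variation f a (Inf K))))
       \<le> (\<Sum>K\<in>d. (\<Sum>L\<in>e K. dist (f (Sup L)) (f (Inf L))) + \<eta>)"
    proof (rule sum_mono)
      fix K assume K: "K \<in> d"
      have "0 \<le> variation f a (Sup K) - variation f a (Inf K)"
        using variation_diff_ge[OF ac rng(1)[OF K] el(1)[OF K] rng(2)[OF K]] by (smt (verit) zero_le_dist)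
      then show "dist (complex_of_real (variation f a (Sup K))) (complex_of_real (variation f a (Inf K))) \<le> (\<Sum>L\<in>e K. dist (f (Sup L)) (f (Inf L))) + \<eta>"
        using ev[OF K] by (simp add: dist_norm flip: of_real_diff)
    qed
    also have "\<dots> = (\<Sum>L\<in>E. dist (f (Sup L)) (f (Inf L))) + card d * \<eta>"
      using sumE[of "\<lambda>x y. dist (f y) (f x)"] by (simp add: sum.distrib)
    also have "\<dots> < \<epsilon>/2 + \<epsilon>/2"
    proof -
      have "card d * \<eta> \<le> \<epsilon>/2" using \<open>\<epsilon> > 0\<close> by (simp add: \<eta>_def field_simps)
      then show ?thesis using \<open>(\<Sum>L\<in>E. dist (f (Sup L)) (f (Inf L))) < \<epsilon>/2\<close> by linarith
    qed
    finally show "(\<Sum>K\<in>d. dist (complex_of_real (variation f a (Sup K))) (complex_of_real (variation f a (Inf K)))) < \<epsilon>" by simp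
  qed
qed

text \<open>Domination is asked for only at distance below r, so that maps which are Lipschitz
  merely on small balls around the trace may be composed with the curve. The bound r in
  \<open>min (\<epsilon>/C) r\<close> keeps every single increment below that distance.\<close>

lemma absolutely_continuous_curve_dominated:
  assumes ac: "absolutely_continuous_curve a b f" and "C > 0" "r > 0"
    and le: "\<And>x y. a \<le> x \<Longrightarrow> x \<le> y \<Longrightarrow> y \<le> b \<Longrightarrow> dist (f x) (f y) < r \<Longrightarrow> dist (g x) (g y) \<le> C * dist (f x) (f y)"
  shows "absolutely_continuous_curve a b g"
  unfolding absolutely_continuous_curve_def
proof (intro allI impI)
  fix \<epsilon> :: real assume "\<epsilon> > 0"
  obtain \<delta> where \<delta>: "\<delta> > 0" "\<And>d S. d division_of S \<Longrightarrow> S \<subseteq> {a..b} \<Longrightarrow> (\<Sum>K\<in>d. Sup K - Inf K) < \<delta> \<Longrightarrow>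
      (\<Sum>K\<in>d. dist (f (Sup K)) (f (Inf K))) < min (\<epsilon>/C) r"
    using absolutely_continuous_curveD[OF ac, of "min (\<epsilon>/C) r"] \<open>\<epsilon> > 0\<close> \<open>C > 0\<close> \<open>r > 0\<close> by auto
  show "\<exists>\<delta>>0. \<forall>d S. d division_of S \<and> S \<subseteq> {a..b} \<and> (\<Sum>K\<in>d. Sup K - Inf K) < \<delta> \<longrightarrow>
       (\<Sum>K\<in>d. dist (g (Sup K)) (g (Inf K))) < \<epsilon>"
  proof (intro exI[of _ \<delta>] conjI allI impI, fact)
    fix d S assume d: "d division_of S \<and> S \<subseteq> {a..b} \<and> (\<Sum>K\<in>d. Sup K - Inf K) < \<delta>"
    then have lt: "(\<Sum>K\<in>d. dist (f (Sup K)) (f (Inf K))) < min (\<epsilon>/C) r" using \<delta>(2) by blast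
    have "finite d" using d by auto
    have "(\<Sum>K\<in>d. dist (g (Sup K)) (g (Inf K))) \<le> (\<Sum>K\<in>d. C * dist (f (Sup K)) (f (Inf K)))"
    proof (rule sum_mono)
      fix K assume K: "K \<in> d"
      note el = division_of_real_element[OF conjunct1[OF d] K]
      have "a \<le> Inf K" "Sup K \<le> b" using el d by (metis atLeastAtMost_iff order_refl subset_iff)+
      moreover have "dist (f (Sup K)) (f (Inf K)) < r"
        using member_le_sum[OF K, of "\<lambda>K. dist (f (Sup K)) (f (Inf K))"] lt \<open>finite d\<close> by auto
      ultimately show "dist (g (Sup K)) (g (Inf K)) \<le> C * dist (f (Sup K)) (f (Inf K))"
        using le[of "Inf K" "Sup K"] el(1) by (simp add: dist_commute)
    qed
    also have "\<dots> = C * (\<Sum>K\<in>d. dist (f (Sup K)) (f (Inf K)))" by (simp add: sum_distrib_left)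
    also have "\<dots> < C * (\<epsilon>/C)"
      using lt \<open>C > 0\<close> by (intro mult_strict_left_mono) auto
    finally show "(\<Sum>K\<in>d. dist (g (Sup K)) (g (Inf K))) < \<epsilon>" using \<open>C > 0\<close> by simp
  qed
qed

lemma absolutely_continuous_curve_uniform:
  assumes ac: "absolutely_continuous_curve a b f" and "\<epsilon> > 0"
  obtains \<delta> where "\<delta> > 0" "\<And>x y. a \<le> x \<Longrightarrow> x \<le> b \<Longrightarrow> a \<le> y \<Longrightarrow> y \<le> b \<Longrightarrow> dist x y < \<delta> \<Longrightarrow> dist (f x) (f y) < \<epsilon>"
proof -
  obtain \<delta> where \<delta>: "\<delta> > 0" "\<And>d S. d division_of S \<Longrightarrow> S \<subseteq> {a..b} \<Longrightarrow> (\<Sum>K\<in>d. Sup K - Inf K) < \<delta> \<Longrightarrow>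
      (\<Sum>K\<in>d. dist (f (Sup K)) (f (Inf K))) < \<epsilon>"
    using absolutely_continuous_curveD[OF ac \<open>\<epsilon> > 0\<close>] by blast
  have *: "dist (f x) (f y) < \<epsilon>" if "a \<le> x" "x \<le> y" "y \<le> b" "dist x y < \<delta>" for x y
  proof -
    have "{{x..y}} division_of {x..y}" using division_of_self[of x y] that by simp
    from \<delta>(2)[OF this] show ?thesis using that by (simp add: dist_real_def dist_commute)
  qed
  show thesis
  proof (rule that[OF \<delta>(1)])
    fix x y assume "a \<le> x" "x \<le> b" "a \<le> y" "y \<le> b" "dist x y < \<delta>"
    then show "dist (f x) (f y) < \<epsilon>" using *[of x y] *[of y x] by (cases "x \<le> y") (auto simp: dist_commute)
  qed
qed

lemma absolutely_continuous_curve_continuous: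
  assumes "absolutely_continuous_curve a b f"
  shows "continuous_on {a..b} f"
  unfolding continuous_on_iff
proof (intro ballI allI impI)
  fix x \<epsilon> :: real assume "x \<in> {a..b}" "\<epsilon> > 0"
  obtain \<delta> where "\<delta> > 0" "\<And>x y. a \<le> x \<Longrightarrow> x \<le> b \<Longrightarrow> a \<le> y \<Longrightarrow> y \<le> b \<Longrightarrow> dist x y < \<delta> \<Longrightarrow> dist (f x) (f y) < \<epsilon>"
    using absolutely_continuous_curve_uniform[OF assms \<open>\<epsilon> > 0\<close>] by blast
  then show "\<exists>d>0. \<forall>x'\<in>{a..b}. dist x' x < d \<longrightarrow> dist (f x') (f x) < \<epsilon>"
    using \<open>x \<in> {a..b}\<close> by (intro exI[of _ \<delta>]) auto
qed

section \<open>Absolutely continuous functions as integrals of their derivatives\<close>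

lemma interval_measure_null_sets:
  fixes F :: "real \<Rightarrow> real"
  assumes mono: "mono F" and cont: "continuous_on UNIV F"
    and ac: "\<And>\<epsilon>. \<epsilon> > 0 \<Longrightarrow> \<exists>\<delta>>0. \<forall>d S. d division_of S \<and> (\<Sum>K\<in>d. Sup K - Inf K) < \<delta> \<longrightarrow> (\<Sum>K\<in>d. F (Sup K) - F (Inf K)) < \<epsilon>"
  shows "absolutely_continuous lborel (interval_measure F)"
  unfolding absolutely_continuous_def
proof
  let ?M = "interval_measure F"
  fix N :: "real set" assume N: "N \<in> null_sets lborel"
  have "emeasure ?M N \<le> ennreal \<epsilon>" if eps: "\<epsilon> > 0" for \<epsilon>
  proof -
    obtain \<delta> where \<delta>: "\<delta> > 0" "\<And>d S. d division_of S \<Longrightarrow> (\<Sum>K\<in>d. Sup K - Inf K) < \<delta> \<Longrightarrow> (\<Sum>K\<in>d. F (Sup K) - F (Inf K)) < \<epsilon>"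
      using ac[OF eps] by blast
    have "N \<in> sets borel" using N by (auto simp: null_sets_def)
    \<comment> \<open>Outer regularity encloses the null set in an open set of measure below
      \<delta>. A compact part of U is covered by finitely many closed intervals inside U; their
      union has a division of total length below \<delta>, so its Stieltjes measure is below
      \<epsilon>. Exhausting U by compact sets finishes the bound.\<close>
    then obtain U where U: "open U" "N \<subseteq> U" "emeasure lborel (U - N) < \<delta>"
      using outer_regular_lborel[of N \<delta>] \<delta>(1) by blast
    have [measurable]: "U \<in> sets borel" "N \<in> sets borel" using U(1) \<open>N \<in> sets borel\<close> by auto
    have "emeasure lborel U = emeasure lborel (U - N)"
      using N by (simp add: emeasure_Diff_null_set)
    with U have lU: "emeasure lborel U < \<delta>" by simp
    have comp: "emeasure ?M C \<le> \<epsilon>" if C: "compact C" "C \<subseteq> U" for C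
    proof -
      have "\<exists>e>0. {x - e .. x + e} \<subseteq> U" if "x \<in> C" for x
        using open_contains_cball[THEN iffD1, OF U(1)] C(2) that by (metis cball_eq_atLeastAtMost subset_iff)
      then obtain e where e: "\<And>x. x \<in> C \<Longrightarrow> e x > 0 \<and> {x - e x .. x + e x} \<subseteq> U" by metis
      obtain C' where C': "C' \<subseteq> C" "finite C'" "C \<subseteq> (\<Union>x\<in>C'. {x - e x <..< x + e x})"
        by (rule compactE_image[OF C(1), of C "\<lambda>x. {x - e x <..< x + e x}"]) (use e in force)+
      obtain p where p: "p division_of (\<Union>x\<in>C'. {x - e x .. x + e x})"
        using elementary_unions_intervals[of "(\<lambda>x. {x - e x .. x + e x}) ` C'"] C'(2) by (metis (no_types, lifting) box_real(2) finite_imageI imageE)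
      define S where "S = (\<Union>x\<in>C'. {x - e x .. x + e x})"
      have SU: "S \<subseteq> U" using e C'(1) by (auto simp: S_def)
      have CS: "C \<subseteq> S" using C'(3) by (force simp: S_def)
      have "compact S" unfolding S_def using C'(2) by (intro compact_UN) auto
      then have [measurable]: "S \<in> sets borel" by (simp add: borel_compact)
      note el = division_of_real_element[OF p[folded S_def]]
      have "(\<Sum>K\<in>p. Sup K - Inf K) = (\<Sum>K\<in>p. measure lebesgue K)"
      proof (rule sum.cong[OF refl])
        fix K assume "K \<in> p"
        from el(1,2)[OF this] show "Sup K - Inf K = measure lebesgue K" by (metis measure_completion content_real sets_lborel borel_closed closed_atLeastAtMost)
      qed
      also have "\<dots> = measure lebesgue S" using content_division[OF p[folded S_def]] .
      also have "\<dots> = measure lborel S" by simp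
      finally have eq: "(\<Sum>K\<in>p. Sup K - Inf K) = measure lborel S" .
      have "emeasure lborel S \<le> emeasure lborel U" using SU by (intro emeasure_mono) auto
      then have "emeasure lborel S < \<delta>" using lU by simp
      then have "measure lborel S < \<delta>"
        using \<delta>(1) by (metis emeasure_eq_ennreal_measure ennreal_less_iff measure_nonneg order_less_imp_not_less top_greatest leD ennreal_less_top order.strict_trans)
      then have sm: "(\<Sum>K\<in>p. F (Sup K) - F (Inf K)) < \<epsilon>" using \<delta>(2)[OF p] eq by simp
      have fin: "finite p" using p by auto
      have Kb: "K \<in> sets borel" if "K \<in> p" for K using el(2)[OF that] by (metis borel_closed closed_atLeastAtMost)
      have "emeasure ?M C \<le> emeasure ?M (\<Union>p)"
        using CS p[folded S_def] Kb fin by (intro emeasure_mono) (auto simp: division_of_def intro!: sets.finite_Union)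
      also have "\<Union>p = (\<Union>K\<in>p. K)" by simp
      also have "emeasure ?M (\<Union>K\<in>p. K) \<le> (\<Sum>K\<in>p. emeasure ?M K)"
        using emeasure_subadditive_finite[OF fin, of "\<lambda>K. K" ?M] Kb by auto
      also have "\<dots> = (\<Sum>K\<in>p. ennreal (F (Sup K) - F (Inf K)))"
      proof (rule sum.cong[OF refl])
        fix K assume "K \<in> p"
        from el(1,2)[OF this] show "emeasure ?M K = ennreal (F (Sup K) - F (Inf K))"
          using emeasure_interval_measure_Icc[of "Inf K" "Sup K" F] mono cont by (metis monoD)
      qed
      also have "\<dots> = ennreal (\<Sum>K\<in>p. F (Sup K) - F (Inf K))"
        using el(1) mono by (intro sum_ennreal) (auto dest: monoD)
      also have "\<dots> \<le> \<epsilon>" using sm by (intro ennreal_leI) auto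
      finally show ?thesis .
    qed
    obtain C where C: "\<And>n. compact(C n)" "\<And>n. C n \<subseteq> U" "\<And>n::nat. C n \<subseteq> interior(C(Suc n))" "\<Union>(range C) = U"
      using open_Union_compact_subsets[OF U(1)] by metis
    have "incseq C" using C(3) interior_subset by (intro incseq_SucI) blast
    have "emeasure ?M N \<le> emeasure ?M U" using U by (intro emeasure_mono) auto
    also have "\<dots> = (SUP n. emeasure ?M (C n))"
      using SUP_emeasure_incseq[OF _ \<open>incseq C\<close>, of ?M] C(1,4) by (simp add: borel_compact image_subset_iff)
    also have "\<dots> \<le> \<epsilon>" using comp C by (intro SUP_least) auto
    finally show ?thesis .
  qed
  then have "emeasure ?M N \<le> 0" by (metis add_0 ennreal_le_epsilon zero_le)
  then show "N \<in> null_sets ?M" using N by (auto simp: null_sets_def)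
qed

text \<open>The integrand is the Radon-Nikodym density of the Stieltjes measure of G with respect to
  Lebesgue measure.\<close>

lemma mono_absolutely_continuous_integral:
  fixes G :: "real \<Rightarrow> real"
  assumes ac: "absolutely_continuous_curve a b (\<lambda>x. of_real (G x))" and "a < b"
    and mono: "\<And>x y. a \<le> x \<Longrightarrow> x \<le> y \<Longrightarrow> y \<le> b \<Longrightarrow> G x \<le> G y"
  obtains h where "h absolutely_integrable_on {a..b}" "\<And>x. x \<in> {a..b} \<Longrightarrow> (h has_integral (G x - G a)) {a..x}"
proof -
  \<comment> \<open>Clamping the argument extends G from {a..b} to a monotone continuous function on
    the whole line, where \<open>interval_measure\<close> lives.\<close>
  define F where "F x = G (max a (min b x))" for x
  have mF: "mono F" unfolding F_def using \<open>a < b\<close> by (intro monoI mono) auto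
  have "continuous_on {a..b} (\<lambda>x. Re (of_real (G x)))"
    by (intro continuous_on_Re absolutely_continuous_curve_continuous[OF ac])
  then have cG: "continuous_on {a..b} G" by simp
  have cF: "continuous_on UNIV F"
    unfolding F_def by (rule continuous_on_compose2[OF cG]) (use \<open>a < b\<close> in \<open>auto intro!: continuous_intros\<close>)
  have acF: "\<exists>\<delta>>0. \<forall>d S. d division_of S \<and> (\<Sum>K\<in>d. Sup K - Inf K) < \<delta> \<longrightarrow> (\<Sum>K\<in>d. F (Sup K) - F (Inf K)) < \<epsilon>" if "\<epsilon> > 0" for \<epsilon>
  proof -
    obtain \<delta> where \<delta>: "\<delta> > 0" "\<And>d S. d division_of S \<Longrightarrow> S \<subseteq> {a..b} \<Longrightarrow> (\<Sum>K\<in>d. Sup K - Inf K) < \<delta> \<Longrightarrow>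
        (\<Sum>K\<in>d. dist (complex_of_real (G (Sup K))) (complex_of_real (G (Inf K)))) < \<epsilon>"
      using absolutely_continuous_curveD[OF ac \<open>\<epsilon> > 0\<close>] by blast
    show ?thesis
    proof (intro exI[of _ \<delta>] conjI allI impI, fact)
      fix d :: "real set set" and S assume d: "d division_of S \<and> (\<Sum>K\<in>d. Sup K - Inf K) < \<delta>"
      note el = division_of_real_element[OF conjunct1[OF d]]
      define c where "c = (\<lambda>x. max a (min b x))"
      obtain d' where d': "d' division_of (\<Union>d')" "\<Union>d' \<subseteq> {a..b}" and s:
        "\<And>\<psi>::real\<Rightarrow>real\<Rightarrow>real. (\<And>x. \<psi> x x = 0) \<Longrightarrow> (\<Sum>K\<in>d'. \<psi> (Inf K) (Sup K)) = (\<Sum>K\<in>d. \<psi> (c (Inf K)) (c (Sup K)))"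
      proof (rule division_of_shrink[OF conjunct1[OF d], of "\<lambda>K. c (Inf K)" "\<lambda>K. c (Sup K)" "{a..b}"])
        fix K assume K: "K \<in> d"
        show "c (Inf K) \<le> c (Sup K)" using el(1)[OF K] by (auto simp: c_def)
        assume "c (Inf K) < c (Sup K)"
        then show "{c (Inf K)..c (Sup K)} \<subseteq> K \<inter> {a..b}"
          by (subst el(2)[OF K]) (use \<open>a < b\<close> in \<open>auto simp: c_def max_def min_def split: if_splits\<close>)
      qed blast
      have "(\<Sum>K\<in>d'. Sup K - Inf K) = (\<Sum>K\<in>d. c (Sup K) - c (Inf K))" using s[of "\<lambda>x y. y - x"] by simp
      also have "\<dots> \<le> (\<Sum>K\<in>d. Sup K - Inf K)"
        by (rule sum_mono, drule el(1)) (auto simp: c_def max_def min_def)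
      finally have "(\<Sum>K\<in>d'. dist (complex_of_real (G (Sup K))) (complex_of_real (G (Inf K)))) < \<epsilon>"
        using \<delta>(2)[OF d'] d by simp
      then have "(\<Sum>K\<in>d. dist (complex_of_real (F (Sup K))) (complex_of_real (F (Inf K)))) < \<epsilon>"
        using s[of "\<lambda>x y. dist (complex_of_real (G y)) (complex_of_real (G x))"] by (simp add: F_def c_def)
      moreover have "(\<Sum>K\<in>d. F (Sup K) - F (Inf K)) \<le> (\<Sum>K\<in>d. dist (complex_of_real (F (Sup K))) (complex_of_real (F (Inf K))))"
        by (rule sum_mono) (simp add: dist_norm flip: of_real_diff)
      ultimately show "(\<Sum>K\<in>d. F (Sup K) - F (Inf K)) < \<epsilon>" by simp
    qed
  qed
  obtain f where f[measurable]: "f \<in> borel_measurable lborel" and fd: "density lborel f = interval_measure F"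
    using sigma_finite_measure.Radon_Nikodym[OF sigma_finite_lborel interval_measure_null_sets[OF mF cF acF]] by auto
  define h where "h x = enn2real (f x)" for x
  have nn: "(\<integral>\<^sup>+t. f t * indicator {a..x} t \<partial>lborel) = ennreal (G x - G a)" if "x \<in> {a..b}" for x
  proof -
    have "(\<integral>\<^sup>+t. f t * indicator {a..x} t \<partial>lborel) = emeasure (interval_measure F) {a..x}"
      by (subst fd[symmetric], subst emeasure_density) auto
    also have "\<dots> = ennreal (F x - F a)" using that mF cF by (intro emeasure_interval_measure_Icc) (auto dest: monoD)
    finally show ?thesis using that by (simp add: F_def)
  qed
  have "AE t in lborel. f t * indicator {a..b} t \<noteq> \<infinity>"
    using nn[of b] \<open>a < b\<close> by (intro nn_integral_PInf_AE) auto
  then have ae: "AE t in lborel. ennreal (indicator {a..x} t * h t) = f t * indicator {a..x} t" if "x \<in> {a..b}" for x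
    by eventually_elim (use that in \<open>auto simp: h_def indicator_def less_top\<close>)
  have hi: "(h has_integral (G x - G a)) {a..x}" if "x \<in> {a..b}" for x
  proof -
    have "((\<lambda>t. indicator {a..x} t * h t) has_integral (G x - G a)) UNIV"
    proof (rule nn_integral_has_integral)
      show "(\<integral>\<^sup>+t. ennreal (indicator {a..x} t * h t) \<partial>lborel) = ennreal (G x - G a)"
        using nn_integral_cong_AE[OF ae[OF that]] nn[OF that] by simp
    qed (use that mono in \<open>auto simp: h_def\<close>)
    moreover have "(\<lambda>t. indicator {a..x} t * h t) = (\<lambda>t. if t \<in> {a..x} then h t else 0)"
      by (auto simp: fun_eq_iff indicator_def)
    ultimately show ?thesis using has_integral_restrict_UNIV by metis
  qed
  show thesis
  proof (rule that[OF _ hi])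
    show "h absolutely_integrable_on {a..b}"
      using hi[of b] \<open>a < b\<close> by (intro nonnegative_absolutely_integrable_1) (auto simp: h_def intro: has_integral_integrable)
  qed
qed

text \<open>Jordan decomposition: with V the variation, V and V + g are increasing and absolutely
  continuous for g = Re f and for g = Im f, so each component is a difference of two
  integrals.\<close>

lemma absolutely_continuous_curve_integral:
  assumes ac: "absolutely_continuous_curve a b f" and "a < b"
  obtains h where "h absolutely_integrable_on {a..b}" "\<And>x. x \<in> {a..b} \<Longrightarrow> (h has_integral (f x - f a)) {a..x}"
proof -
  define V where "V x = variation f a x" for x
  have acV: "absolutely_continuous_curve a b (\<lambda>x. of_real (V x))"
    unfolding V_def using absolutely_continuous_variation[OF ac] \<open>a < b\<close> by auto
  have V: "dist (f x) (f y) \<le> V y - V x" if "a \<le> x" "x \<le> y" "y \<le> b" for x y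
    unfolding V_def using variation_diff_ge[OF ac that] .
  have Vm: "V x \<le> V y" if "a \<le> x" "x \<le> y" "y \<le> b" for x y
    using V[OF that] by (smt (verit) zero_le_dist)
  obtain h0 where h0: "h0 absolutely_integrable_on {a..b}" "\<And>x. x \<in> {a..b} \<Longrightarrow> (h0 has_integral (V x - V a)) {a..x}"
    using mono_absolutely_continuous_integral[OF acV \<open>a < b\<close> Vm] by blast
  have part: "\<exists>h. h absolutely_integrable_on {a..b} \<and> (\<forall>x\<in>{a..b}. (h has_integral (g x - g a)) {a..x})"
    if g: "\<And>x y. \<bar>g x - g y\<bar> \<le> dist (f x) (f y)" for g :: "real \<Rightarrow> real"
  proof -
    have le: "\<bar>g x - g y\<bar> \<le> V y - V x" if "a \<le> x" "x \<le> y" "y \<le> b" for x y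
      using g[of x y] V[OF that] by linarith
    have "absolutely_continuous_curve a b (\<lambda>x. of_real (V x + g x))"
    proof (rule absolutely_continuous_curve_dominated[OF acV, of 2 1])
      fix x y assume xy: "a \<le> x" "x \<le> y" "y \<le> b"
      have "\<bar>(V x + g x) - (V y + g y)\<bar> \<le> 2 * \<bar>V x - V y\<bar>" 
        using abs_triangle_ineq[of "V x - V y" "g x - g y"] le[OF xy] Vm[OF xy] by (simp add: algebra_simps)
      then show "dist (complex_of_real (V x + g x)) (complex_of_real (V y + g y)) \<le> 2 * dist (complex_of_real (V x)) (complex_of_real (V y))"
        unfolding dist_norm of_real_diff[symmetric] norm_of_real .
    qed auto
    moreover have "V x + g x \<le> V y + g y" if "a \<le> x" "x \<le> y" "y \<le> b" for x y
      using le[OF that] by linarith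
    ultimately obtain h1 where h1: "h1 absolutely_integrable_on {a..b}"
       "\<And>x. x \<in> {a..b} \<Longrightarrow> (h1 has_integral ((V x + g x) - (V a + g a))) {a..x}"
      using mono_absolutely_continuous_integral[of a b "\<lambda>x. V x + g x"] \<open>a < b\<close> by blast
    show ?thesis
    proof (intro exI[of _ "\<lambda>x. h1 x - h0 x"] conjI ballI)
      show "(\<lambda>x. h1 x - h0 x) absolutely_integrable_on {a..b}" using h0 h1 by (intro set_integral_diff) auto
      fix x assume "x \<in> {a..b}"
      from has_integral_diff[OF h1(2)[OF this] h0(2)[OF this]]
      show "((\<lambda>x. h1 x - h0 x) has_integral (g x - g a)) {a..x}" by (simp add: algebra_simps)
    qed
  qed
  obtain hr where hr: "hr absolutely_integrable_on {a..b}" "\<And>x. x \<in> {a..b} \<Longrightarrow> (hr has_integral (Re (f x) - Re (f a))) {a..x}"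
    using part[of "\<lambda>x. Re (f x)"] by (metis abs_Re_le_cmod dist_norm minus_complex.simps(1))
  obtain hi where hi: "hi absolutely_integrable_on {a..b}" "\<And>x. x \<in> {a..b} \<Longrightarrow> (hi has_integral (Im (f x) - Im (f a))) {a..x}"
    using part[of "\<lambda>x. Im (f x)"] by (metis abs_Im_le_cmod dist_norm minus_complex.simps(2))
  define h where "h x = complex_of_real (hr x) + \<i> * complex_of_real (hi x)" for x
  have 1: "h absolutely_integrable_on {a..b}"
  proof -
    have "(\<lambda>x. complex_of_real (hr x)) absolutely_integrable_on {a..b}"
      using absolutely_integrable_linear[OF hr(1) bounded_linear_of_real] by (simp add: o_def)
    moreover have "(\<lambda>x. \<i> * complex_of_real (hi x)) absolutely_integrable_on {a..b}"
      using absolutely_integrable_linear[OF hi(1) bounded_linear_compose[OF bounded_linear_mult_right[of \<i>] bounded_linear_of_real]]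
      by (simp add: o_def)
    ultimately
    show ?thesis unfolding h_def by (rule set_integral_add(1))
  qed
  have 2: "(h has_integral (f x - f a)) {a..x}" if "x \<in> {a..b}" for x
  proof -
    have "((\<lambda>x. complex_of_real (hr x)) has_integral complex_of_real (Re (f x) - Re (f a))) {a..x}"
      "((\<lambda>x. \<i> * complex_of_real (hi x)) has_integral \<i> * complex_of_real (Im (f x) - Im (f a))) {a..x}"
      using has_integral_linear[OF hr(2)[OF that] bounded_linear_of_real]
        has_integral_linear[OF hi(2)[OF that] bounded_linear_compose[OF bounded_linear_mult_right bounded_linear_of_real]]
      by (auto simp: o_def)
    from has_integral_add[OF this] show ?thesis unfolding h_def
      by (rule has_integral_eq_rhs) (simp add: complex_eq_iff)
  qed
  show thesis using that[OF 1 2] .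
qed

text \<open>Lebesgue differentiation is applied in one-sided form, to k for the right derivative and
  to the reflection of k for the left one; the exceptional set collects both.\<close>

lemma integral_has_vector_derivative_ae:
  fixes f :: "real \<Rightarrow> complex"
  assumes h: "h absolutely_integrable_on {a..b}" and hi: "\<And>x. x \<in> {a..b} \<Longrightarrow> (h has_integral (f x - f a)) {a..x}"
  obtains N where "negligible N" "\<And>x. x \<in> {a<..<b} - N \<Longrightarrow> (f has_vector_derivative h x) (at x)"
proof -
  define k where "k x = (if x \<in> {a..b} then h x else 0)" for x
  have kU: "k absolutely_integrable_on UNIV" unfolding k_def using h by (subst absolutely_integrable_restrict_UNIV)
  then have kU': "k integrable_on UNIV" by (simp add: set_lebesgue_integral_eq_integral)
  have k: "k integrable_on cbox c d" for c d
    using integrable_on_subcbox[OF kU'] by auto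
  have k2: "(\<lambda>x. k (- x)) integrable_on cbox c d" for c d
    using k[of "-d" "-c"] Henstock_Kurzweil_Integration.integrable_reflect_real[where f=k and a="-d" and b="-c"] by simp
  obtain N1 where N1: "negligible N1" "\<And>x e. \<lbrakk>x \<notin> N1; 0 < e\<rbrakk> \<Longrightarrow>
      \<exists>d>0. \<forall>h. 0 < h \<and> h < d \<longrightarrow> norm(integral (cbox x (x + h *\<^sub>R One)) k /\<^sub>R h ^ DIM(real) - k x) < e"
    using integrable_ccontinuous_explicit[OF k] by metis
  obtain N2 where N2: "negligible N2" "\<And>x e. \<lbrakk>x \<notin> N2; 0 < e\<rbrakk> \<Longrightarrow>
      \<exists>d>0. \<forall>h. 0 < h \<and> h < d \<longrightarrow> norm(integral (cbox x (x + h *\<^sub>R One)) (\<lambda>x. k (- x)) /\<^sub>R h ^ DIM(real) - k (- x)) < e"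
    using integrable_ccontinuous_explicit[OF k2] by metis
  have int: "integral {x..y} k = f y - f x" if "a \<le> x" "x \<le> y" "y \<le> b" for x y
  proof -
    have "integral {x..y} k = integral {x..y} h" using that by (intro integral_cong) (auto simp: k_def)
    moreover have "integral {a..x} h + integral {x..y} h = integral {a..y} h"
      using hi[of y] that by (intro Henstock_Kurzweil_Integration.integral_combine) (auto intro: has_integral_integrable)
    ultimately show ?thesis using hi[of x] hi[of y] that by (auto simp: algebra_simps dest!: integral_unique)
  qed
  show thesis
  proof
    show "negligible (N1 \<union> uminus ` N2)" using N1(1) N2(1) negligible_differentiable_image_negligible[of N2 uminus]
      by (auto intro!: derivative_intros)
    fix x assume x: "x \<in> {a<..<b} - (N1 \<union> uminus ` N2)"
    then have x12: "x \<notin> N1" "- x \<notin> N2" by force+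
    have kx: "k x = h x" using x by (auto simp: k_def)
    show "(f has_vector_derivative h x) (at x)"
      unfolding has_vector_derivative_def has_derivative_at_alt
    proof (intro conjI allI impI)
      show "bounded_linear (\<lambda>xa. xa *\<^sub>R h x)" by (rule bounded_linear_scaleR_left)
      fix e :: real assume "e > 0"
      obtain d1 where d1: "d1 > 0" "\<And>t. 0 < t \<Longrightarrow> t < d1 \<Longrightarrow> norm(integral {x..x + t} k /\<^sub>R t - h x) < e"
        using N1(2)[OF x12(1) \<open>e > 0\<close>] kx by auto
      obtain d2 where d2: "d2 > 0" "\<And>t. 0 < t \<Longrightarrow> t < d2 \<Longrightarrow> norm(integral {-x..-x + t} (\<lambda>x. k (- x)) /\<^sub>R t - h x) < e"
        using N2(2)[OF x12(2) \<open>e > 0\<close>] kx by auto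
      show "\<exists>d>0. \<forall>y. norm (y - x) < d \<longrightarrow> norm (f y - f x - (y - x) *\<^sub>R h x) \<le> e * norm (y - x)"
      proof (intro exI[of _ "min (min d1 d2) (min (x - a) (b - x))"] conjI allI impI)
        show "min (min d1 d2) (min (x - a) (b - x)) > 0" using x d1 d2 by auto
        fix y assume y: "norm (y - x) < min (min d1 d2) (min (x - a) (b - x))"
        have scale: "norm (v - t *\<^sub>R h x) \<le> e * t" if "t > 0" "norm (v /\<^sub>R t - h x) < e" for v t
        proof -
          have "v - t *\<^sub>R h x = t *\<^sub>R (v /\<^sub>R t - h x)" using that by (simp add: algebra_simps)
          then have "norm (v - t *\<^sub>R h x) = t * norm (v /\<^sub>R t - h x)" using that by simp
          then show ?thesis using that by (simp add: mult.commute)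
        qed
        consider "y = x" | "y > x" | "y < x" by linarith
        then show "norm (f y - f x - (y - x) *\<^sub>R h x) \<le> e * norm (y - x)"
        proof cases
          case 2
          have "norm ((f y - f x) /\<^sub>R (y - x) - h x) < e"
            using d1(2)[of "y - x"] y 2 int[of x y] x by auto
          from scale[OF _ this] show ?thesis using 2 by simp
        next
          case 3
          have "integral {-x..-y} (\<lambda>x. k (- x)) = integral {y..x} k" by (rule Henstock_Kurzweil_Integration.integral_reflect_real)
          then have "norm ((f x - f y) /\<^sub>R (x - y) - h x) < e"
            using d2(2)[of "x - y"] y 3 int[of y x] x by auto
          from scale[OF _ this] have "norm ((f x - f y) - (x - y) *\<^sub>R h x) \<le> e * (x - y)" using 3 by simp
          moreover have "f y - f x - (y - x) *\<^sub>R h x = - ((f x - f y) - (x - y) *\<^sub>R h x)" by (simp add: algebra_simps)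
          ultimately show ?thesis using 3 by (metis norm_minus_cancel abs_minus_commute abs_of_pos diff_gt_0_iff_gt real_norm_def)
        qed auto
      qed
    qed
  qed
qed

section \<open>The Kobayashi and Caratheodory distances\<close>

lemma cball_neighbourhood_of_compact:
  fixes K D :: "complex set"
  assumes "compact K" "open D" "K \<subseteq> D"
  obtains e where "e > 0" "\<And>x. x \<in> K \<Longrightarrow> cball x e \<subseteq> D" "compact (\<Union>x\<in>K. cball x e)" "(\<Union>x\<in>K. cball x e) \<subseteq> D"
proof -
  obtain e where e: "e > 0" "\<forall>x\<in>K. \<forall>y\<in>-D. e \<le> dist x y"
    using separate_compact_closed[of K "-D"] assms by auto
  have sub: "cball x (e/2) \<subseteq> D" if "x \<in> K" for x
    using e that by (force simp: subset_iff not_le)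
  have "(\<Union>x\<in>K. cball x (e/2)) = {x + y | x y. x \<in> K \<and> y \<in> cball 0 (e/2)}"
    by (auto simp: dist_norm) (metis add_diff_cancel_left' add.commute diff_add_cancel norm_minus_commute)
  moreover have "compact {x + y | x y. x \<in> K \<and> y \<in> cball 0 (e/2)}" using assms(1) by (intro compact_sums) auto
  ultimately have "compact (\<Union>x\<in>K. cball x (e/2))" by metis
  moreover have "(\<Union>x\<in>K. cball x (e/2)) \<subseteq> D" using sub by blast
  ultimately show thesis using that[of "e/2"] e(1) sub by simp
qed

text \<open>As D need not be convex, the mean value inequality is available only inside a ball
  around x, hence the restriction to distance below r.\<close>

lemma holomorphic_locally_lipschitz_near_compact:
  assumes K: "compact K" "open D" "K \<subseteq> D" and L: "L holomorphic_on D"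
  obtains r B where "r > 0" "B > 0" "\<And>x y. x \<in> K \<Longrightarrow> dist x y < r \<Longrightarrow> dist (L x) (L y) \<le> B * dist x y"
proof -
  obtain e where e: "e > 0" "\<And>x. x \<in> K \<Longrightarrow> cball x e \<subseteq> D" "compact (\<Union>x\<in>K. cball x e)" "(\<Union>x\<in>K. cball x e) \<subseteq> D"
    using cball_neighbourhood_of_compact[OF K] by blast
  have "continuous_on (\<Union>x\<in>K. cball x e) (deriv L)"
    using L K e by (meson holomorphic_deriv holomorphic_on_imp_continuous_on continuous_on_subset)
  then have "bounded (deriv L ` (\<Union>x\<in>K. cball x e))"
    using e(3) by (intro compact_imp_bounded compact_continuous_image)
  then obtain B where B: "B > 0" "\<And>z. z \<in> (\<Union>x\<in>K. cball x e) \<Longrightarrow> norm (deriv L z) \<le> B"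
    unfolding bounded_pos by blast
  show thesis
  proof (rule that[OF e(1) B(1)])
    fix x y assume x: "x \<in> K" and y: "dist x y < e"
    have "norm (L x - L y) \<le> B * norm (x - y)"
    proof (rule field_differentiable_bound[of "cball x e" L "deriv L"])
      show "(L has_field_derivative deriv L z) (at z within cball x e)" if "z \<in> cball x e" for z
        using that e(2)[OF x] L K(2) by (meson has_field_derivative_at_within holomorphic_derivI subsetD)
      show "norm (deriv L z) \<le> B" if "z \<in> cball x e" for z using that x by (intro B(2)) blast
    qed (use y e(1) in auto)
    then show "dist (L x) (L y) \<le> B * dist x y" by (simp add: dist_norm)
  qed
qed

text \<open>L along \<sigma> is again absolutely continuous, hence the integral of its derivative,
  and off a null set the chain rule identifies that derivative.\<close>

lemma holomorphic_increment_le_nn_integral: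
  assumes ac: "absolutely_continuous_curve a b \<sigma>" and "a < b" and "open D" and \<sigma>: "\<sigma> ` {a..b} \<subseteq> D"
    and L: "L holomorphic_on D"
  shows "ennreal (cmod (L (\<sigma> b) - L (\<sigma> a))) \<le>
    (\<integral>\<^sup>+t\<in>{a..b}. ennreal (cmod (deriv L (\<sigma> t) * vector_derivative \<sigma> (at t within {a..b}))) \<partial>lebesgue)"
proof -
  have "compact (\<sigma> ` {a..b})"
    by (intro compact_continuous_image absolutely_continuous_curve_continuous[OF ac]) simp
  then obtain r B where rB: "r > 0" "B > 0" "\<And>x y. x \<in> \<sigma> ` {a..b} \<Longrightarrow> dist x y < r \<Longrightarrow> dist (L x) (L y) \<le> B * dist x y"
    using holomorphic_locally_lipschitz_near_compact[OF _ \<open>open D\<close> \<sigma> L] by blast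
  have acL: "absolutely_continuous_curve a b (\<lambda>t. L (\<sigma> t))"
    by (rule absolutely_continuous_curve_dominated[OF ac rB(2,1)]) (use rB(3) in auto)
  obtain h where h: "h absolutely_integrable_on {a..b}" "\<And>x. x \<in> {a..b} \<Longrightarrow> (h has_integral (\<sigma> x - \<sigma> a)) {a..x}"
    using absolutely_continuous_curve_integral[OF ac \<open>a < b\<close>] by blast
  obtain N where N: "negligible N" "\<And>x. x \<in> {a<..<b} - N \<Longrightarrow> (\<sigma> has_vector_derivative h x) (at x)"
    using integral_has_vector_derivative_ae[OF h] by blast
  obtain k where k: "k absolutely_integrable_on {a..b}" "\<And>x. x \<in> {a..b} \<Longrightarrow> (k has_integral (L (\<sigma> x) - L (\<sigma> a))) {a..x}"
    using absolutely_continuous_curve_integral[OF acL \<open>a < b\<close>] by blast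
  obtain N' where N': "negligible N'" "\<And>x. x \<in> {a<..<b} - N' \<Longrightarrow> ((\<lambda>t. L (\<sigma> t)) has_vector_derivative k x) (at x)"
    using integral_has_vector_derivative_ae[OF k] by blast
  have eq: "k t = deriv L (\<sigma> t) * vector_derivative \<sigma> (at t within {a..b})" if t: "t \<in> {a<..<b} - (N \<union> N')" for t
  proof -
    have "t \<in> interior {a..b}" using t by auto
    then have at: "at t within {a..b} = at t" by (rule at_within_interior)
    have 1: "(\<sigma> has_vector_derivative h t) (at t)" using N(2) t by auto
    have "\<sigma> t \<in> D" using \<sigma> t by auto
    then have "(L has_field_derivative deriv L (\<sigma> t)) (at (\<sigma> t))" using holomorphic_derivI[OF L \<open>open D\<close>] by blast
    from field_vector_diff_chain_at[OF 1 this]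
    have "((\<lambda>t. L (\<sigma> t)) has_vector_derivative h t * deriv L (\<sigma> t)) (at t)" by (simp add: o_def)
    moreover have "((\<lambda>t. L (\<sigma> t)) has_vector_derivative k t) (at t)" using N'(2) t by auto
    ultimately have "k t = h t * deriv L (\<sigma> t)" using vector_derivative_unique_at by blast
    then show ?thesis using vector_derivative_at[OF 1] at by simp
  qed
  have "(LINT t:{a..b}|lebesgue. k t) = L (\<sigma> b) - L (\<sigma> a)"
    using set_lebesgue_integral_eq_integral(2)[OF k(1)] k(2)[of b] \<open>a < b\<close> by (auto dest: integral_unique)
  then have "ennreal (cmod (L (\<sigma> b) - L (\<sigma> a))) \<le> (\<integral>\<^sup>+t. ennreal (cmod (indicator {a..b} t *\<^sub>R k t)) \<partial>lebesgue)"
    using integral_norm_bound_ennreal[of lebesgue "\<lambda>t. indicator {a..b} t *\<^sub>R k t"] k(1)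
    by (simp add: set_lebesgue_integral_def set_integrable_def)
  also have "\<dots> \<le> (\<integral>\<^sup>+t\<in>{a..b}. ennreal (cmod (deriv L (\<sigma> t) * vector_derivative \<sigma> (at t within {a..b}))) \<partial>lebesgue)"
  proof (rule nn_integral_mono_AE)
    have "negligible (N \<union> N' \<union> {a, b})" using N(1) N'(1) by (intro negligible_Un) auto
    then have "AE t in lebesgue. t \<notin> N \<union> N' \<union> {a, b}" using AE_not_in[of "N \<union> N' \<union> {a, b}" lebesgue] unfolding negligible_iff_null_sets by blast
    then show "AE t in lebesgue. ennreal (cmod (indicator {a..b} t *\<^sub>R k t)) \<le>
      ennreal (cmod (deriv L (\<sigma> t) * vector_derivative \<sigma> (at t within {a..b}))) * indicator {a..b} t"
      by eventually_elim (use eq in \<open>auto simp: indicator_def less_le\<close>)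
  qed
  finally show ?thesis .
qed

section \<open>The infinitesimal metric and the Schwarz-Pick lemma\<close>

lemma kobayashi_metric_le:
  assumes "\<phi> \<in> holo_maps (ball 0 1) D" "\<phi> 0 = z" "\<alpha> * deriv \<phi> 0 = X"
  shows "kobayashi_metric D z X \<le> norm \<alpha>"
  unfolding kobayashi_metric_def
  by (rule cInf_lower) (use assms in \<open>auto intro!: bdd_belowI[of _ 0]\<close>)

lemma kobayashi_metric_ge:
  assumes "open D" "z \<in> D"
    and le: "\<And>\<phi> \<alpha>. \<phi> \<in> holo_maps (ball 0 1) D \<Longrightarrow> \<phi> 0 = z \<Longrightarrow> \<alpha> * deriv \<phi> 0 = X \<Longrightarrow> c \<le> norm \<alpha>"
  shows "c \<le> kobayashi_metric D z X"
  unfolding kobayashi_metric_def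
proof (rule cInf_greatest)
  \<comment> \<open>An affine disc in D shows that the infimum ranges over a nonempty set; the real
    infimum of the empty set would carry no information.\<close>
  obtain r where r: "r > 0" "ball z r \<subseteq> D" using assms open_contains_ball by blast
  define \<phi> where "\<phi> = (\<lambda>x. z + of_real r * x)"
  have "(\<phi> has_field_derivative of_real r) (at 0)" unfolding \<phi>_def by (auto intro!: derivative_eq_intros)
  then have "deriv \<phi> 0 = of_real r" by (rule DERIV_imp_deriv)
  moreover have "\<phi> \<in> holo_maps (ball 0 1) D"
    using r unfolding holo_maps_def \<phi>_def by (auto intro!: holomorphic_intros simp: dist_norm norm_mult subset_iff)
  ultimately have "norm (X / of_real r) \<in> {norm \<alpha> |\<alpha>. \<exists>\<phi>\<in>holo_maps (ball 0 1) D. \<phi> 0 = z \<and> \<alpha> * deriv \<phi> 0 = X}"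
    using r by (intro CollectI exI[of _ "X / of_real r"] conjI refl bexI[of _ \<phi>]) (auto simp: \<phi>_def)
  then show "{norm \<alpha> |\<alpha>. \<exists>\<phi>\<in>holo_maps (ball 0 1) D. \<phi> 0 = z \<and> \<alpha> * deriv \<phi> 0 = X} \<noteq> {}" by blast
qed (use le in blast)

lemma Moebius_function_has_field_derivative:
  assumes "norm w < 1" "norm z < 1"
  shows "(Moebius_function 0 w has_field_derivative (1 - of_real (norm w)^2) / (1 - cnj w * z)^2) (at z)"
proof -
  have "norm (cnj w * z) < 1" using norm_mult_less[of "cnj w" 1 z 1] assms by simp
  then have ne: "1 - cnj w * z \<noteq> 0" by auto
  have "((\<lambda>z. (z - w) / (1 - cnj w * z)) has_field_derivative (1 * (1 - cnj w * z) - (z - w) * (- cnj w)) / ((1 - cnj w * z) * (1 - cnj w * z))) (at z)"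
    using ne by (auto intro!: derivative_eq_intros)
  moreover have "(1 * (1 - cnj w * z) - (z - w) * (- cnj w)) = 1 - of_real (norm w)^2"
    using complex_norm_square[of w] by (simp add: algebra_simps)
  moreover have "Moebius_function 0 w = (\<lambda>z. (z - w) / (1 - cnj w * z))" by (auto simp: Moebius_function_simple)
  ultimately show ?thesis unfolding power2_eq_square[of "1 - cnj w * z"] by (simp only:)
qed

lemma Schwarz_Pick:
  assumes f: "f holomorphic_on ball 0 1" "\<And>z. norm z < 1 \<Longrightarrow> norm (f z) < 1"
  shows "norm (deriv f 0) \<le> 1 - norm (f 0) ^ 2"
    and "norm z < 1 \<Longrightarrow> norm (Moebius_function 0 (f 0) (f z)) \<le> norm z"
proof -
  have f0: "norm (f 0) < 1" using f by auto
  define g where "g = (\<lambda>z. Moebius_function 0 (f 0) (f z))"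
  have "Moebius_function 0 (f 0) \<circ> f holomorphic_on ball 0 1"
    using f f0 by (intro holomorphic_on_compose_gen[OF _ Moebius_function_holomorphic]) auto
  then have g: "g holomorphic_on ball 0 1" by (simp add: g_def o_def)
  have g1: "norm (g z) < 1" if "norm z < 1" for z
    unfolding g_def using Moebius_function_norm_lt_1 f0 f(2) that by auto
  have g0: "g 0 = 0" by (simp add: g_def Moebius_function_eq_zero)
  show "norm z < 1 \<Longrightarrow> norm (Moebius_function 0 (f 0) (f z)) \<le> norm z"
    using Schwarz_Lemma(1)[OF g g0 g1] by (simp add: g_def)
  have df: "(f has_field_derivative deriv f 0) (at 0)" using f(1) by (intro holomorphic_derivI[of f "ball 0 1"]) auto
  have e: "1 - cnj (f 0) * f 0 = 1 - of_real (norm (f 0))^2" using complex_norm_square[of "f 0"] by (simp add: mult.commute)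
  have pos: "1 - norm (f 0)^2 > 0" using f0 by (simp add: abs_square_less_1)
  have ne: "(1 - of_real (norm (f 0))^2 :: complex) \<noteq> 0"
    using f0 by (metis abs_norm_cancel abs_square_less_1 of_real_1 of_real_eq_iff of_real_power order_less_irrefl right_minus_eq)
  have "(g has_field_derivative ((1 - of_real (norm (f 0))^2) / (1 - cnj (f 0) * f 0)^2) * deriv f 0) (at 0)"
    unfolding g_def by (rule DERIV_chain2[OF Moebius_function_has_field_derivative df]) (use f0 in auto)
  then have "deriv g 0 = deriv f 0 / (1 - of_real (norm (f 0))^2)"
    using ne by (intro DERIV_imp_deriv) (simp add: e power2_eq_square)
  moreover have "norm (deriv g 0) \<le> 1" using Schwarz_Lemma(2)[OF g g0 g1, of 0] by simp
  moreover have "norm (1 - of_real (norm (f 0))^2 :: complex) = 1 - norm (f 0)^2"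
  proof -
    have "(1 - of_real (norm (f 0))^2 :: complex) = of_real (1 - norm (f 0)^2)" by simp
    then show ?thesis using pos by (metis norm_of_real abs_of_pos)
  qed
  ultimately show "norm (deriv f 0) \<le> 1 - norm (f 0) ^ 2" using pos by (simp add: norm_divide divide_le_eq_1)
qed

text \<open>An analytic disc \<phi> in D yields the self-map f o \<phi> of the unit disc, to which
  Schwarz-Pick applies at 0.\<close>

lemma kobayashi_metric_ge_derivative:
  assumes "open D" "z \<in> D" and f: "f \<in> holo_maps D (ball 0 1)"
  shows "cmod (deriv f z * X) / (1 - cmod (f z)^2) \<le> kobayashi_metric D z X"
proof (rule kobayashi_metric_ge[OF assms(1,2)])
  fix \<phi> \<alpha> assume \<phi>: "\<phi> \<in> holo_maps (ball 0 1) D" "\<phi> 0 = z" and X: "\<alpha> * deriv \<phi> 0 = X"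
  have fh: "f holomorphic_on D" "\<And>z. z \<in> D \<Longrightarrow> norm (f z) < 1" using f by (auto simp: holo_maps_def)
  have ph: "\<phi> holomorphic_on ball 0 1" "\<phi> ` ball 0 1 \<subseteq> D" using \<phi> by (auto simp: holo_maps_def)
  have "(f \<circ> \<phi>) holomorphic_on ball 0 1" using holomorphic_on_compose_gen[OF ph(1) fh(1) ph(2)] .
  then have "norm (deriv (f \<circ> \<phi>) 0) \<le> 1 - norm ((f \<circ> \<phi>) 0)^2"
    by (rule Schwarz_Pick(1)) (use fh ph in force)
  moreover have "deriv (f \<circ> \<phi>) 0 = deriv f z * deriv \<phi> 0"
    using deriv_chain[of \<phi> 0 f] \<phi>(2) assms(1,2) fh(1) ph(1)
    by (simp add: holomorphic_on_imp_differentiable_at)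
  ultimately have 1: "cmod (deriv f z * deriv \<phi> 0) \<le> 1 - cmod (f z)^2" using \<phi>(2) by simp
  have "1 - cmod (f z)^2 > 0" using fh(2)[OF assms(2)] by (simp add: abs_square_less_1)
  moreover have "cmod (deriv f z * X) = cmod \<alpha> * cmod (deriv f z * deriv \<phi> 0)" by (simp add: X[symmetric] norm_mult)
  ultimately show "cmod (deriv f z * X) / (1 - cmod (f z)^2) \<le> norm \<alpha>"
    using mult_left_mono[OF 1, of "cmod \<alpha>"] by (simp add: pos_divide_le_eq)
qed

lemma artanh_le_kobayashi_length:
  assumes "open D" and f: "f \<in> holo_maps D (ball 0 1)" "f z = 0" "f w = of_real \<alpha>" and \<alpha>: "0 \<le> \<alpha>" "\<alpha> < 1"
    and \<sigma>: "a < b" "absolutely_continuous_curve a b \<sigma>" "\<sigma> ` {a..b} \<subseteq> D" "\<sigma> a = z" "\<sigma> b = w"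
  shows "ennreal (artanh \<alpha>) \<le> kobayashi_length D a b \<sigma>"
proof -
  have fh: "f holomorphic_on D" "\<And>z. z \<in> D \<Longrightarrow> norm (f z) < 1" using f by (auto simp: holo_maps_def)
  \<comment> \<open>A branch of artanh o f: |Re f| < 1 keeps 1 + f and 1 - f off the slit. Its
    derivative f' / (1 - f^2) is dominated by the hyperbolic density |f'| / (1 - |f|^2), hence by
    the Kobayashi metric, so the length of \<sigma> bounds the increment artanh \<alpha>.\<close>
  define L where "L = (\<lambda>z. (Ln (1 + f z) - Ln (1 - f z)) / 2)"
  have nR: "1 + f z \<notin> \<real>\<^sub>\<le>\<^sub>0 \<and> 1 - f z \<notin> \<real>\<^sub>\<le>\<^sub>0" if "z \<in> D" for z
  proof -
    have "\<bar>Re (f z)\<bar> < 1" using fh(2)[OF that] abs_Re_le_cmod[of "f z"] by linarith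
    then show ?thesis by (auto simp: complex_nonpos_Reals_iff)
  qed
  have L: "L holomorphic_on D" unfolding L_def using fh(1) nR by (intro holomorphic_intros) auto
  have dL: "deriv L t = deriv f t / (1 - f t ^ 2)" if "t \<in> D" for t
  proof (rule DERIV_imp_deriv)
    have df: "(f has_field_derivative deriv f t) (at t)" using holomorphic_derivI[OF fh(1) assms(1) that] .
    have n0: "1 + f t \<noteq> 0" "1 - f t \<noteq> 0" using nR[OF that] by force+
    have "(L has_field_derivative (inverse (1 + f t) * deriv f t - inverse (1 - f t) * (- deriv f t)) / 2) (at t)"
      unfolding L_def using nR[OF that] df by (auto intro!: derivative_eq_intros)
    moreover have "(inverse (1 + f t) * deriv f t - inverse (1 - f t) * (- deriv f t)) / 2 = deriv f t / (1 - f t ^ 2)"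
    proof -
      have "1 - f t ^ 2 = (1 + f t) * (1 - f t)" by (simp add: algebra_simps power2_eq_square)
      then show ?thesis using n0 by (simp add: divide_simps) (simp add: algebra_simps)
    qed
    ultimately show "(L has_field_derivative deriv f t / (1 - f t ^ 2)) (at t)" by (simp only:)
  qed
  have Lz: "L z = 0" using f by (simp add: L_def)
  have Lw: "L w = of_real (artanh \<alpha>)"
  proof -
    have "Ln (1 + of_real \<alpha>) = of_real (ln (1 + \<alpha>))" "Ln (1 - of_real \<alpha>) = of_real (ln (1 - \<alpha>))"
      using Ln_of_real[of "1 + \<alpha>"] Ln_of_real[of "1 - \<alpha>"] \<alpha> by simp_all
    then show ?thesis using \<alpha> by (simp add: L_def f artanh_def ln_div)
  qed
  have "ennreal (artanh \<alpha>) \<le> ennreal (cmod (L (\<sigma> b) - L (\<sigma> a)))"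
    using Lz Lw \<sigma> by (intro ennreal_leI) (simp add: abs_le_iff)
  also have "\<dots> \<le> (\<integral>\<^sup>+t\<in>{a..b}. ennreal (cmod (deriv L (\<sigma> t) * vector_derivative \<sigma> (at t within {a..b}))) \<partial>lebesgue)"
    by (rule holomorphic_increment_le_nn_integral[OF \<sigma>(2,1) assms(1) \<sigma>(3) L])
  also have "\<dots> \<le> kobayashi_length D a b \<sigma>"
    unfolding kobayashi_length_def
  proof (intro nn_integral_mono)
    fix t
    let ?X = "vector_derivative \<sigma> (at t within {a..b})"
    show "ennreal (cmod (deriv L (\<sigma> t) * ?X)) * indicator {a..b} t \<le> ennreal (kobayashi_metric D (\<sigma> t) ?X) * indicator {a..b} t"
    proof (cases "t \<in> {a..b}")
      case True
      then have tD: "\<sigma> t \<in> D" using \<sigma> by auto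
      have pos: "1 - cmod (f (\<sigma> t))^2 > 0" using fh(2)[OF tD] by (simp add: abs_square_less_1)
      have "1 - cmod (f (\<sigma> t))^2 \<le> cmod (1 - f (\<sigma> t)^2)"
        using norm_triangle_ineq2[of 1 "f (\<sigma> t)^2"] by (simp add: norm_power)
      then have "cmod (deriv L (\<sigma> t) * ?X) \<le> cmod (deriv f (\<sigma> t) * ?X) / (1 - cmod (f (\<sigma> t))^2)"
        unfolding dL[OF tD] using pos by (simp add: norm_divide norm_mult frac_le)
      also have "\<dots> \<le> kobayashi_metric D (\<sigma> t) ?X" by (rule kobayashi_metric_ge_derivative[OF assms(1) tD f(1)])
      finally show ?thesis using True by (simp add: ennreal_leI)
    qed simp
  qed
  finally show ?thesis .
qed

section \<open>Explicit joining curves\<close>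

lemma lipschitz_on_absolutely_continuous_curve:
  assumes "L-lipschitz_on {a..b} \<sigma>"
  shows "absolutely_continuous_curve a b \<sigma>"
proof (rule absolutely_continuous_curve_dominated[where f=of_real and C="L + 1" and r=1])
  show "absolutely_continuous_curve a b of_real"
    unfolding absolutely_continuous_curve_def
  proof (intro allI impI)
    fix \<epsilon> :: real assume "\<epsilon> > 0"
    have "(\<Sum>K\<in>d. dist (complex_of_real (Sup K)) (complex_of_real (Inf K))) = (\<Sum>K\<in>d. Sup K - Inf K)"
      if "d division_of S" for d S
      by (rule sum.cong[OF refl], drule division_of_real_element(1)[OF that]) (simp add: dist_norm flip: of_real_diff)
    then show "\<exists>\<delta>>0. \<forall>d S. d division_of S \<and> S \<subseteq> {a..b} \<and> (\<Sum>K\<in>d. Sup K - Inf K) < \<delta> \<longrightarrow>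
        (\<Sum>K\<in>d. dist (complex_of_real (Sup K)) (complex_of_real (Inf K))) < \<epsilon>"
      using \<open>\<epsilon> > 0\<close> by (intro exI[of _ \<epsilon>] conjI allI impI) (simp, metis)
  qed
  show "L + 1 > 0" using lipschitz_on_nonneg[OF assms] by simp
  fix x y assume "a \<le> x" "x \<le> y" "y \<le> b"
  then have "dist (\<sigma> x) (\<sigma> y) \<le> L * dist x y" using lipschitz_onD[OF assms, of x y] by simp
  also have "\<dots> \<le> (L + 1) * dist (complex_of_real x) (complex_of_real y)"
    by (simp add: dist_norm norm_of_real mult_right_mono flip: of_real_diff)
  finally show "dist (\<sigma> x) (\<sigma> y) \<le> (L + 1) * dist (complex_of_real x) (complex_of_real y)" .
qed simp

text \<open>The integrand of \<^const>\<open>kobayashi_length\<close> need not be measurable, so the length of a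
  concatenation is controlled through a Borel majorant \<open>\<rho>\<close>.\<close>
definition joinable :: "complex set \<Rightarrow> complex \<Rightarrow> complex \<Rightarrow> real \<Rightarrow> bool" where
  "joinable D z w M \<longleftrightarrow> (\<forall>a b. a < b \<longrightarrow> (\<exists>\<sigma> \<rho> S L. L-lipschitz_on {a..b} \<sigma> \<and> \<sigma> ` {a..b} \<subseteq> D \<and> \<sigma> a = z \<and> \<sigma> b = w \<and>
     finite S \<and> \<rho> \<in> borel_measurable borel \<and>
     (\<forall>t\<in>{a<..<b} - S. ennreal (kobayashi_metric D (\<sigma> t) (vector_derivative \<sigma> (at t))) \<le> \<rho> t) \<and>
     (\<integral>\<^sup>+t\<in>{a..b}. \<rho> t \<partial>lborel) \<le> ennreal M))"

lemma joinable_mono: "joinable D z w M \<Longrightarrow> M \<le> M' \<Longrightarrow> joinable D z w M'"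
  unfolding joinable_def by (meson ennreal_leI order_trans)

lemma joinableE:
  assumes "joinable D z w M" "a < b"
  obtains L \<sigma> S \<rho> where "L-lipschitz_on {a..b} \<sigma>" "\<sigma> ` {a..b} \<subseteq> D" "\<sigma> a = z" "\<sigma> b = w"
    "finite S" "\<rho> \<in> borel_measurable borel"
    "\<And>t. t \<in> {a<..<b} - S \<Longrightarrow> ennreal (kobayashi_metric D (\<sigma> t) (vector_derivative \<sigma> (at t))) \<le> \<rho> t"
    "(\<integral>\<^sup>+t\<in>{a..b}. \<rho> t \<partial>lborel) \<le> ennreal M"
proof -
  have "\<exists>\<sigma> \<rho> S L. L-lipschitz_on {a..b} \<sigma> \<and> \<sigma> ` {a..b} \<subseteq> D \<and> \<sigma> a = z \<and> \<sigma> b = w \<and>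
     finite S \<and> \<rho> \<in> borel_measurable borel \<and>
     (\<forall>t\<in>{a<..<b} - S. ennreal (kobayashi_metric D (\<sigma> t) (vector_derivative \<sigma> (at t))) \<le> \<rho> t) \<and>
     (\<integral>\<^sup>+t\<in>{a..b}. \<rho> t \<partial>lborel) \<le> ennreal M"
    using assms unfolding joinable_def by simp
  then obtain \<sigma> \<rho> S L where *: "L-lipschitz_on {a..b} \<sigma> \<and> \<sigma> ` {a..b} \<subseteq> D \<and> \<sigma> a = z \<and> \<sigma> b = w \<and>
     finite S \<and> \<rho> \<in> borel_measurable borel \<and>
     (\<forall>t\<in>{a<..<b} - S. ennreal (kobayashi_metric D (\<sigma> t) (vector_derivative \<sigma> (at t))) \<le> \<rho> t) \<and>
     (\<integral>\<^sup>+t\<in>{a..b}. \<rho> t \<partial>lborel) \<le> ennreal M"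
    by (elim exE)
  show thesis by (rule that[of L \<sigma> S \<rho>]) (use * in simp_all)
qed

lemma joinable_curve:
  assumes "joinable D z w M" "a < b"
  obtains \<sigma> where "absolutely_continuous_curve a b \<sigma>" "\<sigma> ` {a..b} \<subseteq> D" "\<sigma> a = z" "\<sigma> b = w"
    "kobayashi_length D a b \<sigma> \<le> ennreal M"
proof -
  obtain \<sigma> \<rho> S L where \<sigma>: "L-lipschitz_on {a..b} \<sigma>" "\<sigma> ` {a..b} \<subseteq> D" "\<sigma> a = z" "\<sigma> b = w"
    and S: "finite S" and \<rho>: "\<rho> \<in> borel_measurable borel"
    and le: "\<And>t. t \<in> {a<..<b} - S \<Longrightarrow> ennreal (kobayashi_metric D (\<sigma> t) (vector_derivative \<sigma> (at t))) \<le> \<rho> t"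
    and M: "(\<integral>\<^sup>+t\<in>{a..b}. \<rho> t \<partial>lborel) \<le> ennreal M"
    by (rule joinableE[OF assms], rule that)
  have "kobayashi_length D a b \<sigma> \<le> (\<integral>\<^sup>+t\<in>{a..b}. \<rho> t \<partial>lebesgue)"
    unfolding kobayashi_length_def
  proof (rule nn_integral_mono_AE)
    have "negligible (S \<union> {a, b})" using S by (intro negligible_finite) auto
    then have "AE t in lebesgue. t \<notin> S \<union> {a, b}" using AE_not_in unfolding negligible_iff_null_sets by blast
    then show "AE t in lebesgue. ennreal (kobayashi_metric D (\<sigma> t) (vector_derivative \<sigma> (at t within {a..b}))) * indicator {a..b} t \<le> \<rho> t * indicator {a..b} t"
    proof eventually_elim
      case (elim t)
      show ?case
      proof (cases "t \<in> {a..b}")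
        case True
        then have t: "t \<in> {a<..<b}" using elim by auto
        then have "at t within {a..b} = at t" by (intro at_within_interior) simp
        then show ?thesis using le[of t] elim t by simp
      qed simp
    qed
  qed
  also have "\<dots> \<le> ennreal M" using M by (simp add: nn_integral_completion)
  finally show thesis using that \<sigma> lipschitz_on_absolutely_continuous_curve by blast
qed

text \<open>The two curves are run on the two halves of {a..b}, which is why \<open>joinable\<close>
  quantifies over all parameter intervals; the junction time is added to the finite exceptional
  set.\<close>

lemma joinable_trans:
  assumes xy: "joinable D x y M" and yz: "joinable D y z N" and "0 \<le> M" "0 \<le> N"
  shows "joinable D x z (M + N)"
  unfolding joinable_def
proof (intro allI impI)
  fix a b :: real assume "a < b"
  define m where "m = (a + b) / 2"
  have m: "a < m" "m < b" using \<open>a < b\<close> by (auto simp: m_def)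
  obtain \<sigma> \<rho> S L where \<sigma>: "L-lipschitz_on {a..m} \<sigma>" "\<sigma> ` {a..m} \<subseteq> D" "\<sigma> a = x" "\<sigma> m = y"
    and S: "finite S" and \<rho>[measurable]: "\<rho> \<in> borel_measurable borel"
    and le: "\<And>t. t \<in> {a<..<m} - S \<Longrightarrow> ennreal (kobayashi_metric D (\<sigma> t) (vector_derivative \<sigma> (at t))) \<le> \<rho> t"
    and M: "(\<integral>\<^sup>+t\<in>{a..m}. \<rho> t \<partial>lborel) \<le> ennreal M"
    by (rule joinableE[OF xy m(1)], rule that)
  obtain \<sigma>' \<rho>' S' L' where \<sigma>': "L'-lipschitz_on {m..b} \<sigma>'" "\<sigma>' ` {m..b} \<subseteq> D" "\<sigma>' m = y" "\<sigma>' b = z"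
    and S': "finite S'" and \<rho>'[measurable]: "\<rho>' \<in> borel_measurable borel"
    and le': "\<And>t. t \<in> {m<..<b} - S' \<Longrightarrow> ennreal (kobayashi_metric D (\<sigma>' t) (vector_derivative \<sigma>' (at t))) \<le> \<rho>' t"
    and M': "(\<integral>\<^sup>+t\<in>{m..b}. \<rho>' t \<partial>lborel) \<le> ennreal N"
    by (rule joinableE[OF yz m(2)], rule that)
  define s where "s = (\<lambda>t. if t \<le> m then \<sigma> t else \<sigma>' t)"
  define r where "r = (\<lambda>t. \<rho> t * indicator {a..m} t + \<rho>' t * indicator {m..b} t)"
  have eq: "vector_derivative s (at t) = vector_derivative g (at t)" if "eventually (\<lambda>u. s u = g u) (nhds t)" for g t
  proof -
    have "(s has_vector_derivative f) (at t) = (g has_vector_derivative f) (at t)" for f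
      using has_vector_derivative_cong_ev[of UNIV s g t f] that eventually_nhds_x_imp_x[OF that] by simp
    then show ?thesis unfolding vector_derivative_def by simp
  qed
  have "(max L L')-lipschitz_on {a..b} s"
    unfolding s_def by (rule lipschitz_on_concat_max[OF \<sigma>(1) \<sigma>'(1)]) (simp add: \<sigma> \<sigma>')
  moreover have "s ` {a..b} \<subseteq> D" using \<sigma>(2) \<sigma>'(2) by (auto simp: s_def)
  moreover have "s a = x" "s b = z" using m \<sigma> \<sigma>' by (auto simp: s_def)
  moreover have "finite (S \<union> S' \<union> {m})" using S S' by simp
  moreover have "r \<in> borel_measurable borel" unfolding r_def by measurable
  moreover have "\<forall>t\<in>{a<..<b} - (S \<union> S' \<union> {m}). ennreal (kobayashi_metric D (s t) (vector_derivative s (at t))) \<le> r t"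
  proof
    fix t assume t: "t \<in> {a<..<b} - (S \<union> S' \<union> {m})"
    then consider "a < t" "t < m" | "m < t" "t < b" by force
    then show "ennreal (kobayashi_metric D (s t) (vector_derivative s (at t))) \<le> r t"
    proof cases
      case 1
      have "eventually (\<lambda>u. u < m) (nhds t)" using eventually_nhds_in_open[of "{..<m}" t] 1 by simp
      then have "eventually (\<lambda>u. s u = \<sigma> u) (nhds t)" by eventually_elim (simp add: s_def)
      from eq[OF this] show ?thesis using le[of t] t 1 by (simp add: r_def s_def)
    next
      case 2
      have "eventually (\<lambda>u. u > m) (nhds t)" using eventually_nhds_in_open[of "{m<..}" t] 2 by simp
      then have "eventually (\<lambda>u. s u = \<sigma>' u) (nhds t)" by eventually_elim (simp add: s_def)
      from eq[OF this] show ?thesis using le'[of t] t 2 by (simp add: r_def s_def)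
    qed
  qed
  moreover have "(\<integral>\<^sup>+t\<in>{a..b}. r t \<partial>lborel) \<le> ennreal (M + N)"
  proof -
    have "(\<integral>\<^sup>+t\<in>{a..b}. r t \<partial>lborel) \<le> (\<integral>\<^sup>+t. r t \<partial>lborel)"
      by (intro nn_integral_mono) (auto simp: indicator_def)
    also have "\<dots> = (\<integral>\<^sup>+t\<in>{a..m}. \<rho> t \<partial>lborel) + (\<integral>\<^sup>+t\<in>{m..b}. \<rho>' t \<partial>lborel)"
      unfolding r_def by (rule nn_integral_add) auto
    also have "\<dots> \<le> ennreal M + ennreal N" using M M' by (rule add_mono)
    finally show ?thesis using assms by simp
  qed
  ultimately show "\<exists>\<sigma> \<rho> S L. L-lipschitz_on {a..b} \<sigma> \<and> \<sigma> ` {a..b} \<subseteq> D \<and> \<sigma> a = x \<and> \<sigma> b = z \<and>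
     finite S \<and> \<rho> \<in> borel_measurable borel \<and>
     (\<forall>t\<in>{a<..<b} - S. ennreal (kobayashi_metric D (\<sigma> t) (vector_derivative \<sigma> (at t))) \<le> \<rho> t) \<and>
     (\<integral>\<^sup>+t\<in>{a..b}. \<rho> t \<partial>lborel) \<le> ennreal (M + N)"
    by (intro exI[of _ s] exI[of _ r] exI[of _ "S \<union> S' \<union> {m}"] exI[of _ "max L L'"]) (intro conjI)
qed

text \<open>Precomposing h with the automorphism of the disc that sends 0 to s gives an analytic
  disc centred at h s, hence the density v / (1 - s^2) along the radius, and this integrates to
  artanh \<beta>.\<close>

lemma joinable_disc_radius:
  assumes h: "h \<in> holo_maps (ball 0 1) D" and \<beta>: "0 \<le> \<beta>" "\<beta> < 1"
  shows "joinable D (h 0) (h (of_real \<beta>)) (artanh \<beta>)"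
  unfolding joinable_def
proof (intro allI impI)
  fix a b :: real assume "a < b"
  define s where "s t = \<beta> * (t - a) / (b - a)" for t
  define v where "v = \<beta> / (b - a)"
  have s: "0 \<le> s t" "s t \<le> \<beta>" if "t \<in> {a..b}" for t
  proof -
    have "0 \<le> (t - a) / (b - a)" "(t - a) / (b - a) \<le> 1" using that \<open>a < b\<close> by auto
    then have "0 \<le> \<beta> * ((t - a) / (b - a))" "\<beta> * ((t - a) / (b - a)) \<le> \<beta> * 1"
      using mult_nonneg_nonneg[of \<beta>] mult_left_mono[of _ 1 \<beta>] \<beta> by blast+
    then show "0 \<le> s t" "s t \<le> \<beta>" by (simp_all add: s_def)
  qed
  have v: "0 \<le> v" using \<beta> \<open>a < b\<close> by (simp add: v_def)
  have ds: "(s has_real_derivative v) (at t within A)" for t A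
    unfolding s_def v_def using \<open>a < b\<close> by (auto intro!: derivative_eq_intros)
  have hh: "h holomorphic_on ball 0 1" "h ` ball 0 1 \<subseteq> D" using h by (auto simp: holo_maps_def)
  define \<sigma> where "\<sigma> t = h (of_real (s t))" for t
  \<comment> \<open>Clamping \<open>s t\<close> to [0, \<beta>] does not change the majorant on
    {a..b} and keeps its denominator positive elsewhere.\<close>
  define \<rho> where "\<rho> t = v / (1 - (min \<beta> (max 0 (s t)))^2)" for t
  have "continuous_on (cball 0 \<beta>) (deriv h)"
    using hh(1) \<beta> by (intro continuous_on_subset[OF holomorphic_on_imp_continuous_on[OF holomorphic_deriv[OF hh(1) open_ball]]]) auto
  then have "bounded (deriv h ` cball 0 \<beta>)" by (intro compact_imp_bounded compact_continuous_image) auto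
  then obtain B where B: "B > 0" "\<And>z. z \<in> cball 0 \<beta> \<Longrightarrow> norm (deriv h z) \<le> B"
    unfolding bounded_pos by blast
  have "(B * v)-lipschitz_on {a..b} \<sigma>"
  proof (rule lipschitz_onI)
    fix x y assume xy: "x \<in> {a..b}" "y \<in> {a..b}"
    have "norm (h (of_real (s x)) - h (of_real (s y))) \<le> B * norm (complex_of_real (s x) - of_real (s y))"
    proof (rule field_differentiable_bound[of "cball 0 \<beta>" h "deriv h"])
      show "(h has_field_derivative deriv h z) (at z within cball 0 \<beta>)" if "z \<in> cball 0 \<beta>" for z
        by (rule has_field_derivative_at_within, rule holomorphic_derivI[OF hh(1)]) (use that \<beta> in auto)
    qed (use B s[OF xy(1)] s[OF xy(2)] in auto)
    also have "norm (complex_of_real (s x) - of_real (s y)) = v * dist x y"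
    proof -
      have "s x - s y = v * (x - y)" by (simp add: s_def v_def field_simps diff_divide_distrib)
      then have "\<bar>s x - s y\<bar> = v * dist x y" using v by (simp add: abs_mult dist_real_def)
      then show ?thesis by (simp flip: of_real_diff)
    qed
    finally show "dist (\<sigma> x) (\<sigma> y) \<le> B * v * dist x y" by (simp add: \<sigma>_def dist_norm mult.assoc)
  qed (use B v in auto)
  moreover have "\<sigma> ` {a..b} \<subseteq> D"
  proof
    fix z assume "z \<in> \<sigma> ` {a..b}"
    then obtain t where "t \<in> {a..b}" "z = \<sigma> t" by auto
    moreover have "complex_of_real (s t) \<in> ball 0 1" using s[OF \<open>t \<in> {a..b}\<close>] \<beta> by simp
    ultimately show "z \<in> D" using hh(2) by (auto simp: \<sigma>_def)
  qed
  moreover have "\<sigma> a = h 0" "\<sigma> b = h (of_real \<beta>)" using \<open>a < b\<close> by (auto simp: \<sigma>_def s_def)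
  moreover have "(\<lambda>t. ennreal (\<rho> t)) \<in> borel_measurable borel" unfolding \<rho>_def s_def by measurable
  moreover have "\<forall>t\<in>{a<..<b} - {}. ennreal (kobayashi_metric D (\<sigma> t) (vector_derivative \<sigma> (at t))) \<le> ennreal (\<rho> t)"
  proof
    fix t assume t: "t \<in> {a<..<b} - {}"
    then have st: "0 \<le> s t" "s t \<le> \<beta>" using s[of t] by auto
    let ?c = "complex_of_real (s t)"
    have c1: "norm ?c < 1" using st \<beta> by simp
    have dh: "(h has_field_derivative deriv h ?c) (at ?c)" using hh(1) c1 by (intro holomorphic_derivI) auto
    have "((\<lambda>t. complex_of_real (s t)) has_vector_derivative of_real v) (at t)"
      using ds[of t UNIV] by (intro has_vector_derivative_of_real) (simp add: has_real_derivative_iff_has_vector_derivative)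
    from field_vector_diff_chain_at[OF this dh]
    have "(\<sigma> has_vector_derivative of_real v * deriv h ?c) (at t)" by (simp add: \<sigma>_def[abs_def] o_def)
    then have vd: "vector_derivative \<sigma> (at t) = of_real v * deriv h ?c" by (rule vector_derivative_at)
    define \<phi> where "\<phi> = h \<circ> Moebius_function 0 (- ?c)"
    have mo: "Moebius_function 0 (- ?c) ` ball 0 1 \<subseteq> ball 0 1" using Moebius_function_norm_lt_1 c1 by auto
    have "\<phi> \<in> holo_maps (ball 0 1) D"
      unfolding \<phi>_def holo_maps_def
      using holomorphic_on_compose_gen[OF Moebius_function_holomorphic hh(1) mo] c1 mo hh(2) by fastforce
    moreover have \<phi>0: "\<phi> 0 = \<sigma> t" by (simp add: \<phi>_def \<sigma>_def Moebius_function_of_zero)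
    moreover have "deriv \<phi> 0 = deriv h ?c * (1 - of_real (s t)^2)"
    proof (rule DERIV_imp_deriv)
      have "(Moebius_function 0 (- ?c) has_field_derivative (1 - of_real (s t)^2)) (at 0)"
        using Moebius_function_has_field_derivative[of "- ?c" 0] c1 by (simp flip: of_real_power)
      moreover have "Moebius_function 0 (- ?c) 0 = ?c" by (simp add: Moebius_function_of_zero)
      ultimately show "(\<phi> has_field_derivative deriv h ?c * (1 - of_real (s t)^2)) (at 0)"
        unfolding \<phi>_def using DERIV_chain[of h "deriv h ?c" "Moebius_function 0 (- ?c)" 0] dh by simp
    qed
    moreover have pos: "1 - s t ^ 2 > 0" using st \<beta> by (simp add: abs_square_less_1)
    ultimately have "kobayashi_metric D (\<sigma> t) (of_real v * deriv h ?c) \<le> norm (of_real (v / (1 - s t ^ 2)) :: complex)"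
    proof (intro kobayashi_metric_le)
      have "(1 - complex_of_real (s t)^2) \<noteq> 0" using pos by (metis less_irrefl of_real_0 of_real_1 of_real_diff of_real_eq_iff of_real_power)
      then show "of_real (v / (1 - s t ^ 2)) * deriv \<phi> 0 = of_real v * deriv h ?c"
        using \<open>deriv \<phi> 0 = _\<close> by simp
    qed auto
    also have "\<dots> = \<rho> t" 
    proof -
      have "\<rho> t = v / (1 - s t ^ 2)" using st by (simp add: \<rho>_def)
      moreover have "0 \<le> v / (1 - s t ^ 2)" using pos v by simp
      ultimately show ?thesis by (simp only: norm_of_real abs_of_nonneg)
    qed
    finally show "ennreal (kobayashi_metric D (\<sigma> t) (vector_derivative \<sigma> (at t))) \<le> ennreal (\<rho> t)"
      unfolding vd by (rule ennreal_leI)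
  qed
  moreover have "(\<integral>\<^sup>+t\<in>{a..b}. ennreal (\<rho> t) \<partial>lborel) \<le> ennreal (artanh \<beta>)"
  proof -
    have "(\<integral>\<^sup>+t\<in>{a..b}. ennreal (\<rho> t) \<partial>lborel) = ennreal (artanh (s b) - artanh (s a))"
    proof (rule nn_integral_FTC_Icc)
      fix t assume t: "t \<in> {a..b}"
      have "((\<lambda>t. artanh (s t)) has_real_derivative v / (1 - (s t)^2)) (at t)"
        using DERIV_chain2[OF artanh_real_has_field_derivative[of "s t" UNIV] ds[of t UNIV]] s[OF t] \<beta> by auto
      then show "((\<lambda>t. artanh (s t)) has_real_derivative \<rho> t) (at t)" using s[OF t] by (simp add: \<rho>_def)
      show "0 \<le> \<rho> t" using s[OF t] \<beta> v by (auto simp: \<rho>_def abs_square_le_1 intro!: divide_nonneg_nonneg)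
    qed (use \<open>a < b\<close> in \<open>auto simp: \<rho>_def s_def\<close>)
    moreover have "s b = \<beta>" "s a = 0" using \<open>a < b\<close> by (auto simp: s_def)
    ultimately show ?thesis by simp
  qed
  ultimately show "\<exists>\<sigma> \<rho> S L. L-lipschitz_on {a..b} \<sigma> \<and> \<sigma> ` {a..b} \<subseteq> D \<and> \<sigma> a = h 0 \<and> \<sigma> b = h (of_real \<beta>) \<and>
     finite S \<and> \<rho> \<in> borel_measurable borel \<and>
     (\<forall>t\<in>{a<..<b} - S. ennreal (kobayashi_metric D (\<sigma> t) (vector_derivative \<sigma> (at t))) \<le> \<rho> t) \<and>
     (\<integral>\<^sup>+t\<in>{a..b}. \<rho> t \<partial>lborel) \<le> ennreal (artanh \<beta>)"
    by (intro exI[of _ \<sigma>] exI[of _ "\<lambda>t. ennreal (\<rho> t)"] exI[of _ "{}"] exI[of _ "B * v"]) (intro conjI, auto)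
qed

text \<open>An automorphism moves x to 0 and a rotation moves the image of y onto the positive axis,
  which reduces the claim to a radius.\<close>

lemma joinable_disc:
  assumes h: "h \<in> holo_maps (ball 0 1) D" and xy: "norm x < 1" "norm y < 1"
  shows "joinable D (h x) (h y) (artanh (norm (Moebius_function 0 x y)))"
proof -
  define m where "m = Moebius_function 0 x y"
  have m1: "norm m < 1" unfolding m_def using Moebius_function_norm_lt_1 xy by auto
  define e where "e = (if m = 0 then 1 else m / of_real (norm m))"
  have e: "norm e = 1" "e * of_real (norm m) = m" by (auto simp: e_def norm_divide)
  define g where "g = (\<lambda>z. h (Moebius_function 0 (- x) (e * z)))"
  have "g \<in> holo_maps (ball 0 1) D"
  proof -
    have e1: "(\<lambda>z. e * z) ` ball 0 1 \<subseteq> ball 0 1" using e by (auto simp: norm_mult)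
    have "(\<lambda>z. e * z) holomorphic_on ball 0 1" by (intro holomorphic_intros)
    then have 1: "(Moebius_function 0 (- x) \<circ> (\<lambda>z. e * z)) holomorphic_on ball 0 1"
      by (rule holomorphic_on_compose_gen[OF _ Moebius_function_holomorphic e1]) (use xy in auto)
    have 2: "(Moebius_function 0 (- x) \<circ> (\<lambda>z. e * z)) ` ball 0 1 \<subseteq> ball 0 1"
      using Moebius_function_norm_lt_1[of "- x"] xy e by (auto simp: norm_mult)
    have "h \<circ> (Moebius_function 0 (- x) \<circ> (\<lambda>z. e * z)) holomorphic_on ball 0 1"
      by (rule holomorphic_on_compose_gen[OF 1 _ 2]) (use h in \<open>auto simp: holo_maps_def\<close>)
    moreover have "h \<circ> (Moebius_function 0 (- x) \<circ> (\<lambda>z. e * z)) = g" by (auto simp: g_def)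
    moreover have "g ` ball 0 1 \<subseteq> D" using 2 h by (force simp: holo_maps_def g_def)
    ultimately show ?thesis by (simp add: holo_maps_def)
  qed
  from joinable_disc_radius[OF this norm_ge_zero m1]
  have "joinable D (g 0) (g (of_real (norm m))) (artanh (norm m))" .
  moreover have "g 0 = h x" by (simp add: g_def Moebius_function_of_zero)
  moreover have "g (of_real (norm m)) = h y"
    using Moebius_function_compose[of "-x" x y] xy unfolding g_def e(2) by (simp add: m_def)
  ultimately show ?thesis by (simp add: m_def)
qed

lemma joinable_imp_mem:
  assumes "joinable D z w M"
  shows "z \<in> D" "w \<in> D"
proof -
  obtain \<sigma> where "\<sigma> ` {0..1::real} \<subseteq> D" "\<sigma> 0 = z" "\<sigma> 1 = w"
    using joinable_curve[OF assms, of 0 1] by auto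
  then show "z \<in> D" "w \<in> D" by auto
qed

section \<open>Comparison of the two distances\<close>

lemma kobayashi_dist_le:
  assumes "joinable D z w M" "0 \<le> M"
  shows "kobayashi_dist D z w \<le> M"
proof -
  obtain \<sigma> where \<sigma>: "absolutely_continuous_curve 0 1 \<sigma>" "\<sigma> ` {0..1} \<subseteq> D" "\<sigma> 0 = z" "\<sigma> 1 = w"
    "kobayashi_length D 0 1 \<sigma> \<le> ennreal M"
    using joinable_curve[OF assms(1), of 0 1] by auto
  have "Inf {kobayashi_length D a b \<sigma> | a b \<sigma>.
       a < b \<and> absolutely_continuous_curve a b \<sigma> \<and> \<sigma> ` {a..b} \<subseteq> D \<and> \<sigma> a = z \<and> \<sigma> b = w} \<le> kobayashi_length D 0 1 \<sigma>"
    using \<sigma> by (intro Inf_lower CollectI exI[of _ "0::real"] exI[of _ "1::real"] exI[of _ \<sigma>]) auto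
  with \<sigma>(5) show ?thesis unfolding kobayashi_dist_def using \<open>0 \<le> M\<close> by (intro enn2real_leI) auto
qed

text \<open>The hypothesis \<open>joinable\<close> excludes an infinite infimum, which
  \<open>enn2real\<close> would turn into 0.\<close>

lemma artanh_le_kobayashi_dist:
  assumes "open D" and f: "f \<in> holo_maps D (ball 0 1)" "f z = 0" "f w = of_real \<alpha>" and \<alpha>: "0 \<le> \<alpha>" "\<alpha> < 1"
    and j: "joinable D z w M"
  shows "artanh \<alpha> \<le> kobayashi_dist D z w"
proof -
  let ?S = "{kobayashi_length D a b \<sigma> | a b \<sigma>.
       a < b \<and> absolutely_continuous_curve a b \<sigma> \<and> \<sigma> ` {a..b} \<subseteq> D \<and> \<sigma> a = z \<and> \<sigma> b = w}"
  obtain \<sigma> where \<sigma>: "absolutely_continuous_curve 0 1 \<sigma>" "\<sigma> ` {0..1} \<subseteq> D" "\<sigma> 0 = z" "\<sigma> 1 = w"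
    "kobayashi_length D 0 1 \<sigma> \<le> ennreal M"
    using joinable_curve[OF j, of 0 1] by auto
  have "Inf ?S \<le> kobayashi_length D 0 1 \<sigma>"
    using \<sigma> by (intro Inf_lower CollectI exI[of _ "0::real"] exI[of _ "1::real"] exI[of _ \<sigma>]) auto
  then have fin: "Inf ?S < top" using \<sigma>(5) by (meson ennreal_less_top order.strict_trans1)
  have "ennreal (artanh \<alpha>) \<le> Inf ?S"
    using artanh_le_kobayashi_length[OF assms(1) f \<alpha>] by (intro Inf_greatest) auto
  then have "enn2real (ennreal (artanh \<alpha>)) \<le> enn2real (Inf ?S)" using fin by (intro enn2real_mono)
  moreover have "artanh \<alpha> \<le> enn2real (ennreal (artanh \<alpha>))" by (cases "0 \<le> artanh \<alpha>") (auto simp: ennreal_neg)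
  ultimately show ?thesis unfolding kobayashi_dist_def by linarith
qed

lemma holo_maps_subset: "f \<in> holo_maps D E \<Longrightarrow> D' \<subseteq> D \<Longrightarrow> f \<in> holo_maps D' E"
  by (auto simp: holo_maps_def intro: holomorphic_on_subset)

lemma caratheodory_le_kobayashi_dist:
  assumes "open D'" "D' \<subseteq> D" "joinable D' z w M"
  shows "caratheodory_dist D z w \<le> kobayashi_dist D' z w"
  unfolding caratheodory_dist_def
proof (rule cSup_least)
  have "artanh 0 \<in> {artanh \<alpha> | \<alpha> :: real. \<alpha> \<in> {0..<1} \<and>
       (\<exists>f\<in>holo_maps D (ball 0 1). f z = 0 \<and> f w = complex_of_real \<alpha>)}"
    by (intro CollectI exI[of _ "0::real"] conjI bexI[of _ "\<lambda>_. 0"]) (auto simp: holo_maps_def)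
  then show "{artanh \<alpha> | \<alpha> :: real. \<alpha> \<in> {0..<1} \<and>
       (\<exists>f\<in>holo_maps D (ball 0 1). f z = 0 \<and> f w = complex_of_real \<alpha>)} \<noteq> {}" by blast
  fix x assume "x \<in> {artanh \<alpha> | \<alpha> :: real. \<alpha> \<in> {0..<1} \<and>
       (\<exists>f\<in>holo_maps D (ball 0 1). f z = 0 \<and> f w = complex_of_real \<alpha>)}"
  then obtain \<alpha> f where "x = artanh \<alpha>" "0 \<le> \<alpha>" "\<alpha> < 1" "f \<in> holo_maps D (ball 0 1)" "f z = 0" "f w = of_real \<alpha>"
    by auto
  then show "x \<le> kobayashi_dist D' z w"
    using artanh_le_kobayashi_dist[OF assms(1) _ _ _ _ _ assms(3)] holo_maps_subset[OF _ assms(2)] by blast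
qed

text \<open>An automorphism sending f z to 0, followed by a rotation that makes the value at w
  nonnegative, turns f into a competitor for the supremum. That the supremum is bounded above is
  taken from the Kobayashi distance of the smaller set D', where z and w are joinable.\<close>

lemma artanh_le_caratheodory_dist:
  assumes D': "open D'" "D' \<subseteq> D" "joinable D' z w M"
    and f: "f holomorphic_on D" "\<And>x. x \<in> D \<Longrightarrow> norm (f x) < 1"
  shows "artanh (norm (Moebius_function 0 (f z) (f w))) \<le> caratheodory_dist D z w"
proof -
  have zw: "z \<in> D" "w \<in> D" using joinable_imp_mem[OF D'(3)] D'(2) by auto
  define m where "m = Moebius_function 0 (f z) (f w)"
  have m1: "norm m < 1" unfolding m_def using Moebius_function_norm_lt_1 f zw by auto
  define e where "e = (if m = 0 then 1 else of_real (norm m) / m)"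
  have e: "norm e = 1" "e * m = of_real (norm m)" by (auto simp: e_def norm_divide)
  define g where "g = (\<lambda>x. e * Moebius_function 0 (f z) (f x))"
  have "Moebius_function 0 (f z) \<circ> f holomorphic_on D"
    using f zw by (intro holomorphic_on_compose_gen[OF _ Moebius_function_holomorphic]) auto
  then have "g holomorphic_on D" unfolding g_def by (auto intro!: holomorphic_intros simp: o_def)
  moreover have "norm (g x) < 1" if "x \<in> D" for x
    using Moebius_function_norm_lt_1 f zw that e by (auto simp: g_def norm_mult)
  ultimately have g: "g \<in> holo_maps D (ball 0 1)" by (auto simp: holo_maps_def)
  have g2: "g z = 0" "g w = of_real (norm m)" using e by (auto simp: g_def Moebius_function_eq_zero m_def)
  show ?thesis
    unfolding caratheodory_dist_def m_def[symmetric]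
  proof (rule cSup_upper)
    show "artanh (norm m) \<in> {artanh \<alpha> | \<alpha> :: real. \<alpha> \<in> {0..<1} \<and>
       (\<exists>f\<in>holo_maps D (ball 0 1). f z = 0 \<and> f w = complex_of_real \<alpha>)}"
      using m1 g g2 by auto
    show "bdd_above {artanh \<alpha> | \<alpha> :: real. \<alpha> \<in> {0..<1} \<and>
       (\<exists>f\<in>holo_maps D (ball 0 1). f z = 0 \<and> f w = complex_of_real \<alpha>)}"
      using artanh_le_kobayashi_dist[OF D'(1) _ _ _ _ _ D'(3)] holo_maps_subset[OF _ D'(2)]
      by (intro bdd_aboveI[of _ "kobayashi_dist D' z w"]) auto
  qed
qed

lemma artanh_real_mono:
  fixes x y :: real
  assumes "-1 < x" "x \<le> y" "y < 1"
  shows "artanh x \<le> artanh y"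
proof -
  have "(1 + x) / (1 - x) \<le> (1 + y) / (1 - y)" using assms by (intro frac_le) auto
  then show ?thesis unfolding artanh_def using assms by (intro divide_right_mono ln_mono) auto
qed

section \<open>Joining the points of a compact set at bounded cost\<close>

lemma joinable_ball:
  assumes "ball z r \<subseteq> D" "r > 0" "w \<in> ball z (r/2)"
  shows "joinable D z w (artanh (1/2))" "joinable D w z (artanh (1/2))"
proof -
  define h where "h = (\<lambda>x. z + of_real r * x)"
  have h: "h \<in> holo_maps (ball 0 1) D"
    using assms unfolding holo_maps_def h_def by (auto intro!: holomorphic_intros simp: dist_norm norm_mult subset_iff)
  define y where "y = (w - z) / of_real r"
  have y: "norm y < 1/2" "h y = w" "h 0 = z" using assms by (auto simp: y_def h_def norm_divide dist_norm norm_minus_commute field_simps)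
  have mono: "artanh (norm y) \<le> artanh (1/2)"
    using y(1) by (intro artanh_real_mono) (auto intro: less_le_trans[of _ 0])
  have "norm (Moebius_function 0 0 y) = norm y" "norm (Moebius_function 0 y 0) = norm y"
    by (auto simp: Moebius_function_simple)
  then show "joinable D z w (artanh (1/2))" "joinable D w z (artanh (1/2))"
    using joinable_disc[OF h, of 0 y] joinable_disc[OF h, of y 0] y joinable_mono[OF _ mono] by auto
qed

lemma artanh_half_nonneg: "0 \<le> artanh (1/2 :: real)"
  by (simp add: artanh_def)

text \<open>The points that can be joined to x form a relatively clopen subset of D. Both directions
  are carried along, so that no curve has to be reversed.\<close>

lemma joinable_connected:
  assumes "open D" "connected D" and xy: "x \<in> D" "y \<in> D"
  shows "\<exists>M\<ge>0. joinable D x y M \<and> joinable D y x M"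
proof -
  let ?A = "artanh (1/2 :: real)"
  let ?P = "\<lambda>w. \<exists>M\<ge>0. joinable D x w M \<and> joinable D w x M"
  define S where "S = {w \<in> D. ?P w}"
  have step: "?P w'" if "?P w" "joinable D w w' ?A" "joinable D w' w ?A" for w w'
    using that joinable_trans artanh_half_nonneg by (metis add.commute add_nonneg_nonneg)
  have bl: "\<exists>r>0. ball w r \<subseteq> D \<and> (\<forall>w'\<in>ball w r. joinable D w w' ?A \<and> joinable D w' w ?A)" if "w \<in> D" for w
  proof -
    obtain r where r: "r > 0" "ball w r \<subseteq> D" by (rule openE[OF assms(1) \<open>w \<in> D\<close>])
    show ?thesis
    proof (intro exI[of _ "r/2"] conjI ballI)
      show "ball w (r/2) \<subseteq> D" using r subset_ball[of "r/2" r w] by auto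
    qed (use joinable_ball[OF r(2,1)] r in auto)
  qed
  have "openin (top_of_set D) S"
    unfolding openin_contains_ball
  proof (intro conjI ballI)
    show "S \<subseteq> D" by (auto simp: S_def)
    fix w assume "w \<in> S"
    then obtain r where r: "r > 0" "ball w r \<subseteq> D" "\<forall>w'\<in>ball w r. joinable D w w' ?A \<and> joinable D w' w ?A" "?P w"
      using bl[of w] by (auto simp: S_def)
    show "\<exists>e>0. ball w e \<inter> D \<subseteq> S"
      by (intro exI[of _ r] conjI subsetI) (use r step[OF r(4)] in \<open>auto simp: S_def\<close>)
  qed
  moreover have "closedin (top_of_set D) S"
  proof -
    have "openin (top_of_set D) (D - S)"
      unfolding openin_contains_ball
    proof (intro conjI ballI)
      fix w assume w: "w \<in> D - S"
      then obtain r where r: "r > 0" "ball w r \<subseteq> D" "\<forall>w'\<in>ball w r. joinable D w w' ?A \<and> joinable D w' w ?A"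
        using bl[of w] by auto
      show "\<exists>e>0. ball w e \<inter> D \<subseteq> D - S"
      proof (intro exI[of _ r] conjI subsetI)
        fix w' assume w': "w' \<in> ball w r \<inter> D"
        then show "w' \<in> D - S" using step[of w' w] r w by (auto simp: S_def)
      qed (use r in auto)
    qed auto
    moreover have "S = D - (D - S)" by (auto simp: S_def)
    ultimately show ?thesis by (metis closedin_diff closedin_topspace topspace_euclidean_subtopology)
  qed
  moreover have "x \<in> S"
  proof -
    obtain r where "r > 0" "\<forall>w'\<in>ball x r. joinable D x w' ?A \<and> joinable D w' x ?A" using bl[OF xy(1)] by blast
    then have "joinable D x x ?A" by simp
    then show ?thesis using xy artanh_half_nonneg by (auto simp: S_def)
  qed
  ultimately have "S = D" using assms(2) unfolding connected_clopen by blast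
  then show ?thesis using xy by (auto simp: S_def)
qed

text \<open>Finitely many balls of half the admissible radius cover K. Each point is joined to a
  base point through the centre of its ball, at a cost bounded by the sum of the finitely many costs
  of the centres.\<close>

lemma joinable_compact:
  assumes "open D" "connected D" "compact K" "K \<subseteq> D"
  obtains M where "M \<ge> 0" "\<And>x y. x \<in> K \<Longrightarrow> y \<in> K \<Longrightarrow> joinable D x y M"
proof (cases "K = {}")
  case False
  then obtain x0 where x0: "x0 \<in> K" by blast
  let ?A = "artanh (1/2 :: real)"
  have "\<exists>r>0. ball w r \<subseteq> D" if "w \<in> K" for w
    using assms that open_contains_ball by blast
  then obtain r where r: "\<And>w. w \<in> K \<Longrightarrow> r w > 0 \<and> ball w (r w) \<subseteq> D" by metis
  have "\<exists>M\<ge>0. joinable D x0 w M \<and> joinable D w x0 M" if "w \<in> K" for w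
    using joinable_connected[OF assms(1,2)] assms(4) x0 that by blast
  then obtain m where m: "\<And>w. w \<in> K \<Longrightarrow> m w \<ge> 0 \<and> joinable D x0 w (m w) \<and> joinable D w x0 (m w)" by metis
  obtain C where C: "C \<subseteq> K" "finite C" "K \<subseteq> (\<Union>w\<in>C. ball w (r w / 2))"
    by (rule compactE_image[OF assms(3), of K "\<lambda>w. ball w (r w / 2)"]) (use r in force)+
  define M0 where "M0 = (\<Sum>w\<in>C. m w) + ?A"
  have M0: "M0 \<ge> 0" unfolding M0_def using m C artanh_half_nonneg by (intro add_nonneg_nonneg sum_nonneg) auto
  have "joinable D x0 w M0 \<and> joinable D w x0 M0" if "w \<in> K" for w
  proof -
    obtain c where c: "c \<in> C" "w \<in> ball c (r c / 2)" using C \<open>w \<in> K\<close> by blast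
    then have cK: "c \<in> K" using C by auto
    have le: "m c + ?A \<le> M0" unfolding M0_def using member_le_sum[of c C m] c C m by auto
    have j: "joinable D c w ?A" "joinable D w c ?A" using joinable_ball[of c "r c" D w] r[OF cK] c by auto
    have "joinable D x0 w (m c + ?A)" using joinable_trans[OF _ j(1)] m[OF cK] artanh_half_nonneg by auto
    moreover have "joinable D w x0 (?A + m c)" using joinable_trans[OF j(2)] m[OF cK] artanh_half_nonneg by auto
    ultimately show ?thesis using le joinable_mono by (metis add.commute)
  qed
  then show thesis using that[of "M0 + M0"] M0 joinable_trans by (metis add_nonneg_nonneg)
qed (use that[of 0] in auto)

section \<open>Hyperbolic distance in the half-plane\<close>

text \<open>The Poincare distance of the upper half-plane for the density |dz| / (2 Im z), the
  normalisation in which it equals artanh of the pseudohyperbolic distance. The arsinh form is the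
  one in which a perturbation of |x - y| can be estimated by the mean value theorem.\<close>

definition hdist :: "complex \<Rightarrow> complex \<Rightarrow> real" where
  "hdist x y = arsinh (norm (x - y) / (2 * sqrt (Im x * Im y)))"

lemma norm_diff_cnj_square: "norm (x - cnj y) ^ 2 = norm (x - y) ^ 2 + 4 * (Im x * Im y)"
  unfolding cmod_power2 by (simp add: power2_eq_square algebra_simps)

lemma artanh_eq_hdist:
  assumes "Im x > 0" "Im y > 0"
  shows "artanh (norm (x - y) / norm (x - cnj y)) = hdist x y"
proof -
  define d where "d = norm (x - y)"
  define q where "q = sqrt (Im x * Im y)"
  have q: "q > 0" "q^2 = Im x * Im y" using assms by (auto simp: q_def)
  have n: "norm (x - cnj y) = sqrt (d^2 + 4 * q^2)"
    using norm_diff_cnj_square[of x y] by (metis d_def norm_ge_zero q(2) real_sqrt_unique)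
  have "tanh (hdist x y) = (d / (2*q)) / sqrt ((d / (2*q))^2 + 1)"
    unfolding hdist_def tanh_def by (simp add: sinh_arsinh_real cosh_arsinh_real d_def q_def)
  also have "(d / (2*q))^2 + 1 = (d^2 + 4*q^2) / (2*q)^2"
    using q(1) by (simp add: power_divide add_divide_distrib)
  also have "sqrt ((d^2 + 4*q^2) / (2*q)^2) = sqrt (d^2 + 4*q^2) / (2*q)" 
  proof -
    have "sqrt ((2*q)^2) = 2*q" using q(1) by (intro real_sqrt_unique) auto
    then show ?thesis by (simp only: real_sqrt_divide)
  qed
  also have "(d / (2*q)) / (sqrt (d^2 + 4*q^2) / (2*q)) = d / sqrt (d^2 + 4*q^2)" using q by simp
  finally have "tanh (hdist x y) = norm (x - y) / norm (x - cnj y)" by (simp add: n d_def)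
  then show ?thesis using artanh_tanh_real by metis
qed

lemma hdist_nonneg: "Im x > 0 \<Longrightarrow> Im y > 0 \<Longrightarrow> 0 \<le> hdist x y"
  unfolding hdist_def using arsinh_real_neg_iff[of "norm (x - y) / (2 * sqrt (Im x * Im y))"]
  by (simp add: not_less[symmetric] del: arsinh_real_neg_iff) (simp add: not_less divide_nonneg_nonneg)

lemma add_ii_nonzero: "Im x > 0 \<Longrightarrow> x + \<i> \<noteq> 0"
  by (metis add.inverse_unique complex_i_not_neg_numeral  imaginary_unit.sel(2) less_asym neg_less_0_iff_less uminus_complex.sel(2) zero_less_one add.commute)

lemma norm_cayley_less_1:
  assumes "Im x > 0" shows "norm ((x - \<i>) / (x + \<i>)) < 1"
proof -
  have "norm (x - \<i>) ^ 2 < norm (x + \<i>) ^ 2" using assms unfolding cmod_power2 by (simp add: power2_eq_square algebra_simps)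
  then have "norm (x - \<i>) < norm (x + \<i>)" by (rule power_less_imp_less_base) simp
  then show ?thesis by (simp add: norm_divide divide_less_eq_1)
qed

lemma norm_Moebius_cayley:
  assumes "Im x > 0" "Im y > 0"
  shows "norm (Moebius_function 0 ((x - \<i>) / (x + \<i>)) ((y - \<i>) / (y + \<i>))) = norm (x - y) / norm (x - cnj y)"
proof -
  define a where "a = x + \<i>"
  define b where "b = y + \<i>"
  have nz0: "a \<noteq> 0" "b \<noteq> 0" unfolding a_def b_def using add_ii_nonzero assms by blast+
  then have nz: "a \<noteq> 0" "b \<noteq> 0" "cnj a \<noteq> 0" by simp_all
  have xy: "cnj x - y \<noteq> 0" using assms by (auto simp: complex_eq_iff)
  have 1: "(y - \<i>) / b - (x - \<i>) / a = 2 * \<i> * (y - x) / (a * b)"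
    using nz by (simp add: field_simps) (simp add: a_def b_def algebra_simps)
  have 2: "1 - cnj ((x - \<i>) / a) * ((y - \<i>) / b) = 2 * \<i> * (cnj x - y) / (cnj a * b)"
    using nz by (simp add: field_simps) (simp add: a_def b_def algebra_simps)
  have "norm (Moebius_function 0 ((x - \<i>) / a) ((y - \<i>) / b)) = norm (2 * \<i> * (y - x) / (a * b)) / norm (2 * \<i> * (cnj x - y) / (cnj a * b))"
    by (simp only: Moebius_function_simple 1 2 norm_divide)
  also have "\<dots> = norm (y - x) / norm (cnj x - y)" using nz by (simp add: norm_mult norm_divide)
  also have "norm (cnj x - y) = norm (x - cnj y)" by (metis complex_cnj_cnj complex_cnj_diff complex_mod_cnj)
  finally show ?thesis by (simp add: a_def b_def norm_minus_commute)
qed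

text \<open>A map of D into the half-plane becomes a competitor after the Cayley transform. This is
  the lower bound for the Caratheodory distance in the final comparison.\<close>

lemma hdist_le_caratheodory_dist:
  assumes "open D'" "D' \<subseteq> D" "joinable D' z w M"
    and f: "f holomorphic_on D" "\<And>x. x \<in> D \<Longrightarrow> Im (f x) > 0"
  shows "hdist (f z) (f w) \<le> caratheodory_dist D z w"
proof -
  have zw: "z \<in> D" "w \<in> D" using joinable_imp_mem[OF assms(3)] assms(2) by auto
  have "(\<lambda>x. (f x - \<i>) / (f x + \<i>)) holomorphic_on D"
    using f add_ii_nonzero by (intro holomorphic_intros) auto
  from artanh_le_caratheodory_dist[OF assms(1-3) this] norm_cayley_less_1 f(2)
  have "artanh (norm (Moebius_function 0 ((f z - \<i>) / (f z + \<i>)) ((f w - \<i>) / (f w + \<i>)))) \<le> caratheodory_dist D z w" by blast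
  then show ?thesis using norm_Moebius_cayley artanh_eq_hdist f(2) zw by metis
qed

lemma joinable_half_plane:
  assumes h: "h holomorphic_on {x. Im x > 0}" "\<And>x. Im x > 0 \<Longrightarrow> h x \<in> D" and xy: "Im x > 0" "Im y > 0"
  shows "joinable D (h x) (h y) (hdist x y)"
proof -
  define u where "u = (\<lambda>\<zeta>. \<i> * (1 + \<zeta>) / (1 - \<zeta>))"
  have u: "Im (u \<zeta>) > 0" if "norm \<zeta> < 1" for \<zeta>
  proof -
    have "norm \<zeta> ^ 2 < 1" using that by (simp add: abs_square_less_1)
    then have 1: "Re \<zeta> ^ 2 + Im \<zeta> ^ 2 < 1" unfolding cmod_power2 .
    have "1 - \<zeta> \<noteq> 0" using that by auto
    then have "Re (1 - \<zeta>) ^ 2 + Im (1 - \<zeta>)^2 > 0" by (metis cmod_power2 zero_less_norm_iff zero_less_power)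
    moreover have "Im (u \<zeta>) = (1 - (Re \<zeta> ^ 2 + Im \<zeta> ^ 2)) / (Re (1 - \<zeta>) ^ 2 + Im (1 - \<zeta>)^2)"
      unfolding u_def Im_divide by (simp add: power2_eq_square algebra_simps)
    ultimately show ?thesis using 1 by simp
  qed
  have "u holomorphic_on ball 0 1" unfolding u_def by (intro holomorphic_intros) auto
  then have "h \<circ> u holomorphic_on ball 0 1" using h(1) u by (intro holomorphic_on_compose_gen[of u _ h "{x. Im x > 0}"]) auto
  then have "h \<circ> u \<in> holo_maps (ball 0 1) D" using h(2) u by (auto simp: holo_maps_def)
  from joinable_disc[OF this norm_cayley_less_1[OF xy(1)] norm_cayley_less_1[OF xy(2)]]
  have "joinable D ((h \<circ> u) ((x - \<i>) / (x + \<i>))) ((h \<circ> u) ((y - \<i>) / (y + \<i>))) (hdist x y)"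
    using norm_Moebius_cayley artanh_eq_hdist xy by metis
  moreover have "u ((x - \<i>) / (x + \<i>)) = x" if "Im x > 0" for x
  proof -
    define a where "a = x + \<i>"
    have a: "a \<noteq> 0" "x = a - \<i>" using add_ii_nonzero[OF that] by (auto simp: a_def)
    have "1 + (a - \<i> - \<i>) / a = 2 * (a - \<i>) / a" "1 - (a - \<i> - \<i>) / a = 2 * \<i> / a" using a(1) by (auto simp: field_simps)
    then show ?thesis unfolding u_def a_def[symmetric] a(2) using a(1) by simp
  qed
  ultimately show ?thesis using xy by simp
qed

text \<open>The map x \<mapsto> (1 + x) / (1 - x) takes the half-disc onto the first quadrant and
  squaring opens the quadrant to the half-plane. The left side is thus the hyperbolic distance of
  the half-disc, and the square-root factor inside arsinh is its exact deviation from
  \<open>hdist x y\<close>.\<close>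

lemma hdist_half_disc:
  assumes x: "Im x > 0" "norm x < 1" and y: "Im y > 0" "norm y < 1"
  shows "Im (((1 + x) / (1 - x))^2) > 0"
    and "hdist (((1 + x) / (1 - x))^2) (((1 + y) / (1 - y))^2) =
      arsinh (norm (x - y) / (2 * sqrt (Im x * Im y)) * sqrt (1 + norm (x - cnj y)^2 / ((1 - norm x^2) * (1 - norm y^2))))"
proof -
  have Av: "Im (((1 + x) / (1 - x))^2) = 4 * (1 - norm x^2) * Im x / norm (1 - x)^4" if "norm x < 1" for x
  proof -
    have "1 - x \<noteq> 0" using that by auto
    then have nz: "norm (1 - x)^2 \<noteq> 0" by simp
    have "(1 + x) / (1 - x) = (1 + x) * cnj (1 - x) / of_real (norm (1 - x)^2)"
      using complex_div_cnj[of "1 + x" "1 - x"] by (simp add: mult.commute)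
    moreover have "Re ((1 + x) * cnj (1 - x)) = 1 - norm x^2" "Im ((1 + x) * cnj (1 - x)) = 2 * Im x"
      unfolding cmod_power2 by (auto simp: power2_eq_square algebra_simps)
    ultimately have "Re ((1 + x) / (1 - x)) = (1 - norm x^2) / norm (1 - x)^2" "Im ((1 + x) / (1 - x)) = 2 * Im x / norm (1 - x)^2"
      by (simp_all add: Re_divide_of_real Im_divide_of_real del: of_real_power)
    then have "Im (((1 + x) / (1 - x))^2) = 2 * ((1 - norm x^2) / norm (1 - x)^2) * (2 * Im x / norm (1 - x)^2)"
      by (simp only: Im_power2)
    also have "\<dots> = 4 * (1 - norm x^2) * Im x / (norm (1 - x)^2 * norm (1 - x)^2)" by simp
    also have "norm (1 - x)^2 * norm (1 - x)^2 = norm (1 - x)^4" by (simp flip: power_add)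
    finally show ?thesis .
  qed
  have p: "1 - norm x^2 > 0" "1 - norm y^2 > 0" using assms by (auto simp: abs_square_less_1)
  have nx: "norm (1 - x) > 0" "norm (1 - y) > 0" using assms by auto
  show "Im (((1 + x) / (1 - x))^2) > 0" unfolding Av[OF x(2)] using p x nx by simp
  define P where "P = norm (1 - x) * norm (1 - y)"
  have P: "P > 0" using nx by (simp add: P_def)
  have 1: "norm (((1 + x) / (1 - x))^2 - ((1 + y) / (1 - y))^2) = 4 * norm (x - y) * norm (1 - x * y) / P^2"
  proof -
    have nz: "1 - x \<noteq> 0" "1 - y \<noteq> 0" using assms by auto
    have "((1 + x) / (1 - x))^2 - ((1 + y) / (1 - y))^2 = ((1 + x) / (1 - x) - (1 + y) / (1 - y)) * ((1 + x) / (1 - x) + (1 + y) / (1 - y))"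
      by (simp add: power2_eq_square algebra_simps)
    moreover have "(1 + x) / (1 - x) - (1 + y) / (1 - y) = 2 * (x - y) / ((1 - x) * (1 - y))"
      using nz by (simp add: field_simps)
    moreover have "(1 + x) / (1 - x) + (1 + y) / (1 - y) = 2 * (1 - x * y) / ((1 - x) * (1 - y))"
      using nz by (simp add: field_simps)
    ultimately show ?thesis by (simp only: norm_mult norm_divide P_def power2_eq_square) simp
  qed
  define q where "q = sqrt (Im x * Im y)"
  have q: "q > 0" using x y by (simp add: q_def)
  define R where "R = sqrt ((1 - norm x^2) * (1 - norm y^2))"
  have R: "R > 0" "R^2 = (1 - norm x^2) * (1 - norm y^2)" using p by (auto simp: R_def)
  have 2: "sqrt (Im (((1 + x) / (1 - x))^2) * Im (((1 + y) / (1 - y))^2)) = 4 * R * q / P^2"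
  proof -
    have "Im (((1 + x) / (1 - x))^2) * Im (((1 + y) / (1 - y))^2) = (4 * R * q / P^2)^2"
      unfolding Av[OF x(2)] Av[OF y(2)] using R(2) x y
      by (simp add: power_mult_distrib power_divide q_def P_def) (simp add: field_simps)
    then show ?thesis using R q P by simp
  qed
  \<comment> \<open>The deviation factor comes from |1 - x y|^2 = (1 - |x|^2) (1 - |y|^2) + |x - cnj
    y|^2.\<close>
  have 3: "norm (1 - x * y) = R * sqrt (1 + norm (x - cnj y)^2 / ((1 - norm x^2) * (1 - norm y^2)))"
  proof -
    have "norm (1 - x * y)^2 = R^2 + norm (x - cnj y)^2"
      unfolding R(2) unfolding cmod_power2 by (simp add: power2_eq_square algebra_simps)
    also have "\<dots> = (R * sqrt (1 + norm (x - cnj y)^2 / ((1 - norm x^2) * (1 - norm y^2))))^2"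
      using R p unfolding power_mult_distrib R(2)[symmetric] by (simp add: field_simps add_nonneg_nonneg)
    finally show ?thesis using R p by (intro power2_eq_imp_eq[of "norm (1 - x * y)"]) auto
  qed
  have "norm (((1 + x) / (1 - x))^2 - ((1 + y) / (1 - y))^2) / (2 * sqrt (Im (((1 + x) / (1 - x))^2) * Im (((1 + y) / (1 - y))^2)))
      = norm (x - y) * (norm (1 - x * y) / R) / (2 * q)"
    unfolding 1 2 using P R q by (simp add: field_simps)
  also have "norm (1 - x * y) / R = sqrt (1 + norm (x - cnj y)^2 / ((1 - norm x^2) * (1 - norm y^2)))"
    using 3 R by simp
  finally show "hdist (((1 + x) / (1 - x))^2) (((1 + y) / (1 - y))^2) =
      arsinh (norm (x - y) / (2 * sqrt (Im x * Im y)) * sqrt (1 + norm (x - cnj y)^2 / ((1 - norm x^2) * (1 - norm y^2))))"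
    unfolding hdist_def q_def by simp
qed

lemma arsinh_diff_le:
  fixes s s' :: real
  assumes "0 \<le> s" "s \<le> s'"
  shows "arsinh s' - arsinh s \<le> (s' - s) / sqrt (s^2 + 1)"
proof (cases "s = s'")
  case False
  then have "s < s'" using assms by simp
  obtain z where z: "s < z" "z < s'" "arsinh s' - arsinh s = (s' - s) * (1 / sqrt (z^2 + 1))"
    using MVT2[OF \<open>s < s'\<close>, of arsinh "\<lambda>x. 1 / sqrt (x^2 + 1)"] by (auto intro!: derivative_eq_intros)
  have "1 / sqrt (z^2 + 1) \<le> 1 / sqrt (s^2 + 1)"
    using z assms by (intro frac_le) (auto intro!: power_mono add_nonneg_pos)
  then show ?thesis using z(3) assms mult_left_mono[of _ _ "s' - s"] by fastforce
qed simp

text \<open>G inverts the conformal map of the half-disc onto the half-plane, so the cost is the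
  hyperbolic distance of the half-disc. With d = |x - y|, n = |x - cnj y|, q = sqrt (Im x * Im y)
  and s = d / (2 q), one has sqrt (s^2 + 1) = n / (2 q). A relative error n^2 in s therefore changes
  arsinh s by at most s n^2 * 2 q / n = d n.\<close>

lemma joinable_half_disc_unit:
  assumes h: "h holomorphic_on {x. Im x > 0} \<inter> ball 0 1" "\<And>x. Im x > 0 \<Longrightarrow> norm x < 1 \<Longrightarrow> h x \<in> D"
    and x: "Im x > 0" "norm x \<le> 1/2" and y: "Im y > 0" "norm y \<le> 1/2"
  shows "joinable D (h x) (h y) (hdist x y + norm (x - y) * norm (x - cnj y))"
proof -
  define G where "G = (\<lambda>v. (csqrt v - 1) / (csqrt v + 1))"
  have G: "Im (G v) > 0 \<and> norm (G v) < 1" if "Im v > 0" for v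
  proof -
    define s where "s = csqrt v"
    have s2: "s^2 = v" by (simp add: s_def)
    have "Re s \<ge> 0" "Re s \<noteq> 0" using csqrt_principal[of v] that s2
      by (auto simp: s_def[symmetric] Im_power2 simp del: csqrt.simps)
    then have sR: "Re s > 0" by simp
    have "2 * Re s * Im s > 0" using that s2 by (metis Im_power2)
    then have sI: "Im s > 0" using sR by (simp add: zero_less_mult_iff)
    have nz: "s + 1 \<noteq> 0" using sR by (auto simp: complex_eq_iff)
    have "norm (s - 1) ^ 2 < norm (s + 1) ^ 2" using sR unfolding cmod_power2 by (simp add: power2_eq_square algebra_simps)
    then have "norm (s - 1) < norm (s + 1)" by (rule power_less_imp_less_base) simp
    then have 1: "norm (G v) < 1" by (simp add: G_def s_def[symmetric] norm_divide divide_less_eq_1)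
    have "Im (G v) = 2 * Im s / norm (s + 1)^2"
      unfolding G_def s_def[symmetric] Im_divide cmod_power2 by (simp add: algebra_simps)
    then show ?thesis using 1 sI nz by simp
  qed
  have nR: "v \<notin> \<real>\<^sub>\<le>\<^sub>0" if "Im v > 0" for v using that by (auto simp: complex_nonpos_Reals_iff)
  have nz: "csqrt v + 1 \<noteq> 0" for v
  proof
    assume "csqrt v + 1 = 0"
    then have "Re (csqrt v) = -1" by (metis add_eq_0_iff2 one_complex.simps(1) uminus_complex.simps(1))
    then show False using csqrt_principal[of v] by linarith
  qed
  have "G holomorphic_on {x. Im x > 0}" unfolding G_def using nR nz by (intro holomorphic_intros) auto
  then have "h \<circ> G holomorphic_on {x. Im x > 0}" using h(1) G by (intro holomorphic_on_compose_gen[OF _ h(1)]) auto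
  moreover have "(h \<circ> G) v \<in> D" if "Im v > 0" for v using h(2) G that by auto
  moreover have nn: "norm x < 1" "norm y < 1" using x y by auto
  moreover note hdist_half_disc(1)[OF x(1) nn(1) y(1) nn(2)] hdist_half_disc(1)[OF y(1) nn(2) x(1) nn(1)]
  ultimately have j: "joinable D ((h \<circ> G) (((1 + x) / (1 - x))^2)) ((h \<circ> G) (((1 + y) / (1 - y))^2))
     (hdist (((1 + x) / (1 - x))^2) (((1 + y) / (1 - y))^2))"
    by (intro joinable_half_plane)
  have GA: "G (((1 + x) / (1 - x))^2) = x" if "norm x < 1" for x
  proof -
    have n1: "1 - x \<noteq> 0" using that by auto
    have "norm x^2 < 1" using that by (simp add: abs_square_less_1)
    then have r: "Re x ^ 2 + Im x ^2 < 1" unfolding cmod_power2 .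
    have "Re ((1 + x) / (1 - x)) = (1 - (Re x ^ 2 + Im x ^2)) / norm (1 - x)^2"
      unfolding Re_divide cmod_power2 by (simp add: power2_eq_square algebra_simps)
    then have "Re ((1 + x) / (1 - x)) > 0" using r n1 by simp
    then have "csqrt (((1 + x) / (1 - x))^2) = (1 + x) / (1 - x)" by (intro csqrt_unique) auto
    moreover have "(1 + x) / (1 - x) - 1 = 2 * x / (1 - x)" "(1 + x) / (1 - x) + 1 = 2 / (1 - x)" using n1 by (auto simp: field_simps)
    ultimately show ?thesis using n1 by (simp add: G_def)
  qed
  define d where "d = norm (x - y)"
  define q where "q = sqrt (Im x * Im y)"
  define n where "n = norm (x - cnj y)"
  define s where "s = d / (2 * q)"
  define \<epsilon> where "\<epsilon> = n^2 / ((1 - norm x^2) * (1 - norm y^2))"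
  have q: "q > 0" "q^2 = Im x * Im y" using x y by (auto simp: q_def)
  have nd: "n^2 = d^2 + 4 * q^2" using norm_diff_cnj_square[of x y] q by (simp add: n_def d_def)
  have n0: "n > 0" using nd q by (metis add_nonneg_pos n_def norm_ge_zero order_less_le power_zero_numeral zero_le_power2 zero_less_mult_iff zero_less_numeral zero_less_power less_irrefl)
  have "norm x^2 \<le> (1/2)^2" "norm y^2 \<le> (1/2)^2" using x y by (intro power_mono; simp)+
  then have 34: "3/4 \<le> 1 - norm x^2" "3/4 \<le> 1 - norm y^2" by (auto simp: power2_eq_square)
  have "(3/4) * (3/4) \<le> (1 - norm x^2) * (1 - norm y^2)" by (intro mult_mono) (use 34 in auto)
  then have pr: "1/2 \<le> (1 - norm x^2) * (1 - norm y^2)" by simp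
  have \<epsilon>: "0 \<le> \<epsilon>" "\<epsilon> \<le> 2 * n^2"
    using pr divide_left_mono[of "1/2" "(1 - norm x^2) * (1 - norm y^2)" "n^2"] by (auto simp: \<epsilon>_def)
  have s0: "0 \<le> s" using q by (simp add: s_def d_def)
  have sq: "sqrt (1 + \<epsilon>) \<le> 1 + \<epsilon> / 2"
    using \<epsilon> by (intro real_le_lsqrt) (auto simp: power2_eq_square algebra_simps)
  have "arsinh (s * sqrt (1 + \<epsilon>)) - arsinh s \<le> (s * sqrt (1 + \<epsilon>) - s) / sqrt (s^2 + 1)"
    using s0 \<epsilon> mult_left_mono[of 1 "sqrt (1 + \<epsilon>)" s] by (intro arsinh_diff_le) auto
  also have "\<dots> \<le> (s * n^2) / sqrt (s^2 + 1)"
  proof (intro divide_right_mono)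
    have "s * sqrt (1 + \<epsilon>) \<le> s * (1 + n^2)" using sq \<epsilon> s0 by (intro mult_left_mono) auto
    then show "s * sqrt (1 + \<epsilon>) - s \<le> s * n^2" by (simp add: algebra_simps)
  qed simp
  also have "sqrt (s^2 + 1) = n / (2 * q)"
  proof -
    have "s^2 + 1 = (n / (2*q))^2" using q(1) by (simp add: s_def power_divide nd field_simps)
    then show ?thesis using n0 q by simp
  qed
  also have "(s * n^2) / (n / (2 * q)) = d * n" using n0 q by (simp add: s_def power2_eq_square)
  finally have "arsinh (s * sqrt (1 + \<epsilon>)) \<le> hdist x y + norm (x - y) * norm (x - cnj y)"
    by (simp add: hdist_def s_def d_def q_def n_def)
  then have "hdist (((1 + x) / (1 - x))^2) (((1 + y) / (1 - y))^2) \<le> hdist x y + norm (x - y) * norm (x - cnj y)"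
    using hdist_half_disc(2)[OF x(1) nn(1) y(1) nn(2)] by (simp add: s_def \<epsilon>_def d_def q_def n_def)
  then show ?thesis using joinable_mono[OF j] GA nn by simp
qed

lemma joinable_half_disc:
  fixes t r :: real
  assumes h: "h holomorphic_on {x. Im x > 0} \<inter> ball (of_real t) r" "\<And>x. Im x > 0 \<Longrightarrow> x \<in> ball (of_real t) r \<Longrightarrow> h x \<in> D"
    and x: "Im x > 0" "norm (x - of_real t) \<le> r/2" and y: "Im y > 0" "norm (y - of_real t) \<le> r/2" and "r > 0"
  shows "joinable D (h x) (h y) (hdist x y + norm (x - y) * norm (x - cnj y) / r^2)"
proof -
  define A :: "complex \<Rightarrow> complex" where "A = (\<lambda>u. of_real t + of_real r * u)"
  define B :: "complex \<Rightarrow> complex" where "B = (\<lambda>v. (v - of_real t) / of_real r)"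
  have AB: "A (B v) = v" for v using \<open>r > 0\<close> by (simp add: A_def B_def)
  have A1: "A ` ({x. Im x > 0} \<inter> ball 0 1) \<subseteq> {x. Im x > 0} \<inter> ball (of_real t) r"
    using \<open>r > 0\<close> by (auto simp: A_def dist_norm norm_mult)
  have "A holomorphic_on {x. Im x > 0} \<inter> ball 0 1" unfolding A_def by (intro holomorphic_intros)
  then have 1: "h \<circ> A holomorphic_on {x. Im x > 0} \<inter> ball 0 1" by (rule holomorphic_on_compose_gen[OF _ h(1) A1])
  have 2: "(h \<circ> A) u \<in> D" if "Im u > 0" "norm u < 1" for u using A1 h(2) that by (force simp: image_subset_iff)
  have B: "Im (B v) = Im v / r" "norm (B v) = norm (v - of_real t) / r" for v
    using \<open>r > 0\<close> by (auto simp: B_def norm_divide Im_divide_of_real)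
  have "joinable D ((h \<circ> A) (B x)) ((h \<circ> A) (B y)) (hdist (B x) (B y) + norm (B x - B y) * norm (B x - cnj (B y)))"
    by (rule joinable_half_disc_unit[OF 1 2]) (use x y \<open>r > 0\<close> in \<open>auto simp: B field_simps\<close>)
  moreover have n1: "norm (B x - B y) = norm (x - y) / r"
  proof -
    have "B x - B y = (x - y) / of_real r" by (simp add: B_def diff_divide_distrib)
    then show ?thesis using \<open>r > 0\<close> by (simp add: norm_divide)
  qed
  moreover have "norm (B x - cnj (B y)) = norm (x - cnj y) / r"
  proof -
    have "B x - cnj (B y) = (x - cnj y) / of_real r" by (simp add: B_def diff_divide_distrib)
    then show ?thesis using \<open>r > 0\<close> by (simp add: norm_divide)
  qed
  moreover have "hdist (B x) (B y) = hdist x y"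
  proof -
    have "sqrt (Im x / r * (Im y / r)) = sqrt (Im x * Im y) / r" using \<open>r > 0\<close> by (simp add: real_sqrt_divide real_sqrt_mult)
    then show ?thesis unfolding hdist_def n1 B(1) using \<open>r > 0\<close> by simp
  qed
  ultimately show ?thesis using \<open>r > 0\<close> by (simp add: AB power2_eq_square)
qed

text \<open>From arsinh u \<ge> ln (2 u). Together with the next estimate for vertical pairs it
  shows that lifting two points to a fixed height and crossing there costs only a bounded amount
  more than \<open>hdist\<close>, which is enough for points far apart.\<close>

lemma hdist_ge_ln:
  assumes "Im x > 0" "Im y > 0" "x \<noteq> y"
  shows "ln (norm (x - y)) - ln (Im x) / 2 - ln (Im y) / 2 \<le> hdist x y"
proof -
  define u where "u = norm (x - y) / (2 * sqrt (Im x * Im y))"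
  have u: "u > 0" using assms by (simp add: u_def)
  have "ln (2 * u) \<le> arsinh u"
    unfolding arsinh_real_def using u by (intro ln_mono) (auto intro!: real_le_rsqrt)
  moreover have "ln (2 * u) = ln (norm (x - y)) - ln (Im x) / 2 - ln (Im y) / 2"
    using assms by (simp add: u_def ln_div ln_mult ln_sqrt add_divide_distrib)
  ultimately show ?thesis by (simp add: hdist_def u_def)
qed

lemma hdist_vertical_le:
  assumes "Re x = Re y" "0 < Im x" "Im x \<le> Im y"
  shows "hdist x y \<le> ln 2 + ln (Im y / Im x) / 2" "hdist y x \<le> ln 2 + ln (Im y / Im x) / 2"
proof -
  define a where "a = sqrt (Im x)"
  define b where "b = sqrt (Im y)"
  have ab: "0 < a" "a \<le> b" "Im x = a^2" "Im y = b^2" using assms by (auto simp: a_def b_def)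
  have n: "norm (x - y) = b^2 - a^2"
    using assms ab by (simp add: cmod_def)
  define u where "u = norm (x - y) / (2 * sqrt (Im x * Im y))"
  have u: "u = (b^2 - a^2) / (2 * (a * b))" unfolding u_def n ab(3,4) using ab by (simp add: real_sqrt_mult)
  have u0: "0 \<le> u" unfolding u_def using assms by (intro divide_nonneg_nonneg) auto
  have "sqrt (u^2 + 1) \<le> u + 1" using u0 by (intro real_le_lsqrt) (auto simp: power2_eq_square algebra_simps)
  then have "arsinh u \<le> ln (2 * u + 1)"
    unfolding arsinh_real_def using u0 by (intro ln_mono add_nonneg_pos) (auto intro: add_nonneg_pos)
  also have "2 * u + 1 \<le> 2 * (b / a)"
  proof -
    have "2 * u = b / a - a / b" using ab(1,2) by (simp add: u field_simps power2_eq_square)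
    moreover have "1 \<le> b / a" "0 \<le> a / b" using ab by auto
    ultimately show ?thesis by linarith
  qed
  then have "ln (2 * u + 1) \<le> ln (2 * (b / a))" using u0 by (intro ln_mono) auto
  also have "ln (2 * (b / a)) = ln 2 + ln (b / a)" using ab by (intro ln_mult_pos) auto
  also have "ln (b / a) = ln (Im y / Im x) / 2"
  proof -
    have "Im y / Im x = (b / a)^2" using ab by (simp add: power_divide)
    then show ?thesis using ab by (simp add: ln_realpow)
  qed
  finally have 1: "arsinh u \<le> ln 2 + ln (Im y / Im x) / 2" .
  then show "hdist x y \<le> ln 2 + ln (Im y / Im x) / 2" by (simp add: hdist_def u_def)
  show "hdist y x \<le> ln 2 + ln (Im y / Im x) / 2" using 1 by (simp add: hdist_def u_def norm_minus_commute mult.commute)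
qed

section \<open>Localization from a boundary chart\<close>

lemma artanh_le_double:
  fixes u :: real
  assumes "0 \<le> u" "u \<le> 1/2"
  shows "artanh u \<le> 2 * u"
proof -
  have "ln ((1 + u) / (1 - u)) \<le> (1 + u) / (1 - u) - 1" using assms by (intro ln_le_minus_one) auto
  also have "\<dots> = 2 * u / (1 - u)" using assms by (simp add: field_simps)
  also have "\<dots> \<le> 2 * u / (1/2)" using assms by (intro divide_left_mono) auto
  finally show ?thesis by (simp add: artanh_def)
qed

lemma localization_from_chart:
  fixes D U\<^sub>0 U V :: "complex set"
  assumes D: "open D"
    and \<Psi>: "\<Psi> holomorphic_on D" "\<And>z. z \<in> D \<Longrightarrow> Im (\<Psi> z) > 0"
    and g: "g holomorphic_on {x. Im x > 0} \<inter> ball 0 r" "\<And>x. Im x > 0 \<Longrightarrow> norm x < r \<Longrightarrow> g x \<in> D \<and> \<Psi> (g x) = x"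
    and g\<Psi>: "\<And>z. z \<in> D \<inter> U\<^sub>0 \<Longrightarrow> norm (\<Psi> z) < r/2 \<and> g (\<Psi> z) = z"
    and r: "r > 0" and L: "L > 0"
    and gL: "\<And>x y. Im x > 0 \<Longrightarrow> norm x < r \<Longrightarrow> Im y > 0 \<Longrightarrow> norm y < r \<Longrightarrow> dist (g x) (g y) \<le> L * dist x y"
    and \<Psi>L: "\<And>z w. z \<in> D \<inter> U\<^sub>0 \<Longrightarrow> w \<in> D \<inter> U\<^sub>0 \<Longrightarrow> dist (\<Psi> z) (\<Psi> w) \<le> L * dist z w"
    and \<Psi>\<delta>: "\<And>z. z \<in> D \<inter> U\<^sub>0 \<Longrightarrow> Im (\<Psi> z) \<le> L * boundary_dist D z"
    and U: "open U" "relatively_compact_in V U" "U \<subseteq> U\<^sub>0" "connected (D \<inter> U)"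
  shows "\<exists>C>0. \<forall>z\<in>D \<inter> V. \<forall>w\<in>D \<inter> V.
         0 \<le> kobayashi_dist (D \<inter> U) z w - caratheodory_dist D z w \<and>
         kobayashi_dist (D \<inter> U) z w - caratheodory_dist D z w
           \<le> C * dist z w * (dist z w + sqrt (boundary_dist D z) * sqrt (boundary_dist D w))"
proof -
  have cV: "compact (closure V)" "closure V \<subseteq> U" using U(2) by (auto simp: relatively_compact_in_def)
  have VU: "V \<subseteq> U" using cV(2) closure_subset by blast
  obtain e where e: "e > 0" "\<And>x. x \<in> closure V \<Longrightarrow> cball x e \<subseteq> U" "compact (\<Union>x\<in>closure V. cball x e)" "(\<Union>x\<in>closure V. cball x e) \<subseteq> U"
    using cball_neighbourhood_of_compact[OF cV(1) U(1) cV(2)] by blast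
  define D' where "D' = D \<inter> U"
  have D': "open D'" "D' \<subseteq> D" "connected D'" "D' \<subseteq> D \<inter> U\<^sub>0" using D U by (auto simp: D'_def)
  \<comment> \<open>The bound r / 4 keeps half-discs of radius \<eta> centred at Re (\<Psi> z)
    inside the domain of g, and L * 2 \<eta> \<le> e keeps their images under g within e of V, hence
    inside U.\<close>
  define \<eta> where "\<eta> = min (e / (2 * L)) (r / 4)"
  have \<eta>: "\<eta> > 0" "L * \<eta> \<le> e / 2" "\<eta> \<le> r / 4"
    using e(1) r L mult_left_mono[of \<eta> "e / (2 * L)" L] by (auto simp: \<eta>_def)
  let ?\<delta> = "boundary_dist D"
  have \<delta>0: "0 \<le> ?\<delta> z" for z by (simp add: boundary_dist_def infdist_nonneg)
  have zV: "z \<in> D \<inter> U\<^sub>0" "z \<in> D'" "Im (\<Psi> z) > 0" "norm (\<Psi> z) < r/2" "g (\<Psi> z) = z" if "z \<in> D \<inter> V" for z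
    using that VU U(3) g\<Psi>[of z] \<Psi>(2)[of z] by (auto simp: D'_def)
  have near: "g x \<in> D'" "g x \<in> (\<Union>x\<in>closure V. cball x e)" if z: "z \<in> D \<inter> V" and x: "Im x > 0" "norm x < r" "dist (\<Psi> z) x \<le> 2 * \<eta>" for z x
  proof -
    have "dist (g (\<Psi> z)) (g x) \<le> L * dist (\<Psi> z) x" using zV[OF z] x r by (intro gL) auto
    also have "\<dots> \<le> L * (2 * \<eta>)" using x L by (intro mult_left_mono) auto
    also have "\<dots> \<le> e" using \<eta>(2) by simp
    finally have "g x \<in> cball z e" using zV(5)[OF z] by simp
    moreover have "z \<in> closure V" using z closure_subset by blast
    ultimately show "g x \<in> (\<Union>x\<in>closure V. cball x e)" by blast
    then show "g x \<in> D'" using subsetD[OF e(4)] g(2)[OF x(1,2)] by (auto simp: D'_def)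
  qed
  have half: "joinable D' (g x) (g y) (hdist x y + norm (x - y) * norm (x - cnj y) / \<eta>^2)"
    if z: "z \<in> D \<inter> V" and small: "Im (\<Psi> z) < \<eta> / 4"
      and x: "Im x > 0" "norm (x - of_real (Re (\<Psi> z))) \<le> \<eta> / 2" and y: "Im y > 0" "norm (y - of_real (Re (\<Psi> z))) \<le> \<eta> / 2" for z x y
  proof (rule joinable_half_disc[where t="Re (\<Psi> z)"])
    let ?t = "complex_of_real (Re (\<Psi> z))"
    have t: "norm ?t < r/2" using zV(4)[OF z] abs_Re_le_cmod[of "\<Psi> z"] by simp
    have dt: "dist (\<Psi> z) ?t < \<eta> / 4"
    proof -
      have "\<Psi> z - ?t = \<i> * of_real (Im (\<Psi> z))" by (simp add: complex_eq_iff)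
      then show ?thesis using small zV(3)[OF z] by (simp add: dist_norm norm_mult)
    qed
    have nr: "norm v < r" if "v \<in> ball ?t \<eta>" for v
    proof -
      have "norm v \<le> norm ?t + dist ?t v" by (metis dist_norm norm_triangle_sub add.commute norm_minus_commute)
      then show ?thesis using t that \<eta> r by (auto simp: )
    qed
    show "g holomorphic_on {x. Im x > 0} \<inter> ball ?t \<eta>"
      by (rule holomorphic_on_subset[OF g(1)]) (use nr in auto)
    show "g v \<in> D'" if "Im v > 0" "v \<in> ball ?t \<eta>" for v
    proof (rule near(1)[OF z that(1) nr[OF that(2)]])
      have "dist (\<Psi> z) v \<le> dist (\<Psi> z) ?t + dist ?t v" by (rule dist_triangle)
      then show "dist (\<Psi> z) v \<le> 2 * \<eta>" using dt that(2) \<eta>(1) by auto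
    qed
  qed (use x y \<eta> in auto)
  have cn: "norm (x - cnj y) \<le> norm (x - y) + 2 * (sqrt (Im x) * sqrt (Im y))" if "Im x > 0" "Im y > 0" for x y
  proof -
    have "norm (x - cnj y) ^ 2 \<le> (norm (x - y) + 2 * (sqrt (Im x) * sqrt (Im y)))^2"
      unfolding norm_diff_cnj_square using that by (simp add: power2_sum power_mult_distrib)
    then show ?thesis using that by (intro power2_le_imp_le[of "norm (x - cnj y)"]) auto
  qed
  \<comment> \<open>The part of D' away from the boundary, where one constant M bounds all joining
    costs. The threshold is such that height at least \<eta> / 8 in the chart forces the distance
    condition, by the estimate of Im \<Psi> by the boundary distance.\<close>
  define K where "K = {u \<in> (\<Union>x\<in>closure V. cball x e). \<eta> / (8 * L) \<le> ?\<delta> u}"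
  have K: "compact K" "K \<subseteq> D'"
  proof -
    have "closed {u. \<eta> / (8 * L) \<le> ?\<delta> u}"
      unfolding boundary_dist_def by (intro closed_Collect_le continuous_intros)
    moreover have "K = (\<Union>x\<in>closure V. cball x e) \<inter> {u. \<eta> / (8 * L) \<le> ?\<delta> u}" by (auto simp: K_def)
    ultimately show "compact K" using e(3) by (metis compact_Int_closed)
    have "u \<in> D" if "\<eta> / (8 * L) \<le> ?\<delta> u" for u
    proof (rule ccontr)
      assume "u \<notin> D"
      then have "?\<delta> u = 0" unfolding boundary_dist_def by (simp add: infdist_zero)
      then show False using that \<eta> L by (simp add: divide_le_0_iff)
    qed
    then show "K \<subseteq> D'" using subsetD[OF e(4)] unfolding K_def D'_def by blast
  qed
  have inK: "u \<in> K" if "u \<in> D \<inter> U\<^sub>0" "u \<in> (\<Union>x\<in>closure V. cball x e)" "\<eta> / 8 \<le> Im (\<Psi> u)" for u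
  proof -
    have "\<eta> / 8 \<le> L * ?\<delta> u" using \<Psi>\<delta>[OF that(1)] that(3) by linarith
    then have "\<eta> / (8 * L) \<le> ?\<delta> u" using L by (simp add: field_simps)
    then show ?thesis using that by (simp add: K_def)
  qed
  obtain M where M: "M \<ge> 0" "\<And>x y. x \<in> K \<Longrightarrow> y \<in> K \<Longrightarrow> joinable D' x y M"
    using joinable_compact[OF D'(1,3) K] by blast
  define A where "A = (ln 2 + 1 :: real)"
  have A0: "A \<ge> 0" by (simp add: A_def)
  \<comment> \<open>A point near the boundary is lifted vertically in the chart to height \<eta> /
    4. Apart from half the logarithm of the height ratio this costs at most A: ln 2 from the
    vertical estimate and 1 from the half-disc error. The summand M covers points that already lie
    in K.\<close>
  have up: "\<exists>u\<in>K. joinable D' z u (A + ln (r / Im (\<Psi> z)) / 2 + M) \<and> joinable D' u z (A + ln (r / Im (\<Psi> z)) / 2 + M)"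
    if z: "z \<in> D \<inter> V" for z
  proof -
    have le: "Im (\<Psi> z) \<le> r" using zV(4)[OF z] abs_Im_le_cmod[of "\<Psi> z"] r by linarith
    have ln0: "0 \<le> ln (r / Im (\<Psi> z))" using le zV(3)[OF z] by simp
    show ?thesis
    proof (cases "Im (\<Psi> z) < \<eta> / 4")
      case False
      have "z \<in> (\<Union>x\<in>closure V. cball x e)" using z e(1) closure_subset by force
      then have zK: "z \<in> K" using inK zV[OF z] False \<eta>(1) by auto
      then show ?thesis using M(2)[OF zK zK] joinable_mono[of D' z z M "A + ln (r / Im (\<Psi> z)) / 2 + M"] A0 ln0 by auto
    next
      case True
      let ?t = "complex_of_real (Re (\<Psi> z))"
      define x where "x = \<Psi> z"
      define y where "y = Complex (Re x) (\<eta> / 4)"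
      have x: "Im x > 0" "Im x < \<eta>/4" using zV[OF z] True by (auto simp: x_def)
      have y: "Im y = \<eta>/4" "Re y = Re x" by (auto simp: y_def)
      have xt: "x - ?t = \<i> * of_real (Im x)" "y - ?t = \<i> * of_real (\<eta>/4)" "x - y = \<i> * of_real (Im x - \<eta>/4)"
        "x - cnj y = \<i> * of_real (Im x + \<eta>/4)" "y - cnj x = \<i> * of_real (Im x + \<eta>/4)"
        by (auto simp: complex_eq_iff x_def y_def)
      have nx: "norm (x - ?t) \<le> \<eta> / 2" "norm (y - ?t) \<le> \<eta>/2" "norm (x - y) \<le> \<eta>" "norm (x - cnj y) \<le> \<eta>" "norm (y - cnj x) \<le> \<eta>"
        unfolding xt norm_mult norm_of_real using x \<eta> by auto
      have "norm (x - y) * norm (x - cnj y) \<le> \<eta> * \<eta>" "norm (y - x) * norm (y - cnj x) \<le> \<eta> * \<eta>"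
        using nx \<eta>(1) by (auto intro!: mult_mono simp: norm_minus_commute)
      then have er: "norm (x - y) * norm (x - cnj y) / \<eta>^2 \<le> 1" "norm (y - x) * norm (y - cnj x) / \<eta>^2 \<le> 1"
        using \<eta>(1) by (auto simp: power2_eq_square)
      have "ln (Im y / Im x) \<le> ln (r / Im x)" using x \<eta> r unfolding y by (intro ln_mono divide_right_mono) auto
      then have hv: "hdist x y \<le> ln 2 + ln (r / Im x) / 2" "hdist y x \<le> ln 2 + ln (r / Im x) / 2"
        using hdist_vertical_le[of x y] x y by auto
      have yr: "norm y < r"
      proof -
        have "norm y \<le> norm ?t + norm (y - ?t)" by (metis norm_triangle_sub)
        moreover have "norm ?t < r/2" using zV(4)[OF z] abs_Re_le_cmod[of "\<Psi> z"] by simp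
        ultimately show ?thesis using nx(2) \<eta> r by linarith
      qed
      have j: "joinable D' (g x) (g y) (A + ln (r / Im x) / 2)" "joinable D' (g y) (g x) (A + ln (r / Im x) / 2)"
      proof -
        have "0 < Im y" using y \<eta>(1) by simp
        note h1 = half[OF z True x(1) nx(1) this nx(2)] and h2 = half[OF z True this nx(2) x(1) nx(1)]
        show "joinable D' (g x) (g y) (A + ln (r / Im x) / 2)"
          by (rule joinable_mono[OF h1]) (use hv er in \<open>unfold A_def, linarith\<close>)
        show "joinable D' (g y) (g x) (A + ln (r / Im x) / 2)"
          by (rule joinable_mono[OF h2]) (use hv er in \<open>unfold A_def, linarith\<close>)
      qed
      have yz: "dist (\<Psi> z) y \<le> 2 * \<eta>" using nx(3) \<eta>(1) by (simp add: dist_norm x_def)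
      have y0: "Im y > 0" using \<eta> y by simp
      have gy: "g y \<in> D'" "g y \<in> (\<Union>x\<in>closure V. cball x e)" using near[OF z y0 yr yz] by auto
      have "g y \<in> K" using inK[of "g y"] gy D'(4) g(2)[OF y0 yr] y \<eta>(1) by auto
      moreover have "g x = z" using zV[OF z] by (simp add: x_def)
      ultimately show ?thesis using j joinable_mono M(1) by (auto simp: x_def intro!: bexI[of _ "g y"] elim!: joinable_mono)
    qed
  qed
  \<comment> \<open>The excess over \<open>hdist\<close> when both points are lifted to K and joined
    there: the terms ln (Im x) and ln (Im y) cancel against those in the lower bound for
    \<open>hdist\<close>.\<close>
  define lD where "lD = 2 * (A + M + ln r / 2) + M - ln (\<eta> / 8)"
  have main: "\<exists>N\<ge>0. joinable D' z w N \<and> N - hdist (\<Psi> z) (\<Psi> w) \<le>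
      (2 * L^2/\<eta>^2 + (8 * L / \<eta>)^2 + \<bar>lD\<bar> * (8 * L / \<eta>)^2) * dist z w * (dist z w + sqrt (?\<delta> z) * sqrt (?\<delta> w))"
    (is "\<exists>N\<ge>0. _ \<and> _ \<le> ?C * _ * _")
    if z: "z \<in> D \<inter> V" and w: "w \<in> D \<inter> V" for z w
  proof -
    define x where "x = \<Psi> z"
    define y where "y = \<Psi> w"
    have x: "Im x > 0" "norm x < r/2" "g x = z" and y: "Im y > 0" "norm y < r/2" "g y = w"
      using zV[OF z] zV[OF w] by (auto simp: x_def y_def)
    define Q where "Q = sqrt (?\<delta> z) * sqrt (?\<delta> w)"
    have Q0: "0 \<le> Q" unfolding Q_def by (intro mult_nonneg_nonneg real_sqrt_ge_zero \<delta>0)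
    have xL: "norm (x - y) \<le> L * dist z w" using \<Psi>L[OF zV(1)[OF z] zV(1)[OF w]] by (simp add: x_def y_def dist_norm)
    have Ix: "Im x \<le> L * ?\<delta> z" "Im y \<le> L * ?\<delta> w" using \<Psi>\<delta> zV(1) z w by (auto simp: x_def y_def)
    have sI: "sqrt (Im x) * sqrt (Im y) \<le> L * Q"
    proof -
      have "sqrt (Im x) * sqrt (Im y) \<le> sqrt (L * ?\<delta> z) * sqrt (L * ?\<delta> w)"
        using Ix x y by (intro mult_mono real_sqrt_le_mono) auto
      also have "\<dots> = L * Q" using L by (simp add: Q_def real_sqrt_mult)
      finally show ?thesis .
    qed
    have hd0: "0 \<le> hdist x y" using hdist_nonneg x y by blast
    have d0: "0 \<le> dist z w" by simp
    have C: "2 * L^2/\<eta>^2 * dist z w * (dist z w + Q) \<le> ?C * dist z w * (dist z w + Q)"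
      "(8 * L / \<eta>)^2 * dist z w * (dist z w + Q) \<le> ?C * dist z w * (dist z w + Q)"
      "\<bar>lD\<bar> * (8 * L / \<eta>)^2 * dist z w * (dist z w + Q) \<le> ?C * dist z w * (dist z w + Q)"
    proof -
      have p: "0 \<le> 2 * L^2/\<eta>^2" "0 \<le> (8 * L / \<eta>)^2" "0 \<le> \<bar>lD\<bar> * (8 * L / \<eta>)^2" by simp_all
      have dQ: "0 \<le> dist z w + Q" using Q0 by simp
      have "c * dist z w * (dist z w + Q) \<le> ?C * dist z w * (dist z w + Q)" if "c \<le> ?C" for c
        by (intro mult_right_mono that dQ d0)
      then show "2 * L^2/\<eta>^2 * dist z w * (dist z w + Q) \<le> ?C * dist z w * (dist z w + Q)"
        "(8 * L / \<eta>)^2 * dist z w * (dist z w + Q) \<le> ?C * dist z w * (dist z w + Q)"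
        "\<bar>lD\<bar> * (8 * L / \<eta>)^2 * dist z w * (dist z w + Q) \<le> ?C * dist z w * (dist z w + Q)"
        using p by (meson add_increasing add_increasing2 add_nonneg_nonneg order_refl)+
    qed
    consider "norm (x - y) \<le> \<eta> / 8" "Im x < \<eta>/4" | "norm (x - y) \<le> \<eta> / 8" "Im x \<ge> \<eta>/4" | "norm (x - y) > \<eta> / 8" by linarith
    then show ?thesis
    proof cases
      case 1
      let ?t = "complex_of_real (Re x)"
      have "x - ?t = \<i> * of_real (Im x)" by (simp add: complex_eq_iff)
      then have xt: "norm (x - ?t) \<le> \<eta> / 4" using 1 x by (simp add: norm_mult)
      have "norm (y - ?t) \<le> norm (x - y) + norm (x - ?t)"
        using norm_triangle_ineq4[of "x - ?t" "x - y"] by simp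
      then have yt: "norm (y - ?t) \<le> \<eta> / 2" using xt 1 \<eta> by linarith
      have j: "joinable D' z w (hdist x y + norm (x - y) * norm (x - cnj y) / \<eta>^2)"
        using half[OF z, of x y] 1 xt yt x y \<eta> by (simp add: x_def)
      have "norm (x - cnj y) \<le> L * dist z w + 2 * (L * Q)" using cn[OF x(1) y(1)] xL sI by linarith
      also have "\<dots> \<le> 2 * L * (dist z w + Q)" using L by (simp add: algebra_simps)
      finally have "norm (x - y) * norm (x - cnj y) \<le> (L * dist z w) * (2 * L * (dist z w + Q))"
        using xL L by (intro mult_mono) auto
      then have "norm (x - y) * norm (x - cnj y) / \<eta>^2 \<le> (L * dist z w) * (2 * L * (dist z w + Q)) / \<eta>^2"
        by (intro divide_right_mono) auto
      also have "\<dots> = 2 * L^2/\<eta>^2 * dist z w * (dist z w + Q)" by (simp add: power2_eq_square)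
      finally show ?thesis
        using j C(1) hd0 unfolding x_def[symmetric] y_def[symmetric] Q_def[symmetric]
        by (intro exI[of _ "hdist x y + norm (x - y) * norm (x - cnj y) / \<eta>^2"]) auto
    next
      case 2
      \<comment> \<open>A disc of radius \<eta> / 4 around x fits into the half-plane and gives a
        cost linear in |x - y|. Both heights are at least \<eta> / 8, so L * Q \<ge> \<eta> / 8 and
        the linear cost is absorbed by the product of |z - w| and Q.\<close>
      define h where "h = (\<lambda>\<zeta>. g (x + of_real (\<eta>/4) * \<zeta>))"
      have in1: "Im (x + of_real (\<eta>/4) * \<zeta>) > 0 \<and> norm (x + of_real (\<eta>/4) * \<zeta>) < r \<and> dist x (x + of_real (\<eta>/4) * \<zeta>) \<le> 2 * \<eta>" if "norm \<zeta> < 1" for \<zeta>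
      proof -
        have n: "norm (of_real (\<eta>/4) * \<zeta>) < \<eta>/4" using that \<eta>(1) by (simp add: norm_mult)
        have "\<bar>Im (of_real (\<eta>/4) * \<zeta>)\<bar> < \<eta>/4" using abs_Im_le_cmod n by (rule le_less_trans)
        then have "Im (x + of_real (\<eta>/4) * \<zeta>) > 0" using 2(2) unfolding plus_complex.sel by linarith
        moreover have "norm (x + of_real (\<eta>/4) * \<zeta>) < r" using norm_triangle_ineq[of x "of_real (\<eta>/4) * \<zeta>"] n x(2) \<eta> r by linarith
        moreover have "dist x (x + of_real (\<eta>/4) * \<zeta>) \<le> 2 * \<eta>" using n \<eta>(1) unfolding dist_norm by (simp add: norm_minus_commute)
        ultimately show ?thesis by blast
      qed
      have "h \<in> holo_maps (ball 0 1) D'"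
      proof -
        have "(\<lambda>\<zeta>. x + of_real (\<eta>/4) * \<zeta>) holomorphic_on ball 0 1" by (intro holomorphic_intros)
        then have "g \<circ> (\<lambda>\<zeta>. x + of_real (\<eta>/4) * \<zeta>) holomorphic_on ball 0 1"
          by (rule holomorphic_on_compose_gen[OF _ g(1)]) (use in1 in auto)
        moreover have "h \<zeta> \<in> D'" if "norm \<zeta> < 1" for \<zeta>
          unfolding h_def using near(1)[OF z] in1[OF that] by (simp add: x_def)
        ultimately show ?thesis by (auto simp: holo_maps_def h_def o_def)
      qed
      moreover define v where "v = (y - x) / of_real (\<eta>/4)"
      moreover have nv: "norm v = norm (x - y) * 4 / \<eta>" 
        using \<eta>(1) by (simp add: v_def norm_divide norm_minus_commute del: of_real_divide)
      then have nv2: "norm v \<le> 1/2" using 2(1) \<eta>(1) unfolding nv by (simp add: divide_le_eq)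
      ultimately have "joinable D' (h 0) (h v) (artanh (norm (Moebius_function 0 0 v)))" by (intro joinable_disc) auto
      moreover have "h 0 = z" "h v = w" using x y \<eta>(1) by (auto simp: h_def v_def simp del: of_real_divide)
      ultimately have "joinable D' z w (artanh (norm v))" by (simp add: Moebius_function_simple)
      then have j: "joinable D' z w (2 * norm v)" using artanh_le_double[OF norm_ge_zero nv2] joinable_mono by blast
      have "\<bar>Im x - Im y\<bar> \<le> norm (x - y)" using abs_Im_le_cmod[of "x - y"] by simp
      then have "\<eta>/8 \<le> Im y" "\<eta>/8 \<le> Im x" using 2 \<eta>(1) by linarith+
      then have "sqrt (\<eta>/8) * sqrt (\<eta>/8) \<le> sqrt (Im x) * sqrt (Im y)" using \<eta>(1) by (intro mult_mono real_sqrt_le_mono) auto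
      then have Qb: "\<eta>/8 \<le> L * Q" using sI \<eta>(1) by simp
      have "2 * norm v \<le> 8 * L / \<eta> * dist z w" using xL \<eta>(1) unfolding nv by (simp add: field_simps)
      also have "\<dots> \<le> 8 * L / \<eta> * dist z w * (8 * L / \<eta> * (dist z w + Q))"
      proof -
        have "1 \<le> 8 * L / \<eta> * Q" using Qb \<eta>(1) by (simp add: field_simps)
        also have "\<dots> \<le> 8 * L / \<eta> * (dist z w + Q)" using L \<eta>(1) by (intro mult_left_mono) auto
        finally show ?thesis using L \<eta>(1) mult_left_mono[of 1 "8 * L / \<eta> * (dist z w + Q)" "8 * L / \<eta> * dist z w"] by simp
      qed
      also have "\<dots> = (8 * L / \<eta>)^2 * dist z w * (dist z w + Q)" by (simp add: power2_eq_square)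
      finally show ?thesis using j C(2) hd0 unfolding x_def[symmetric] y_def[symmetric] Q_def[symmetric]
        by (intro exI[of _ "2 * norm v"]) auto
    next
      case 3
      \<comment> \<open>Here |z - w| exceeds \<eta> / (8 L), so every constant is bounded by a
        multiple of |z - w|^2.\<close>
      obtain u where u: "u \<in> K" "joinable D' z u (A + ln (r / Im x) / 2 + M)" using up[OF z] by (auto simp: x_def)
      obtain v where v: "v \<in> K" "joinable D' v w (A + ln (r / Im y) / 2 + M)" using up[OF w] by (auto simp: y_def)
      have "Im x \<le> r" "Im y \<le> r" using x(2) y(2) abs_Im_le_cmod[of x] abs_Im_le_cmod[of y] r by linarith+
      then have l0: "0 \<le> ln (r / Im x)" "0 \<le> ln (r / Im y)" using x y by auto
      define N where "N = (A + ln (r / Im x) / 2 + M) + M + (A + ln (r / Im y) / 2 + M)"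
      have N0: "0 \<le> N" using A0 M(1) l0 by (simp add: N_def)
      have j: "joinable D' z w N"
        unfolding N_def by (rule joinable_trans[OF joinable_trans[OF u(2) M(2)[OF u(1) v(1)]] v(2)]) (use A0 M(1) l0 in auto)
      have "ln (\<eta>/8) \<le> ln (norm (x - y))" using 3 \<eta>(1) by (intro ln_mono) auto
      moreover have "x \<noteq> y" using 3 \<eta>(1) by auto
      ultimately have "ln (\<eta>/8) - ln (Im x) / 2 - ln (Im y) / 2 \<le> hdist x y" using hdist_ge_ln[OF x(1) y(1)] by linarith
      moreover have "ln (r / Im x) = ln r - ln (Im x)" "ln (r / Im y) = ln r - ln (Im y)" using x y r by (auto simp: ln_div)
      ultimately have "N - hdist x y \<le> lD" unfolding N_def lD_def by (simp add: field_simps)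
      also have "lD \<le> \<bar>lD\<bar> * 1" by simp
      also have "\<dots> \<le> \<bar>lD\<bar> * ((8 * L / \<eta> * dist z w) * (8 * L / \<eta> * (dist z w + Q)))"
      proof (intro mult_left_mono)
        have "\<eta>/8 \<le> L * dist z w" using 3 xL by linarith
        then have 1: "1 \<le> 8 * L / \<eta> * dist z w" using \<eta>(1) by (simp add: field_simps)
        also have "\<dots> \<le> 8 * L / \<eta> * (dist z w + Q)" using L \<eta>(1) Q0 by (intro mult_left_mono) auto
        finally show "1 \<le> (8 * L / \<eta> * dist z w) * (8 * L / \<eta> * (dist z w + Q))" using 1 mult_mono[of 1 "8 * L / \<eta> * dist z w" 1 "8 * L / \<eta> * (dist z w + Q)"] by simp
      qed simp
      also have "\<dots> = \<bar>lD\<bar> * (8 * L / \<eta>)^2 * dist z w * (dist z w + Q)" by (simp add: power2_eq_square)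
      finally show ?thesis using j C(3) N0 unfolding x_def[symmetric] y_def[symmetric] Q_def[symmetric]
        by (intro exI[of _ N]) auto
    qed
  qed
  show ?thesis
  proof (intro exI conjI ballI)
    show "(2 * L^2/\<eta>^2 + (8 * L / \<eta>)^2 + \<bar>lD\<bar> * (8 * L / \<eta>)^2) > 0" using L \<eta>(1) by (auto intro!: add_pos_nonneg)
    fix z w assume zw: "z \<in> D \<inter> V" "w \<in> D \<inter> V"
    obtain N where N: "N \<ge> 0" "joinable D' z w N" and le: "N - hdist (\<Psi> z) (\<Psi> w) \<le>
      (2 * L^2/\<eta>^2 + (8 * L / \<eta>)^2 + \<bar>lD\<bar> * (8 * L / \<eta>)^2) * dist z w * (dist z w + sqrt (?\<delta> z) * sqrt (?\<delta> w))"
      using main[OF zw] by blast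
    show "0 \<le> kobayashi_dist (D \<inter> U) z w - caratheodory_dist D z w"
      using caratheodory_le_kobayashi_dist[OF D'(1,2) N(2)] by (simp add: D'_def)
    show "kobayashi_dist (D \<inter> U) z w - caratheodory_dist D z w \<le>
      (2 * L^2/\<eta>^2 + (8 * L / \<eta>)^2 + \<bar>lD\<bar> * (8 * L / \<eta>)^2) * dist z w * (dist z w + sqrt (?\<delta> z) * sqrt (?\<delta> w))"
      using kobayashi_dist_le[OF N(2,1)] hdist_le_caratheodory_dist[OF D'(1,2) N(2) \<Psi>] le unfolding D'_def by linarith
  qed
qed

section \<open>Dini barriers\<close>

text \<open>Multiplication by i turns the excluded sector around the negative imaginary axis into a
  sector around the positive real axis, so i w keeps a distance from s comparable both to s and to
  |w|.\<close>

lemma barrier_denominator: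
  fixes s :: real
  assumes "s > 0" and w: "Im w > - \<bar>Re w\<bar>"
  shows "norm (of_real s - \<i> * w) ^ 2 \<ge> s^2 / 2" "norm (of_real s - \<i> * w) ^ 2 \<ge> norm w ^ 2 / 2"
proof -
  have n: "norm (of_real s - \<i> * w) ^ 2 = (s + Im w)^2 + (Re w)^2" unfolding cmod_power2 by simp
  have ar1: "E / 2 \<le> A + C \<and> (C + B) / 2 \<le> A + C" if "E \<le> 2 * (A + B)" "B \<le> C" "0 \<le> A" for A B C E :: real
    by (intro conjI; insert that; argo)
  have ar2: "E / 2 \<le> A + C \<and> (C + B) / 2 \<le> A + C" if "E + B \<le> A" "0 \<le> E" "0 \<le> B" "0 \<le> C" for A B C E :: real
    by (intro conjI; insert that; argo)
  have "(s + Im w)^2 + (Re w)^2 \<ge> s^2 / 2 \<and> (s + Im w)^2 + (Re w)^2 \<ge> ((Re w)^2 + (Im w)^2) / 2"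
  proof (cases "Im w \<ge> 0")
    case True
    then have "(s + Im w)^2 \<ge> s^2 + (Im w)^2" using assms by (simp add: power2_sum)
    then show ?thesis using ar2[OF _ zero_le_power2 zero_le_power2 zero_le_power2] by blast
  next
    case False
    then have "\<bar>Im w\<bar> \<le> \<bar>Re w\<bar>" using w by linarith
    then have 1: "(Im w)^2 \<le> (Re w)^2" unfolding abs_le_square_iff .
    have "2 * ((s + Im w)^2 + (Im w)^2) - s^2 = (s + 2 * Im w)^2" by (simp add: power2_eq_square algebra_simps)
    then have "2 * ((s + Im w)^2 + (Im w)^2) \<ge> s^2" by (smt (verit) zero_le_power2)
    then show ?thesis using ar1[OF _ 1 zero_le_power2] by blast
  qed
  then show "norm (of_real s - \<i> * w) ^ 2 \<ge> s^2 / 2" "norm (of_real s - \<i> * w) ^ 2 \<ge> norm w ^ 2 / 2"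
    unfolding n cmod_power2 by auto
qed

text \<open>The building block of the barrier. In Im q = Re w * s / |s - i w|^2 both |w| much
  smaller and |w| much larger than s give small values, so each term bends the boundary essentially
  at its own scale, in the direction given by the sign of Re w. The constant 3/2 is a rational bound
  for sqrt 2.\<close>

lemma barrier_term:
  fixes s :: real
  assumes "s > 0" and w: "Im w > - \<bar>Re w\<bar>"
  defines "q \<equiv> \<i> * w / (of_real s - \<i> * w)"
  shows "of_real s - \<i> * w \<noteq> 0" "norm q \<le> 3/2"
    and "Im q = Re w * s / norm (of_real s - \<i> * w)^2"
    and "Im w \<ge> 0 \<Longrightarrow> Re q \<le> 0"
    and "Re w = 0 \<Longrightarrow> Im q = 0"
proof -
  note d = barrier_denominator[OF assms(1) w]
  have "s^2 / 2 > 0" using assms(1) by simp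
  then have pos: "norm (of_real s - \<i> * w) ^ 2 > 0" using d(1) by linarith
  then show nz: "of_real s - \<i> * w \<noteq> 0" by auto
  have "norm w ^ 2 \<le> (3/2 * norm (of_real s - \<i> * w))^2"

  proof -
    have "A \<le> 9/4 * B" if "A / 2 \<le> B" "0 \<le> A" for A B :: real using that by linarith
    from this[OF d(2) zero_le_power2] show ?thesis by (simp add: power_mult_distrib power_divide)
  qed
  then have "norm w \<le> 3/2 * norm (of_real s - \<i> * w)" by (rule power2_le_imp_le) simp
  then show "norm q \<le> 3/2" using nz by (simp add: q_def norm_divide norm_mult divide_le_eq)
  have den: "(Re (of_real s - \<i> * w))^2 + (Im (of_real s - \<i> * w))^2 = norm (of_real s - \<i> * w)^2" by (simp only: cmod_power2)
  show Imq: "Im q = Re w * s / norm (of_real s - \<i> * w)^2"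
    unfolding q_def Im_divide den by (simp add: algebra_simps)
  show "Re w = 0 \<Longrightarrow> Im q = 0" using Imq by simp
  assume "Im w \<ge> 0"
  have "Re q = - ((Re w)^2 + Im w * (s + Im w)) / norm (of_real s - \<i> * w)^2"
    unfolding q_def Re_divide den by (simp add: algebra_simps power2_eq_square)
  moreover have "(Re w)^2 + Im w * (s + Im w) \<ge> 0" using \<open>Im w \<ge> 0\<close> assms(1) by simp
  ultimately show "Re q \<le> 0" by (simp add: divide_nonpos_nonneg)
qed

lemma sin_ge_half:
  fixes v :: real
  assumes "0 \<le> v" "v \<le> 1"
  shows "v / 2 \<le> sin v"
proof (cases "v = 0")
  case False
  then obtain z where z: "0 < z" "z < v" "sin v - sin 0 = (v - 0) * cos z"
    using MVT2[of 0 v sin cos] assms by (auto simp: DERIV_sin)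
  have "cos (pi/3) \<le> cos z" using z assms pi_gt3 by (intro cos_monotone_0_pi_le) auto
  then have "v * (1/2) \<le> v * cos z" using assms by (intro mult_left_mono) (auto simp: cos_60)
  then show ?thesis using z(3) by simp
qed simp

text \<open>The factor \<open>exp P\<close> turns the boundary of the half-plane by an angle comparable to \<open>c j\<close> at
  distance \<open>\<rho> / 2 ^ j\<close> from the origin. The terms of \<open>P\<close> are bounded uniformly in the scale, so
  summability of \<open>c\<close>, i.e. the Dini condition, is all that is needed for \<open>F w\<close> to be comparable
  to \<open>w\<close>.\<close>
lemma Dini_barrier:
  fixes c :: "nat \<Rightarrow> real" and \<rho> :: real
  assumes \<rho>: "\<rho> > 0" and c: "\<And>j. 0 < c j" "summable c" "suminf c \<le> 1/4"
  obtains F where "F holomorphic_on {w. Im w > - \<bar>Re w\<bar>}"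
    "\<And>w. Im w > - \<bar>Re w\<bar> \<Longrightarrow> norm (F w) \<le> 2 * norm w"
    "\<And>w. Im w > 0 \<Longrightarrow> norm (F w) \<le> norm w"
    "\<And>w. Im w > 0 \<Longrightarrow> Im (F w) > 0"
    "\<And>y::real. y > 0 \<Longrightarrow> \<exists>t::real. y/2 \<le> t \<and> t \<le> y \<and> F (\<i> * of_real y) = \<i> * of_real t"
    "\<And>y::real. y > 0 \<Longrightarrow> norm (deriv F (\<i> * of_real y)) \<ge> 1/8"
    "\<And>w j. Im w > 0 \<Longrightarrow> \<rho> / 2^(j+1) < norm w \<Longrightarrow> norm w \<le> \<rho> / 2^j \<Longrightarrow> norm (F w) * (c j / 100) \<le> Im (F w)"
    "\<And>w j. Im w \<le> 0 \<Longrightarrow> - Im w \<le> norm w * (c j / 100) \<Longrightarrow> \<rho> / 2^(j+1) < norm w \<Longrightarrow> norm w \<le> \<rho> / 2^j \<Longrightarrow> Im w > - \<bar>Re w\<bar> \<and> Im (F w) > 0"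
proof -
  define S where "S = {w. Im w > - \<bar>Re w\<bar>}"
  define s where "s j = \<rho> / 2 ^ j" for j :: nat
  have s: "s j > 0" for j using \<rho> by (simp add: s_def)
  define q where "q j w = \<i> * w / (of_real (s j) - \<i> * w)" for j w
  note bt = barrier_term[OF s, folded q_def]
  have oS: "open S" unfolding S_def by (intro open_Collect_less continuous_intros)
  \<comment> \<open>Each term is at most 3/2 * c j, uniformly in w, so the series converges to a
    holomorphic P with |P| \<le> 3/2 * 1/4 = 3/8.\<close>
  define a where "a j w = of_real (c j) * q j w" for j w
  have na: "norm (a j w) \<le> 3/2 * c j" if "w \<in> S" for j w
  proof -
    have "norm (q j w) \<le> 3/2" using bt(2)[of w j] that by (simp add: S_def)
    then have "c j * norm (q j w) \<le> c j * (3/2)" using c(1)[of j] by (intro mult_left_mono) auto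
    then show ?thesis using c(1)[of j] by (simp add: a_def norm_mult)
  qed
  have sc: "summable (\<lambda>j. 3/2 * c j)" using c(2) by (rule summable_mult)
  have ah: "(a j has_field_derivative deriv (a j) w) (at w)" if "w \<in> S" for j w
  proof -
    have "a j holomorphic_on S" unfolding a_def q_def using bt(1)[of _ j] by (intro holomorphic_intros) (auto simp: S_def)
    then show ?thesis using oS that by (rule holomorphic_derivI)
  qed
  obtain P P' where "\<forall>w\<in>S. ((\<lambda>j. a j w) sums P w) \<and> ((\<lambda>j. deriv (a j) w) sums P' w) \<and> (P has_field_derivative P' w) (at w)"
  proof (rule series_and_derivative_comparison[OF oS sc ah])
    show "\<forall>\<^sub>F n in sequentially. \<forall>x\<in>S. norm (a n x) \<le> 3/2 * c n" using na by (intro always_eventually allI ballI)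
  qed
  then have P: "((\<lambda>j. a j w) sums P w) \<and> P field_differentiable (at w)" if "w \<in> S" for w
    using that by (auto simp: field_differentiable_def)
  have Ph: "P holomorphic_on S" using P by (simp add: holomorphic_on_def field_differentiable_at_within)
  have nP: "norm (P w) \<le> 3/8" if "w \<in> S" for w
  proof -
    have sm: "summable (\<lambda>j. norm (a j w))" by (rule summable_comparison_test[OF _ sc]) (use na[OF that] in auto)
    have "norm (P w) \<le> (\<Sum>j. norm (a j w))" using P[OF that] summable_norm[OF sm] by (auto dest: sums_unique)
    also have "\<dots> \<le> (\<Sum>j. 3/2 * c j)" by (rule suminf_le[OF na[OF that] sm sc])
    also have "\<dots> \<le> 3/8" using c(3) suminf_mult[OF c(2), of "3/2"] by simp
    finally show ?thesis .
  qed
  have ImP: "(\<lambda>j. c j * Im (q j w)) sums Im (P w)" if "w \<in> S" for w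
    using sums_Im[OF conjunct1[OF P[OF that]]] by (simp add: a_def)
  have ReP: "(\<lambda>j. c j * Re (q j w)) sums Re (P w)" if "w \<in> S" for w
    using sums_Re[OF conjunct1[OF P[OF that]]] by (simp add: a_def)
  have Imq: "Im (q j w) = Re w * s j / norm (of_real (s j) - \<i> * w)^2" if "w \<in> S" for j w
    using bt(3)[of w j] that by (simp add: S_def)
  have v0: "Im (P w) = 0" if "w \<in> S" "Re w = 0" for w
    using ImP[OF that(1)] Imq[OF that(1)] that(2) by (simp add: sums_iff)
  have v1: "\<bar>Im (P w)\<bar> \<le> 3/8" if "w \<in> S" for w using nP[OF that] abs_Im_le_cmod[of "P w"] by linarith
  have vpos: "0 \<le> Im (P w)" if "w \<in> S" "Re w \<ge> 0" for w
  proof -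
    have "0 \<le> c j * Im (q j w)" for j unfolding Imq[OF that(1)] using c(1)[of j] s[of j] that(2) by simp
    then show ?thesis using sums_le[OF _ sums_zero ImP[OF that(1)]] by blast
  qed
  have vneg: "Im (P w) \<le> 0" if "w \<in> S" "Re w \<le> 0" for w
  proof -
    have "0 \<le> - (c j * Im (q j w))" for j unfolding Imq[OF that(1)] using c(1)[of j] s[of j] that(2)
      by (simp add: divide_nonpos_nonneg mult_nonpos_nonneg mult_nonneg_nonpos)
    then have "0 \<le> - Im (P w)" using sums_le[OF _ sums_zero sums_minus[OF ImP[OF that(1)]]] by blast
    then show ?thesis by simp
  qed
  \<comment> \<open>All terms of Im P have the sign of Re w, so the single term of the scale of w is
    a lower bound. The 16 arises from |Re w| \<ge> s j / 4 and the denominator at most (2 s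
    j)^2.\<close>
  have vbig: "c j / 16 \<le> \<bar>Im (P w)\<bar>" if w: "w \<in> S" and x: "\<bar>Re w\<bar> \<ge> norm w / 2" and j: "s (j+1) < norm w" "norm w \<le> s j" for w j
  proof -
    have sj: "s (j + 1) = s j / 2" by (simp add: s_def)
    have den: "norm (of_real (s j) - \<i> * w) \<le> 2 * s j"
      using norm_triangle_ineq4[of "of_real (s j)" "\<i> * w"] j s[of j] by (simp add: norm_mult)
    have nz: "norm (of_real (s j) - \<i> * w) > 0" using bt(1)[of w j] w by (simp add: S_def)
    have "c j / 16 = c j * (s j / 4 * s j / (2 * s j)^2)" using s[of j] by (simp add: power2_eq_square)
    also have "\<dots> \<le> c j * (\<bar>Re w\<bar> * s j / norm (of_real (s j) - \<i> * w)^2)"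
      using x j s[of j] den nz c(1)[of j] unfolding sj
      by (intro mult_left_mono frac_le mult_right_mono power_mono) auto
    also have "\<dots> = \<bar>c j * Im (q j w)\<bar>" unfolding Imq[OF w] using c(1)[of j] s[of j] by (simp add: abs_mult)
    also have "\<dots> \<le> \<bar>Im (P w)\<bar>"
    proof (cases "Re w \<ge> 0")
      case True
      then have nn: "0 \<le> c i * Im (q i w)" for i unfolding Imq[OF w] using c(1)[of i] s[of i] by simp
      have "c j * Im (q j w) \<le> Im (P w)"
        using sum_le_suminf[OF sums_summable[OF ImP[OF w]], of "{j}"] nn sums_unique[OF ImP[OF w]] by simp
      then show ?thesis using nn[of j] by linarith
    next
      case False
      then have nn: "0 \<le> - (c i * Im (q i w))" for i unfolding Imq[OF w] using c(1)[of i] s[of i]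
        by (simp add: divide_nonpos_nonneg mult_nonpos_nonneg mult_nonneg_nonpos)
      note sm = sums_minus[OF ImP[OF w]]
      have "- (c j * Im (q j w)) \<le> - Im (P w)"
        using sum_le_suminf[OF sums_summable[OF sm], of "{j}"] nn sums_unique[OF sm] by simp
      then show ?thesis using nn[of j] by linarith
    qed
    finally show ?thesis .
  qed
  have Rneg: "Re (P w) \<le> 0" if "Im w > 0" for w
  proof -
    have w: "w \<in> S" using that by (auto simp: S_def intro: le_less_trans[of _ 0])
    have "0 \<le> - (c j * Re (q j w))" for j using bt(4)[of w j] c(1)[of j] w that by (simp add: S_def mult_nonneg_nonpos)
    then have "0 \<le> - Re (P w)" using sums_le[OF _ sums_zero sums_minus[OF ReP[OF w]]] by blast
    then show ?thesis by simp
  qed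
  have e38: "exp (3/8::real) \<le> 2" using exp_bound[of "3/8"] by (simp add: power2_eq_square)
  have eR: "1/2 \<le> exp (Re (P w))" "exp (Re (P w)) \<le> 2" if "w \<in> S" for w
  proof -
    have r: "\<bar>Re (P w)\<bar> \<le> 3/8" using nP[OF that] abs_Re_le_cmod[of "P w"] by linarith
    have "exp (Re (P w)) \<le> exp (3/8)" using r by simp
    then show "exp (Re (P w)) \<le> 2" using e38 by (rule order_trans)
    have "exp (- (3/8)) \<le> exp (Re (P w))" using r by (simp add: abs_le_iff)
    moreover have "1/2 \<le> exp (- (3/8::real))" using e38 by (simp add: exp_minus field_simps)
    ultimately show "1/2 \<le> exp (Re (P w))" by linarith
  qed
  define F where "F w = w * exp (P w)" for w
  have FS: "F holomorphic_on S" unfolding F_def using Ph by (intro holomorphic_intros)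
  have nF: "norm (F w) = norm w * exp (Re (P w))" for w by (simp add: F_def norm_mult)
  \<comment> \<open>The first summand is nonnegative because Im P has the sign of Re w. It is what
    keeps Im F positive slightly below the real axis.\<close>
  have IF: "Im (F w) = exp (Re (P w)) * (Re w * sin (Im (P w)) + Im w * cos (Im (P w)))" for w
    by (simp add: F_def exp_eq_polar Re_exp Im_exp algebra_simps)
  have cv: "1/2 \<le> cos (Im (P w))" if "w \<in> S" for w
  proof -
    have "cos (pi/3) \<le> cos \<bar>Im (P w)\<bar>" using v1[OF that] pi_gt3 by (intro cos_monotone_0_pi_le) auto
    then show ?thesis by (simp add: cos_60)
  qed
  have xs0: "Re w * sin (Im (P w)) \<ge> 0" if "w \<in> S" for w
  proof (cases "Re w \<ge> 0")
    case True
    then have "0 \<le> sin (Im (P w))" using vpos[OF that] v1[OF that] pi_gt3 by (intro sin_ge_zero) auto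
    then show ?thesis using True by simp
  next
    case False
    then have "0 \<le> sin (- Im (P w))" using vneg[OF that] v1[OF that] pi_gt3 by (intro sin_ge_zero) auto
    then show ?thesis using False by (simp add: mult_nonpos_nonpos)
  qed
  have xs: "norm w * (c j / 64) \<le> Re w * sin (Im (P w))"
    if w: "w \<in> S" and x: "\<bar>Re w\<bar> \<ge> norm w / 2" and j: "s (j+1) < norm w" "norm w \<le> s j" for w j
  proof -
    have vb: "c j / 16 \<le> \<bar>Im (P w)\<bar>" using vbig[OF w x j] .
    have "c j / 16 / 2 \<le> \<bar>Im (P w)\<bar> / 2" using vb by simp
    also have "\<dots> \<le> sin \<bar>Im (P w)\<bar>" using v1[OF w] by (intro sin_ge_half) auto
    finally have "norm w / 2 * (c j / 16 / 2) \<le> \<bar>Re w\<bar> * sin \<bar>Im (P w)\<bar>"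
      using x c(1)[of j] by (intro mult_mono) auto
    also have "\<dots> = Re w * sin (Im (P w))"
    proof (cases "Re w \<ge> 0")
      case True then show ?thesis using vpos[OF w] by simp
    next
      case False then show ?thesis using vneg[OF w] by (simp add: abs_of_nonpos)
    qed
    finally show ?thesis by simp
  qed
  have cj: "c j \<le> 1/4" for j
    using sum_le_suminf[OF c(2), of "{j}"] c(1,3) by (simp add: less_imp_le)
  have SI: "w \<in> S" if "Im w > 0" for w using that by (auto simp: S_def intro: le_less_trans[of _ 0])
  show thesis
  proof (rule that[of F])
    show "F holomorphic_on {w. Im w > - \<bar>Re w\<bar>}" using FS by (simp add: S_def)
    show "norm (F w) \<le> 2 * norm w" if "Im w > - \<bar>Re w\<bar>" for w
      using eR(2)[of w] that mult_left_mono[of "exp (Re (P w))" 2 "norm w"] by (simp add: nF S_def mult.commute)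
    show "norm (F w) \<le> norm w" if "Im w > 0" for w
      using Rneg[OF that] mult_left_mono[of "exp (Re (P w))" 1 "norm w"] by (simp add: nF)
    show "Im (F w) > 0" if "Im w > 0" for w
    proof -
      have "0 < Im w * cos (Im (P w))" using cv[OF SI[OF that]] that by (intro mult_pos_pos) auto
      then show ?thesis unfolding IF using xs0[OF SI[OF that]] by (intro mult_pos_pos) auto
    qed
    show "\<exists>t::real. y/2 \<le> t \<and> t \<le> y \<and> F (\<i> * of_real y) = \<i> * of_real t" if "y > 0" for y :: real
    proof -
      let ?w = "\<i> * complex_of_real y"
      have w: "?w \<in> S" "Im ?w > 0" using SI[of ?w] that by auto
      have "P ?w = of_real (Re (P ?w))" using v0[OF w(1)] by (simp add: complex_eq_iff)
      then have "F ?w = \<i> * of_real (y * exp (Re (P ?w)))"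
        unfolding F_def by (metis (no_types, lifting) exp_of_real mult.assoc of_real_mult)
      moreover have "y/2 \<le> y * exp (Re (P ?w))" using eR(1)[OF w(1)] that mult_left_mono[of "1/2" "exp (Re (P ?w))" y] by simp
      moreover have "y * exp (Re (P ?w)) \<le> y" using Rneg[OF w(2)] that mult_left_mono[of "exp (Re (P ?w))" 1 y] by simp
      ultimately show ?thesis by blast
    qed
    show "norm (deriv F (\<i> * of_real y)) \<ge> 1/8" if "y > 0" for y :: real
    proof -
      let ?w = "\<i> * complex_of_real y"
      have w: "?w \<in> S" using SI[of ?w] that by auto
      have sub: "cball ?w (y/2) \<subseteq> S"
      proof
        fix u assume "u \<in> cball ?w (y/2)"
        then have "\<bar>Im (?w - u)\<bar> \<le> y/2"
          unfolding mem_cball dist_norm by (rule order_trans[OF abs_Im_le_cmod])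
        then have "y - Im u \<le> y/2" using abs_ge_self[of "Im (?w - u)"] by simp
        then have "Im u > 0" using that by simp
        then show "u \<in> S" by (rule SI)
      qed
      \<comment> \<open>P is bounded by 3/8 on a disc of radius y / 2, so |w P'| \<le> 3/4 at w = i
        y and the factor 1 + w P' of F' stays away from 0.\<close>
      have "norm ((deriv ^^ 1) P ?w) \<le> fact 1 * (3/8) / (y/2)^1"
      proof (rule Cauchy_inequality)
        show "P holomorphic_on ball ?w (y/2)" using Ph sub ball_subset_cball by (meson holomorphic_on_subset subset_trans)
        show "continuous_on (cball ?w (y/2)) P" using Ph sub by (meson holomorphic_on_imp_continuous_on continuous_on_subset)
        show "norm (P u) \<le> 3/8" if "norm (?w - u) = y/2" for u
        proof (rule nP)
          show "u \<in> S" by (rule subsetD[OF sub]) (use that in \<open>simp add: dist_norm\<close>)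
        qed
      qed (use that in auto)
      then have dP: "norm (deriv P ?w) \<le> 3 / (4 * y)" by simp
      have dF: "(F has_field_derivative exp (P ?w) * (1 + ?w * deriv P ?w)) (at ?w)"
      proof -
        have "(P has_field_derivative deriv P ?w) (at ?w)" using holomorphic_derivI[OF Ph oS w] .
        then show ?thesis unfolding F_def by (auto intro!: derivative_eq_intros simp: algebra_simps)
      qed
      have "norm (?w * deriv P ?w) \<le> y * (3 / (4 * y))" 
        using mult_left_mono[OF dP, of y] that by (simp add: norm_mult)
      then have "norm (?w * deriv P ?w) \<le> 3/4" using that by simp
      then have "1/4 \<le> norm (1 + ?w * deriv P ?w)" using norm_diff_ineq[of 1 "?w * deriv P ?w"] by simp
      then have "1/2 * (1/4) \<le> exp (Re (P ?w)) * norm (1 + ?w * deriv P ?w)" using eR(1)[OF w] by (intro mult_mono) auto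
      then show ?thesis using DERIV_imp_deriv[OF dF] by (simp add: norm_mult)
    qed
    show "norm (F w) * (c j / 100) \<le> Im (F w)" if Iw: "Im w > 0" and j: "\<rho> / 2^(j+1) < norm w" "norm w \<le> \<rho> / 2^j" for w j
    proof -
      have w: "w \<in> S" using SI[OF Iw] .
      have "norm w * (c j / 100) \<le> Re w * sin (Im (P w)) + Im w * cos (Im (P w))"
      proof (cases "Im w \<ge> norm w / 2")
        case True
        have "norm w * (c j / 100) \<le> norm w / 2 * (1/2)"
          using cj[of j] mult_left_mono[of "c j / 100" "1/4" "norm w"] by simp
        also have "\<dots> \<le> Im w * cos (Im (P w))" using True cv[OF w] Iw by (intro mult_mono) auto
        finally show ?thesis using xs0[OF w] by linarith
      next
        case False
        have "norm w \<le> \<bar>Re w\<bar> + \<bar>Im w\<bar>" by (rule cmod_le)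
        then have x: "\<bar>Re w\<bar> \<ge> norm w / 2" using False Iw by simp
        have "norm w * (c j / 100) \<le> norm w * (c j / 64)" using c(1)[of j] by (intro mult_left_mono) auto
        also have "\<dots> \<le> Re w * sin (Im (P w))" using xs[OF w x] j by (simp add: s_def)
        finally have "norm w * (c j / 100) \<le> Re w * sin (Im (P w))" .
        moreover have "0 \<le> Im w * cos (Im (P w))" using cv[OF w] Iw by (intro mult_nonneg_nonneg) auto
        ultimately show ?thesis by linarith
      qed
      then have "exp (Re (P w)) * (norm w * (c j / 100)) \<le> exp (Re (P w)) * (Re w * sin (Im (P w)) + Im w * cos (Im (P w)))"
        by (intro mult_left_mono) auto
      then show ?thesis unfolding nF IF by (simp only: mult.commute mult.left_commute)
    qed
    \<comment> \<open>Im w may be negative here; its contribution, at most |w| c j / 100 in size, is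
      beaten by the gain |w| c j / 64 from Re w * sin (Im P).\<close>
    show "Im w > - \<bar>Re w\<bar> \<and> Im (F w) > 0" if Iw: "Im w \<le> 0" "- Im w \<le> norm w * (c j / 100)" and j: "\<rho> / 2^(j+1) < norm w" "norm w \<le> \<rho> / 2^j" for w j
    proof -
      have n0: "norm w > 0" using j(1) \<rho> by (smt (verit) divide_pos_pos zero_less_power)
      have "norm w * (c j / 100) \<le> norm w * (1/400)" using cj[of j] by (intro mult_left_mono) auto
      then have Is: "- Im w \<le> norm w / 400" using Iw by linarith
      have "norm w \<le> \<bar>Re w\<bar> + \<bar>Im w\<bar>" by (rule cmod_le)
      then have x1: "\<bar>Re w\<bar> \<ge> norm w / 2" using Is Iw(1) n0 by argo
      then have "- \<bar>Re w\<bar> < Im w" using Is n0 by argo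
      note x = x1 this
      then have w: "w \<in> S" by (simp add: S_def)
      have "- Im w * cos (Im (P w)) \<le> norm w * (c j / 100) * 1" using Iw cv[OF w] by (intro mult_mono) auto
      moreover have "norm w * (c j / 100) < norm w * (c j / 64)" using n0 c(1)[of j] by (intro mult_strict_left_mono) auto
      moreover have "norm w * (c j / 64) \<le> Re w * sin (Im (P w))" using xs[OF w x(1)] j by (simp add: s_def)
      ultimately have "Re w * sin (Im (P w)) + Im w * cos (Im (P w)) > 0" by simp
      then show ?thesis unfolding IF using x by simp
    qed
  qed
qed

section \<open>Quantitative Schwarz, Hopf and Harnack estimates\<close>

lemma Hopf_ball:
  assumes h: "h holomorphic_on ball c r" "\<And>u. u \<in> ball c r \<Longrightarrow> norm (h u) < 1" and u: "u \<in> ball c r"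
  shows "(1 - norm (h c)) / 4 * (1 - norm (u - c) / r) \<le> 1 - norm (h u)"
proof -
  have r: "r > 0" using u by (metis mem_ball dist_not_less_zero linorder_not_less order.strict_trans1 zero_le_dist)
  define f where "f = (\<lambda>\<zeta>. h (c + of_real r * \<zeta>))"
  have im: "(\<lambda>\<zeta>. c + of_real r * \<zeta>) ` ball 0 1 \<subseteq> ball c r" using r by (auto simp: dist_norm norm_mult)
  have "(\<lambda>\<zeta>. c + of_real r * \<zeta>) holomorphic_on ball 0 1" by (intro holomorphic_intros)
  then have "h \<circ> (\<lambda>\<zeta>. c + of_real r * \<zeta>) holomorphic_on ball 0 1" by (rule holomorphic_on_compose_gen[OF _ h(1) im])
  then have fh: "f holomorphic_on ball 0 1" by (simp add: f_def o_def)
  have f1: "norm (f z) < 1" if "norm z < 1" for z unfolding f_def by (rule h(2)) (use r that in \<open>auto simp: dist_norm norm_mult\<close>)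
  define z where "z = (u - c) / of_real r"
  define t where "t = norm z"
  have t: "t = norm (u - c) / r" "t < 1" using u r by (auto simp: t_def z_def norm_divide dist_norm norm_minus_commute)
  have fz: "f z = h u" "f 0 = h c" using r by (auto simp: f_def z_def)
  define a where "a = h c"
  define b where "b = h u"
  have ab: "norm a < 1" "norm b < 1" using h(2) u r by (auto simp: a_def b_def)
  have "norm (Moebius_function 0 a b) \<le> t"
    using Schwarz_Pick(2)[OF fh f1, of z] t(2) fz by (simp add: t_def a_def b_def)
  moreover have "1 - cnj a * b \<noteq> 0" using norm_mult_less[of "cnj a" 1 b 1] ab by auto
  ultimately have m: "norm (b - a) \<le> t * norm (1 - cnj a * b)"
    by (simp add: Moebius_function_simple norm_divide divide_le_eq)
  \<comment> \<open>This identity rewrites Schwarz-Pick as (1 - t^2) |1 - cnj a b|^2 \<le> (1 -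
    |a|^2) (1 - |b|^2). With |1 - cnj a b| \<ge> 1 - |a| it bounds 1 - |b| below linearly in 1 - t,
    which is a Hopf lemma with explicit constant.\<close>
  have id: "norm (1 - cnj a * b)^2 - norm (b - a)^2 = (1 - norm a^2) * (1 - norm b^2)"
    unfolding cmod_power2 by (simp add: power2_eq_square algebra_simps)
  define k where "k = norm (1 - cnj a * b)"
  have k: "1 - norm a \<le> k"
  proof -
    have "norm (cnj a * b) \<le> norm a * 1" unfolding norm_mult using ab by (intro mult_mono) auto
    then show ?thesis using norm_triangle_ineq2[of 1 "cnj a * b"] by (simp add: k_def)
  qed
  have t0: "0 \<le> t" by (simp add: t_def)
  have "norm (b - a)^2 \<le> (t * k)^2" using m by (intro power_mono) (auto simp: k_def)
  then have "(1 - t^2) * k^2 \<le> (1 - norm a^2) * (1 - norm b^2)"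
    using id by (simp add: k_def power_mult_distrib algebra_simps)
  moreover have "(1 - t) * (1 - norm a)^2 \<le> (1 - t^2) * k^2"
  proof (rule mult_mono)
    have "t * t \<le> t * 1" using t t0 by (intro mult_left_mono) auto
    then show "1 - t \<le> 1 - t^2" by (simp add: power2_eq_square)
    show "(1 - norm a)^2 \<le> k^2" using k ab by (intro power_mono) auto
    show "0 \<le> 1 - t^2" using t t0 by (simp add: abs_square_le_1)
  qed simp
  ultimately have "(1 - t) * (1 - norm a) * (1 - norm a) \<le> (1 + norm a) * (1 - norm b^2) * (1 - norm a)"
    by (simp add: power2_eq_square algebra_simps)
  then have 1: "(1 - t) * (1 - norm a) \<le> (1 + norm a) * (1 - norm b^2)" using ab by (simp add: mult_le_cancel_right)
  have "(1 + norm a) * (1 - norm b^2) \<le> 2 * (2 * (1 - norm b))"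
  proof (rule mult_mono)
    have "1 - norm b^2 = (1 + norm b) * (1 - norm b)" by (simp add: power2_eq_square algebra_simps)
    also have "\<dots> \<le> 2 * (1 - norm b)" using ab by (intro mult_right_mono) auto
    finally show "1 - norm b^2 \<le> 2 * (1 - norm b)" .
    show "0 \<le> 1 - norm b^2" using ab by (simp add: abs_square_le_1)
  qed (use ab in auto)
  then have "(1 - t) * (1 - norm a) \<le> 4 * (1 - norm b)" using 1 by linarith
  then show ?thesis unfolding t(1)[symmetric] a_def b_def by (simp add: mult.commute)
qed

lemma norm_deriv_ball_le:
  assumes h: "h holomorphic_on ball c r" "\<And>u. u \<in> ball c r \<Longrightarrow> norm (h u) < 1" and r: "r > 0"
  shows "norm (deriv h c) \<le> 2 * (1 - norm (h c)) / r"
proof -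
  define f where "f = (\<lambda>\<zeta>. h (c + of_real r * \<zeta>))"
  have im: "(\<lambda>\<zeta>. c + of_real r * \<zeta>) ` ball 0 1 \<subseteq> ball c r" using r by (auto simp: dist_norm norm_mult)
  have "(\<lambda>\<zeta>. c + of_real r * \<zeta>) holomorphic_on ball 0 1" by (intro holomorphic_intros)
  then have "h \<circ> (\<lambda>\<zeta>. c + of_real r * \<zeta>) holomorphic_on ball 0 1" by (rule holomorphic_on_compose_gen[OF _ h(1) im])
  then have fh: "f holomorphic_on ball 0 1" by (simp add: f_def o_def)
  have f1: "norm (f z) < 1" if "norm z < 1" for z unfolding f_def by (rule h(2)) (use r that in \<open>auto simp: dist_norm norm_mult\<close>)
  have dh: "(h has_field_derivative deriv h c) (at (c + of_real r * 0))"
    using holomorphic_derivI[OF h(1) open_ball, of c] r by simp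
  have "((\<lambda>\<zeta>. c + of_real r * \<zeta>) has_field_derivative of_real r) (at 0)" by (auto intro!: derivative_eq_intros)
  from DERIV_chain2[OF dh this] have "deriv f 0 = deriv h c * of_real r" unfolding f_def by (rule DERIV_imp_deriv)
  then have "norm (deriv h c) * r \<le> 1 - norm (h c)^2"
    using Schwarz_Pick(1)[OF fh f1] r by (simp add: f_def norm_mult)
  also have "1 - norm (h c)^2 = (1 + norm (h c)) * (1 - norm (h c))" by (simp add: power2_eq_square algebra_simps)
  also have "\<dots> \<le> 2 * (1 - norm (h c))" using h(2)[of c] r by (intro mult_right_mono) auto
  finally show ?thesis using r by (simp add: field_simps)
qed

lemma half_plane_disc_map:
  assumes e: "e holomorphic_on ball 0 1" and e': "\<forall>u. norm u < 1 \<longrightarrow> Im (e u) > 0"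
  defines "h \<equiv> \<lambda>u. (e u - e 0) / (e u - cnj (e 0))"
  shows "h holomorphic_on ball 0 1" "\<And>u. norm u < 1 \<Longrightarrow> norm (h u) < 1" "h 0 = 0"
    and "\<And>u. norm u < 1 \<Longrightarrow> e u - cnj (e 0) \<noteq> 0"
proof -
  have e0: "Im (e 0) > 0" using e' by simp
  show nz: "e u - cnj (e 0) \<noteq> 0" if "norm u < 1" for u
    using e'[rule_format, OF that] e0 by (auto simp: complex_eq_iff)
  show "h holomorphic_on ball 0 1" unfolding h_def using e nz by (intro holomorphic_intros) auto
  show "h 0 = 0" by (simp add: h_def)
  show "norm (h u) < 1" if "norm u < 1" for u
  proof -
    have "norm (e u - e 0)^2 < norm (e u - cnj (e 0))^2"
      unfolding norm_diff_cnj_square using e'[rule_format, OF that] e0 by simp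
    then have "norm (e u - e 0) < norm (e u - cnj (e 0))" by (rule power_less_imp_less_base) simp
    then show ?thesis by (simp add: h_def norm_divide divide_less_eq_1)
  qed
qed

text \<open>Harnack's inequality for the positive harmonic function Im e, derived from the Schwarz
  lemma after mapping the half-plane to the disc with e 0 going to 0.\<close>

lemma half_plane_lower:
  assumes e: "e holomorphic_on ball 0 1" "\<And>u. norm u < 1 \<Longrightarrow> Im (e u) > 0" and u: "norm u < 1"
  shows "Im (e 0) * (1 - norm u) / 4 \<le> Im (e u)"
proof -
  have "\<forall>u. norm u < 1 \<longrightarrow> Im (e u) > 0" using e(2) by blast
  note h = half_plane_disc_map[OF e(1) this]
  have e0: "Im (e 0) > 0" using e(2) by simp
  define n where "n = norm (e u - cnj (e 0))"
  have n: "n > 0" using h(4)[OF u] by (simp add: n_def)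
  have "norm ((e u - e 0) / (e u - cnj (e 0))) \<le> norm u"
    using Schwarz_Lemma(1)[OF h(1,3,2) u] by simp
  then have "norm (e u - e 0) \<le> norm u * n" using n by (simp add: norm_divide n_def divide_le_eq)
  then have "norm (e u - e 0)^2 \<le> (norm u * n)^2" by (intro power_mono) auto
  then have "(1 - norm u^2) * n^2 \<le> 4 * (Im (e u) * Im (e 0))"
    using norm_diff_cnj_square[of "e u" "e 0"] by (simp add: n_def power_mult_distrib algebra_simps)
  moreover have "(1 - norm u) * (Im (e 0) * Im (e 0)) \<le> (1 - norm u^2) * n^2"
  proof (rule mult_mono)
    have "norm u * norm u \<le> norm u * 1" using u by (intro mult_left_mono) auto
    then show "1 - norm u \<le> 1 - norm u^2" by (simp add: power2_eq_square)
    have "Im (e 0) \<le> n" using abs_Im_le_cmod[of "e u - cnj (e 0)"] e(2)[OF u] e0 by (simp add: n_def)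
    then show "Im (e 0) * Im (e 0) \<le> n^2" unfolding power2_eq_square using e0 by (intro mult_mono) auto
    show "0 \<le> 1 - norm u^2" using u by (simp add: abs_square_le_1)
  qed (use e0 in auto)
  ultimately have "(Im (e 0) * (1 - norm u)) * Im (e 0) \<le> (4 * Im (e u)) * Im (e 0)" by (simp add: mult_ac)
  then have "Im (e 0) * (1 - norm u) \<le> 4 * Im (e u)" using e0 by (simp add: mult_le_cancel_right)
  then show ?thesis by simp
qed

lemma half_plane_deriv:
  assumes e: "e holomorphic_on ball c r" "\<And>u. u \<in> ball c r \<Longrightarrow> Im (e u) > 0" and r: "r > 0"
  shows "norm (deriv e c) \<le> 2 * Im (e c) / r"
proof -
  define f where "f = (\<lambda>\<zeta>. e (c + of_real r * \<zeta>))"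
  have im: "(\<lambda>\<zeta>. c + of_real r * \<zeta>) ` ball 0 1 \<subseteq> ball c r" using r by (auto simp: dist_norm norm_mult)
  have "(\<lambda>\<zeta>. c + of_real r * \<zeta>) holomorphic_on ball 0 1" by (intro holomorphic_intros)
  then have "e \<circ> (\<lambda>\<zeta>. c + of_real r * \<zeta>) holomorphic_on ball 0 1" by (rule holomorphic_on_compose_gen[OF _ e(1) im])
  then have fh: "f holomorphic_on ball 0 1" by (simp add: f_def o_def)
  have f1: "Im (f z) > 0" if "norm z < 1" for z unfolding f_def by (rule e(2)) (use r that in \<open>auto simp: dist_norm norm_mult\<close>)
  have "\<forall>z. norm z < 1 \<longrightarrow> Im (f z) > 0" using f1 by blast
  note h = half_plane_disc_map[OF fh this]
  have f0: "f 0 = e c" by (simp add: f_def)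
  have ec: "Im (e c) > 0" using e(2) r by simp
  have de: "(e has_field_derivative deriv e c) (at (c + of_real r * 0))"
    using holomorphic_derivI[OF e(1) open_ball, of c] r by simp
  have "((\<lambda>\<zeta>. c + of_real r * \<zeta>) has_field_derivative of_real r) (at 0)" by (auto intro!: derivative_eq_intros)
  from DERIV_chain2[OF de this] have df: "(f has_field_derivative deriv e c * of_real r) (at 0)" unfolding f_def .
  have ne: "f 0 - cnj (f 0) \<noteq> 0" using h(4)[of 0] by simp
  have "((\<lambda>u. (f u - f 0) / (f u - cnj (f 0))) has_field_derivative
     ((deriv e c * of_real r) * (f 0 - cnj (f 0)) - (f 0 - f 0) * (deriv e c * of_real r)) / ((f 0 - cnj (f 0)) * (f 0 - cnj (f 0)))) (at 0)"
    using df ne by (auto intro!: derivative_eq_intros)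
  then have "deriv (\<lambda>u. (f u - f 0) / (f u - cnj (f 0))) 0 = deriv e c * of_real r / (f 0 - cnj (f 0))"
    using ne by (intro DERIV_imp_deriv) simp
  moreover have "norm (deriv (\<lambda>u. (f u - f 0) / (f u - cnj (f 0))) 0) \<le> 1"
    using Schwarz_Lemma(2)[OF h(1,3,2), of 0] by simp
  moreover have "norm (f 0 - cnj (f 0)) = 2 * Im (e c)"
  proof -
    have "f 0 - cnj (f 0) = of_real (2 * Im (e c)) * \<i>" by (simp add: f0 complex_eq_iff)
    then show ?thesis using ec by (simp add: norm_mult)
  qed
  ultimately have "norm (deriv e c) * r \<le> 2 * Im (e c)" using r ec by (simp add: norm_divide norm_mult divide_le_eq)
  then show ?thesis using r by (simp add: field_simps)
qed

lemma level_exists: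
  fixes t \<rho> :: real
  assumes "0 < t" "t \<le> \<rho>"
  obtains j :: nat where "\<rho> / 2^(j+1) < t" "t \<le> \<rho> / 2^j"
proof -
  have "\<exists>n. \<rho> / 2^n < t"
  proof -
    obtain n where "\<rho> / t < 2^n" using real_arch_pow[of 2 "\<rho> / t"] by auto
    then show ?thesis using assms by (intro exI[of _ n]) (simp add: field_simps)
  qed
  note ex = this
  define n where "n = (LEAST n. \<rho> / 2^n < t)"
  have n: "\<rho> / 2^n < t" "\<And>m. m < n \<Longrightarrow> \<not> \<rho> / 2^m < t"
    unfolding n_def using LeastI_ex[OF ex] not_less_Least by blast+
  then have "n \<noteq> 0" using assms by (intro notI) simp
  then obtain j where "n = j + 1" by (metis Suc_eq_plus1 not0_implies_Suc)
  then show thesis using n(1) n(2)[of j] by (intro that[of j]) auto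
qed

text \<open>The Moebius map \<open>\<zeta> \<mapsto> \<zeta> / (1 - 2 \<i> \<zeta> / \<rho>)\<close> fixes \<open>0\<close> to second order and sends a point of the
  lower half-plane to infinity; it carries the whole complement of the truncated cusp, and not
  only the part near \<open>0\<close>, into the region on which a barrier is available.\<close>
lemma exterior_Moebius:
  fixes c :: "nat \<Rightarrow> real" and \<rho> :: real
  assumes \<rho>: "\<rho> > 0" and c: "\<And>j. 0 < c j" "\<And>j. c j \<le> 1/4" "decseq c" and \<zeta>: "\<zeta> \<noteq> 0"
    and cusp: "\<And>i. \<rho> / 2^(i+1) < norm \<zeta> \<Longrightarrow> norm \<zeta> \<le> \<rho> / 2^i \<Longrightarrow> - norm \<zeta> * (c (i+1) / 200) < Im \<zeta>"
  defines "N \<equiv> - 1 / \<zeta> + 2 * \<i> / of_real \<rho>"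
  shows "N \<noteq> 0" "Im (- 1 / N) > 0 \<or> (\<exists>j. Im (- 1 / N) \<le> 0 \<and> - Im (- 1 / N) \<le> norm (- 1 / N) * (c j / 100) \<and>
      \<rho> / 2^(j+1) < norm (- 1 / N) \<and> norm (- 1 / N) \<le> \<rho> / 2^j)"
proof -
  define n where "n = norm \<zeta>"
  have n: "n > 0" using \<zeta> by (simp add: n_def)
  have IN: "Im N = Im \<zeta> / n^2 + 2 / \<rho>"
  proof -
    have "Im (2 * \<i> / of_real \<rho>) = 2 / \<rho>" unfolding Im_divide_of_real by simp
    moreover have "Im (- 1 / \<zeta>) = Im \<zeta> / n^2" unfolding n_def cmod_power2 by (simp add: Im_divide)
    ultimately show ?thesis by (simp add: N_def)
  qed
  have Iw: "Im (- 1 / N) = Im N / norm N^2" unfolding cmod_power2 by (simp add: Im_divide)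
  have "N \<noteq> 0 \<and> (Im (- 1 / N) > 0 \<or> (\<exists>j. Im (- 1 / N) \<le> 0 \<and> - Im (- 1 / N) \<le> norm (- 1 / N) * (c j / 100) \<and>
      \<rho> / 2^(j+1) < norm (- 1 / N) \<and> norm (- 1 / N) \<le> \<rho> / 2^j))"
  proof (cases "Im N > 0")
    case True
    then have "N \<noteq> 0" by auto
    then show ?thesis using True Iw by simp
  next
    case False
    \<comment> \<open>The imaginary part of -1 / \<zeta> is at least -1 / |\<zeta>|, so for
      |\<zeta>| \<ge> \<rho> the summand 2 / \<rho> would win. Thus only points at which the cusp
      condition is available remain.\<close>
    have "n < \<rho>"
    proof (rule ccontr)
      assume "\<not> n < \<rho>"
      then have "1 / n \<le> 1 / \<rho>" using \<rho> by (intro divide_left_mono) auto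
      moreover have "- n / n^2 \<le> Im \<zeta> / n^2" using abs_Im_le_cmod[of \<zeta>] by (intro divide_right_mono) (auto simp: n_def)
      moreover have "- n / n^2 = - (1 / n)" using n by (simp add: power2_eq_square)
      moreover have "2 / \<rho> = 1 / \<rho> + 1 / \<rho>" "1 / \<rho> > 0" using \<rho> by auto
      ultimately show False using False IN by linarith
    qed
    then obtain i where i: "\<rho> / 2^(i+1) < n" "n \<le> \<rho> / 2^i" using level_exists[of n \<rho>] n by auto
    have lo: "- n * (c (i+1) / 200) < Im \<zeta>" using cusp[of i] i by (simp add: n_def)
    define k where "k = - Im \<zeta> / n^2"
    have "- Im \<zeta> / n^2 \<le> (n * (c (i+1) / 200)) / n^2" using lo by (intro divide_right_mono) auto
    then have k1: "k \<le> c (i+1) / 200 / n" using n by (simp add: k_def power2_eq_square)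
    have k2: "2 / \<rho> \<le> k" using False IN by (simp add: k_def)
    \<comment> \<open>Combining both bounds on k forces |\<zeta>| \<le> \<rho> / 1600. Hence N
      \<zeta> is close to -1, and -1 / N has almost the modulus of \<zeta>.\<close>
    have "c (i+1) / 200 / n \<le> 1/800 / n" using c(2)[of "i+1"] n by (intro divide_right_mono) auto
    then have "2 / \<rho> \<le> 1/800 / n" using k1 k2 by linarith
    then have small: "2 * n / \<rho> \<le> 1/800" using n \<rho> by (simp add: field_simps)
    have Nz: "N * \<zeta> = - 1 + 2 * \<i> * \<zeta> / of_real \<rho>" unfolding N_def using \<zeta> by (simp add: field_simps)
    have "norm (2 * \<i> * \<zeta> / of_real \<rho>) \<le> 1/800" using small \<rho> by (simp add: norm_mult norm_divide n_def)
    then have Nn: "799/800 \<le> norm N * n" "norm N * n \<le> 801/800"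
      using norm_triangle_ineq[of "-1" "2 * \<i> * \<zeta> / of_real \<rho>"] norm_triangle_ineq2[of "-1" "- (2 * \<i> * \<zeta> / of_real \<rho>)"] Nz
      by (simp_all add: n_def flip: norm_mult)
    have N0: "N \<noteq> 0" using Nn(1) by auto
    define m where "m = norm (- 1 / N)"
    have mN: "m = 1 / norm N" by (simp add: m_def norm_divide)
    have m: "m > 0" "m \<le> 801/799 * n" "n \<le> 801/800 * m"
      using N0 Nn n by (auto simp: mN field_simps)
    have m2: "m \<le> 2 * n" "799/800 * n \<le> m" using m Nn N0 n by (auto simp: mN field_simps)
    have "m \<le> \<rho>" using m2 small \<rho> n by (simp add: field_simps)
    then obtain j where j: "\<rho> / 2^(j+1) < m" "m \<le> \<rho> / 2^j" using level_exists[of m \<rho>] m by auto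
    \<comment> \<open>The dyadic levels of \<zeta> and of -1 / N may differ, but j \<le> i + 1. This
      is why the cusp condition at level i involves c (i + 1).\<close>
    have "\<rho> / 2^(i+2) < \<rho> / 2^j"
    proof -
      have "\<rho> / 2^(i+2) = \<rho> / 2^(i+1) / 2" by simp
      also have "\<dots> < n / 2" using i(1) by (intro divide_strict_right_mono) auto
      also have "n / 2 \<le> m" using m2 n by linarith
      finally show ?thesis using j(2) by simp
    qed
    then have "(2::real)^j < 2^(i+2)" using \<rho> by (simp add: divide_less_cancel frac_less2 field_simps)
    then have "j < i + 2" by (rule power_less_imp_less_exp[rotated]) simp
    then have cc: "c (i+1) \<le> c j" using c(3) by (auto simp: decseq_def)
    have "- Im N \<le> k" using IN k_def \<rho> by simp
    then have "- Im (- 1 / N) \<le> k * m^2" unfolding Iw mN power_divide using mult_right_mono[of "- Im N" k "1 / norm N^2"] by simp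
    also have "\<dots> \<le> c (i+1) / 200 / n * m^2" using k1 by (intro mult_right_mono) auto
    also have "\<dots> = m * (c (i+1) / 200) * (m / n)" by (simp add: power2_eq_square)
    also have "\<dots> \<le> m * (c (i+1) / 200) * 2" using m2 n m c(1)[of "i+1"] by (intro mult_left_mono) (auto simp: divide_le_eq)
    also have "\<dots> \<le> m * (c j / 100)" using cc m by simp
    finally have "- Im (- 1 / N) \<le> m * (c j / 100)" .
    moreover have "Im (- 1 / N) \<le> 0" unfolding Iw using False by (simp add: divide_nonpos_nonneg)
    ultimately show ?thesis using N0 j unfolding m_def by blast
  qed
  then show "N \<noteq> 0" "Im (- 1 / N) > 0 \<or> (\<exists>j. Im (- 1 / N) \<le> 0 \<and> - Im (- 1 / N) \<le> norm (- 1 / N) * (c j / 100) \<and>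
      \<rho> / 2^(j+1) < norm (- 1 / N) \<and> norm (- 1 / N) \<le> \<rho> / 2^j)" by blast+
qed

section \<open>The Riemann map near a boundary graph\<close>

text \<open>Dini smoothness enters only through \<open>cusp_in\<close> and \<open>cusp_out\<close>: with respect to the tangent
  direction \<open>T x\<close> at \<open>Complex x (g x)\<close>, the boundary of \<open>D\<close> has slope at most \<open>c (j + 1) / 200\<close> at
  distance \<open>\<rho> / 2 ^ j\<close>, uniformly in \<open>x\<close>.\<close>
locale local_graph =
  fixes D :: "complex set" and g :: "real \<Rightarrow> real" and a \<rho> :: real and T :: "real \<Rightarrow> complex" and c :: "nat \<Rightarrow> real"
  assumes D: "open D" and a: "a > 0" and g0: "g 0 = 0"
    and gL: "\<And>x y. \<bar>x\<bar> \<le> a \<Longrightarrow> \<bar>y\<bar> \<le> a \<Longrightarrow> \<bar>g x - g y\<bar> \<le> \<bar>x - y\<bar> / 4"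
    and box: "\<And>x y. \<bar>x\<bar> \<le> a \<Longrightarrow> \<bar>y\<bar> \<le> a \<Longrightarrow> Complex x y \<in> D \<longleftrightarrow> g x < y"
    and T: "\<And>x. \<bar>x\<bar> \<le> a / 2 \<Longrightarrow> norm (T x) = 1" "\<And>x. \<bar>x\<bar> \<le> a / 2 \<Longrightarrow> norm (T x - 1) \<le> 1/4"
    and \<rho>: "0 < \<rho>" "\<rho> \<le> a / 16"
    and c: "\<And>j. 0 < c j" "decseq c" "summable c" "suminf c \<le> 1/4"
    and cusp_in: "\<And>x \<zeta> j. \<bar>x\<bar> \<le> a / 2 \<Longrightarrow> \<rho> / 2^(j+1) < norm \<zeta> \<Longrightarrow> norm \<zeta> \<le> \<rho> / 2^j \<Longrightarrow>
      norm \<zeta> * (c (j+1) / 200) \<le> Im \<zeta> \<Longrightarrow> Complex x (g x) + T x * \<zeta> \<in> D"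
    and cusp_out: "\<And>x \<zeta> j. \<bar>x\<bar> \<le> a / 2 \<Longrightarrow> \<rho> / 2^(j+1) < norm \<zeta> \<Longrightarrow> norm \<zeta> \<le> \<rho> / 2^j \<Longrightarrow>
      Im \<zeta> \<le> - norm \<zeta> * (c (j+1) / 200) \<Longrightarrow> Complex x (g x) + T x * \<zeta> \<notin> D"
begin

definition "q x = Complex x (g x)"
text \<open>Only the part of the complement of D below the graph in the box is kept. Other
  complementary components are ignored, so the complement of K in the sphere is simply connected
  whatever the topology of D. The point \<open>zc\<close> is a centre of star shape of K.\<close>

definition "K = {z. \<bar>Re z\<bar> \<le> a \<and> - a \<le> Im z \<and> Im z \<le> g (Re z)}"
definition "zc = Complex 0 (- a / 2)"

text \<open>The complement of \<open>K\<close> in the Riemann sphere, seen in the coordinate \<open>1 / (z - zc)\<close>.\<close>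
definition "W = {\<omega>. \<omega> = 0 \<or> zc + 1 / \<omega> \<notin> K}"

section \<open>Geometry of the compact set K and its uniformization\<close>

lemma g_bound: "\<bar>x\<bar> \<le> a \<Longrightarrow> \<bar>g x\<bar> \<le> \<bar>x\<bar> / 4"
  using gL[of x 0] g0 a by simp

lemma c_le: "c j \<le> 1/4"
  using sum_le_suminf[OF c(3), of "{j}"] c(1,4) by (simp add: less_imp_le)

lemma box': "\<bar>Re z\<bar> \<le> a \<Longrightarrow> \<bar>Im z\<bar> \<le> a \<Longrightarrow> z \<in> D \<longleftrightarrow> g (Re z) < Im z"
  using box[of "Re z" "Im z"] by simp

lemma in_K: "\<bar>Re z\<bar> \<le> a \<Longrightarrow> \<bar>Im z\<bar> \<le> a \<Longrightarrow> z \<in> K \<longleftrightarrow> z \<notin> D"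
  using box'[of z] by (auto simp: K_def)

lemma D_disjoint_K: "z \<in> D \<Longrightarrow> z \<notin> K"
proof
  assume z: "z \<in> D" "z \<in> K"
  then have zK: "\<bar>Re z\<bar> \<le> a" "- a \<le> Im z" "Im z \<le> g (Re z)" by (auto simp: K_def)
  then have "Im z \<le> a" using g_bound[OF zK(1)] a by linarith
  then show False using box'[of z] z zK by (simp add: abs_le_iff)
qed

lemma continuous_g: "continuous_on {z. \<bar>Re z\<bar> \<le> a} (\<lambda>z. g (Re z))"
proof (rule continuous_on_compose2[of "{- a..a}" g])
  have "(1/4)-lipschitz_on {- a..a} g"
    by (rule lipschitz_onI) (use gL in \<open>auto simp: dist_real_def abs_le_iff\<close>)
  then show "continuous_on {- a..a} g" by (rule lipschitz_on_continuous_on)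
qed (auto intro!: continuous_intros)

lemma closed_strip: "closed {z. \<bar>Re z\<bar> \<le> r}" "closed {z. \<bar>Im z\<bar> \<le> r}"
  by (intro closed_Collect_le continuous_intros)+

lemma compact_K: "compact K"
proof -
  have "K = {z\<in>{z. \<bar>Re z\<bar> \<le> a}. Im z \<le> g (Re z)} \<inter> {z. - a \<le> Im z}" by (auto simp: K_def)
  moreover have "closed {z\<in>{z. \<bar>Re z\<bar> \<le> a}. Im z \<le> g (Re z)}"
    by (intro continuous_on_closed_Collect_le continuous_g closed_strip continuous_intros)
  moreover have "closed {z. - a \<le> Im z}" by (intro closed_Collect_le continuous_intros)
  ultimately have "closed K" by (metis closed_Int)
  moreover have "norm z \<le> 2 * a" if "z \<in> K" for z
  proof -
    have "\<bar>Im z\<bar> \<le> a" using that g_bound[of "Re z"] by (auto simp: K_def)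
    then show ?thesis using cmod_le[of z] that by (auto simp: K_def)
  qed
  then have "bounded K" by (auto simp: bounded_iff)
  ultimately show ?thesis by (simp add: compact_eq_bounded_closed)
qed

text \<open>A segment towards \<open>zc\<close> from a point at height at most -a / 4 stays at such
  heights, below all values of g. From a higher point it has descended by at least (1 - t) a / 4 at
  parameter t, which is the most that g, of slope at most 1/4, can have dropped.\<close>

lemma K_starlike:
  assumes z: "z \<in> K" and t: "0 \<le> t" "t \<le> 1"
  shows "zc + of_real t * (z - zc) \<in> K"
proof -
  let ?w = "zc + of_real t * (z - zc)"
  have Rw: "Re ?w = t * Re z" by (simp add: zc_def)
  have Iw: "Im ?w = - a / 2 + t * (Im z + a / 2)" by (simp add: zc_def)
  have zK: "\<bar>Re z\<bar> \<le> a" "- a \<le> Im z" "Im z \<le> g (Re z)" using z by (auto simp: K_def)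
  have tR: "\<bar>t * Re z\<bar> \<le> a"
  proof -
    have "\<bar>t\<bar> * \<bar>Re z\<bar> \<le> 1 * a" using t zK by (intro mult_mono) auto
    then show ?thesis by (simp add: abs_mult)
  qed
  have lo: "- a \<le> Im ?w"
  proof -
    have "t * (- a / 2) \<le> t * (Im z + a / 2)" using t zK by (intro mult_left_mono) auto
    moreover have "t * (a / 2) \<le> 1 * (a / 2)" using t a by (intro mult_right_mono) auto
    ultimately show ?thesis unfolding Iw by simp
  qed
  have g1: "\<bar>g (t * Re z)\<bar> \<le> a / 4" using g_bound[OF tR] tR by simp
  have hi: "Im ?w \<le> g (t * Re z)"
  proof (cases "Im z \<le> - a / 4")
    case True
    have "t * (Im z + a / 2) \<le> 1 * (a / 4)"
    proof (cases "Im z + a / 2 \<ge> 0")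
      case p: True
      show ?thesis using t p True by (intro mult_mono) auto
    next
      case False
      then have "t * (Im z + a / 2) \<le> 0" using t by (intro mult_nonneg_nonpos) auto
      then show ?thesis using a by simp
    qed
    then show ?thesis unfolding Iw using g1 by (simp add: abs_le_iff)
  next
    case False
    have gg: "\<bar>g (t * Re z) - g (Re z)\<bar> \<le> \<bar>t * Re z - Re z\<bar> / 4" using gL[OF tR zK(1)] .
    have "\<bar>t * Re z - Re z\<bar> = (1 - t) * \<bar>Re z\<bar>"
    proof -
      have "t * Re z - Re z = (t - 1) * Re z" by (simp add: algebra_simps)
      then show ?thesis using t by (simp add: abs_mult)
    qed
    also have "\<dots> \<le> (1 - t) * a" using zK t by (intro mult_left_mono) auto
    finally have "g (Re z) - (1 - t) * a / 4 \<le> g (t * Re z)" using gg unfolding abs_le_iff by argo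
    moreover have "(1 - t) * (a / 4) \<le> (1 - t) * (Im z + a / 2)" using False t by (intro mult_left_mono) auto
    moreover have "- a / 2 + t * (Im z + a / 2) = Im z - (1 - t) * (Im z + a / 2)" by (simp add: left_diff_distrib)
    ultimately show ?thesis unfolding Iw using zK(3) by simp
  qed
  show ?thesis using tR lo hi unfolding K_def mem_Collect_eq Rw by simp
qed

lemma q_in_K: "\<bar>x\<bar> \<le> a \<Longrightarrow> q x \<in> K"
  using g_bound[of x] by (auto simp: K_def q_def)

lemma zc_in_K: "zc \<in> K" "0 \<in> K" using a g0 by (auto simp: K_def zc_def)

lemma open_W: "open W"
proof -
  have b: "norm (z - zc) \<le> 3 * a" if "z \<in> K" for z
  proof -
    have "\<bar>Im z\<bar> \<le> a" "\<bar>Re z\<bar> \<le> a" using that g_bound[of "Re z"] by (auto simp: K_def)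
    then have "norm z \<le> 2 * a" using cmod_le[of z] by simp
    moreover have "norm zc \<le> a / 2" using cmod_le[of zc] a by (simp add: zc_def)
    ultimately show ?thesis using norm_triangle_ineq4[of z zc] a by linarith
  qed
  have eq: "W = ball 0 (1 / (4 * a)) \<union> (- {0} \<inter> (\<lambda>\<omega>. zc + 1 / \<omega>) -` (- K))"
  proof -
    have sub: "\<omega> \<in> W" if "norm \<omega> < 1 / (4 * a)" for \<omega>
    proof (cases "\<omega> = 0")
      case False
      have "norm \<omega> * (4 * a) < 1" using that a by (simp add: field_simps)
      then have "4 * a < norm (1 / \<omega>)" using False by (simp add: norm_divide field_simps)
      then show ?thesis using b[of "zc + 1 / \<omega>"] a by (auto simp: W_def)
    qed (simp add: W_def)
    have gen: "X = B \<union> Y" if "B \<subseteq> X" "0 \<in> B" "X = {0} \<union> Y" for B X Y :: "complex set"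
      unfolding that(3) using that(1,2) that(3) by blast
    have s1: "ball 0 (1 / (4 * a)) \<subseteq> W" using sub by auto
    have s3: "W = {0} \<union> (- {0} \<inter> (\<lambda>\<omega>. zc + 1 / \<omega>) -` (- K))" by (auto simp: W_def)
    show ?thesis by (rule gen[OF s1 _ s3]) (use a in simp)
  qed
  have "open (- {0} \<inter> (\<lambda>\<omega>. zc + 1 / \<omega>) -` (- K))"
    using compact_K by (intro continuous_open_preimage continuous_intros) (auto simp: compact_imp_closed open_Compl)
  then show ?thesis unfolding eq by auto
qed

text \<open>Inversion at \<open>zc\<close> turns the star shape of K about \<open>zc\<close> into a
  star shape of W about 0.\<close>

lemma simply_connected_W: "simply_connected W"
proof (rule starlike_imp_simply_connected)
  have "of_real t * \<omega> \<in> W" if "\<omega> \<in> W" "0 \<le> t" "t \<le> 1" for t \<omega>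
  proof (cases "t = 0 \<or> \<omega> = 0")
    case False
    have "zc + 1 / (of_real t * \<omega>) \<notin> K"
    proof
      assume "zc + 1 / (of_real t * \<omega>) \<in> K"
      from K_starlike[OF this that(2,3)] have "zc + 1 / \<omega> \<in> K" using False by simp
      then show False using that False by (simp add: W_def)
    qed
    then show ?thesis by (simp add: W_def)
  qed (auto simp: W_def)
  then have "closed_segment 0 \<omega> \<subseteq> W" if "\<omega> \<in> W" for \<omega>
    using that by (auto simp: closed_segment_def scaleR_conv_of_real)
  then show "starlike W" unfolding starlike_def by (intro bexI[of _ 0]) (auto simp: W_def)
qed

lemma W_not_UNIV: "W \<noteq> UNIV"
proof
  assume "W = UNIV"
  then have "1 / (0 - zc) \<in> W" by simp
  moreover have "zc \<noteq> 0" using a by (auto simp: zc_def complex_eq_iff)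
  ultimately show False using zc_in_K by (auto simp: W_def)
qed

text \<open>The normalisation f 0 = 0 sends infinity in the z-sphere to the centre of the disc,
  where the barriers of all boundary points agree.\<close>

lemma W_uniformization:
  obtains f R where "f holomorphic_on W" "R holomorphic_on ball 0 1"
    "\<And>\<omega>. \<omega> \<in> W \<Longrightarrow> norm (f \<omega>) < 1 \<and> R (f \<omega>) = \<omega>" "\<And>\<xi>. norm \<xi> < 1 \<Longrightarrow> R \<xi> \<in> W \<and> f (R \<xi>) = \<xi>" "f 0 = 0"
proof -
  have W0: "0 \<in> W" by (simp add: W_def)
  obtain f R where f: "f holomorphic_on W" "R holomorphic_on ball 0 1"
    and fR: "\<forall>\<omega>\<in>W. f \<omega> \<in> ball 0 1 \<and> R (f \<omega>) = \<omega>" "\<forall>\<xi>\<in>ball 0 1. R \<xi> \<in> W \<and> f (R \<xi>) = \<xi>"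
    using Riemann_mapping_theorem[of W] open_W simply_connected_W W_not_UNIV W0 by blast
  define b where "b = f 0"
  have b: "norm b < 1" "norm (- b) < 1" using fR(1) W0 by (auto simp: b_def)
  define f' where "f' = Moebius_function 0 b \<circ> f"
  define R' where "R' = R \<circ> Moebius_function 0 (- b)"
  have m1: "norm (Moebius_function 0 b z) < 1" "norm (Moebius_function 0 (- b) z) < 1" if "norm z < 1" for z
    using Moebius_function_norm_lt_1 b that by auto
  show thesis
  proof (rule that[of f' R'])
    show "f' holomorphic_on W" unfolding f'_def
      by (rule holomorphic_on_compose_gen[OF f(1) Moebius_function_holomorphic[OF b(1)]]) (use fR in auto)
    show "R' holomorphic_on ball 0 1" unfolding R'_def
      by (rule holomorphic_on_compose_gen[OF Moebius_function_holomorphic[OF b(2)] f(2)]) (use m1 in auto)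
    show "f' 0 = 0" by (simp add: f'_def b_def Moebius_function_eq_zero)
    show "norm (f' \<omega>) < 1 \<and> R' (f' \<omega>) = \<omega>" if "\<omega> \<in> W" for \<omega>
      using fR(1) that m1 Moebius_function_compose[of "- b" b "f \<omega>"] b by (auto simp: f'_def R'_def)
    show "R' \<xi> \<in> W \<and> f' (R' \<xi>) = \<xi>" if "norm \<xi> < 1" for \<xi>
      using fR(2) that m1 Moebius_function_compose[of b "- b" \<xi>] b by (auto simp: f'_def R'_def)
  qed
qed

end

text \<open>The barrier F depends only on c and \<rho> and serves every boundary point after
  translation and rotation, so one F is fixed together with the Riemann map f of W and its inverse
  R.\<close>

locale uniformized_graph = local_graph +
  fixes F f R :: "complex \<Rightarrow> complex"
  assumes Fh: "F holomorphic_on {w. Im w > - \<bar>Re w\<bar>}"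
    and F2: "\<And>w. Im w > - \<bar>Re w\<bar> \<Longrightarrow> norm (F w) \<le> 2 * norm w"
    and F1: "\<And>w. Im w > 0 \<Longrightarrow> norm (F w) \<le> norm w"
    and Fpos: "\<And>w. Im w > 0 \<Longrightarrow> Im (F w) > 0"
    and Fi: "\<And>y::real. y > 0 \<Longrightarrow> \<exists>t::real. y/2 \<le> t \<and> t \<le> y \<and> F (\<i> * of_real y) = \<i> * of_real t"
    and Fd: "\<And>y::real. y > 0 \<Longrightarrow> norm (deriv F (\<i> * of_real y)) \<ge> 1/8"
    and Fin: "\<And>w j. Im w > 0 \<Longrightarrow> \<rho> / 2^(j+1) < norm w \<Longrightarrow> norm w \<le> \<rho> / 2^j \<Longrightarrow> norm (F w) * (c j / 100) \<le> Im (F w)"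
    and Fout: "\<And>w j. Im w \<le> 0 \<Longrightarrow> - Im w \<le> norm w * (c j / 100) \<Longrightarrow> \<rho> / 2^(j+1) < norm w \<Longrightarrow> norm w \<le> \<rho> / 2^j \<Longrightarrow> Im w > - \<bar>Re w\<bar> \<and> Im (F w) > 0"
    and fR: "f holomorphic_on W" "R holomorphic_on ball 0 1"
      "\<And>\<omega>. \<omega> \<in> W \<Longrightarrow> norm (f \<omega>) < 1 \<and> R (f \<omega>) = \<omega>" "\<And>\<xi>. norm \<xi> < 1 \<Longrightarrow> R \<xi> \<in> W \<and> f (R \<xi>) = \<xi>" "f 0 = 0"
begin

definition "\<Psi> z = f (1 / (z - zc))"

section \<open>Barriers transported to the uniformized domain\<close>

lemma D_W: "z \<in> D \<Longrightarrow> z \<noteq> zc \<and> 1 / (z - zc) \<in> W"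
  using D_disjoint_K[of z] zc_in_K by (auto simp: W_def)

lemma \<Psi>_holomorphic: "\<Psi> holomorphic_on D"
proof -
  have "(\<lambda>z. 1 / (z - zc)) holomorphic_on D" using D_W by (intro holomorphic_intros) auto
  then have "f \<circ> (\<lambda>z. 1 / (z - zc)) holomorphic_on D"
    by (rule holomorphic_on_compose_gen[OF _ fR(1)]) (use D_W in auto)
  then show ?thesis by (simp add: \<Psi>_def[abs_def] o_def)
qed

lemma \<Psi>_disc: "z \<in> D \<Longrightarrow> norm (\<Psi> z) < 1" and R_\<Psi>: "z \<in> D \<Longrightarrow> R (\<Psi> z) = 1 / (z - zc)"
  using fR(3) D_W by (auto simp: \<Psi>_def)

text \<open>In the coordinate \<omega> = 1 / (z - zc) this is -1 / \<zeta> + 2 i / \<rho> with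
  \<zeta> = (z - q x) / T x, written so that it makes sense at \<omega> = 0, that is at z =
  infinity. Thus -1 / N is the Moebius image \<zeta> / (1 - 2 i \<zeta> / \<rho>) of the normalised
  coordinate at the boundary point q x.\<close>

definition "N x \<omega> = - (T x * \<omega>) / (1 + \<omega> * (zc - q x)) + 2 * \<i> / of_real \<rho>"
definition "E x \<omega> = F (- 1 / N x \<omega>)"

lemma N_iota:
  assumes "z \<noteq> zc" "z \<noteq> q x" "\<bar>x\<bar> \<le> a / 4"
  shows "N x (1 / (z - zc)) = - 1 / ((z - q x) / T x) + 2 * \<i> / of_real \<rho>"
proof -
  have Tn: "T x \<noteq> 0" using T(1)[of x] assms a by auto
  have eq: "1 + 1 / (z - zc) * (zc - q x) = (z - q x) / (z - zc)" using assms by (simp add: field_simps)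
  show ?thesis unfolding N_def eq using assms Tn by (simp add: divide_simps)
qed

text \<open>A point outside K within \<rho> of q x belongs to D and so avoids the exterior cusp at q
  x; \<open>exterior_Moebius\<close> then takes care of all of W. Infinity is treated separately:
  there -1 / N = i \<rho> / 2.\<close>

lemma N_W:
  assumes x: "\<bar>x\<bar> \<le> a / 4" and \<omega>: "\<omega> \<in> W"
  shows "1 + \<omega> * (zc - q x) \<noteq> 0" "N x \<omega> \<noteq> 0" "Im (- 1 / N x \<omega>) > - \<bar>Re (- 1 / N x \<omega>)\<bar>" "Im (E x \<omega>) > 0"
proof -
  have xa: "\<bar>x\<bar> \<le> a / 2" "\<bar>x\<bar> \<le> a" using x a by auto
  have Tn: "norm (T x) = 1" "T x \<noteq> 0" using T(1)[OF xa(1)] by auto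
  have "1 + \<omega> * (zc - q x) \<noteq> 0 \<and> N x \<omega> \<noteq> 0 \<and> (Im (- 1 / N x \<omega>) > 0 \<or> (\<exists>j. Im (- 1 / N x \<omega>) \<le> 0 \<and> - Im (- 1 / N x \<omega>) \<le> norm (- 1 / N x \<omega>) * (c j / 100) \<and>
      \<rho> / 2^(j+1) < norm (- 1 / N x \<omega>) \<and> norm (- 1 / N x \<omega>) \<le> \<rho> / 2^j))"
  proof (cases "\<omega> = 0")
    case True
    have "N x 0 = of_real (2 / \<rho>) * \<i>" by (simp add: N_def)
    moreover have "- 1 / (of_real (2 / \<rho>) * \<i>) = of_real (\<rho> / 2) * \<i>" using \<rho> by (simp add: field_simps)
    ultimately show ?thesis using True \<rho> by simp
  next
    case False
    define z where "z = zc + 1 / \<omega>"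
    have zK: "z \<notin> K" using \<omega> False by (simp add: W_def z_def)
    have zz: "z \<noteq> zc" "\<omega> = 1 / (z - zc)" using False by (auto simp: z_def)
    have zq: "z \<noteq> q x" using zK q_in_K[OF xa(2)] by auto
    define \<zeta> where "\<zeta> = (z - q x) / T x"
    have \<zeta>: "\<zeta> \<noteq> 0" "z = q x + T x * \<zeta>" "norm \<zeta> = norm (z - q x)" using zq Tn by (auto simp: \<zeta>_def norm_divide)
    have cu: "- norm \<zeta> * (c (i+1) / 200) < Im \<zeta>" if i: "\<rho> / 2^(i+1) < norm \<zeta>" "norm \<zeta> \<le> \<rho> / 2^i" for i
    proof (rule ccontr)
      assume "\<not> ?thesis"
      then have "Complex x (g x) + T x * \<zeta> \<notin> D" using cusp_out[OF xa(1) i] by simp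
      then have zD: "z \<notin> D" using \<zeta>(2) by (simp add: q_def)
      have "\<rho> / 2^i \<le> \<rho> / 1" using \<rho>(1) by (intro divide_left_mono) auto
      then have n: "norm (z - q x) \<le> \<rho>" using i(2) \<zeta>(3) by simp
      have "\<bar>Re (z - q x)\<bar> \<le> \<rho>" "\<bar>Im (z - q x)\<bar> \<le> \<rho>" using n abs_Re_le_cmod abs_Im_le_cmod order_trans by blast+
      then have "\<bar>Re z\<bar> \<le> a" "\<bar>Im z\<bar> \<le> a" using x \<rho> g_bound[OF xa(2)] by (auto simp: q_def)
      then show False using in_K zD zK by blast
    qed
    have "1 + \<omega> * (zc - q x) = (z - q x) / (z - zc)" unfolding zz(2) using zz(1) by (simp add: field_simps)
    then have 1: "1 + \<omega> * (zc - q x) \<noteq> 0" using zz zq by simp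
    have 2: "N x \<omega> = - 1 / \<zeta> + 2 * \<i> / of_real \<rho>" unfolding zz(2) \<zeta>_def by (rule N_iota[OF zz(1) zq x])
    show ?thesis using 1 exterior_Moebius[OF \<rho>(1) c(1) c_le c(2) \<zeta>(1) cu] unfolding 2 by blast
  qed
  then show "1 + \<omega> * (zc - q x) \<noteq> 0" "N x \<omega> \<noteq> 0" "Im (- 1 / N x \<omega>) > - \<bar>Re (- 1 / N x \<omega>)\<bar>" "Im (E x \<omega>) > 0"
    unfolding E_def using Fpos Fout by (force, force, smt (verit), blast)
qed

lemma E_holomorphic:
  assumes x: "\<bar>x\<bar> \<le> a / 4"
  shows "E x holomorphic_on W"
proof -
  have "N x holomorphic_on W" unfolding N_def[abs_def] using N_W(1)[OF x] \<rho> by (intro holomorphic_intros) auto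
  then have "(\<lambda>\<omega>. - 1 / N x \<omega>) holomorphic_on W" using N_W(2)[OF x] by (intro holomorphic_intros) auto
  then have "F \<circ> (\<lambda>\<omega>. - 1 / N x \<omega>) holomorphic_on W"
    by (rule holomorphic_on_compose_gen[OF _ Fh]) (use N_W(3)[OF x] in auto)
  then show ?thesis by (simp add: E_def[abs_def] o_def)
qed

text \<open>At the centre of the disc -1 / N equals i \<rho> / 2 whatever x is, and F has height at
  least \<rho> / 4 there. This makes the later constants independent of the boundary point.\<close>

lemma E_R:
  assumes x: "\<bar>x\<bar> \<le> a / 4"
  shows "E x \<circ> R holomorphic_on ball 0 1" "\<And>\<xi>. norm \<xi> < 1 \<Longrightarrow> Im ((E x \<circ> R) \<xi>) > 0" "Im ((E x \<circ> R) 0) \<ge> \<rho> / 4"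
proof -
  show "E x \<circ> R holomorphic_on ball 0 1"
    by (rule holomorphic_on_compose_gen[OF fR(2) E_holomorphic[OF x]]) (use fR(4) in auto)
  show "Im ((E x \<circ> R) \<xi>) > 0" if "norm \<xi> < 1" for \<xi> using N_W(4)[OF x] fR(4)[OF that] by simp
  have W0: "0 \<in> W" by (simp add: W_def)
  have R0: "R 0 = 0" using fR(3)[OF W0] fR(5) by simp
  have N0: "- 1 / N x 0 = \<i> * of_real (\<rho> / 2)" using \<rho> by (simp add: N_def field_simps)
  obtain t where t: "\<rho> / 2 / 2 \<le> t" "F (\<i> * of_real (\<rho> / 2)) = \<i> * of_real t" using Fi[of "\<rho> / 2"] \<rho> by auto
  have "(E x \<circ> R) 0 = \<i> * of_real t" unfolding o_apply R0 E_def N0 t(2) ..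
  then show "Im ((E x \<circ> R) 0) \<ge> \<rho> / 4" using t(1) by simp
qed

text \<open>Two factors 2: one from the Moebius map when |z - q x| \<le> \<rho> / 4, the other from
  |F w| \<le> 2 |w|.\<close>

lemma norm_E_iota_le:
  assumes x: "\<bar>x\<bar> \<le> a / 4" and z: "z \<in> D" "norm (z - q x) \<le> \<rho> / 4"
  shows "norm (E x (1 / (z - zc))) \<le> 4 * norm (z - q x)"
proof -
  have zz: "z \<noteq> zc" "1 / (z - zc) \<in> W" using D_W[OF z(1)] by auto
  have zq: "z \<noteq> q x" using q_in_K[of x] D_disjoint_K[OF z(1)] x a by auto
  have "norm (T x) = 1" using T(1)[of x] x a by auto
  define \<zeta> where "\<zeta> = (z - q x) / T x"
  have \<zeta>: "\<zeta> \<noteq> 0" "norm \<zeta> = norm (z - q x)" using zq \<open>norm (T x) = 1\<close> by (auto simp: \<zeta>_def norm_divide)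
  define M where "M = N x (1 / (z - zc))"
  have "M = - 1 / \<zeta> + 2 * \<i> / of_real \<rho>" unfolding M_def \<zeta>_def by (rule N_iota[OF zz(1) zq x])
  then have "M * \<zeta> = - 1 + 2 * \<i> * \<zeta> / of_real \<rho>" using \<zeta>(1) by (simp add: field_simps)
  moreover have "norm (2 * \<i> * \<zeta> / of_real \<rho>) \<le> 1/2" using z(2) \<zeta>(2) \<rho> by (simp add: norm_mult norm_divide field_simps)
  ultimately have "1/2 \<le> norm M * norm \<zeta>"
    using norm_triangle_ineq2[of "-1" "- (2 * \<i> * \<zeta> / of_real \<rho>)"] by (simp flip: norm_mult)
  moreover have M0: "M \<noteq> 0" unfolding M_def by (rule N_W(2)[OF x zz(2)])
  ultimately have "norm (- 1 / M) \<le> 2 * norm \<zeta>" by (simp add: norm_divide field_simps)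
  moreover have "norm (F (- 1 / M)) \<le> 2 * norm (- 1 / M)" unfolding M_def by (rule F2[OF N_W(3)[OF x zz(2)]])
  ultimately show ?thesis unfolding E_def M_def[symmetric] \<zeta>(2)[symmetric] by linarith
qed

text \<open>Harnack bounds 1 - |\<Psi>| by the barrier at q x, which grows at most linearly in the
  distance from q x. The constant is 16 divided by the height \<rho> / 4 at the centre.\<close>

lemma one_minus_\<Psi>_le:
  assumes x: "\<bar>x\<bar> \<le> a / 4" and z: "z \<in> D" "norm (z - q x) \<le> \<rho> / 4"
  shows "1 - norm (\<Psi> z) \<le> 64 / \<rho> * norm (z - q x)"
proof -
  let ?e = "E x \<circ> R"
  have "Im (?e 0) * (1 - norm (\<Psi> z)) / 4 \<le> Im (?e (\<Psi> z))"
    by (rule half_plane_lower[OF E_R(1,2)[OF x] \<Psi>_disc[OF z(1)]])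
  also have "?e (\<Psi> z) = E x (1 / (z - zc))" using R_\<Psi>[OF z(1)] by simp
  also have "Im \<dots> \<le> 4 * norm (z - q x)" using norm_E_iota_le[OF assms] abs_Im_le_cmod[of "E x (1 / (z - zc))"] by linarith
  finally have "Im (?e 0) * (1 - norm (\<Psi> z)) \<le> 16 * norm (z - q x)" by simp
  moreover have "\<rho> / 4 * (1 - norm (\<Psi> z)) \<le> Im (?e 0) * (1 - norm (\<Psi> z))"
    using E_R(3)[OF x] \<Psi>_disc[OF z(1)] by (intro mult_right_mono) auto
  ultimately show ?thesis using \<rho> by (simp add: field_simps)
qed

text \<open>Since |F u| \<le> |u|, the dyadic level i of F u is at least the level j of u, so c (i +
  1) \<le> c j and the slope c j / 100 of the image boundary clears the interior cusp.\<close>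

lemma interior_cusp:
  assumes x: "\<bar>x\<bar> \<le> a / 4" and u: "Im u > 0" "norm u \<le> \<rho>"
  shows "q x + T x * F u \<in> D"
proof -
  have "u \<noteq> 0" using u by auto
  then obtain j where j: "\<rho> / 2^(j+1) < norm u" "norm u \<le> \<rho> / 2^j" using level_exists[of "norm u" \<rho>] u by auto
  have "F u \<noteq> 0" using Fpos[OF u(1)] by auto
  then obtain i where i: "\<rho> / 2^(i+1) < norm (F u)" "norm (F u) \<le> \<rho> / 2^i"
    using level_exists[of "norm (F u)" \<rho>] u F1[OF u(1)] by auto
  have "\<rho> / 2^(i+1) < \<rho> / 2^j" using i(1) F1[OF u(1)] j(2) by linarith
  then have "(2::real)^j < 2^(i+1)" using \<rho> by (simp add: field_simps)
  then have "j < i + 1" by (rule power_less_imp_less_exp[rotated]) simp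
  then have "c (i+1) \<le> c j" using c(2) by (auto simp: decseq_def)
  then have "norm (F u) * (c (i+1) / 200) \<le> norm (F u) * (c j / 100)" using c(1)[of j] by (intro mult_left_mono) auto
  then have "norm (F u) * (c (i+1) / 200) \<le> Im (F u)" using Fin[OF u(1) j] by linarith
  then show ?thesis using cusp_in[OF _ i, of x] x a by (simp add: q_def)
qed

text \<open>A compact part of D containing the images of the centres of all discs to which the Hopf
  lemma is applied.\<close>

definition "B0 = {z. \<bar>Re z\<bar> \<le> a / 2 \<and> g (Re z) + \<rho> / 8 \<le> Im z \<and> Im z \<le> a}"

lemma \<Psi>_B0:
  obtains \<kappa> where "0 < \<kappa>" "\<And>z. z \<in> B0 \<Longrightarrow> z \<in> D \<and> norm (\<Psi> z) \<le> 1 - \<kappa>"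
proof -
  have BD: "z \<in> D" if "z \<in> B0" for z
    using that box'[of z] g_bound[of "Re z"] a \<rho> by (auto simp: B0_def)
  have eq: "B0 = {z\<in>{z. \<bar>Re z\<bar> \<le> a / 2}. g (Re z) + \<rho> / 8 \<le> Im z} \<inter> {z. Im z \<le> a}" by (auto simp: B0_def)
  have "closed {z\<in>{z. \<bar>Re z\<bar> \<le> a / 2}. g (Re z) + \<rho> / 8 \<le> Im z}"
    by (intro continuous_on_closed_Collect_le closed_strip continuous_intros continuous_on_subset[OF continuous_g]) (use a in auto)
  moreover have "closed {z. Im z \<le> a}" by (intro closed_Collect_le continuous_intros)
  ultimately have "closed B0" unfolding eq by (rule closed_Int)
  moreover have "norm z \<le> 2 * a" if "z \<in> B0" for z
  proof -
    have "\<bar>Im z\<bar> \<le> a" "\<bar>Re z\<bar> \<le> a" using that g_bound[of "Re z"] a \<rho> by (auto simp: B0_def)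
    then show ?thesis using cmod_le[of z] by simp
  qed
  then have "bounded B0" by (auto simp: bounded_iff)
  ultimately have comp: "compact B0" by (simp add: compact_eq_bounded_closed)
  have ne: "\<i> * of_real a \<in> B0" using a \<rho> g0 by (auto simp: B0_def)
  have "continuous_on B0 (\<lambda>z. norm (\<Psi> z))"
    using BD by (intro continuous_on_norm continuous_on_subset[OF holomorphic_on_imp_continuous_on[OF \<Psi>_holomorphic]]) auto
  then obtain z0 where z0: "z0 \<in> B0" "\<And>z. z \<in> B0 \<Longrightarrow> norm (\<Psi> z) \<le> norm (\<Psi> z0)"
    using continuous_attains_sup[OF comp] ne by blast
  show thesis using \<Psi>_disc[OF BD[OF z0(1)]] z0 BD by (intro that[of "1 - norm (\<Psi> z0)"]) auto
qed

text \<open>The Hopf lemma for \<Psi> along u \<mapsto> q x + T x * F u on the disc around i \<rho>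
  / 2 that touches the real line at 0. The value at the centre is controlled by \<kappa>, that is by
  compactness of \<open>B0\<close>, hence uniformly in x.\<close>

lemma one_minus_\<Psi>_ge:
  assumes \<kappa>: "0 < \<kappa>" "\<And>z. z \<in> B0 \<Longrightarrow> z \<in> D \<and> norm (\<Psi> z) \<le> 1 - \<kappa>"
    and x: "\<bar>x\<bar> \<le> a / 4" and \<delta>: "0 < \<delta>" "\<delta> \<le> \<rho> / 4"
  shows "\<kappa> * \<delta> / (2 * \<rho>) \<le> 1 - norm (\<Psi> (q x + T x * (\<i> * of_real \<delta>)))"
proof -
  have Tx: "norm (T x) = 1" "norm (T x - 1) \<le> 1/4" using T[of x] x a by auto
  have iS: "\<i> * of_real y \<in> {w. Im w > - \<bar>Re w\<bar>}" if "y > 0" for y :: real using that by simp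
  \<comment> \<open>F preserves the positive imaginary axis. Its height is at most \<delta> at i
    \<delta> and at least \<rho> / 4 at i \<rho> / 2, so an intermediate y satisfies F (i y) = i
    \<delta>.\<close>
  have "\<exists>y\<ge>\<delta>. y \<le> \<rho> / 2 \<and> Im (F (\<i> * of_real y)) = \<delta>"
  proof (rule IVT')
    show "Im (F (\<i> * of_real \<delta>)) \<le> \<delta>" using Fi[OF \<delta>(1)] by auto
    show "\<delta> \<le> Im (F (\<i> * of_real (\<rho> / 2)))" using Fi[of "\<rho> / 2"] \<rho> \<delta> by auto
    show "continuous_on {\<delta>..\<rho> / 2} (\<lambda>y. Im (F (\<i> * of_real y)))"
      by (intro continuous_on_Im continuous_on_compose2[OF holomorphic_on_imp_continuous_on[OF Fh]] continuous_intros)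
        (use \<delta> in auto)
  qed (use \<delta> in auto)
  then obtain y where y: "\<delta> \<le> y" "y \<le> \<rho> / 2" "Im (F (\<i> * of_real y)) = \<delta>" by blast
  have Fy: "F (\<i> * of_real y) = \<i> * of_real \<delta>" using Fi[of y] y \<delta> by auto
  define ctr where "ctr = \<i> * complex_of_real (\<rho> / 2)"
  have bl: "Im u > 0 \<and> norm u \<le> \<rho>" if "u \<in> ball ctr (\<rho> / 2)" for u
  proof -
    have n: "norm (ctr - u) < \<rho> / 2" using that by (simp add: dist_norm)
    then have "\<bar>Im (ctr - u)\<bar> < \<rho> / 2" by (rule le_less_trans[OF abs_Im_le_cmod])
    then have "Im u > 0" unfolding abs_less_iff by (simp add: ctr_def)
    moreover have "norm ctr = \<rho> / 2" using \<rho> by (simp add: ctr_def norm_mult)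
    ultimately show ?thesis using n norm_triangle_ineq4[of ctr "ctr - u"] by simp
  qed
  define h where "h u = \<Psi> (q x + T x * F u)" for u
  have hD: "q x + T x * F u \<in> D" if "u \<in> ball ctr (\<rho> / 2)" for u using interior_cusp[OF x] bl[OF that] by auto
  have "F holomorphic_on ball ctr (\<rho> / 2)" by (rule holomorphic_on_subset[OF Fh]) (use bl in force)
  then have "(\<lambda>u. q x + T x * F u) holomorphic_on ball ctr (\<rho> / 2)" by (intro holomorphic_intros)
  then have "\<Psi> \<circ> (\<lambda>u. q x + T x * F u) holomorphic_on ball ctr (\<rho> / 2)"
    by (rule holomorphic_on_compose_gen[OF _ \<Psi>_holomorphic]) (use hD in auto)
  then have hh: "h holomorphic_on ball ctr (\<rho> / 2)" by (simp add: h_def[abs_def] o_def)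
  have h1: "norm (h u) < 1" if "u \<in> ball ctr (\<rho> / 2)" for u using \<Psi>_disc[OF hD[OF that]] by (simp add: h_def)
  have uc: "\<i> * of_real y - ctr = \<i> * of_real (y - \<rho> / 2)" by (simp add: ctr_def algebra_simps)
  have nu: "norm (\<i> * of_real y - ctr) = \<rho> / 2 - y" unfolding uc norm_mult norm_of_real norm_ii using y(2) by simp
  have "\<i> * of_real y \<in> ball ctr (\<rho> / 2)" using nu y \<delta> by (simp add: dist_norm norm_minus_commute)
  from Hopf_ball[OF hh h1 this]
  have "(1 - norm (h ctr)) / 4 * (1 - (\<rho> / 2 - y) / (\<rho> / 2)) \<le> 1 - norm (h (\<i> * of_real y))" unfolding nu .
  moreover have "1 - (\<rho> / 2 - y) / (\<rho> / 2) = 2 * y / \<rho>" using \<rho> by (simp add: field_simps)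
  moreover have "\<kappa> \<le> 1 - norm (h ctr)"
  proof -
    obtain t where t: "\<rho> / 4 \<le> t" "t \<le> \<rho> / 2" "F ctr = \<i> * of_real t" using Fi[of "\<rho> / 2"] \<rho> by (auto simp: ctr_def)
    let ?z = "q x + T x * F ctr"
    define d where "d = (T x - 1) * (\<i> * of_real t)"
    have "norm d \<le> 1/4 * t" unfolding d_def norm_mult using Tx t \<rho> by (auto intro!: mult_mono)
    then have d: "\<bar>Re d\<bar> \<le> t / 4" "\<bar>Im d\<bar> \<le> t / 4" using abs_Re_le_cmod[of d] abs_Im_le_cmod[of d] by linarith+
    have zz: "?z = q x + \<i> * of_real t + d" by (simp add: t d_def algebra_simps)
    have R: "Re ?z = x + Re d" and I: "Im ?z = g x + t + Im d" unfolding zz by (simp_all add: q_def)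
    have xr: "\<bar>x + Re d\<bar> \<le> a / 2" using abs_triangle_ineq[of x "Re d"] x d t \<rho> by linarith
    have "\<bar>g (x + Re d) - g x\<bar> \<le> \<bar>x + Re d - x\<bar> / 4" by (rule gL) (use xr x a in auto)
    moreover have "\<bar>x + Re d - x\<bar> = \<bar>Re d\<bar>" by simp
    ultimately have gd: "g (x + Re d) \<le> g x + t / 16" using d unfolding abs_le_iff by argo
    have gx: "g x \<le> a / 16" using g_bound[of x] x a by linarith
    have "g (x + Re d) + \<rho> / 8 \<le> g x + t + Im d" "g x + t + Im d \<le> a" using gd gx d t \<rho> by linarith+
    then have "?z \<in> B0" unfolding B0_def mem_Collect_eq R I using xr by blast
    from \<kappa>(2)[OF this] show ?thesis by (simp add: h_def)
  qed
  then have "\<kappa> / 4 * (2 * y / \<rho>) \<le> (1 - norm (h ctr)) / 4 * (2 * y / \<rho>)" using y \<delta> \<rho> by (intro mult_right_mono) auto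
  moreover have "\<kappa> / 4 * (2 * \<delta> / \<rho>) \<le> \<kappa> / 4 * (2 * y / \<rho>)" using y \<kappa> \<rho> by (intro mult_left_mono divide_right_mono) auto
  moreover have "\<kappa> / 4 * (2 * \<delta> / \<rho>) = \<kappa> * \<delta> / (2 * \<rho>)" by simp
  moreover have "h (\<i> * of_real y) = \<Psi> (q x + T x * (\<i> * of_real \<delta>))" by (simp add: h_def Fy)
  ultimately show ?thesis by (metis order_trans)
qed

text \<open>A nearest point of the complement lies on the graph, since otherwise a short step from
  it towards z would stay outside D. If z were not on the normal there, the exterior cusp, whose
  slope tends to 0, would contain points closer to z.\<close>

lemma nearest_boundary_point:
  assumes z: "z \<in> D" "norm z \<le> \<rho> / 16"
  defines "\<delta> \<equiv> boundary_dist D z"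
  obtains x where "\<bar>x\<bar> \<le> a / 4" "z = q x + T x * (\<i> * of_real \<delta>)" "0 < \<delta>" "\<delta> \<le> norm z" "ball z \<delta> \<subseteq> D"
proof -
  have z0: "0 \<notin> D" using box'[of 0] g0 a by simp
  have cl: "closed (- D)" using D by auto
  have ne: "- D \<noteq> {}" using z0 by auto
  have d1: "\<delta> \<le> norm z" using infdist_le[of 0 "- D" z] z0 by (simp add: \<delta>_def boundary_dist_def dist_norm)
  obtain p where p: "p \<in> - D" "\<delta> = dist z p"
    using infdist_attains_inf[OF cl ne, of z] by (auto simp: \<delta>_def boundary_dist_def)
  have d0: "0 < \<delta>" using p z by auto
  have bl: "ball z \<delta> \<subseteq> D"
  proof
    fix u assume u: "u \<in> ball z \<delta>"
    show "u \<in> D"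
    proof (rule ccontr)
      assume "u \<notin> D"
      then have "\<delta> \<le> dist z u" using infdist_le[of u "- D" z] by (simp add: \<delta>_def boundary_dist_def)
      then show False using u by simp
    qed
  qed
  have np: "norm p \<le> \<rho> / 8"
  proof -
    have "norm p \<le> norm z + dist z p" by (metis dist_norm norm_triangle_sub norm_minus_commute)
    then show ?thesis using p d1 z by linarith
  qed
  then have pb: "\<bar>Re p\<bar> \<le> \<rho> / 8" "\<bar>Im p\<bar> \<le> \<rho> / 8" using abs_Re_le_cmod[of p] abs_Im_le_cmod[of p] by linarith+
  define x where "x = Re p"
  have x: "\<bar>x\<bar> \<le> a / 4" "\<bar>x\<bar> \<le> a / 2" "\<bar>x\<bar> \<le> a" using pb \<rho> a by (auto simp: x_def)
  have ple: "Im p \<le> g x" using box'[of p] p pb x \<rho> a by (auto simp: x_def)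
  have pq: "p = q x"
  proof (rule ccontr)
    assume "p \<noteq> q x"
    then have lt: "Im p < g x" using ple by (auto simp: q_def x_def complex_eq_iff)
    define P where "P s = p + of_real s * (z - p)" for s :: real
    have bx: "\<bar>Re (P s)\<bar> \<le> a" "\<bar>Im (P s)\<bar> \<le> a" if "0 \<le> s" "s \<le> 1" for s
    proof -
      have "norm (of_real s * (z - p)) \<le> 1 * norm (z - p)" unfolding norm_mult using that by (intro mult_right_mono) auto
      then have "norm (P s) \<le> \<rho>" using norm_triangle_ineq[of p "of_real s * (z - p)"] np d1 z p \<rho> by (simp add: P_def dist_norm)
      then show "\<bar>Re (P s)\<bar> \<le> a" "\<bar>Im (P s)\<bar> \<le> a" using abs_Re_le_cmod[of "P s"] abs_Im_le_cmod[of "P s"] \<rho> by linarith+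
    qed
    define e where "e = g x - Im p"
    define s where "s = min 1 (e / (4 * (\<delta> + 1)))"
    have s: "0 < s" "s \<le> 1" using lt d0 by (auto simp: s_def e_def)
    have "s * \<delta> \<le> e / (4 * (\<delta> + 1)) * (\<delta> + 1)" using s d0 lt by (intro mult_mono) (auto simp: s_def e_def)
    moreover have "e / (4 * (\<delta> + 1)) * (\<delta> + 1) = e / 4" using d0 by (simp add: field_simps)
    ultimately have sd: "s * \<delta> \<le> e / 4" by (simp only:)
    have n: "norm (of_real s * (z - p)) \<le> e / 4" using sd s p by (simp add: norm_mult dist_norm)
    have "\<bar>Re (of_real s * (z - p))\<bar> \<le> e / 4" "\<bar>Im (of_real s * (z - p))\<bar> \<le> e / 4"
      using n abs_Re_le_cmod abs_Im_le_cmod order_trans by blast+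
    then have RP: "\<bar>Re (P s) - x\<bar> \<le> e / 4" "\<bar>Im (P s) - Im p\<bar> \<le> e / 4" by (simp_all add: P_def x_def)
    have "\<bar>g (Re (P s)) - g x\<bar> \<le> \<bar>Re (P s) - x\<bar> / 4" by (rule gL) (use bx[of s] s x in auto)
    then have "g (Re (P s)) \<ge> g x - e / 16" using RP unfolding abs_le_iff by argo
    then have "Im (P s) \<le> g (Re (P s))" using RP lt unfolding e_def abs_le_iff by argo
    then have "P s \<notin> D" using box'[of "P s"] bx[of s] s by auto
    then have "\<delta> \<le> dist z (P s)" using infdist_le[of "P s" "- D" z] by (simp add: \<delta>_def boundary_dist_def)
    moreover have "z - P s = of_real (1 - s) * (z - p)" by (simp add: P_def algebra_simps)
    then have "dist z (P s) = (1 - s) * \<delta>" using s p by (simp add: dist_norm norm_mult del: of_real_diff)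
    ultimately show False using mult_pos_pos[OF s(1) d0] by (simp add: algebra_simps)
  qed
  have Tn: "norm (T x) = 1" "T x \<noteq> 0" using T(1)[OF x(2)] by auto
  define \<zeta> where "\<zeta> = (z - q x) / T x"
  have z\<zeta>: "z = q x + T x * \<zeta>" using Tn by (simp add: \<zeta>_def)
  have n\<zeta>: "norm \<zeta> = \<delta>" using Tn p pq by (simp add: \<zeta>_def norm_divide dist_norm)
  have "\<zeta> = \<i> * of_real \<delta>"
  proof (rule ccontr)
    assume ne: "\<zeta> \<noteq> \<i> * of_real \<delta>"
    \<comment> \<open>The vector v points into the lower half-plane and has positive inner product
      \<delta> * k with \<zeta>, so a short step along v approaches \<zeta> while staying in the
      exterior cusp.\<close>
    define v where "v = \<zeta> - \<i> * of_real \<delta>"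
    have v0: "norm v > 0" using ne by (simp add: v_def)
    have "Im \<zeta> \<le> \<delta>" using abs_Im_le_cmod[of \<zeta>] n\<zeta> by simp
    have sq: "(Re \<zeta>)^2 + (Im \<zeta>)^2 = \<delta>^2" using n\<zeta> by (metis cmod_power2)
    have "Im \<zeta> \<noteq> \<delta>"
    proof
      assume "Im \<zeta> = \<delta>"
      then have "Re \<zeta> = 0" using sq by simp
      then show False using ne \<open>Im \<zeta> = \<delta>\<close> by (simp add: complex_eq_iff)
    qed
    then have k: "Im \<zeta> < \<delta>" using \<open>Im \<zeta> \<le> \<delta>\<close> by simp
    define k where "k = \<delta> - Im \<zeta>"
    have k0: "k > 0" "Im v = - k" using k by (auto simp: k_def v_def)
    have inner: "Re v * Re \<zeta> + Im v * Im \<zeta> = \<delta> * k"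
      using sq by (simp add: v_def k_def power2_eq_square algebra_simps)
    have "c \<longlonglongrightarrow> 0" by (rule summable_LIMSEQ_zero[OF c(3)])
    then have "(\<lambda>j. c (j + 1)) \<longlonglongrightarrow> 0" by (rule LIMSEQ_ignore_initial_segment)
    then have ev1: "\<forall>\<^sub>F j in sequentially. c (j + 1) < 200 * k / norm v"
      using k0 v0 by (intro order_tendstoD) auto
    have "(\<lambda>j. \<rho> / 2^j) \<longlonglongrightarrow> 0"
      using LIMSEQ_divide_realpow_zero[of 2 \<rho>] by simp
    then have ev2: "\<forall>\<^sub>F j in sequentially. \<rho> / 2^j < 2 * \<delta> * k / norm v"
      using k0 v0 d0 by (intro order_tendstoD) auto
    obtain j where j: "c (j + 1) < 200 * k / norm v" "\<rho> / 2^j < 2 * \<delta> * k / norm v"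
      using eventually_happens[OF eventually_conj[OF ev1 ev2]] by auto
    define s where "s = \<rho> / 2^j / norm v"
    have s0: "s > 0" using \<rho> v0 by (simp add: s_def)
    define u where "u = of_real s * v"
    have nu: "norm u = \<rho> / 2^j"
    proof -
      have "norm u = s * norm v" using s0 by (simp add: u_def norm_mult)
      then show ?thesis using v0 by (simp add: s_def)
    qed
    have "norm v * (c (j+1) / 200) \<le> k" using j(1) v0 by (simp add: field_simps)
    then have "s * (norm v * (c (j+1) / 200)) \<le> s * k" using s0 by (intro mult_left_mono) auto
    moreover have "norm u = s * norm v" using s0 by (simp add: u_def norm_mult)
    moreover have "Im u = - (s * k)" using k0 by (simp add: u_def)
    ultimately have "Im u \<le> - norm u * (c (j+1) / 200)" by (simp add: mult.assoc)
    moreover have "\<rho> / 2^(j+1) < norm u" unfolding nu using \<rho> by (intro divide_strict_left_mono) auto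
    ultimately have "q x + T x * u \<notin> D" using cusp_out[OF x(2), of j u] nu by (simp add: q_def)
    then have "\<delta> \<le> dist z (q x + T x * u)" using infdist_le[of "q x + T x * u" "- D" z] by (simp add: \<delta>_def boundary_dist_def)
    also have "dist z (q x + T x * u) = norm (T x * (\<zeta> - u))" by (subst z\<zeta>) (simp add: dist_norm algebra_simps)
    also have "\<dots> = norm (\<zeta> - u)" using Tn by (simp add: norm_mult)
    finally have "\<delta>^2 \<le> norm (\<zeta> - u)^2" using d0 by (intro power_mono) auto
    also have "norm (\<zeta> - u)^2 = \<delta>^2 - 2 * s * (\<delta> * k) + s^2 * norm v^2"
      unfolding inner[symmetric] sq[symmetric] cmod_power2[of v] unfolding cmod_power2 u_def by (simp add: power2_eq_square algebra_simps)
    finally have "s * (2 * (\<delta> * k)) \<le> s * (s * norm v^2)" by (simp add: power2_eq_square algebra_simps)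
    then have "2 * (\<delta> * k) \<le> s * norm v^2" using s0 by simp
    also have "\<dots> = \<rho> / 2^j * norm v" using v0 by (simp add: s_def power2_eq_square)
    also have "\<dots> < 2 * \<delta> * k / norm v * norm v" using j(2) v0 by (intro mult_strict_right_mono) auto
    finally show False using v0 by simp
  qed
  then show thesis using that[OF x(1) _ d0 d1 bl] z\<zeta> by simp
qed

text \<open>The upper bound on \<Psi>' is Schwarz-Pick on the ball of radius \<delta> about z, where
  1 - |\<Psi> z| = O(\<delta>). For the lower bound the barrier at the foot point is factored as E x
  o R after \<Psi>. Its derivative at z is at least 1/32, while that of E x o R at \<Psi> z is at
  most 16 \<rho> / \<kappa>, since 1 - |\<Psi> z| is at least of order \<delta>.\<close>

lemma \<Psi>_bounds:
  assumes \<kappa>: "0 < \<kappa>" "\<And>z. z \<in> B0 \<Longrightarrow> z \<in> D \<and> norm (\<Psi> z) \<le> 1 - \<kappa>"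
    and z: "z \<in> D" "norm z \<le> \<rho> / 16"
  shows "1 - norm (\<Psi> z) \<le> 64 / \<rho> * boundary_dist D z"
    and "norm (deriv \<Psi> z) \<le> 128 / \<rho>"
    and "\<kappa> / (512 * \<rho>) \<le> norm (deriv \<Psi> z)"
proof -
  define \<delta> where "\<delta> = boundary_dist D z"
  obtain x where x: "\<bar>x\<bar> \<le> a / 4" and zx: "z = q x + T x * (\<i> * of_real \<delta>)" and \<delta>: "0 < \<delta>" "\<delta> \<le> norm z" and bl: "ball z \<delta> \<subseteq> D"
    using nearest_boundary_point[OF z, folded \<delta>_def] by blast
  have Tn: "norm (T x) = 1" "T x \<noteq> 0" using T(1)[of x] x a by auto
  have nz: "norm (z - q x) = \<delta>" using Tn \<delta> by (simp add: zx norm_mult)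
  have d4: "\<delta> \<le> \<rho> / 4" using \<delta> z \<rho> by simp
  show up: "1 - norm (\<Psi> z) \<le> 64 / \<rho> * boundary_dist D z"
    using one_minus_\<Psi>_le[OF x z(1)] nz d4 by (simp add: \<delta>_def)
  have "norm (deriv \<Psi> z) \<le> 2 * (1 - norm (\<Psi> z)) / \<delta>"
    by (rule norm_deriv_ball_le[OF holomorphic_on_subset[OF \<Psi>_holomorphic bl] _ \<delta>(1)]) (use \<Psi>_disc bl in auto)
  also have "\<dots> \<le> 2 * (64 / \<rho> * \<delta>) / \<delta>" using up \<delta> by (intro divide_right_mono mult_left_mono) (auto simp: \<delta>_def)
  also have "\<dots> = 128 / \<rho>" using \<delta> by simp
  finally show "norm (deriv \<Psi> z) \<le> 128 / \<rho>" .
  let ?e = "E x \<circ> R"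
  let ?\<xi> = "\<Psi> z"
  have lo: "\<kappa> * \<delta> / (2 * \<rho>) \<le> 1 - norm ?\<xi>" using one_minus_\<Psi>_ge[OF \<kappa> x \<delta>(1) d4] zx by simp
  have lo0: "0 < \<kappa> * \<delta> / (2 * \<rho>)" using \<kappa> \<delta> \<rho> by simp
  have sub: "ball ?\<xi> (1 - norm ?\<xi>) \<subseteq> ball 0 1"
  proof
    fix u assume "u \<in> ball ?\<xi> (1 - norm ?\<xi>)"
    then show "u \<in> ball 0 1" using norm_triangle_ineq4[of ?\<xi> "?\<xi> - u"] by (simp add: dist_norm)
  qed
  have "norm (deriv ?e ?\<xi>) \<le> 2 * Im (?e ?\<xi>) / (1 - norm ?\<xi>)"
    by (rule half_plane_deriv[OF holomorphic_on_subset[OF E_R(1)[OF x] sub]]) (use E_R(2)[OF x] sub lo lo0 in auto)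
  also have "\<dots> \<le> 2 * (4 * \<delta>) / (\<kappa> * \<delta> / (2 * \<rho>))"
  proof (intro frac_le mult_left_mono)
    have "Im (?e ?\<xi>) \<le> norm (E x (1 / (z - zc)))" using R_\<Psi>[OF z(1)] abs_Im_le_cmod[of "E x (1 / (z - zc))"] by simp
    then show "Im (?e ?\<xi>) \<le> 4 * \<delta>" using norm_E_iota_le[OF x z(1)] nz d4 by simp
  qed (use lo lo0 \<delta> in auto)
  also have "\<dots> = 16 * \<rho> / \<kappa>" using \<delta> \<kappa> \<rho> by (simp add: field_simps)
  finally have eup: "norm (deriv ?e ?\<xi>) \<le> 16 * \<rho> / \<kappa>" .
  have dz: "deriv (\<lambda>u. E x (1 / (u - zc))) z = deriv ?e ?\<xi> * deriv \<Psi> z"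
  proof -
    have "(?e has_field_derivative deriv ?e ?\<xi>) (at ?\<xi>)"
      using holomorphic_derivI[OF E_R(1)[OF x] open_ball, of ?\<xi>] \<Psi>_disc[OF z(1)] by simp
    moreover have "(\<Psi> has_field_derivative deriv \<Psi> z) (at z)" using holomorphic_derivI[OF \<Psi>_holomorphic D z(1)] .
    ultimately have "((\<lambda>u. ?e (\<Psi> u)) has_field_derivative deriv ?e ?\<xi> * deriv \<Psi> z) (at z)" by (rule DERIV_chain2)
    from this D z(1) have "((\<lambda>u. E x (1 / (u - zc))) has_field_derivative deriv ?e ?\<xi> * deriv \<Psi> z) (at z)"
      by (rule has_field_derivative_transform_within_open) (simp add: R_\<Psi>)
    then show ?thesis by (rule DERIV_imp_deriv)
  qed
  \<comment> \<open>The Moebius map sends z to a point i y, where |F'| \<ge> 1/8. Its own derivative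
    is at least 1/4 in modulus because \<delta> \<le> \<rho> / 4 gives \<delta> (1 / \<delta> + 2 /
    \<rho>) \<le> 2.\<close>
  have "1/32 \<le> norm (deriv (\<lambda>u. E x (1 / (u - zc))) z)"
  proof -
    define M where "M u = - 1 / ((u - q x) / T x) + 2 * \<i> / of_real \<rho>" for u
    have zq: "z - q x \<noteq> 0" using nz \<delta> by auto
    define y where "y = 1 / (1 / \<delta> + 2 / \<rho>)"
    have y0: "y > 0" using \<delta> \<rho> by (simp add: y_def add_pos_pos)
    have "(z - q x) / T x = \<i> * of_real \<delta>" using zx Tn by simp
    then have Mz: "M z = \<i> * of_real (1 / \<delta> + 2 / \<rho>)" unfolding M_def using \<delta> \<rho> by (simp add: field_simps)
    have wz: "- 1 / M z = \<i> * of_real y"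
    proof -
      have "- 1 / (\<i> * complex_of_real Y) = \<i> * of_real (1 / Y)" if "Y \<noteq> 0" for Y
        using that by (subst divide_eq_eq) simp
      moreover have "1 / \<delta> + 2 / \<rho> \<noteq> 0" using y0 unfolding y_def by auto
      ultimately show ?thesis unfolding Mz y_def by blast
    qed
    have M0: "M z \<noteq> 0" using wz y0 by auto
    have "(M has_field_derivative T x / (z - q x)^2) (at z)"
      unfolding M_def using zq Tn by (auto intro!: derivative_eq_intros simp: power2_eq_square field_simps)
    then have dM: "((\<lambda>u. - 1 / M u) has_field_derivative (T x / (z - q x)^2) / (M z)^2) (at z)"
      using M0 by (auto intro!: derivative_eq_intros simp: power2_eq_square)
    have oS: "open {w. Im w > - \<bar>Re w\<bar>}" by (intro open_Collect_less continuous_intros)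
    have dF: "(F has_field_derivative deriv F (- 1 / M z)) (at (- 1 / M z))"
      using holomorphic_derivI[OF Fh oS, of "- 1 / M z"] y0 unfolding wz by simp
    have "((\<lambda>u. F (- 1 / M u)) has_field_derivative deriv F (- 1 / M z) * ((T x / (z - q x)^2) / (M z)^2)) (at z)"
      by (rule DERIV_chain2[OF dF dM])
    from this D z(1) have "((\<lambda>u. E x (1 / (u - zc))) has_field_derivative deriv F (- 1 / M z) * ((T x / (z - q x)^2) / (M z)^2)) (at z)"
    proof (rule has_field_derivative_transform_within_open)
      fix u assume u: "u \<in> D"
      have "u \<noteq> q x" using q_in_K[of x] D_disjoint_K[OF u] x a by auto
      then show "F (- 1 / M u) = E x (1 / (u - zc))" using N_iota[of u x] D_W[OF u] x by (simp add: E_def M_def)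
    qed
    then have dd: "deriv (\<lambda>u. E x (1 / (u - zc))) z = deriv F (\<i> * of_real y) * ((T x / (z - q x)^2) / (M z)^2)"
      unfolding wz by (rule DERIV_imp_deriv)
    have "norm (M z) = 1 / \<delta> + 2 / \<rho>" unfolding Mz using \<delta> \<rho> by (simp only: norm_mult norm_of_real) simp
    then have "norm ((T x / (z - q x)^2) / (M z)^2) = 1 / (\<delta> * (1 / \<delta> + 2 / \<rho>))^2"
      by (simp only: norm_divide norm_mult norm_power power_mult_distrib Tn(1) nz divide_divide_eq_left)
    moreover have "(\<delta> * (1 / \<delta> + 2 / \<rho>))^2 \<le> 2^2"
    proof (rule power_mono)
      have "\<delta> * (1 / \<delta> + 2 / \<rho>) = 1 + 2 * \<delta> / \<rho>" using \<delta> by (simp add: field_simps)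
      also have "\<dots> \<le> 2" using d4 \<rho> by (simp add: field_simps)
      finally show "\<delta> * (1 / \<delta> + 2 / \<rho>) \<le> 2" .
    qed (use \<delta> \<rho> in auto)
    then have "1 / 2^2 \<le> 1 / (\<delta> * (1 / \<delta> + 2 / \<rho>))^2"
    proof (intro divide_left_mono mult_pos_pos)
      have "0 < \<delta> * (1 / \<delta> + 2 / \<rho>)" using \<delta> \<rho> by (intro mult_pos_pos add_pos_pos) auto
      then show "0 < (\<delta> * (1 / \<delta> + 2 / \<rho>))^2" by (rule zero_less_power)
    qed auto
    ultimately have "1/8 * (1/4) \<le> norm (deriv F (\<i> * of_real y)) * norm ((T x / (z - q x)^2) / (M z)^2)"
      using Fd[OF y0] by (intro mult_mono) auto
    then show ?thesis unfolding dd norm_mult by simp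
  qed
  then have "1/32 \<le> norm (deriv ?e ?\<xi>) * norm (deriv \<Psi> z)" unfolding dz norm_mult .
  also have "\<dots> \<le> 16 * \<rho> / \<kappa> * norm (deriv \<Psi> z)" using eup by (intro mult_right_mono) auto
  finally show "\<kappa> / (512 * \<rho>) \<le> norm (deriv \<Psi> z)" using \<kappa> \<rho> by (simp add: field_simps)
qed

end

text \<open>Collects the hypotheses on \<Psi> and g in \<open>localization_from_chart\<close>, so
  that a chart constructed in normalised position can be carried to the given boundary point as one
  object.\<close>

definition boundary_chart :: "complex set \<Rightarrow> complex set \<Rightarrow> (complex \<Rightarrow> complex) \<Rightarrow> (complex \<Rightarrow> complex) \<Rightarrow> real \<Rightarrow> real \<Rightarrow> bool" where
  "boundary_chart D U \<Psi> g r L \<longleftrightarrow> open U \<and> r > 0 \<and> L > 0 \<and>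
     \<Psi> holomorphic_on D \<and> (\<forall>z\<in>D. Im (\<Psi> z) > 0) \<and>
     g holomorphic_on {x. Im x > 0} \<inter> ball 0 r \<and>
     (\<forall>x. Im x > 0 \<longrightarrow> norm x < r \<longrightarrow> g x \<in> D \<and> \<Psi> (g x) = x) \<and>
     (\<forall>z\<in>D \<inter> U. norm (\<Psi> z) < r / 2 \<and> g (\<Psi> z) = z \<and> Im (\<Psi> z) \<le> L * boundary_dist D z) \<and>
     (\<forall>x y. Im x > 0 \<longrightarrow> norm x < r \<longrightarrow> Im y > 0 \<longrightarrow> norm y < r \<longrightarrow> dist (g x) (g y) \<le> L * dist x y) \<and>
     (\<forall>z\<in>D \<inter> U. \<forall>w\<in>D \<inter> U. dist (\<Psi> z) (\<Psi> w) \<le> L * dist z w)"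

lemma cayley_disc:
  fixes \<tau> \<xi> :: complex
  assumes "norm \<tau> = 1" "norm \<xi> < 1"
  shows "\<tau> + \<xi> \<noteq> 0" "Im (\<i> * (\<tau> - \<xi>) / (\<tau> + \<xi>)) = (1 - norm \<xi> ^ 2) / norm (\<tau> + \<xi>)^2"
proof -
  show ne: "\<tau> + \<xi> \<noteq> 0" using assms by (metis add_eq_0_iff less_irrefl norm_minus_cancel)
  have t1: "(Re \<tau>)^2 + (Im \<tau>)^2 = 1" using assms(1) by (metis cmod_power2 one_power2)
  have "Im (\<i> * (\<tau> - \<xi>) / (\<tau> + \<xi>)) = (((Re \<tau>)^2 + (Im \<tau>)^2) - ((Re \<xi>)^2 + (Im \<xi>)^2)) / norm (\<tau> + \<xi>)^2"
    unfolding Im_divide cmod_power2 by (simp add: power2_eq_square algebra_simps)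
  then show "Im (\<i> * (\<tau> - \<xi>) / (\<tau> + \<xi>)) = (1 - norm \<xi> ^ 2) / norm (\<tau> + \<xi>)^2" unfolding t1 cmod_power2 .
qed

context uniformized_graph
begin

section \<open>Lipschitz bound and boundary value of the Riemann map\<close>

lemma \<Psi>_segment_lipschitz:
  assumes \<kappa>: "0 < \<kappa>" "\<And>z. z \<in> B0 \<Longrightarrow> z \<in> D \<and> norm (\<Psi> z) \<le> 1 - \<kappa>"
    and seg: "\<And>u. u \<in> closed_segment z w \<Longrightarrow> u \<in> D \<and> norm u \<le> \<rho> / 16"
  shows "norm (\<Psi> z - \<Psi> w) \<le> 128 / \<rho> * norm (z - w)"
proof (rule field_differentiable_bound[of "closed_segment z w" \<Psi> "deriv \<Psi>"])
  show "(\<Psi> has_field_derivative deriv \<Psi> u) (at u within closed_segment z w)" if "u \<in> closed_segment z w" for u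
    using holomorphic_derivI[OF \<Psi>_holomorphic D] seg[OF that] by (blast intro: has_field_derivative_at_within)
  show "norm (deriv \<Psi> u) \<le> 128 / \<rho>" if "u \<in> closed_segment z w" for u
    using \<Psi>_bounds(2)[OF \<kappa>] seg[OF that] by blast
qed auto

text \<open>D need not be convex near 0, so both points are first raised by h = |z - w|. The segment
  between the raised points clears the graph because its slope is at most 1/4. Three segments of
  length h give 3 * 128 = 384.\<close>

lemma \<Psi>_lipschitz:
  assumes \<kappa>: "0 < \<kappa>" "\<And>z. z \<in> B0 \<Longrightarrow> z \<in> D \<and> norm (\<Psi> z) \<le> 1 - \<kappa>"
    and z: "z \<in> D" "norm z \<le> \<rho> / 128" and w: "w \<in> D" "norm w \<le> \<rho> / 128"
  shows "norm (\<Psi> z - \<Psi> w) \<le> 384 / \<rho> * norm (z - w)"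
proof (cases "z = w")
  case False
  define h where "h = norm (z - w)"
  have h: "h > 0" "h \<le> \<rho> / 64" using False norm_triangle_ineq4[of z w] z w by (auto simp: h_def)
  have inD: "u \<in> D" if "norm u \<le> \<rho> / 16" "g (Re u) < Im u" for u
  proof -
    have "\<bar>Re u\<bar> \<le> a" "\<bar>Im u\<bar> \<le> a" using abs_Re_le_cmod[of u] abs_Im_le_cmod[of u] that \<rho> a by linarith+
    then show ?thesis using box' that by blast
  qed
  have gz: "g (Re v) < Im v" "\<bar>Re v\<bar> \<le> a" if "v \<in> D" "norm v \<le> \<rho> / 128" for v
  proof -
    have "\<bar>Re v\<bar> \<le> a" "\<bar>Im v\<bar> \<le> a" using abs_Re_le_cmod[of v] abs_Im_le_cmod[of v] that \<rho> a by linarith+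
    then show "g (Re v) < Im v" "\<bar>Re v\<bar> \<le> a" using box' that by blast+
  qed
  have vert: "norm (\<Psi> v - \<Psi> (v + \<i> * of_real h)) \<le> 128 / \<rho> * h" if v: "v \<in> D" "norm v \<le> \<rho> / 128" for v
  proof -
    have "norm (\<Psi> v - \<Psi> (v + \<i> * of_real h)) \<le> 128 / \<rho> * norm (v - (v + \<i> * of_real h))"
    proof (rule \<Psi>_segment_lipschitz[OF \<kappa>])
      fix u assume "u \<in> closed_segment v (v + \<i> * of_real h)"
      then obtain t where t: "0 \<le> t" "t \<le> 1" "u = v + of_real t * (\<i> * of_real h)"
        by (auto simp: closed_segment_def scaleR_conv_of_real algebra_simps)
      have th: "0 \<le> t * h" "t * h \<le> h" using t h mult_right_mono[of t 1 h] by auto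
      have "norm (of_real t * (\<i> * of_real h)) = t * h" using t h by (simp add: norm_mult)
      then have "norm u \<le> \<rho> / 16" unfolding t(3) using norm_triangle_ineq[of v "of_real t * (\<i> * of_real h)"] v(2) th h \<rho> by linarith
      moreover have "g (Re u) < Im u" unfolding t(3) using gz(1)[OF v] th by simp
      ultimately show "u \<in> D \<and> norm u \<le> \<rho> / 16" using inD by blast
    qed
    then show ?thesis using h by (simp add: norm_mult)
  qed
  have "norm (\<Psi> (z + \<i> * of_real h) - \<Psi> (w + \<i> * of_real h)) \<le> 128 / \<rho> * norm ((z + \<i> * of_real h) - (w + \<i> * of_real h))"
  proof (rule \<Psi>_segment_lipschitz[OF \<kappa>])
    fix u assume "u \<in> closed_segment (z + \<i> * of_real h) (w + \<i> * of_real h)"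
    then obtain t where t: "0 \<le> t" "t \<le> 1" "u = z + of_real t * (w - z) + \<i> * of_real h"
      by (auto simp: closed_segment_def scaleR_conv_of_real algebra_simps)
    have n1: "norm (of_real t * (w - z)) \<le> h"
      using t h mult_right_mono[of t 1 h] by (simp add: norm_mult h_def norm_minus_commute)
    have n2: "norm (\<i> * of_real h) = h" using h by (simp add: norm_mult)
    have un: "norm u \<le> \<rho> / 16" unfolding t(3)
      using norm_triangle_ineq[of "z + of_real t * (w - z)" "\<i> * of_real h"] norm_triangle_ineq[of z "of_real t * (w - z)"] n1 n2 z(2) h \<rho> by linarith
    then have ua: "\<bar>Re u\<bar> \<le> a" using abs_Re_le_cmod[of u] \<rho> a by linarith
    have Ru: "Re u = (1 - t) * Re z + t * Re w" "Im u = (1 - t) * Im z + t * Im w + h" unfolding t(3) by (simp_all add: algebra_simps)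
    have d: "\<bar>Re z - Re w\<bar> \<le> h" using abs_Re_le_cmod[of "z - w"] by (simp add: h_def)
    have "Re u - Re z = t * (Re w - Re z)" "Re u - Re w = (1 - t) * (Re z - Re w)" unfolding Ru by (simp_all add: algebra_simps)
    then have "\<bar>Re u - Re z\<bar> = t * \<bar>Re z - Re w\<bar>" "\<bar>Re u - Re w\<bar> = (1 - t) * \<bar>Re z - Re w\<bar>" using t by (simp_all add: abs_mult abs_minus_commute)
    then have dd: "\<bar>Re u - Re z\<bar> \<le> h" "\<bar>Re u - Re w\<bar> \<le> h"
      using d t mult_mono[of t 1 "\<bar>Re z - Re w\<bar>" h] mult_mono[of "1 - t" 1 "\<bar>Re z - Re w\<bar>" h] h by simp_all
    have "g (Re u) \<le> g (Re z) + h / 4" using gL[OF ua gz(2)[OF z]] dd(1) unfolding abs_le_iff by argo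
    moreover have "g (Re u) \<le> g (Re w) + h / 4" using gL[OF ua gz(2)[OF w]] dd(2) unfolding abs_le_iff by argo
    ultimately have "g (Re u) - h / 4 \<le> Im z" "g (Re u) - h / 4 \<le> Im w" using gz(1)[OF z] gz(1)[OF w] by linarith+
    then have "(1 - t) * (g (Re u) - h / 4) \<le> (1 - t) * Im z" "t * (g (Re u) - h / 4) \<le> t * Im w" using t by (auto intro: mult_left_mono)
    then have "(1 - t) * (g (Re u) - h / 4) + t * (g (Re u) - h / 4) \<le> (1 - t) * Im z + t * Im w" by (rule add_mono)
    moreover have "(1 - t) * X + t * X = X" for X by (simp add: algebra_simps)
    ultimately have "g (Re u) - h / 4 \<le> (1 - t) * Im z + t * Im w" by simp
    then have "g (Re u) < Im u" unfolding Ru using h by linarith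
    then show "u \<in> D \<and> norm u \<le> \<rho> / 16" using inD un by blast
  qed
  then have hor: "norm (\<Psi> (z + \<i> * of_real h) - \<Psi> (w + \<i> * of_real h)) \<le> 128 / \<rho> * h" by (simp add: h_def)
  let ?z = "\<Psi> (z + \<i> * of_real h)" and ?w = "\<Psi> (w + \<i> * of_real h)"
  have "\<Psi> z - \<Psi> w = (\<Psi> z - ?z) + (?z - ?w) - (\<Psi> w - ?w)" by simp
  then have "norm (\<Psi> z - \<Psi> w) \<le> norm (\<Psi> z - ?z) + norm (?z - ?w) + norm (\<Psi> w - ?w)"
    by (smt (verit) norm_triangle_ineq norm_triangle_ineq4)
  then have "norm (\<Psi> z - \<Psi> w) \<le> 3 * (128 / \<rho> * h)" using vert[OF z] vert[OF w] hor by linarith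
  then show ?thesis by (simp add: h_def)
qed simp

text \<open>The Lipschitz bound makes \<Psi> Cauchy along a sequence descending the imaginary axis
  to 0, and 1 - |\<Psi>| = O(boundary distance) makes the limit unimodular.\<close>

lemma \<Psi>_limit:
  assumes \<kappa>: "0 < \<kappa>" "\<And>z. z \<in> B0 \<Longrightarrow> z \<in> D \<and> norm (\<Psi> z) \<le> 1 - \<kappa>"
  obtains \<tau> where "norm \<tau> = 1" "\<And>z. z \<in> D \<Longrightarrow> norm z \<le> \<rho> / 128 \<Longrightarrow> norm (\<Psi> z - \<tau>) \<le> 384 / \<rho> * norm z"
    "\<And>\<epsilon>. \<epsilon> > 0 \<Longrightarrow> \<exists>z\<in>D. norm z \<le> \<rho> / 128 \<and> norm (\<Psi> z - \<tau>) < \<epsilon>"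
proof -
  define zs where "zs n = \<i> * complex_of_real (\<rho> / 128 / real (Suc n))" for n
  have nzs: "norm (zs n) = \<rho> / 128 / real (Suc n)" for n
    unfolding zs_def norm_mult norm_of_real norm_ii using \<rho> by simp
  have le: "norm (zs n) \<le> \<rho> / 128" for n
    unfolding nzs using \<rho> by (simp add: field_simps)
  have "Im (zs n) > 0" "Re (zs n) = 0" for n using \<rho> by (simp_all add: zs_def)
  moreover have "\<bar>Im (zs n)\<bar> \<le> a" for n using abs_Im_le_cmod[of "zs n"] le[of n] \<rho> a by linarith
  ultimately have zsD: "zs n \<in> D" for n using box'[of "zs n"] g0 a by simp
  have "(\<lambda>n. \<rho> / 128 / real (Suc n)) \<longlonglongrightarrow> 0"
    using LIMSEQ_inverse_real_of_nat[THEN tendsto_mult_left, of "\<rho> / 128"] by (simp add: field_simps)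
  then have nz0: "(\<lambda>n. norm (zs n)) \<longlonglongrightarrow> 0" unfolding nzs .
  then have zs0: "zs \<longlonglongrightarrow> 0" by (rule tendsto_norm_zero_cancel)
  have "Cauchy (\<lambda>n. \<Psi> (zs n))"
  proof (rule CauchyI)
    fix e :: real assume "e > 0"
    have "Cauchy zs" using zs0 by (rule LIMSEQ_imp_Cauchy)
    then obtain M where M: "\<And>m n. m \<ge> M \<Longrightarrow> n \<ge> M \<Longrightarrow> norm (zs m - zs n) < e / (384 / \<rho>)"
      using CauchyD[of zs "e / (384 / \<rho>)"] \<open>e > 0\<close> \<rho> by auto
    have "norm (\<Psi> (zs m) - \<Psi> (zs n)) < e" if "m \<ge> M" "n \<ge> M" for m n
    proof -
      have "norm (\<Psi> (zs m) - \<Psi> (zs n)) \<le> 384 / \<rho> * norm (zs m - zs n)" by (rule \<Psi>_lipschitz[OF \<kappa> zsD le zsD le])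
      also have "\<dots> < 384 / \<rho> * (e / (384 / \<rho>))" using M[OF that] \<rho> by (intro mult_strict_left_mono) auto
      finally show ?thesis using \<rho> by simp
    qed
    then show "\<exists>M. \<forall>m\<ge>M. \<forall>n\<ge>M. norm (\<Psi> (zs m) - \<Psi> (zs n)) < e" by blast
  qed
  then obtain \<tau> where \<tau>: "(\<lambda>n. \<Psi> (zs n)) \<longlonglongrightarrow> \<tau>" by (metis Cauchy_convergent_iff convergent_def)
  show thesis
  proof (rule that[of \<tau>])
    have lim: "(\<lambda>n. norm (\<Psi> (zs n))) \<longlonglongrightarrow> norm \<tau>" using \<tau> by (rule tendsto_norm)
    have le1: "norm \<tau> \<le> 1" by (rule LIMSEQ_le_const2[OF lim]) (use \<Psi>_disc[OF zsD] less_imp_le in blast)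
    have "1 - 64 / \<rho> * norm (zs n) \<le> norm (\<Psi> (zs n))" for n
    proof -
      have n16: "norm (zs n) \<le> \<rho> / 16" using le[of n] \<rho> by simp
      have "0 \<notin> D" using box'[of 0] g0 a by simp
      then have "boundary_dist D (zs n) \<le> norm (zs n)" using infdist_le[of 0 "- D" "zs n"] by (simp add: boundary_dist_def dist_norm)
      then have "64 / \<rho> * boundary_dist D (zs n) \<le> 64 / \<rho> * norm (zs n)" using \<rho> by (intro mult_left_mono) auto
      then show ?thesis using \<Psi>_bounds(1)[OF \<kappa> zsD n16] by linarith
    qed
    moreover have "(\<lambda>n. 1 - 64 / \<rho> * norm (zs n)) \<longlonglongrightarrow> 1 - 64 / \<rho> * 0" by (intro tendsto_intros nz0)
    ultimately have "1 \<le> norm \<tau>" using LIMSEQ_le[OF _ lim] by fastforce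
    then show "norm \<tau> = 1" using le1 by simp
    show "norm (\<Psi> z - \<tau>) \<le> 384 / \<rho> * norm z" if "z \<in> D" "norm z \<le> \<rho> / 128" for z
    proof -
      have "(\<lambda>n. norm (\<Psi> z - \<Psi> (zs n))) \<longlonglongrightarrow> norm (\<Psi> z - \<tau>)" by (intro tendsto_intros \<tau>)
      moreover have "(\<lambda>n. 384 / \<rho> * norm (z - zs n)) \<longlonglongrightarrow> 384 / \<rho> * norm (z - 0)" by (intro tendsto_intros zs0)
      ultimately have "norm (\<Psi> z - \<tau>) \<le> 384 / \<rho> * norm (z - 0)"
        by (rule LIMSEQ_le) (use \<Psi>_lipschitz[OF \<kappa> that zsD le] in blast)
      then show ?thesis by simp
    qed
    show "\<exists>z\<in>D. norm z \<le> \<rho> / 128 \<and> norm (\<Psi> z - \<tau>) < \<epsilon>" if "\<epsilon> > 0" for \<epsilon>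
    proof -
      obtain n where "norm (\<Psi> (zs n) - \<tau>) < \<epsilon>" using LIMSEQ_D[OF \<tau> \<open>\<epsilon> > 0\<close>] by blast
      then show ?thesis using zsD le by blast
    qed
  qed
qed

section \<open>The inverse of the Riemann map near the boundary point\<close>

definition "Z \<xi> = zc + 1 / R \<xi>"

lemma Z_\<Psi>: "z \<in> D \<Longrightarrow> R (\<Psi> z) \<noteq> 0 \<and> Z (\<Psi> z) = z"
  using R_\<Psi>[of z] D_W[of z] by (simp add: Z_def)

lemma \<Psi>_Z:
  assumes "norm \<xi> < 1" "R \<xi> \<noteq> 0"
  shows "\<Psi> (Z \<xi>) = \<xi>" "Z \<xi> \<notin> K"
proof -
  show "\<Psi> (Z \<xi>) = \<xi>" using fR(4)[OF assms(1)] assms(2) by (simp add: \<Psi>_def Z_def)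
  show "Z \<xi> \<notin> K" using fR(4)[OF assms(1)] assms(2) by (simp add: W_def Z_def)
qed

text \<open>Differentiating \<Psi> (Z u) = u turns the lower bound on \<Psi>' into an upper bound on
  Z'.\<close>

lemma Z_deriv:
  assumes \<kappa>: "0 < \<kappa>" "\<And>z. z \<in> B0 \<Longrightarrow> z \<in> D \<and> norm (\<Psi> z) \<le> 1 - \<kappa>"
    and \<xi>: "norm \<xi> < 1" "R \<xi> \<noteq> 0" "Z \<xi> \<in> D" "norm (Z \<xi>) \<le> \<rho> / 16"
  obtains Z' where "(Z has_field_derivative Z') (at \<xi>)" "norm Z' \<le> 512 * \<rho> / \<kappa>"
proof -
  have dR: "(R has_field_derivative deriv R \<xi>) (at \<xi>)" using holomorphic_derivI[OF fR(2) open_ball] \<xi>(1) by simp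
  define Z' where "Z' = - deriv R \<xi> / (R \<xi>)^2"
  have dZ: "(Z has_field_derivative Z') (at \<xi>)"
    unfolding Z_def[abs_def] Z'_def using dR \<xi>(2) by (auto intro!: derivative_eq_intros simp: power2_eq_square)
  have d\<Psi>: "(\<Psi> has_field_derivative deriv \<Psi> (Z \<xi>)) (at (Z \<xi>))" using holomorphic_derivI[OF \<Psi>_holomorphic D \<xi>(3)] .
  have comp: "((\<lambda>u. \<Psi> (Z u)) has_field_derivative deriv \<Psi> (Z \<xi>) * Z') (at \<xi>)" by (rule DERIV_chain2[OF d\<Psi> dZ])
  have op: "open (ball 0 1 \<inter> R -` (- {0}))"
    using fR(2) by (intro continuous_open_preimage holomorphic_on_imp_continuous_on) auto
  have "((\<lambda>u. u) has_field_derivative deriv \<Psi> (Z \<xi>) * Z') (at \<xi>)"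
    using comp op by (rule has_field_derivative_transform_within_open) (use \<xi> \<Psi>_Z(1) in auto)
  then have "deriv \<Psi> (Z \<xi>) * Z' = 1" using DERIV_unique[OF _ DERIV_ident] by blast
  then have n: "norm (deriv \<Psi> (Z \<xi>)) * norm Z' = 1" by (metis norm_mult norm_one)
  have "\<kappa> / (512 * \<rho>) * norm Z' \<le> norm (deriv \<Psi> (Z \<xi>)) * norm Z'"
    using \<Psi>_bounds(3)[OF \<kappa> \<xi>(3,4)] by (intro mult_right_mono) auto
  then have "norm Z' \<le> 512 * \<rho> / \<kappa>" unfolding n using \<kappa>(1) \<rho> by (simp add: field_simps)
  then show thesis using that dZ by blast
qed

text \<open>Along a segment in the disc that starts at the image of a point near \<open>0\<close>, the inverse map
  \<open>Z\<close> moves slowly as long as it stays near \<open>0\<close>, hence it never leaves.\<close>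
lemma Z_near:
  assumes \<kappa>: "0 < \<kappa>" "\<And>z. z \<in> B0 \<Longrightarrow> z \<in> D \<and> norm (\<Psi> z) \<le> 1 - \<kappa>"
    and z1: "z1 \<in> D" "norm z1 \<le> \<rho> / 128" and \<xi>: "norm \<xi> < 1" "norm (\<xi> - \<Psi> z1) \<le> \<kappa> / 65536"
  shows "R \<xi> \<noteq> 0 \<and> Z \<xi> \<in> D \<and> norm (Z \<xi>) < \<rho> / 16"
proof -
  define \<zeta> where "\<zeta> t = \<Psi> z1 + of_real t * (\<xi> - \<Psi> z1)" for t :: real
  have \<zeta>1: "norm (\<zeta> t) < 1" if "0 \<le> t" "t \<le> 1" for t
  proof -
    have "\<zeta> t \<in> closed_segment (\<Psi> z1) \<xi>" using that unfolding closed_segment_def \<zeta>_def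
      by (intro CollectI exI[of _ t]) (simp add: scaleR_conv_of_real algebra_simps)
    moreover have "closed_segment (\<Psi> z1) \<xi> \<subseteq> ball 0 1"
      using \<xi> \<Psi>_disc[OF z1(1)] by (intro closed_segment_subset convex_ball) auto
    ultimately show ?thesis by auto
  qed
  define G where "G = {\<omega>. \<omega> \<noteq> 0 \<and> zc + 1 / \<omega> \<in> D \<inter> ball 0 (\<rho> / 16)}"
  have "open (- {0} \<inter> (\<lambda>\<omega>. zc + 1 / \<omega>) -` (D \<inter> ball 0 (\<rho> / 16)))"
    using D by (intro continuous_open_preimage continuous_intros) auto
  moreover have "G = - {0} \<inter> (\<lambda>\<omega>. zc + 1 / \<omega>) -` (D \<inter> ball 0 (\<rho> / 16))" by (auto simp: G_def)
  ultimately have oG: "open G" by simp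
  have c\<zeta>: "continuous_on {0..1} (\<lambda>t. R (\<zeta> t))"
    by (rule continuous_on_compose2[OF holomorphic_on_imp_continuous_on[OF fR(2)]])
      (use \<zeta>1 in \<open>auto simp: \<zeta>_def intro!: continuous_intros\<close>)
  have inG: "R (\<zeta> t) \<in> G \<longleftrightarrow> R (\<zeta> t) \<noteq> 0 \<and> Z (\<zeta> t) \<in> D \<and> norm (Z (\<zeta> t)) < \<rho> / 16" for t
    by (auto simp: G_def Z_def)
  define bad where "bad = {0..1} \<inter> (\<lambda>t. R (\<zeta> t)) -` (- G)"
  have "closed bad" unfolding bad_def using oG by (intro continuous_closed_preimage c\<zeta>) auto
  then have "compact bad" using compact_Int_closed[of "{0..1}" bad] by (simp add: bad_def Int_assoc[symmetric])
  have "bad = {}"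
  proof (rule ccontr)
    assume "bad \<noteq> {}"
    \<comment> \<open>The first parameter at which the claim fails. Up to s the image stays within
      \<rho> / 32 of 0; passing to the limit shows that this closed condition, and then the claim
      itself, still holds at s.\<close>
    then obtain s where s: "s \<in> bad" "\<And>t. t \<in> bad \<Longrightarrow> s \<le> t" using compact_attains_inf[OF \<open>compact bad\<close>] by blast
    have s01: "0 \<le> s" "s \<le> 1" using s(1) by (auto simp: bad_def)
    have good: "R (\<zeta> t) \<noteq> 0 \<and> Z (\<zeta> t) \<in> D \<and> norm (Z (\<zeta> t)) < \<rho> / 16" if "0 \<le> t" "t < s" for t
      using s(2)[of t] that s01 inG[of t] by (auto simp: bad_def)
    have start: "Z (\<zeta> 0) = z1" "R (\<zeta> 0) \<in> G" using Z_\<Psi>[OF z1(1)] z1 \<rho> inG[of 0] by (auto simp: \<zeta>_def)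
    then have "s \<noteq> 0" using s(1) by (auto simp: bad_def)
    then have s0: "0 < s" using s01 by simp
    have bd: "norm (Z (\<zeta> t)) \<le> \<rho> / 32" if t: "0 \<le> t" "t < s" for t
    proof -
      have sg: "\<exists>u. 0 \<le> u \<and> u \<le> t \<and> v = \<zeta> u" if v: "v \<in> closed_segment (\<zeta> 0) (\<zeta> t)" for v
      proof -
        obtain l where l: "0 \<le> l" "l \<le> 1" "v = (1 - l) *\<^sub>R \<zeta> 0 + l *\<^sub>R \<zeta> t" using v by (auto simp: closed_segment_def)
        have "v = \<zeta> (l * t)" unfolding l(3) \<zeta>_def by (simp add: scaleR_conv_of_real algebra_simps)
        moreover have "0 \<le> l * t" "l * t \<le> t" using l t mult_right_mono[of l 1 t] by auto
        ultimately show ?thesis by blast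
      qed
      have "\<exists>Z'. (Z has_field_derivative Z') (at v) \<and> norm Z' \<le> 512 * \<rho> / \<kappa>" if v: "v \<in> closed_segment (\<zeta> 0) (\<zeta> t)" for v
      proof -
        obtain u where u: "0 \<le> u" "u \<le> t" "v = \<zeta> u" using sg[OF v] by blast
        have gu: "R v \<noteq> 0" "Z v \<in> D" "norm (Z v) \<le> \<rho> / 16" using good[of u] u t by auto
        have "norm v < 1" using \<zeta>1[of u] u t s01 by auto
        from Z_deriv[OF \<kappa> this gu] show ?thesis by blast
      qed
      then obtain Z' where Z': "\<And>v. v \<in> closed_segment (\<zeta> 0) (\<zeta> t) \<Longrightarrow> (Z has_field_derivative Z' v) (at v) \<and> norm (Z' v) \<le> 512 * \<rho> / \<kappa>"
        by metis
      have "norm (Z (\<zeta> t) - Z (\<zeta> 0)) \<le> 512 * \<rho> / \<kappa> * norm (\<zeta> t - \<zeta> 0)"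
        by (rule field_differentiable_bound[of "closed_segment (\<zeta> 0) (\<zeta> t)" Z Z'])
          (use Z' in \<open>auto intro: has_field_derivative_at_within\<close>)
      also have "norm (\<zeta> t - \<zeta> 0) \<le> 1 * (\<kappa> / 65536)"
      proof -
        have "norm (\<zeta> t - \<zeta> 0) = t * norm (\<xi> - \<Psi> z1)" using t by (simp add: \<zeta>_def norm_mult)
        also have "\<dots> \<le> 1 * (\<kappa> / 65536)" using t s01 \<xi> by (intro mult_mono) auto
        finally show ?thesis .
      qed
      then have "512 * \<rho> / \<kappa> * norm (\<zeta> t - \<zeta> 0) \<le> 512 * \<rho> / \<kappa> * (1 * (\<kappa> / 65536))" using \<rho> \<kappa>(1) by (intro mult_left_mono) auto
      \<comment> \<open>The origin of \<kappa> / 65536: multiplied by the derivative bound 512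
        \<rho> / \<kappa> it is \<rho> / 128.\<close>
      also have "\<dots> = \<rho> / 128" using \<kappa>(1) by simp
      finally have "norm (Z (\<zeta> t) - z1) \<le> \<rho> / 128" using start(1) by simp
      then show ?thesis using norm_triangle_ineq[of z1 "Z (\<zeta> t) - z1"] z1(2) \<rho> by simp
    qed
    define ts where "ts n = s * (1 - 1 / real (Suc (Suc n)))" for n
    have ts: "0 \<le> ts n" "ts n < s" for n
      using s0 by (auto simp: ts_def field_simps)
    have "(\<lambda>n. 1 / real (Suc (Suc n))) \<longlonglongrightarrow> 0"
      using LIMSEQ_ignore_initial_segment[OF LIMSEQ_inverse_real_of_nat, of 1] by (simp add: inverse_eq_divide)
    then have "ts \<longlonglongrightarrow> s * (1 - 0)" unfolding ts_def by (intro tendsto_intros)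
    then have tl: "ts \<longlonglongrightarrow> s" by simp
    have Rl: "(\<lambda>n. R (\<zeta> (ts n))) \<longlonglongrightarrow> R (\<zeta> s)"
      by (rule continuous_on_tendsto_compose[OF c\<zeta> tl]) (use ts s01 less_imp_le in \<open>auto intro!: always_eventually order_trans[OF less_imp_le[OF ts(2)]]\<close>)
    have zcn: "norm zc = a / 2"
    proof -
      have "zc = \<i> * of_real (- a / 2)" by (simp add: zc_def complex_eq_iff)
      then have "norm zc = \<bar>- a / 2\<bar>" by (metis norm_mult norm_of_real norm_ii mult_1)
      then show ?thesis using a by simp
    qed
    \<comment> \<open>Z cannot escape to infinity: while it is within a of \<open>zc\<close>, the
      value of R has modulus at least 1 / a.\<close>
    have lb: "1 / a \<le> norm (R (\<zeta> (ts n)))" for n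
    proof -
      have "R (\<zeta> (ts n)) \<noteq> 0" using good ts by blast
      then have "norm (Z (\<zeta> (ts n)) - zc) * norm (R (\<zeta> (ts n))) = 1" unfolding Z_def norm_mult[symmetric] by simp
      moreover have "norm (Z (\<zeta> (ts n)) - zc) \<le> a"
        using norm_triangle_ineq4[of "Z (\<zeta> (ts n))" zc] zcn bd[OF ts(1)[of n] ts(2)[of n]] \<rho> a by linarith
      then have "norm (Z (\<zeta> (ts n)) - zc) * norm (R (\<zeta> (ts n))) \<le> a * norm (R (\<zeta> (ts n)))" by (rule mult_right_mono) simp
      ultimately show ?thesis using a by (simp add: field_simps)
    qed
    have "1 / a \<le> norm (R (\<zeta> s))" using LIMSEQ_le_const[OF tendsto_norm[OF Rl]] lb by blast
    then have R0: "R (\<zeta> s) \<noteq> 0" using a by auto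
    have "(\<lambda>n. Z (\<zeta> (ts n))) \<longlonglongrightarrow> Z (\<zeta> s)" unfolding Z_def by (intro tendsto_intros Rl R0)
    then have ns: "norm (Z (\<zeta> s)) \<le> \<rho> / 32" using LIMSEQ_le_const2[OF tendsto_norm] bd[OF ts] by blast
    \<comment> \<open>The limit is known only to avoid K; inside the box this already means lying in
      D.\<close>
    have "Z (\<zeta> s) \<notin> K" using \<Psi>_Z(2)[OF \<zeta>1[OF s01] R0] .
    moreover have "\<bar>Re (Z (\<zeta> s))\<bar> \<le> a" "\<bar>Im (Z (\<zeta> s))\<bar> \<le> a"
      using abs_Re_le_cmod[of "Z (\<zeta> s)"] abs_Im_le_cmod[of "Z (\<zeta> s)"] ns \<rho> a by linarith+
    ultimately have "Z (\<zeta> s) \<in> D" using in_K by blast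
    then have "R (\<zeta> s) \<in> G" using inG[of s] R0 ns \<rho> by simp
    then show False using s(1) by (simp add: bad_def)
  qed
  then have "1 \<notin> bad" by simp
  then have "R (\<zeta> 1) \<in> G" by (simp add: bad_def)
  then show ?thesis using inG[of 1] by (simp add: \<zeta>_def)
qed

lemma uniformized_boundary_chart: "\<exists>U \<Psi>' g' r L. 0 \<in> U \<and> boundary_chart D U \<Psi>' g' r L"
proof -
  obtain \<kappa> where \<kappa>: "0 < \<kappa>" "\<And>z. z \<in> B0 \<Longrightarrow> z \<in> D \<and> norm (\<Psi> z) \<le> 1 - \<kappa>" using \<Psi>_B0 by blast
  obtain \<tau> where \<tau>: "norm \<tau> = 1" "\<And>z. z \<in> D \<Longrightarrow> norm z \<le> \<rho> / 128 \<Longrightarrow> norm (\<Psi> z - \<tau>) \<le> 384 / \<rho> * norm z"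
    "\<And>\<epsilon>. \<epsilon> > 0 \<Longrightarrow> \<exists>z\<in>D. norm z \<le> \<rho> / 128 \<and> norm (\<Psi> z - \<tau>) < \<epsilon>"
    using \<Psi>_limit[OF \<kappa>] by blast
  \<comment> \<open>Half the radius in \<open>Z_near\<close>: the other half is spent on the
    distance from \<tau> to \<Psi> z1, since \<tau> itself is not a value of \<Psi>.\<close>
  define r0 where "r0 = \<kappa> / 131072"
  have r0: "r0 > 0" using \<kappa>(1) by (simp add: r0_def)
  obtain z1 where z1: "z1 \<in> D" "norm z1 \<le> \<rho> / 128" "norm (\<Psi> z1 - \<tau>) < r0" using \<tau>(3)[OF r0] by blast
  have near: "R \<xi> \<noteq> 0" "Z \<xi> \<in> D" "norm (Z \<xi>) \<le> \<rho> / 16" if "norm \<xi> < 1" "norm (\<xi> - \<tau>) < r0" for \<xi>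
  proof -
    have "norm (\<xi> - \<Psi> z1) \<le> norm (\<xi> - \<tau>) + norm (\<Psi> z1 - \<tau>)" using norm_triangle_ineq4[of "\<xi> - \<tau>" "\<Psi> z1 - \<tau>"] by simp
    then have "norm (\<xi> - \<Psi> z1) \<le> \<kappa> / 65536" using that z1 by (simp add: r0_def)
    from Z_near[OF \<kappa> z1(1,2) that(1) this] show "R \<xi> \<noteq> 0" "Z \<xi> \<in> D" "norm (Z \<xi>) \<le> \<rho> / 16" by auto
  qed
  \<comment> \<open>An intersection of two discs is convex, so the derivative bound on Z integrates
    directly to a Lipschitz bound.\<close>
  define C where "C = ball 0 1 \<inter> ball \<tau> r0"
  have inC: "\<xi> \<in> C \<longleftrightarrow> norm \<xi> < 1 \<and> norm (\<xi> - \<tau>) < r0" for \<xi> by (auto simp: C_def dist_norm norm_minus_commute)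
  have "\<exists>Z'. (Z has_field_derivative Z') (at \<xi>) \<and> norm Z' \<le> 512 * \<rho> / \<kappa>" if "\<xi> \<in> C" for \<xi>
    using Z_deriv[OF \<kappa>, of \<xi>] near[of \<xi>] that unfolding inC by metis
  then obtain Z' where Z': "\<And>\<xi>. \<xi> \<in> C \<Longrightarrow> (Z has_field_derivative Z' \<xi>) (at \<xi>) \<and> norm (Z' \<xi>) \<le> 512 * \<rho> / \<kappa>" by metis
  have ZL: "norm (Z \<xi> - Z \<eta>) \<le> 512 * \<rho> / \<kappa> * norm (\<xi> - \<eta>)" if "\<xi> \<in> C" "\<eta> \<in> C" for \<xi> \<eta>
    by (rule field_differentiable_bound[of C Z Z'])
      (use Z' that in \<open>auto simp: C_def intro!: convex_Int intro: has_field_derivative_at_within\<close>)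
  have Zh: "Z holomorphic_on C" using Z' unfolding holomorphic_on_def field_differentiable_def by (blast intro: has_field_derivative_at_within)
  define r where "r = min (1/2) (r0 / 4)"
  have r: "r > 0" "r \<le> 1/2" "4 * r \<le> r0" using r0 by (auto simp: r_def)
  \<comment> \<open>A Cayley transform sending \<tau> to 0 and its inverse; both have bounded
    derivative on the regions used, so the estimates for \<Psi> and Z pass to the
    half-plane.\<close>
  define cay where "cay \<xi> = \<i> * (\<tau> - \<xi>) / (\<tau> + \<xi>)" for \<xi>
  define inv where "inv x = \<tau> * (\<i> - x) / (\<i> + x)" for x
  have \<tau>0: "\<tau> \<noteq> 0" using \<tau>(1) by auto
  have ix: "1/2 \<le> norm (\<i> + x)" "\<i> + x \<noteq> 0" if "norm x < r" for x
  proof -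
    show "1/2 \<le> norm (\<i> + x)" using norm_diff_ineq[of \<i> x] that r by simp
    then show "\<i> + x \<noteq> 0" by auto
  qed
  have inv\<tau>: "norm (inv x - \<tau>) < r0" if "norm x < r" for x
  proof -
    have "inv x - \<tau> = - 2 * \<tau> * x / (\<i> + x)" unfolding inv_def using ix(2)[OF that] by (simp add: field_simps)
    then have "norm (inv x - \<tau>) = 2 * norm x / norm (\<i> + x)" by (simp add: norm_mult norm_divide \<tau>(1))
    also have "\<dots> \<le> 2 * norm x / (1/2)" using ix(1)[OF that] by (intro divide_left_mono) auto
    also have "\<dots> < r0" using that r by simp
    finally show ?thesis .
  qed
  have inv1: "norm (inv x) < 1" if "Im x > 0" for x
  proof -
    have "norm (inv x) = norm ((x - \<i>) / (x + \<i>))" by (simp add: inv_def norm_mult norm_divide \<tau>(1) norm_minus_commute add.commute)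
    then show ?thesis using norm_cayley_less_1[OF that] by simp
  qed
  have invC: "inv x \<in> C" if "Im x > 0" "norm x < r" for x using inC inv1 inv\<tau> that by blast
  have cay_inv: "cay (inv x) = x" if "norm x < r" for x
  proof -
    have "\<tau> - inv x = 2 * \<tau> * x / (\<i> + x)" "\<tau> + inv x = 2 * \<tau> * \<i> / (\<i> + x)"
      unfolding inv_def using ix(2)[OF that] by (auto simp: field_simps)
    then have "cay (inv x) = \<i> * (2 * \<tau> * x / (\<i> + x)) / (2 * \<tau> * \<i> / (\<i> + x))" by (simp only: cay_def)
    also have "\<dots> = x" using ix(2)[OF that] \<tau>0 by simp
    finally show ?thesis .
  qed
  have inv_cay: "inv (cay \<xi>) = \<xi>" if "norm \<xi> < 1" for \<xi>
  proof -
    have ne: "\<tau> + \<xi> \<noteq> 0" using cayley_disc(1)[OF \<tau>(1) that] .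
    have "\<i> - cay \<xi> = 2 * \<i> * \<xi> / (\<tau> + \<xi>)" "\<i> + cay \<xi> = 2 * \<i> * \<tau> / (\<tau> + \<xi>)"
      unfolding cay_def using ne by (auto simp: field_simps)
    then have "inv (cay \<xi>) = \<tau> * (2 * \<i> * \<xi> / (\<tau> + \<xi>)) / (2 * \<i> * \<tau> / (\<tau> + \<xi>))" by (simp only: inv_def)
    also have "\<dots> = \<xi>" using ne \<tau>0 by simp
    finally show ?thesis .
  qed
  define \<Psi>' where "\<Psi>' z = cay (\<Psi> z)" for z
  define g' where "g' x = Z (inv x)" for x
  \<comment> \<open>Chosen so that 384 / \<rho> * \<rho>3 \<le> r / 4: then \<Psi> z is within r / 4
    of \<tau>, and the denominator \<tau> + \<Psi> z of \<open>cay\<close> has modulus at least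
    1.\<close>
  define \<rho>3 where "\<rho>3 = min (\<rho> / 128) (r / (4 * (384 / \<rho>)))"
  have \<rho>3: "\<rho>3 > 0" "\<rho>3 \<le> \<rho> / 128" "384 / \<rho> * \<rho>3 \<le> r / 4"
  proof -
    show "\<rho>3 > 0" "\<rho>3 \<le> \<rho> / 128" using \<rho> r by (auto simp: \<rho>3_def)
    have "384 / \<rho> * \<rho>3 \<le> 384 / \<rho> * (r / (4 * (384 / \<rho>)))" using \<rho> by (intro mult_left_mono) (auto simp: \<rho>3_def)
    then show "384 / \<rho> * \<rho>3 \<le> r / 4" using \<rho> by simp
  qed
  define L where "L = 768 / \<rho> + 8 * (512 * \<rho> / \<kappa>)"
  have L: "768 / \<rho> \<le> L" "8 * (512 * \<rho> / \<kappa>) \<le> L" "L > 0" using \<rho> \<kappa>(1) by (auto simp: L_def intro!: add_pos_pos)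
  have n\<tau>: "norm (\<Psi> z - \<tau>) \<le> r / 4" "1 \<le> norm (\<tau> + \<Psi> z)" if "z \<in> D" "norm z < \<rho>3" for z
  proof -
    have "384 / \<rho> * norm z \<le> 384 / \<rho> * \<rho>3" using that \<rho> by (intro mult_left_mono) auto
    then show 1: "norm (\<Psi> z - \<tau>) \<le> r / 4" using \<tau>(2)[OF that(1)] that \<rho>3 by fastforce
    have "2 * norm \<tau> = norm ((\<tau> + \<Psi> z) - (\<Psi> z - \<tau>))" by (simp flip: norm_mult)
    also have "\<dots> \<le> norm (\<tau> + \<Psi> z) + norm (\<Psi> z - \<tau>)" by (rule norm_triangle_ineq4)
    finally show "1 \<le> norm (\<tau> + \<Psi> z)" using 1 r \<tau>(1) by simp
  qed
  have "boundary_chart D (ball 0 \<rho>3) \<Psi>' g' r L"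
    unfolding boundary_chart_def
  proof (intro conjI ballI allI impI)
    show "\<Psi>' holomorphic_on D" unfolding \<Psi>'_def[abs_def] cay_def using cayley_disc(1)[OF \<tau>(1) \<Psi>_disc] \<Psi>_holomorphic by (intro holomorphic_intros) auto
    show "Im (\<Psi>' z) > 0" if "z \<in> D" for z
    proof -
      have "norm (\<Psi> z)^2 < 1" using \<Psi>_disc[OF that] by (simp add: abs_square_less_1)
      then show ?thesis unfolding \<Psi>'_def cay_def cayley_disc(2)[OF \<tau>(1) \<Psi>_disc[OF that]] using cayley_disc(1)[OF \<tau>(1) \<Psi>_disc[OF that]] by simp
    qed
    have "inv holomorphic_on {x. Im x > 0} \<inter> ball 0 r" unfolding inv_def using ix(2) by (intro holomorphic_intros) auto
    then have "Z \<circ> inv holomorphic_on {x. Im x > 0} \<inter> ball 0 r" by (rule holomorphic_on_compose_gen[OF _ Zh]) (use invC in auto)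
    then show "g' holomorphic_on {x. Im x > 0} \<inter> ball 0 r" by (simp add: g'_def[abs_def] o_def)
    show "g' x \<in> D" "\<Psi>' (g' x) = x" if "Im x > 0" "norm x < r" for x
    proof -
      have i: "norm (inv x) < 1" "norm (inv x - \<tau>) < r0" using inv1 inv\<tau> that by auto
      show "g' x \<in> D" using near(2)[OF i] by (simp add: g'_def)
      show "\<Psi>' (g' x) = x" using \<Psi>_Z(1)[OF i(1) near(1)[OF i]] cay_inv[OF that(2)] by (simp add: \<Psi>'_def g'_def)
    qed
    fix z assume "z \<in> D \<inter> ball 0 \<rho>3"
    then have z: "z \<in> D" "norm z < \<rho>3" by auto
    note n = n\<tau>[OF z]
    have "norm (\<Psi>' z) = norm (\<Psi> z - \<tau>) / norm (\<tau> + \<Psi> z)" by (simp add: \<Psi>'_def cay_def norm_mult norm_divide norm_minus_commute)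
    also have "\<dots> \<le> norm (\<Psi> z - \<tau>) / 1" using n by (intro divide_left_mono) auto
    finally show "norm (\<Psi>' z) < r / 2" using n(1) r(1) by simp
    show "g' (\<Psi>' z) = z" using inv_cay[OF \<Psi>_disc[OF z(1)]] Z_\<Psi>[OF z(1)] by (simp add: g'_def \<Psi>'_def)
    have "Im (\<Psi>' z) = (1 - norm (\<Psi> z)^2) / norm (\<tau> + \<Psi> z)^2" unfolding \<Psi>'_def cay_def by (rule cayley_disc(2)[OF \<tau>(1) \<Psi>_disc[OF z(1)]])
    also have "\<dots> \<le> (1 - norm (\<Psi> z)^2) / 1"
    proof (rule divide_left_mono)
      show "1 \<le> norm (\<tau> + \<Psi> z)^2" using n(2) by (simp add: one_le_power)
      show "0 \<le> 1 - norm (\<Psi> z)^2" using \<Psi>_disc[OF z(1)] by (simp add: abs_square_le_1)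
      show "0 < norm (\<tau> + \<Psi> z)^2 * 1" using n(2) by (simp add: zero_less_power) (use cayley_disc(1)[OF \<tau>(1) \<Psi>_disc[OF z(1)]] in simp)
    qed
    also have "\<dots> = (1 + norm (\<Psi> z)) * (1 - norm (\<Psi> z))" by (simp add: power2_eq_square algebra_simps)
    also have "\<dots> \<le> 2 * (1 - norm (\<Psi> z))" using \<Psi>_disc[OF z(1)] by (intro mult_right_mono) auto
    also have "\<dots> \<le> 2 * (64 / \<rho> * boundary_dist D z)" using \<Psi>_bounds(1)[OF \<kappa> z(1)] z \<rho>3 \<rho> by simp
    also have "\<dots> = 128 / \<rho> * boundary_dist D z" by simp
    also have "\<dots> \<le> L * boundary_dist D z"
    proof (rule mult_right_mono)
      have "128 / \<rho> \<le> 768 / \<rho>" using \<rho> by (intro divide_right_mono) auto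
      then show "128 / \<rho> \<le> L" using L(1) by linarith
    qed (simp add: boundary_dist_def infdist_nonneg)
    finally show "Im (\<Psi>' z) \<le> L * boundary_dist D z" .
    fix w assume "w \<in> D \<inter> ball 0 \<rho>3"
    then have w: "w \<in> D" "norm w < \<rho>3" by auto
    have ne: "\<tau> + \<Psi> z \<noteq> 0" "\<tau> + \<Psi> w \<noteq> 0" using cayley_disc(1)[OF \<tau>(1) \<Psi>_disc] z w by auto
    have "\<Psi>' z - \<Psi>' w = - 2 * \<i> * \<tau> * (\<Psi> z - \<Psi> w) / ((\<tau> + \<Psi> z) * (\<tau> + \<Psi> w))"
      unfolding \<Psi>'_def cay_def using ne by (simp add: field_simps)
    then have "norm (\<Psi>' z - \<Psi>' w) = 2 * norm (\<Psi> z - \<Psi> w) / (norm (\<tau> + \<Psi> z) * norm (\<tau> + \<Psi> w))"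
      by (simp add: norm_mult norm_divide \<tau>(1))
    also have "\<dots> \<le> 2 * norm (\<Psi> z - \<Psi> w) / (1 * 1)"
      using n(2) n\<tau>(2)[OF w] ne by (intro divide_left_mono mult_mono) auto
    also have "\<dots> \<le> 2 * (384 / \<rho> * norm (z - w))" using \<Psi>_lipschitz[OF \<kappa> z(1) _ w(1)] z w \<rho>3 by simp
    also have "\<dots> = 768 / \<rho> * norm (z - w)" by simp
    also have "\<dots> \<le> L * norm (z - w)" using L(1) by (intro mult_right_mono) auto
    finally show "dist (\<Psi>' z) (\<Psi>' w) \<le> L * dist z w" by (simp add: dist_norm)
  next
    fix x y assume x: "Im x > 0" "norm x < r" and y: "Im y > 0" "norm y < r"
    have "inv x - inv y = 2 * \<i> * \<tau> * (y - x) / ((\<i> + x) * (\<i> + y))"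
      unfolding inv_def using ix(2)[OF x(2)] ix(2)[OF y(2)] by (simp add: field_simps)
    then have "norm (inv x - inv y) = 2 * norm (x - y) / (norm (\<i> + x) * norm (\<i> + y))"
      by (simp add: norm_mult norm_divide \<tau>(1) norm_minus_commute)
    also have "\<dots> \<le> 2 * norm (x - y) / (1/2 * (1/2))"
      using ix[OF x(2)] ix[OF y(2)] by (intro divide_left_mono mult_mono) auto
    finally have i: "norm (inv x - inv y) \<le> 8 * norm (x - y)" by simp
    have "norm (g' x - g' y) \<le> 512 * \<rho> / \<kappa> * norm (inv x - inv y)" unfolding g'_def by (rule ZL[OF invC[OF x] invC[OF y]])
    also have "\<dots> \<le> 512 * \<rho> / \<kappa> * (8 * norm (x - y))" using i \<rho> \<kappa>(1) by (intro mult_left_mono) auto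
    also have "\<dots> = 8 * (512 * \<rho> / \<kappa>) * norm (x - y)" by simp
    also have "\<dots> \<le> L * norm (x - y)" using L(2) by (intro mult_right_mono) auto
    finally show "dist (g' x) (g' y) \<le> L * dist x y" by (simp add: dist_norm)
  qed (use r L in auto)
  moreover have "0 \<in> ball (0::complex) \<rho>3" using \<rho>3 by simp
  ultimately show ?thesis by blast
qed

end

context local_graph
begin

lemma exists_boundary_chart: "\<exists>U \<Psi> h r L. 0 \<in> U \<and> boundary_chart D U \<Psi> h r L"
proof -
  obtain F where F: "F holomorphic_on {w. Im w > - \<bar>Re w\<bar>}"
    "\<And>w. Im w > - \<bar>Re w\<bar> \<Longrightarrow> norm (F w) \<le> 2 * norm w"
    "\<And>w. Im w > 0 \<Longrightarrow> norm (F w) \<le> norm w"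
    "\<And>w. Im w > 0 \<Longrightarrow> Im (F w) > 0"
    "\<And>y::real. y > 0 \<Longrightarrow> \<exists>t::real. y/2 \<le> t \<and> t \<le> y \<and> F (\<i> * of_real y) = \<i> * of_real t"
    "\<And>y::real. y > 0 \<Longrightarrow> norm (deriv F (\<i> * of_real y)) \<ge> 1/8"
    "\<And>w j. Im w > 0 \<Longrightarrow> \<rho> / 2^(j+1) < norm w \<Longrightarrow> norm w \<le> \<rho> / 2^j \<Longrightarrow> norm (F w) * (c j / 100) \<le> Im (F w)"
    "\<And>w j. Im w \<le> 0 \<Longrightarrow> - Im w \<le> norm w * (c j / 100) \<Longrightarrow> \<rho> / 2^(j+1) < norm w \<Longrightarrow> norm w \<le> \<rho> / 2^j \<Longrightarrow> Im w > - \<bar>Re w\<bar> \<and> Im (F w) > 0"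
    using that by (rule Dini_barrier[OF \<rho>(1) c(1,3,4)])
  obtain f R where fR: "f holomorphic_on W" "R holomorphic_on ball 0 1"
    "\<And>\<omega>. \<omega> \<in> W \<Longrightarrow> norm (f \<omega>) < 1 \<and> R (f \<omega>) = \<omega>" "\<And>\<xi>. norm \<xi> < 1 \<Longrightarrow> R \<xi> \<in> W \<and> f (R \<xi>) = \<xi>" "f 0 = 0"
    using that by (rule W_uniformization)
  interpret uniformized_graph D g a \<rho> T c F f R
    by unfold_locales (use F fR in blast)+
  show ?thesis by (rule uniformized_boundary_chart)
qed

end

section \<open>Dini-smooth arcs as graphs\<close>

lemma modulus_of_continuity_mono:
  "s \<le> t \<Longrightarrow> modulus_of_continuity S f s \<le> modulus_of_continuity S f t"
  unfolding modulus_of_continuity_def by (rule SUP_subset_mono) auto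

lemma dist_le_modulus_of_continuity:
  "x \<in> S \<Longrightarrow> y \<in> S \<Longrightarrow> dist x y \<le> t \<Longrightarrow> ennreal (dist (f x) (f y)) \<le> modulus_of_continuity S f t"
  unfolding modulus_of_continuity_def by (rule SUP_upper2[of "(x, y)"]) auto

text \<open>At most one of the disjoint dyadic intervals contains t. On it monotonicity handles the
  modulus, and t \<le> 2^(-k) gives 2^k \<le> 1 / t.\<close>

lemma dyadic_step_le:
  fixes m :: "real \<Rightarrow> ennreal"
  assumes m: "\<And>s t. s \<le> t \<Longrightarrow> m s \<le> m t"
  shows "(\<Sum>j<n. m (1 / 2^(j+1)) * ennreal (2^j) * indicator {1 / 2^(j+1)<..1 / 2^j} t) \<le> m t / ennreal t * indicator {0<..1} t"
proof (cases "\<exists>k<n. t \<in> {1 / 2^(k+1)<..1 / 2^k}")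
  case True
  then obtain k where k: "k < n" "1 / 2^(k+1) < t" "t \<le> 1 / 2^k" by auto
  have pos: "(0::real) < 1 / 2^(k+1)" by simp
  then have t0: "0 < t" using k by linarith
  have "1 / 2^k \<le> (1::real)" by simp
  then have t1: "t \<le> 1" using k by linarith
  have other: "t \<notin> {1 / 2^(j+1)<..1 / 2^j}" if "j \<noteq> k" for j
  proof (cases "j < k")
    case True
    then have "(1::real) / 2^k \<le> 1 / 2^(j+1)" by (intro divide_left_mono power_increasing) auto
    then show ?thesis using k by simp
  next
    case False
    then have "(1::real) / 2^j \<le> 1 / 2^(k+1)" using that by (intro divide_left_mono power_increasing) auto
    then show ?thesis using k by simp
  qed
  have "(\<Sum>j<n. m (1 / 2^(j+1)) * ennreal (2^j) * indicator {1 / 2^(j+1)<..1 / 2^j} t)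
      = (\<Sum>j<n. if j = k then m (1 / 2^(k+1)) * ennreal (2^k) else 0)"
    using other k by (intro sum.cong refl) (auto simp: indicator_def)
  also have "\<dots> = m (1 / 2^(k+1)) * ennreal (2^k)" using k by (simp add: sum.delta)
  also have "\<dots> \<le> m t * ennreal (1 / t)"
  proof (rule mult_mono)
    show "ennreal (2^k) \<le> ennreal (1 / t)" using k t0 by (intro ennreal_leI) (simp add: field_simps)
    show "m (1 / 2^(k+1)) \<le> m t" using k m by (simp add: less_imp_le)
  qed auto
  also have "\<dots> = m t / ennreal t * indicator {0<..1} t"
  proof -
    have "ennreal (1 / t) = inverse (ennreal t)" using t0 by (simp add: inverse_ennreal inverse_eq_divide)
    then show ?thesis using t0 t1 by (simp add: divide_ennreal_def)
  qed
  finally show ?thesis .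
next
  case False
  then have "(\<Sum>j<n. m (1 / 2^(j+1)) * ennreal (2^j) * indicator {1 / 2^(j+1)<..1 / 2^j} t) = 0"
    by (intro sum.neutral) (auto simp: indicator_def)
  then show ?thesis by simp
qed

text \<open>Since 2^j (2^(-j) - 2^(-j-1)) = 1/2, each dyadic interval contributes at least half a
  modulus to the Dini integral. Its finiteness therefore makes every modulus at a dyadic scale
  finite and their sum convergent.\<close>

lemma dini_dyadic_moduli:
  assumes "dini_continuous_on S f"
  obtains W :: "nat \<Rightarrow> real" where "\<And>j. 0 \<le> W j" "decseq W" "summable W"
    "\<And>x y j. x \<in> S \<Longrightarrow> y \<in> S \<Longrightarrow> \<bar>x - y\<bar> \<le> 1 / 2^(j+1) \<Longrightarrow> norm (f x - f y) \<le> W j"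
proof -
  define m where "m = modulus_of_continuity S f"
  have mm: "m s \<le> m t" if "s \<le> t" for s t unfolding m_def using that by (rule modulus_of_continuity_mono)
  define I where "I = (\<integral>\<^sup>+t\<in>{0<..1}. m t / ennreal t \<partial>lborel)"
  have I: "I < \<infinity>" using assms by (simp add: dini_continuous_on_def I_def m_def)
  have sums: "(\<Sum>j<n. m (1 / 2^(j+1)) * ennreal (1/2)) \<le> I" for n
  proof -
    have int: "(\<integral>\<^sup>+t. m (1 / 2^(j+1)) * ennreal (2^j) * indicator {1 / (2::real)^(j+1)<..1 / 2^j} t \<partial>lborel) = m (1 / 2^(j+1)) * ennreal (1/2)" for j :: nat
    proof -
      have "(1::real) / 2^(j+1) \<le> 1 / 2^j" by (intro divide_left_mono power_increasing) auto
      then have "(\<integral>\<^sup>+t. m (1 / 2^(j+1)) * ennreal (2^j) * indicator {1 / (2::real)^(j+1)<..1 / 2^j} t \<partial>lborel)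
        = m (1 / 2^(j+1)) * ennreal (2^j) * ennreal (1 / 2^j - 1 / 2^(j+1))"
        by (subst nn_integral_cmult_indicator) auto
      also have "\<dots> = m (1 / 2^(j+1)) * (ennreal (2^j) * ennreal (1 / 2^j - 1 / 2^(j+1)))" by (rule mult.assoc)
      also have "ennreal (2^j) * ennreal (1 / 2^j - 1 / 2^(j+1)) = ennreal (2^j * (1 / 2^j - 1 / 2^(j+1)))"
        by (rule ennreal_mult'[symmetric]) simp
      also have "2^j * (1 / 2^j - 1 / 2^(j+1)) = (1/2::real)" by (simp add: right_diff_distrib)
      finally show ?thesis .
    qed
    have "(\<Sum>j<n. m (1 / 2^(j+1)) * ennreal (1/2))
      = (\<integral>\<^sup>+t. (\<Sum>j<n. m (1 / 2^(j+1)) * ennreal (2^j) * indicator {1 / (2::real)^(j+1)<..1 / 2^j} t) \<partial>lborel)"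
      by (subst nn_integral_sum) (simp_all only: int, measurable)
    also have "\<dots> \<le> I" unfolding I_def by (intro nn_integral_mono dyadic_step_le mm)
    finally show ?thesis .
  qed
  have fin: "m (1 / 2^(j+1)) < \<infinity>" for j :: nat
  proof -
    have "m (1 / 2^(j+1)) * ennreal (1/2) \<le> (\<Sum>i<Suc j. m (1 / 2^(i+1)) * ennreal (1/2))"
      by (rule member_le_sum) auto
    also have "\<dots> < \<infinity>" using sums I by (rule le_less_trans)
    finally show ?thesis by (auto simp: ennreal_mult_less_top)
  qed
  define W where "W j = enn2real (m (1 / 2^(j+1)))" for j :: nat
  have eW: "ennreal (W j) = m (1 / 2^(j+1))" for j using fin[of j] by (simp add: W_def less_top)
  show thesis
  proof (rule that[of W])
    show W0: "0 \<le> W j" for j by (simp add: W_def)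
    show "decseq W"
    proof (rule decseq_SucI)
      fix j
      have "(1::real) / 2^(Suc j+1) \<le> 1 / 2^(j+1)" by (intro divide_left_mono power_increasing) auto
      from mm[OF this] show "W (Suc j) \<le> W j" using W0 unfolding eW[symmetric] by (simp add: ennreal_le_iff)
    qed
    show "summable W"
    proof (rule summableI_nonneg_bounded[OF W0])
      fix n
      have "ennreal (\<Sum>j<n. W j * (1/2)) = (\<Sum>j<n. ennreal (W j * (1/2)))"
        by (rule sum_ennreal[symmetric]) (use W0 in simp)
      also have "\<dots> = (\<Sum>j<n. m (1 / 2^(j+1)) * ennreal (1/2))"
        unfolding eW[symmetric] by (intro sum.cong refl ennreal_mult) (use W0 in auto)
      also have "\<dots> \<le> ennreal (enn2real I)" using sums I by (simp add: less_top)
      finally have "(\<Sum>j<n. W j * (1/2)) \<le> enn2real I" by (simp add: ennreal_le_iff)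
      then show "(\<Sum>j<n. W j) \<le> 2 * enn2real I" by (simp flip: sum_divide_distrib)
    qed
    show "norm (f x - f y) \<le> W j" if "x \<in> S" "y \<in> S" "\<bar>x - y\<bar> \<le> 1 / 2^(j+1)" for x y j
    proof -
      have "ennreal (dist (f x) (f y)) \<le> ennreal (W j)"
        unfolding eW m_def by (rule dist_le_modulus_of_continuity) (use that in \<open>auto simp: dist_real_def\<close>)
      then show ?thesis using W0 by (simp add: ennreal_le_iff dist_norm)
    qed
  qed
qed

section \<open>From a regular arc to a graph with cusp conditions\<close>

lemma vector_derivative_increment_bound:
  fixes f f' :: "real \<Rightarrow> complex"
  assumes S: "convex S" and f: "\<And>t. t \<in> S \<Longrightarrow> (f has_vector_derivative f' t) (at t within S)"
    and B: "\<And>t. t \<in> S \<Longrightarrow> norm (f' t - v) \<le> B" and st: "s \<in> S" "t \<in> S"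
  shows "norm (f s - f t - of_real (s - t) * v) \<le> B * \<bar>s - t\<bar>"
proof -
  have "norm ((f s - s *\<^sub>R v) - (f t - t *\<^sub>R v)) \<le> B * norm (s - t)"
  proof (rule differentiable_bound[OF S _ _ st])
    fix x assume x: "x \<in> S"
    have "((\<lambda>x. f x - x *\<^sub>R v) has_vector_derivative f' x - 1 *\<^sub>R v) (at x within S)"
      by (rule has_vector_derivative_diff[OF f[OF x]]) (auto intro!: derivative_eq_intros)
    then show "((\<lambda>x. f x - x *\<^sub>R v) has_derivative (\<lambda>h. h *\<^sub>R (f' x - v))) (at x within S)"
      by (simp add: has_vector_derivative_def)
    show "onorm (\<lambda>h. h *\<^sub>R (f' x - v)) \<le> B"
      by (rule onorm_le) (use mult_right_mono[OF B[OF x] abs_ge_zero] in \<open>simp add: mult.commute\<close>)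
  qed
  moreover have "(f s - s *\<^sub>R v) - (f t - t *\<^sub>R v) = f s - f t - of_real (s - t) * v"
    by (simp add: scaleR_conv_of_real algebra_simps)
  ultimately show ?thesis by simp
qed

text \<open>The situation after a rigid motion: the boundary point is 0 and the tangent there is the
  positive real direction. The conditions \<open>on_arc\<close> and \<open>off_arc\<close> express
  the equality of boundary and arc through the open set D and connected sets missing the
  arc.\<close>

locale smooth_boundary_arc =
  fixes D N :: "complex set" and \<mu> \<mu>' :: "real \<Rightarrow> complex" and t0 \<nu> :: real and M :: "nat \<Rightarrow> real"
  assumes D: "open D" and N: "open N" "0 \<in> N" and arc: "arc \<mu>"
    and on_arc: "\<And>z. z \<in> N \<Longrightarrow> z \<in> path_image \<mu> \<Longrightarrow> z \<notin> D"
    and off_arc: "\<And>S. connected S \<Longrightarrow> S \<subseteq> N \<Longrightarrow> S \<inter> path_image \<mu> = {} \<Longrightarrow> S \<subseteq> D \<or> S \<inter> D = {}"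
    and t0: "0 < t0" "t0 < 1" "\<mu> t0 = 0" "\<mu>' t0 = of_real \<nu>" and \<nu>: "\<nu> > 0"
    and \<mu>: "\<And>t. t \<in> {0..1} \<Longrightarrow> (\<mu> has_vector_derivative \<mu>' t) (at t within {0..1})"
    and M: "\<And>j. 0 \<le> M j" "decseq M" "summable M"
      "\<And>x y j. x \<in> {0..1} \<Longrightarrow> y \<in> {0..1} \<Longrightarrow> \<bar>x - y\<bar> \<le> 1 / 2^(j+1) \<Longrightarrow> norm (\<mu>' x - \<mu>' y) \<le> M j"
    and side: "\<exists>e>0. \<forall>s\<in>{0<..<e}. \<i> * of_real (s * \<nu>) \<in> D \<and> - (\<i> * of_real (s * \<nu>)) \<notin> D"
begin

lemma increment_bound:
  assumes "convex S" "S \<subseteq> {0..1}" "\<And>t. t \<in> S \<Longrightarrow> norm (\<mu>' t - v) \<le> B" "s \<in> S" "t \<in> S"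
  shows "norm (\<mu> s - \<mu> t - of_real (s - t) * v) \<le> B * \<bar>s - t\<bar>"
  using assms by (intro vector_derivative_increment_bound[of S \<mu> \<mu>'])
    (auto intro: has_vector_derivative_within_subset[OF \<mu>])

lemma nearly_straight:
  obtains \<delta> where "\<delta> > 0" "{t0 - \<delta>..t0 + \<delta>} \<subseteq> {0..1}" "\<And>t. \<bar>t - t0\<bar> \<le> \<delta> \<Longrightarrow> norm (\<mu>' t - of_real \<nu>) \<le> \<nu> / 16"
proof -
  have "eventually (\<lambda>j. M j < \<nu> / 16) sequentially"
    using summable_LIMSEQ_zero[OF M(3)] \<nu> by (intro order_tendstoD(2)[of _ 0]) auto
  moreover have "(\<lambda>j. 1 / 2^(j+1) :: real) \<longlonglongrightarrow> 0"
    using LIMSEQ_ignore_initial_segment[OF LIMSEQ_power_zero[of "1/2::real"], of 1] by (simp add: power_one_over)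
  then have "eventually (\<lambda>j. 1 / 2^(j+1) < min t0 (1 - t0)) sequentially"
    by (rule order_tendstoD(2)) (use t0 in auto)
  ultimately have "eventually (\<lambda>j. M j < \<nu> / 16 \<and> 1 / 2^(j+1) < min t0 (1 - t0)) sequentially" by (rule eventually_conj)
  then obtain j where j: "M j < \<nu> / 16" "1 / 2^(j+1) < min t0 (1 - t0)" unfolding eventually_sequentially by blast
  show thesis
  proof (rule that[of "1 / 2^(j+1)"])
    show sub: "{t0 - 1 / 2^(j+1)..t0 + 1 / 2^(j+1)} \<subseteq> {0..1}" using j(2) by auto
    show "norm (\<mu>' t - of_real \<nu>) \<le> \<nu> / 16" if "\<bar>t - t0\<bar> \<le> 1 / 2^(j+1)" for t
    proof -
      have "t \<in> {t0 - 1 / 2^(j+1)..t0 + 1 / 2^(j+1)}" using that by (auto simp: abs_le_iff)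
      then have "norm (\<mu>' t - \<mu>' t0) \<le> M j" using that t0 sub by (intro M(4)) auto
      then show ?thesis using j(1) t0(4) by simp
    qed
  qed simp
qed

lemma exists_local_graph: "\<exists>g a \<rho> T c. local_graph D g a \<rho> T c"
proof -
  obtain \<delta> where \<delta>: "\<delta> > 0" "{t0 - \<delta>..t0 + \<delta>} \<subseteq> {0..1}" "\<And>t. \<bar>t - t0\<bar> \<le> \<delta> \<Longrightarrow> norm (\<mu>' t - of_real \<nu>) \<le> \<nu> / 16"
    using nearly_straight by blast
  define I where "I = {t0 - \<delta>..t0 + \<delta>}"
  have I: "t \<in> I \<longleftrightarrow> \<bar>t - t0\<bar> \<le> \<delta>" "t \<in> I \<Longrightarrow> t \<in> {0..1}" for t using \<delta>(2) by (auto simp: I_def abs_le_iff)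
  have inc: "norm (\<mu> s - \<mu> t - of_real (s - t) * of_real \<nu>) \<le> \<nu> / 16 * \<bar>s - t\<bar>" if "s \<in> I" "t \<in> I" for s t
  proof (rule increment_bound[of I])
    show "convex I" by (simp add: I_def)
    show "I \<subseteq> {0..1}" using I(2) by blast
    show "norm (\<mu>' t - of_real \<nu>) \<le> \<nu> / 16" if "t \<in> I" for t using that I(1) \<delta>(3) by blast
  qed (use that in auto)
  have inc_Re: "\<bar>Re (\<mu> s) - Re (\<mu> t) - (s - t) * \<nu>\<bar> \<le> \<nu> / 16 * \<bar>s - t\<bar>" if "s \<in> I" "t \<in> I" for s t
    using abs_Re_le_cmod[of "\<mu> s - \<mu> t - of_real (s - t) * of_real \<nu>"] inc[OF that] by simp
  have inc_Im: "\<bar>Im (\<mu> s) - Im (\<mu> t)\<bar> \<le> \<nu> / 16 * \<bar>s - t\<bar>" if "s \<in> I" "t \<in> I" for s t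
    using abs_Im_le_cmod[of "\<mu> s - \<mu> t - of_real (s - t) * of_real \<nu>"] inc[OF that] by simp
  have lower: "15/16 * (\<nu> * \<bar>s - t\<bar>) \<le> \<bar>Re (\<mu> s) - Re (\<mu> t)\<bar>" if "s \<in> I" "t \<in> I" for s t
  proof -
    have "\<bar>(s - t) * \<nu>\<bar> = \<nu> * \<bar>s - t\<bar>" using \<nu> by (simp add: abs_mult)
    then show ?thesis using inc_Re[OF that] by linarith
  qed
  have inj: "s = t" if "s \<in> I" "t \<in> I" "Re (\<mu> s) = Re (\<mu> t)" for s t
    using lower[OF that(1,2)] that(3) \<nu> by (simp add: mult_le_0_iff)
  have cont: "continuous_on {0..1} \<mu>" using arc by (simp add: arc_def path_def)
  have t0I: "t0 \<in> I" "t0 - \<delta> \<in> I" "t0 + \<delta> \<in> I" using \<delta>(1) by (auto simp: I_def)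
  have surj: "\<exists>t\<in>I. Re (\<mu> t) = x" if "\<bar>x\<bar> \<le> 15/16 * (\<nu> * \<delta>)" for x
  proof -
    have "Re (\<mu> (t0 + \<delta>)) \<ge> 15/16 * (\<nu> * \<delta>)" "Re (\<mu> (t0 - \<delta>)) \<le> - (15/16 * (\<nu> * \<delta>))"
    proof -
      have "\<bar>Re (\<mu> (t0 + \<delta>)) - \<nu> * \<delta>\<bar> \<le> (\<nu> * \<delta>) / 16" "\<bar>Re (\<mu> (t0 - \<delta>)) + \<nu> * \<delta>\<bar> \<le> (\<nu> * \<delta>) / 16"
        using inc_Re[OF t0I(3,1)] inc_Re[OF t0I(2,1)] t0(3) \<delta>(1) by (simp_all add: mult.commute)
      then show "Re (\<mu> (t0 + \<delta>)) \<ge> 15/16 * (\<nu> * \<delta>)" "Re (\<mu> (t0 - \<delta>)) \<le> - (15/16 * (\<nu> * \<delta>))" unfolding abs_le_iff by argo+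
    qed
    then have "\<exists>t\<ge>t0 - \<delta>. t \<le> t0 + \<delta> \<and> Re (\<mu> t) = x"
      using that \<delta> cont by (intro IVT') (auto intro!: continuous_intros intro: continuous_on_subset)
    then show ?thesis by (auto simp: I_def)
  qed
  \<comment> \<open>The arc is simple, so its part outside I has positive distance from 0. In a
    small box the arc is therefore nothing but the graph over the real axis.\<close>
  define J where "J = {0..1} - {t0 - \<delta><..<t0 + \<delta>}"
  have "compact (\<mu> ` J)"
  proof (rule compact_continuous_image)
    show "continuous_on J \<mu>" using cont by (rule continuous_on_subset) (simp add: J_def)
    show "compact J" unfolding J_def by (intro compact_diff) auto
  qed
  moreover have "0 \<notin> \<mu> ` J"
  proof
    assume "0 \<in> \<mu> ` J"
    then obtain t where t: "t \<in> J" "\<mu> t = \<mu> t0" using t0(3) by auto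
    then have "t = t0" using inj_onD[of \<mu> "{0..1}" t t0] arc t0(1,2) by (auto simp: arc_def J_def)
    then show False using t(1) \<delta>(1) by (simp add: J_def)
  qed
  ultimately have "open (- (\<mu> ` J) \<inter> N)" "0 \<in> - (\<mu> ` J) \<inter> N" using N by (auto simp: compact_imp_closed open_Compl)
  then obtain d where d: "d > 0" "ball 0 d \<subseteq> - (\<mu> ` J) \<inter> N" using open_contains_ball by blast
  \<comment> \<open>The first bound puts [-a, a] into the projection of the arc over I; the second
    puts the box into the ball of radius d, as |z| \<le> 2 a there.\<close>
  define a where "a = min (15/16 * (\<nu> * \<delta>)) (d / 4)"
  have a: "a > 0" "a \<le> 15/16 * (\<nu> * \<delta>)" "a \<le> d / 4" using \<nu> \<delta>(1) d(1) by (auto simp: a_def)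
  define s where "s x = (SOME t. t \<in> I \<and> Re (\<mu> t) = x)" for x
  have s: "s x \<in> I" "Re (\<mu> (s x)) = x" if "\<bar>x\<bar> \<le> a" for x
  proof -
    have "\<exists>t. t \<in> I \<and> Re (\<mu> t) = x" using surj[of x] that a(2) by fastforce
    then have "s x \<in> I \<and> Re (\<mu> (s x)) = x" unfolding s_def by (rule someI_ex)
    then show "s x \<in> I" "Re (\<mu> (s x)) = x" by auto
  qed
  have s0: "s 0 = t0" using inj[OF s(1) t0I(1), of 0] s(2)[of 0] a(1) t0(3) by simp
  define g where "g x = Im (\<mu> (s x))" for x
  have \<mu>s: "\<mu> (s x) = Complex x (g x)" if "\<bar>x\<bar> \<le> a" for x using s(2)[OF that] by (simp add: g_def complex_eq_iff)
  have g0: "g 0 = 0" using s0 t0(3) by (simp add: g_def)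
  have gL: "\<bar>g x - g y\<bar> \<le> \<bar>x - y\<bar> / 4" if "\<bar>x\<bar> \<le> a" "\<bar>y\<bar> \<le> a" for x y
  proof -
    have "15/16 * (\<nu> * \<bar>s x - s y\<bar>) \<le> \<bar>x - y\<bar>" using lower[OF s(1)[OF that(1)] s(1)[OF that(2)]] s(2) that by simp
    moreover have "\<bar>g x - g y\<bar> \<le> \<nu> / 16 * \<bar>s x - s y\<bar>" unfolding g_def by (rule inc_Im[OF s(1)[OF that(1)] s(1)[OF that(2)]])
    moreover have "\<nu> / 16 * \<bar>s x - s y\<bar> = (\<nu> * \<bar>s x - s y\<bar>) / 16" by simp
    ultimately show ?thesis using abs_ge_zero[of "x - y"] by argo
  qed
  have ga: "\<bar>g x\<bar> \<le> a / 4" if "\<bar>x\<bar> \<le> a" for x using gL[OF that, of 0] g0 that a(1) by simp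
  have boxN: "z \<in> N \<and> (z \<in> path_image \<mu> \<longrightarrow> Im z = g (Re z))" if z: "\<bar>Re z\<bar> \<le> a" "\<bar>Im z\<bar> \<le> a" for z
  proof -
    have "norm z < d" using cmod_le[of z] z a d(1) by linarith
    then have zb: "z \<in> - (\<mu> ` J) \<inter> N" using d(2) by auto
    have "Im z = g (Re z)" if zp: "z \<in> path_image \<mu>"
    proof -
      obtain t where t: "t \<in> {0..1}" "z = \<mu> t" using zp by (auto simp: path_image_def)
      then have "t \<in> I" using zb by (auto simp: J_def I_def)
      then have "s (Re z) = t" using inj s z(1) t(2) by blast
      then show ?thesis using t(2) by (simp add: g_def)
    qed
    then show ?thesis using zb by blast
  qed
  \<comment> \<open>A point of the box off the graph is connected to \<sigma> i a without meeting
    the arc: vertically to the edge of the box, then horizontally. So membership in D is constant on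
    each side.\<close>
  have same_side: "z \<in> D \<longleftrightarrow> \<i> * of_real (\<sigma> * a) \<in> D"
    if \<sigma>: "\<sigma> = 1 \<or> \<sigma> = -1" and z: "\<bar>Re z\<bar> \<le> a" "\<bar>Im z\<bar> \<le> a" "0 < \<sigma> * (Im z - g (Re z))" for \<sigma> z
  proof -
    define Q where "Q = {z. \<bar>Re z\<bar> \<le> a \<and> \<bar>Im z\<bar> \<le> a \<and> 0 < \<sigma> * (Im z - g (Re z))}"
    have QN: "Q \<subseteq> N" "Q \<inter> path_image \<mu> = {}" using boxN by (force simp: Q_def)+
    have link: "u \<in> D \<longleftrightarrow> w \<in> D" if "closed_segment u w \<subseteq> Q" for u w
      using off_arc[of "closed_segment u w"] that QN ends_in_segment[of u w] by blast
    define z1 where "z1 = Complex (Re z) (\<sigma> * a)"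
    have top: "Complex x (\<sigma> * a) \<in> Q" if "\<bar>x\<bar> \<le> a" for x
    proof -
      have "\<sigma> * (\<sigma> * a - g x) \<ge> a - a / 4" using \<sigma> ga[OF that] by (auto simp: abs_le_iff)
      then show ?thesis using that \<sigma> a(1) by (auto simp: Q_def)
    qed
    have "closed_segment z z1 \<subseteq> Q"
    proof
      fix u assume "u \<in> closed_segment z z1"
      then obtain r where r: "0 \<le> r" "r \<le> 1" "u = (1 - r) *\<^sub>R z + r *\<^sub>R z1" by (auto simp: closed_segment_def)
      have Ru: "Re u = Re z" "Im u = (1 - r) * Im z + r * (\<sigma> * a)" by (simp_all add: r(3) z1_def algebra_simps)
      have "\<bar>Im u\<bar> \<le> (1 - r) * \<bar>Im z\<bar> + r * \<bar>\<sigma> * a\<bar>"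
        unfolding Ru using abs_triangle_ineq[of "(1 - r) * Im z" "r * (\<sigma> * a)"] r by (simp add: abs_mult)
      also have "\<dots> \<le> (1 - r) * a + r * a" using r z(2) \<sigma> a(1) by (intro add_mono mult_left_mono) auto
      finally have i: "\<bar>Im u\<bar> \<le> a" by (simp add: algebra_simps)
      have t1: "\<sigma> * (\<sigma> * a - g (Re z)) > 0" using top[OF z(1)] by (simp add: Q_def)
      have "\<sigma> * (Im u - g (Re z)) = (1 - r) * (\<sigma> * (Im z - g (Re z))) + r * (\<sigma> * (\<sigma> * a - g (Re z)))"
        unfolding Ru by (simp add: algebra_simps)
      moreover have "\<dots> > 0"
      proof (cases "r = 0")
        case False
        have "0 \<le> (1 - r) * (\<sigma> * (Im z - g (Re z)))" using r(2) z(3) by (intro mult_nonneg_nonneg[of "1 - r"]) auto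
        moreover have "0 < r * (\<sigma> * (\<sigma> * a - g (Re z)))" using False r(1) t1 by (intro mult_pos_pos[of r]) auto
        ultimately show ?thesis by (rule add_nonneg_pos)
      qed (use z(3) in simp)
      ultimately show "u \<in> Q" using i z(1) Ru(1) by (simp add: Q_def)
    qed
    moreover have "closed_segment z1 (Complex 0 (\<sigma> * a)) \<subseteq> Q"
    proof
      fix u assume "u \<in> closed_segment z1 (Complex 0 (\<sigma> * a))"
      then obtain r where r: "0 \<le> r" "r \<le> 1" "u = (1 - r) *\<^sub>R z1 + r *\<^sub>R Complex 0 (\<sigma> * a)" by (auto simp: closed_segment_def)
      have "u = Complex ((1 - r) * Re z) (\<sigma> * a)" by (simp add: r(3) z1_def complex_eq_iff algebra_simps)
      moreover have "\<bar>(1 - r) * Re z\<bar> \<le> 1 * a" unfolding abs_mult using r z(1) by (intro mult_mono) auto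
      ultimately show "u \<in> Q" using top by simp
    qed
    ultimately have "z \<in> D \<longleftrightarrow> Complex 0 (\<sigma> * a) \<in> D" using link by blast
    moreover have "Complex 0 (\<sigma> * a) = \<i> * of_real (\<sigma> * a)" by (simp add: complex_eq_iff)
    ultimately show ?thesis by simp
  qed
  \<comment> \<open>The one-sidedness hypothesis, evaluated at one small parameter on the normal at
    0, decides which side of the graph is D.\<close>
  obtain e where e: "e > 0" "\<And>s. s \<in> {0<..<e} \<Longrightarrow> \<i> * of_real (s * \<nu>) \<in> D \<and> - (\<i> * of_real (s * \<nu>)) \<notin> D" using side by blast
  define s1 where "s1 = min (e / 2) (a / \<nu>)"
  have s1: "0 < s1" "s1 < e" "s1 * \<nu> \<le> a" "0 < s1 * \<nu>"
  proof -
    show 1: "0 < s1" "s1 < e" using e(1) a(1) \<nu> by (auto simp: s1_def)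
    have "s1 * \<nu> \<le> a / \<nu> * \<nu>" using \<nu> by (intro mult_right_mono) (auto simp: s1_def)
    then show "s1 * \<nu> \<le> a" using \<nu> by simp
    show "0 < s1 * \<nu>" using 1 \<nu> by simp
  qed
  have above: "\<i> * of_real (1 * a) \<in> D"
    using same_side[of 1 "\<i> * of_real (s1 * \<nu>)"] e(2)[of s1] s1 g0 a(1) by simp
  have below: "\<i> * of_real (-1 * a) \<notin> D"
    using same_side[of "-1" "- (\<i> * of_real (s1 * \<nu>))"] e(2)[of s1] s1 g0 a(1) by simp
  have box: "z \<in> D \<longleftrightarrow> g (Re z) < Im z" if z: "\<bar>Re z\<bar> \<le> a" "\<bar>Im z\<bar> \<le> a" for z
  proof -
    consider "g (Re z) < Im z" | "g (Re z) = Im z" | "Im z < g (Re z)" by linarith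
    then show ?thesis
    proof cases
      case 1
      then show ?thesis using same_side[of 1 z] z above by simp
    next
      case 2
      then have "z = \<mu> (s (Re z))" using \<mu>s[OF z(1)] by (simp add: complex_eq_iff)
      moreover have "\<mu> (s (Re z)) \<in> path_image \<mu>" using I(2)[OF s(1)[OF z(1)]] by (simp add: path_image_def)
      ultimately show ?thesis using on_arc boxN[OF z] 2 by simp
    next
      case 3
      then show ?thesis using same_side[of "-1" z] z below by simp
    qed
  qed
  define T where "T x = sgn (\<mu>' (s x))" for x
  have \<mu>': "15/16 * \<nu> \<le> norm (\<mu>' (s x))" "norm (\<mu>' (s x) - of_real \<nu>) \<le> \<nu> / 16" if "\<bar>x\<bar> \<le> a" for x
  proof -
    show 1: "norm (\<mu>' (s x) - of_real \<nu>) \<le> \<nu> / 16" using \<delta>(3) s(1)[OF that] I(1) by blast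
    show "15/16 * \<nu> \<le> norm (\<mu>' (s x))"
      using norm_triangle_ineq4[of "\<mu>' (s x)" "\<mu>' (s x) - of_real \<nu>"] 1 \<nu> by simp
  qed
  have T\<mu>: "\<mu>' (s x) = of_real (norm (\<mu>' (s x))) * T x" for x
    by (cases "\<mu>' (s x) = 0") (simp_all add: T_def sgn_div_norm scaleR_conv_of_real)
  have T1: "norm (T x) = 1" if "\<bar>x\<bar> \<le> a" for x using \<mu>'(1)[OF that] \<nu> by (auto simp: T_def norm_sgn)
  have T2: "norm (T x - 1) \<le> 1/4" if x: "\<bar>x\<bar> \<le> a" for x
  proof -
    define n where "n = norm (\<mu>' (s x))"
    have n: "15/16 * \<nu> \<le> n" "\<bar>n - \<nu>\<bar> \<le> \<nu> / 16"
      using \<mu>'[OF x] norm_triangle_ineq3[of "\<mu>' (s x)" "of_real \<nu>"] \<nu> by (auto simp: n_def)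
    have "of_real n * (T x - 1) = (\<mu>' (s x) - of_real \<nu>) - of_real (n - \<nu>)"
      using T\<mu>[of x] by (simp add: n_def algebra_simps)
    then have "norm (of_real n * (T x - 1)) \<le> norm (\<mu>' (s x) - of_real \<nu>) + norm (of_real (n - \<nu>) :: complex)"
      by (metis norm_triangle_ineq4)
    also have "\<dots> \<le> \<nu> / 16 + \<nu> / 16" using \<mu>'(2)[OF x] n(2) by (intro add_mono) (auto simp del: of_real_diff)
    finally have "n * norm (T x - 1) \<le> \<nu> / 8" by (simp add: norm_mult n_def)
    moreover have "15/16 * \<nu> * norm (T x - 1) \<le> n * norm (T x - 1)" using n(1) by (rule mult_right_mono) simp
    ultimately have "\<nu> * (15/16 * norm (T x - 1)) \<le> \<nu> * (1/8)" by simp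
    then have "15/16 * norm (T x - 1) \<le> 1/8" using \<nu> by (simp only: mult_le_cancel_left_pos)
    then show ?thesis by simp
  qed
  \<comment> \<open>Converts distances in the plane into parameter lengths: \<open>lower\<close>
    gives the factor 16 / (15 \<nu>), rounded up to 2 / \<nu>.\<close>
  define k where "k = 2 / \<nu>"
  have k: "k > 0" using \<nu> by (simp add: k_def)
  \<comment> \<open>Here h is the height of z above the graph at Re z. Multiplying by the conjugate
    of T x makes the tangential increment real, so Im \<zeta> and h * Re (T x) differ only by the
    deviation E of the arc from its tangent.\<close>
  have cusp: "\<exists>h. (z \<in> D \<longleftrightarrow> 0 < h) \<and> \<bar>Im \<zeta> - h * Re (T x)\<bar> \<le> k * norm \<zeta> * M j"
    if x: "\<bar>x\<bar> \<le> a / 2" and \<zeta>: "norm \<zeta> \<le> a / 16" "k * norm \<zeta> \<le> 1 / 2^(j+1)" and z: "z = Complex x (g x) + T x * \<zeta>" for x \<zeta> j z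
  proof -
    have xa: "\<bar>x\<bar> \<le> a" using x a(1) by simp
    have nT\<zeta>: "norm (T x * \<zeta>) = norm \<zeta>" by (simp add: norm_mult T1[OF xa])
    have Re_z: "Re z - x = Re (T x * \<zeta>)" "Im z - g x = Im (T x * \<zeta>)" unfolding z by simp_all
    have Re_z_le: "\<bar>Re z - x\<bar> \<le> norm \<zeta>" unfolding Re_z nT\<zeta>[symmetric] by (rule abs_Re_le_cmod)
    have Im_z_le: "\<bar>Im z - g x\<bar> \<le> norm \<zeta>" unfolding Re_z nT\<zeta>[symmetric] by (rule abs_Im_le_cmod)
    have za: "\<bar>Re z\<bar> \<le> a" "\<bar>Im z\<bar> \<le> a" using Re_z_le Im_z_le x ga[OF xa] \<zeta>(1) a(1) by linarith+
    define h where "h = Im z - g (Re z)"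
    define t where "t = s (Re z)"
    have t: "t \<in> I" "\<mu> t = Complex (Re z) (g (Re z))" using s(1)[OF za(1)] \<mu>s[OF za(1)] by (auto simp: t_def)
    have sx: "s x \<in> I" "\<mu> (s x) = Complex x (g x)" using s(1)[OF xa] \<mu>s[OF xa] by auto
    have "15/16 * (\<nu> * \<bar>t - s x\<bar>) \<le> norm \<zeta>" using lower[OF t(1) sx(1)] Re_z_le by (simp add: t(2) sx(2))
    then have "\<nu> * \<bar>t - s x\<bar> \<le> 2 * norm \<zeta>" using norm_ge_zero[of \<zeta>] by linarith
    then have ts: "\<bar>t - s x\<bar> \<le> k * norm \<zeta>" using \<nu> by (simp add: k_def field_simps)
    define E where "E = \<mu> t - \<mu> (s x) - of_real (t - s x) * \<mu>' (s x)"
    have E: "norm E \<le> M j * \<bar>t - s x\<bar>"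
      unfolding E_def
    proof (rule increment_bound[of "closed_segment (s x) t"])
      have sub: "closed_segment (s x) t \<subseteq> I" using sx(1) t(1) by (intro closed_segment_subset) (auto simp: I_def)
      then show "closed_segment (s x) t \<subseteq> {0..1}" using I(2) by blast
      show "norm (\<mu>' u - \<mu>' (s x)) \<le> M j" if "u \<in> closed_segment (s x) t" for u
      proof (rule M(4))
        show "u \<in> {0..1}" "s x \<in> {0..1}" using sub that I(2) sx(1) by blast+
        have "\<bar>u - s x\<bar> \<le> \<bar>t - s x\<bar>" using that by (auto simp: closed_segment_eq_real_ivl split: if_splits)
        then show "\<bar>u - s x\<bar> \<le> 1 / 2^(j+1)" using ts \<zeta>(2) by linarith
      qed
    qed auto
    have TT: "T x * cnj (T x) = 1" using T1[OF xa] complex_norm_square[of "T x"] by simp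
    have zt: "z = \<mu> t + \<i> * of_real h" by (simp add: t(2) h_def complex_eq_iff)
    have "T x * \<zeta> = of_real (t - s x) * \<mu>' (s x) + E + \<i> * of_real h"
    proof -
      have "T x * \<zeta> = \<mu> t + \<i> * of_real h - Complex x (g x)" using zt z by (metis add_diff_cancel_left')
      then show ?thesis by (simp add: E_def sx(2))
    qed
    also have "\<dots> = of_real ((t - s x) * norm (\<mu>' (s x))) * T x + E + \<i> * of_real h"
      by (subst T\<mu>) (simp add: algebra_simps)
    finally have "cnj (T x) * (T x * \<zeta>) = cnj (T x) * (of_real ((t - s x) * norm (\<mu>' (s x))) * T x + E + \<i> * of_real h)" by simp
    then have "(T x * cnj (T x)) * \<zeta> = of_real ((t - s x) * norm (\<mu>' (s x))) * (T x * cnj (T x)) + cnj (T x) * E + cnj (T x) * (\<i> * of_real h)"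
      by (simp only: algebra_simps)
    then have \<zeta>eq: "\<zeta> = of_real ((t - s x) * norm (\<mu>' (s x))) + cnj (T x) * E + cnj (T x) * (\<i> * of_real h)"
      unfolding TT by simp
    have "Im (of_real ((t - s x) * norm (\<mu>' (s x))) :: complex) = 0" by (rule Im_complex_of_real)
    moreover have "Im (cnj (T x) * (\<i> * of_real h)) = h * Re (T x)" by simp
    ultimately have "Im \<zeta> - h * Re (T x) = Im (cnj (T x) * E)"
      using arg_cong[OF \<zeta>eq, of Im] unfolding plus_complex.sel by linarith
    then have "\<bar>Im \<zeta> - h * Re (T x)\<bar> \<le> norm (cnj (T x) * E)" using abs_Im_le_cmod by metis
    also have "\<dots> = norm E" by (simp add: norm_mult T1[OF xa])
    also have "\<dots> \<le> M j * (k * norm \<zeta>)" using E mult_left_mono[OF ts M(1)[of j]] by linarith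
    finally have "\<bar>Im \<zeta> - h * Re (T x)\<bar> \<le> k * norm \<zeta> * M j" by (simp add: mult.commute)
    moreover have "z \<in> D \<longleftrightarrow> 0 < h" using box[OF za] by (simp add: h_def)
    ultimately show ?thesis by blast
  qed
  \<comment> \<open>The tail of M is made so small that 200 k times its sum is at most 1/8; the
    geometric part of c sums to another 1/8.\<close>
  obtain n0 where n0: "\<And>n. n \<ge> n0 \<Longrightarrow> norm (\<Sum>i. M (i + n)) < 1 / (1600 * k)"
    using suminf_exist_split[of "1 / (1600 * k)" M] M(3) k by auto
  have "(\<lambda>j. 1 / 2^(j+2) :: real) \<longlonglongrightarrow> 0"
    using LIMSEQ_ignore_initial_segment[OF LIMSEQ_power_zero[of "1/2::real"], of 2] by (simp add: power_one_over)
  then have "eventually (\<lambda>j. 1 / 2^(j+2) < k * (a / 16)) sequentially"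
    by (rule order_tendstoD(2)) (use k a(1) in auto)
  then obtain n1 where n1: "\<And>n. n \<ge> n1 \<Longrightarrow> 1 / 2^(n+2) < k * (a / 16)" unfolding eventually_sequentially by blast
  define n where "n = max n0 n1"
  define \<rho> where "\<rho> = 1 / 2^(n+2) / k"
  \<comment> \<open>200 k M is the slope bound \<open>k * M\<close> in the scaling c / 200 of
    \<open>local_graph\<close>. The geometric term makes c positive and the slope estimate
    strict.\<close>
  define c where "c j = 200 * k * M (j + n) + (1/2)^j / 16" for j
  have \<rho>: "0 < \<rho>" "\<rho> \<le> a / 16" using k n1[of n] by (auto simp: \<rho>_def n_def field_simps)
  have c_pos: "0 < c j" for j using k M(1)[of "j + n"] by (auto simp: c_def intro!: add_nonneg_pos)
  have sumM: "summable (\<lambda>j. M (j + n))" using M(3) by (simp add: summable_iff_shift)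
  have key: "\<exists>h. (Complex x (g x) + T x * \<zeta> \<in> D \<longleftrightarrow> 0 < h) \<and> \<bar>Im \<zeta> - h * Re (T x)\<bar> < norm \<zeta> * (c (j+1) / 200) \<and> Re (T x) > 0"
    if x: "\<bar>x\<bar> \<le> a / 2" and \<zeta>: "\<rho> / 2^(j+1) < norm \<zeta>" "norm \<zeta> \<le> \<rho> / 2^j" for x \<zeta> j
  proof -
    have "0 < \<rho> / 2^(j+1)" using \<rho>(1) by simp
    then have \<zeta>0: "0 < norm \<zeta>" using \<zeta>(1) by linarith
    have "\<rho> / 2^j \<le> \<rho> / 1" using \<rho>(1) by (intro divide_left_mono) auto
    then have \<zeta>a: "norm \<zeta> \<le> a / 16" using \<zeta>(2) \<rho>(2) by linarith
    have "k * norm \<zeta> \<le> k * (\<rho> / 2^j)" using \<zeta>(2) k by (intro mult_left_mono) auto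
    \<comment> \<open>The choice \<rho> = 2^(-n-2) / k is made here: distance \<rho> / 2^j then
      corresponds to the modulus with index j + 1 + n, which is bounded by c (j + 1).\<close>
    also have "\<dots> = 1 / 2^((j+1+n)+1)" using k by (simp add: \<rho>_def power_add)
    finally have k\<zeta>: "k * norm \<zeta> \<le> 1 / 2^((j+1+n)+1)" .
    obtain h where h: "Complex x (g x) + T x * \<zeta> \<in> D \<longleftrightarrow> 0 < h" "\<bar>Im \<zeta> - h * Re (T x)\<bar> \<le> k * norm \<zeta> * M (j+1+n)"
      using cusp[OF x \<zeta>a k\<zeta> refl] by blast
    have "k * M (j+1+n) < c (j+1) / 200" by (simp add: c_def)
    then have "norm \<zeta> * (k * M (j+1+n)) < norm \<zeta> * (c (j+1) / 200)" using \<zeta>0 by (rule mult_strict_left_mono)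
    moreover have "k * norm \<zeta> * M (j+1+n) = norm \<zeta> * (k * M (j+1+n))" by simp
    moreover have "\<bar>x\<bar> \<le> a" using x a(1) by simp
    then have "Re (T x) > 0" using abs_Re_le_cmod[of "T x - 1"] T2[of x] by (simp add: abs_le_iff)
    ultimately show ?thesis using h by (metis order_le_less_trans)
  qed
  have "local_graph D g a \<rho> T c"
  proof
    show "Complex x y \<in> D \<longleftrightarrow> g x < y" if "\<bar>x\<bar> \<le> a" "\<bar>y\<bar> \<le> a" for x y using box[of "Complex x y"] that by simp
    show "norm (T x) = 1" "norm (T x - 1) \<le> 1/4" if "\<bar>x\<bar> \<le> a / 2" for x using T1 T2 that a(1) by auto
    show "decseq c"
    proof (rule decseq_SucI)
      fix j
      have "M (Suc j + n) \<le> M (j + n)" using M(2) by (rule decseqD) simp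
      then have "200 * k * M (Suc j + n) \<le> 200 * k * M (j + n)" using k by (intro mult_left_mono) auto
      then show "c (Suc j) \<le> c j" unfolding c_def by (rule add_mono) simp
    qed
    have s1: "summable (\<lambda>j. 200 * k * M (j + n))" using sumM by (rule summable_mult)
    have s2: "(\<lambda>j. (1/2)^j / 16 :: real) sums (2 / 16)"
      using geometric_sums[of "1/2::real"] by (intro sums_divide) simp
    show "summable c" unfolding c_def[abs_def] using s1 sums_summable[OF s2] by (rule summable_add)
    have "suminf c = 200 * k * (\<Sum>j. M (j + n)) + 2 / 16"
      unfolding c_def[abs_def] suminf_add[OF s1 sums_summable[OF s2], symmetric] sums_unique[OF s2, symmetric]
      using suminf_mult[OF sumM] by simp
    moreover have "(\<Sum>j. M (j + n)) < 1 / (1600 * k)" using n0[of n] by (simp add: n_def abs_less_iff)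
    then have "200 * k * (\<Sum>j. M (j + n)) \<le> 200 * k * (1 / (1600 * k))" using k by (intro mult_left_mono) auto
    ultimately show "suminf c \<le> 1/4" using k by simp
    show "Complex x (g x) + T x * \<zeta> \<in> D"
      if x: "\<bar>x\<bar> \<le> a / 2" "\<rho> / 2^(j+1) < norm \<zeta>" "norm \<zeta> \<le> \<rho> / 2^j" and i: "norm \<zeta> * (c (j+1) / 200) \<le> Im \<zeta>" for x \<zeta> j
    proof -
      obtain h where h: "Complex x (g x) + T x * \<zeta> \<in> D \<longleftrightarrow> 0 < h" "\<bar>Im \<zeta> - h * Re (T x)\<bar> < norm \<zeta> * (c (j+1) / 200)" "Re (T x) > 0"
        using key[OF x] by blast
      have "h * Re (T x) > 0" using h(2) i by linarith
      then show ?thesis using h(1,3) by (simp add: zero_less_mult_iff)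
    qed
    show "Complex x (g x) + T x * \<zeta> \<notin> D"
      if x: "\<bar>x\<bar> \<le> a / 2" "\<rho> / 2^(j+1) < norm \<zeta>" "norm \<zeta> \<le> \<rho> / 2^j" and i: "Im \<zeta> \<le> - norm \<zeta> * (c (j+1) / 200)" for x \<zeta> j
    proof -
      obtain h where h: "Complex x (g x) + T x * \<zeta> \<in> D \<longleftrightarrow> 0 < h" "\<bar>Im \<zeta> - h * Re (T x)\<bar> < norm \<zeta> * (c (j+1) / 200)" "Re (T x) > 0"
        using key[OF x] by blast
      have "h * Re (T x) < 0" using h(2) i by linarith
      then show ?thesis using h(1,3) by (simp add: mult_less_0_iff)
    qed
  qed (use D a(1) g0 gL \<rho> c_pos in auto)
  then show ?thesis by blast
qed

end

text \<open>The rigid motion \<phi> takes 0 to p and the real direction to the tangent at p. The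
  chart is found for the preimage of D under \<phi> and carried back; as \<phi> and \<psi> are
  isometries, the constants r and L are unchanged.\<close>

lemma boundary_chart_at_dini_smooth_point:
  assumes D: "open D" and p: "dini_smooth_boundary_point D p"
  obtains U \<Psi> g r L where "p \<in> U" "boundary_chart D U \<Psi> g r L"
proof -
  obtain N \<gamma> \<gamma>' where N: "open N" "p \<in> N" and arc: "arc \<gamma>" and p\<gamma>: "p \<in> \<gamma> ` {0<..<1}"
    and fr: "frontier D \<inter> N = path_image \<gamma> \<inter> N"
    and \<gamma>: "\<And>t. t \<in> {0..1} \<Longrightarrow> (\<gamma> has_vector_derivative \<gamma>' t) (at t within {0..1}) \<and> \<gamma>' t \<noteq> 0"
    and dini: "dini_continuous_on {0..1} \<gamma>'"
    and side: "\<And>t. t \<in> {0<..<1} \<Longrightarrow> \<gamma> t \<in> N \<Longrightarrow>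
        \<exists>e>0. \<forall>s\<in>{0<..<e}. \<gamma> t + of_real s * (\<i> * \<gamma>' t) \<in> D \<and> \<gamma> t - of_real s * (\<i> * \<gamma>' t) \<notin> D"
    using p unfolding dini_smooth_boundary_point_def by blast
  obtain t0 where t0: "0 < t0" "t0 < 1" "\<gamma> t0 = p" using p\<gamma> by auto
  obtain M where M: "\<And>j. 0 \<le> M j" "decseq M" "summable M"
    "\<And>x y j. x \<in> {0..1} \<Longrightarrow> y \<in> {0..1} \<Longrightarrow> \<bar>x - y\<bar> \<le> 1 / 2^(j+1) \<Longrightarrow> norm (\<gamma>' x - \<gamma>' y) \<le> M j"
    using dini_dyadic_moduli[OF dini] by blast
  define \<nu> where "\<nu> = norm (\<gamma>' t0)"
  define \<tau> where "\<tau> = sgn (\<gamma>' t0)"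
  have \<nu>: "\<nu> > 0" using \<gamma>[of t0] t0 by (simp add: \<nu>_def)
  have \<tau>: "norm \<tau> = 1" "\<tau> \<noteq> 0" "\<gamma>' t0 = \<tau> * of_real \<nu>"
  proof -
    show "norm \<tau> = 1" using \<nu> by (simp add: \<tau>_def \<nu>_def norm_sgn)
    then show "\<tau> \<noteq> 0" by auto
    show "\<gamma>' t0 = \<tau> * of_real \<nu>" using \<nu> by (simp add: \<tau>_def \<nu>_def sgn_div_norm scaleR_conv_of_real)
  qed
  define \<phi> where "\<phi> z = p + \<tau> * z" for z
  define \<psi> where "\<psi> z = (z - p) / \<tau>" for z
  have inv: "\<phi> (\<psi> z) = z" "\<psi> (\<phi> z) = z" for z using \<tau>(2) by (simp_all add: \<phi>_def \<psi>_def)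
  have iso: "dist (\<psi> z) (\<psi> w) = dist z w" "dist (\<phi> z) (\<phi> w) = dist z w" for z w
  proof -
    have "\<psi> z - \<psi> w = (z - w) / \<tau>" by (simp add: \<psi>_def flip: diff_divide_distrib)
    then show "dist (\<psi> z) (\<psi> w) = dist z w" by (simp add: dist_norm norm_divide \<tau>(1))
    have "\<phi> z - \<phi> w = \<tau> * (z - w)" by (simp add: \<phi>_def algebra_simps)
    then show "dist (\<phi> z) (\<phi> w) = dist z w" by (simp add: dist_norm norm_mult \<tau>(1))
  qed
  have c\<phi>: "continuous_on S \<phi>" for S unfolding \<phi>_def[abs_def] by (intro continuous_intros)
  have c\<psi>: "continuous_on S \<psi>" for S unfolding \<psi>_def[abs_def] using \<tau>(2) by (intro continuous_intros) auto
  have frD: "frontier D \<inter> D = {}" using D by (simp add: frontier_def interior_open Diff_Int_distrib2)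
  have path: "z \<in> path_image (\<lambda>t. \<psi> (\<gamma> t)) \<longleftrightarrow> \<phi> z \<in> path_image \<gamma>" for z
    unfolding path_image_def image_iff by (metis inv)
  interpret A: smooth_boundary_arc "\<phi> -` D" "\<phi> -` N" "\<lambda>t. \<psi> (\<gamma> t)" "\<lambda>t. \<gamma>' t / \<tau>" t0 \<nu> M
  proof
    show "open (\<phi> -` D)" "open (\<phi> -` N)" using D N(1) c\<phi>[of UNIV] by (auto intro: open_vimage)
    show "0 \<in> \<phi> -` N" using N(2) by (simp add: \<phi>_def)
    show "arc (\<lambda>t. \<psi> (\<gamma> t))"
      unfolding arc_def path_def
    proof
      show "continuous_on {0..1} (\<lambda>t. \<psi> (\<gamma> t))"
        using arc continuous_on_compose2[OF c\<psi>[of UNIV]] by (auto simp: arc_def path_def)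
      show "inj_on (\<lambda>t. \<psi> (\<gamma> t)) {0..1}"
        using arc unfolding arc_def inj_on_def by (metis inv(1))
    qed
    show "z \<notin> \<phi> -` D" if "z \<in> \<phi> -` N" "z \<in> path_image (\<lambda>t. \<psi> (\<gamma> t))" for z
      using that fr frD path by blast
    show "S \<subseteq> \<phi> -` D \<or> S \<inter> \<phi> -` D = {}"
      if S: "connected S" "S \<subseteq> \<phi> -` N" "S \<inter> path_image (\<lambda>t. \<psi> (\<gamma> t)) = {}" for S
    proof -
      have "connected (\<phi> ` S)" using c\<phi> S(1) by (rule connected_continuous_image)
      moreover have "\<phi> ` S \<inter> frontier D = {}" using S(2,3) fr path by blast
      ultimately have "\<phi> ` S \<inter> D = {} \<or> \<phi> ` S - D = {}" using connected_Int_frontier by blast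
      then show ?thesis by blast
    qed
    show "0 < t0" "t0 < 1" "\<psi> (\<gamma> t0) = 0" "\<gamma>' t0 / \<tau> = of_real \<nu>" using t0 \<tau> by (auto simp: \<psi>_def)
    show "((\<lambda>t. \<psi> (\<gamma> t)) has_vector_derivative \<gamma>' t / \<tau>) (at t within {0..1})" if "t \<in> {0..1}" for t
      unfolding \<psi>_def using \<gamma>[OF that] has_vector_derivative_diff[of \<gamma> _ _ "\<lambda>t. p" 0] \<tau>(2)
      by (auto intro!: has_vector_derivative_divide derivative_eq_intros)
    show "norm (\<gamma>' x / \<tau> - \<gamma>' y / \<tau>) \<le> M j" if "x \<in> {0..1}" "y \<in> {0..1}" "\<bar>x - y\<bar> \<le> 1 / 2^(j+1)" for x y j
      using M(4)[OF that] by (simp add: norm_divide \<tau>(1) flip: diff_divide_distrib)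
    obtain e where e: "e > 0" "\<forall>s\<in>{0<..<e}. p + of_real s * (\<i> * \<gamma>' t0) \<in> D \<and> p - of_real s * (\<i> * \<gamma>' t0) \<notin> D"
      using side[of t0] t0 N(2) by auto
    have "\<phi> (\<i> * of_real (s * \<nu>)) = p + of_real s * (\<i> * \<gamma>' t0)" "\<phi> (- (\<i> * of_real (s * \<nu>))) = p - of_real s * (\<i> * \<gamma>' t0)" for s
      by (simp_all add: \<phi>_def \<tau>(3))
    then show "\<exists>e>0. \<forall>s\<in>{0<..<e}. \<i> * of_real (s * \<nu>) \<in> \<phi> -` D \<and> - (\<i> * of_real (s * \<nu>)) \<notin> \<phi> -` D"
      using e by auto
  qed (use M \<nu> in auto)
  obtain G a \<rho> T c where "local_graph (\<phi> -` D) G a \<rho> T c" using A.exists_local_graph by blast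
  then obtain U \<Psi> g r L where U: "0 \<in> U" "boundary_chart (\<phi> -` D) U \<Psi> g r L"
    using local_graph.exists_boundary_chart by metis
  note ch = U(2)[unfolded boundary_chart_def]
  have pD: "p \<notin> D"
  proof -
    have "p \<in> path_image \<gamma>" using t0 unfolding path_image_def by (intro image_eqI[of _ _ t0]) auto
    then show ?thesis using fr frD N(2) by blast
  qed
  have bd: "boundary_dist (\<phi> -` D) (\<psi> z) \<le> boundary_dist D z" for z
  proof -
    have "infdist (\<psi> z) (- (\<phi> -` D)) \<le> dist z y" if "y \<in> - D" for y
      using infdist_le[of "\<psi> y" "- (\<phi> -` D)" "\<psi> z"] that by (simp add: inv iso)
    moreover have "- D \<noteq> {}" using pD by blast
    ultimately show ?thesis unfolding boundary_dist_def infdist_notempty[OF \<open>- D \<noteq> {}\<close>] by (intro cINF_greatest) auto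
  qed
  have "boundary_chart D (\<psi> -` U) (\<lambda>z. \<Psi> (\<psi> z)) (\<lambda>x. \<phi> (g x)) r L"
    unfolding boundary_chart_def
  proof (intro conjI ballI allI impI)
    show "open (\<psi> -` U)" using ch c\<psi>[of UNIV] by (auto intro: open_vimage)
    have "\<Psi> \<circ> \<psi> holomorphic_on D"
    proof (rule holomorphic_on_compose_gen)
      show "\<psi> holomorphic_on D" unfolding \<psi>_def[abs_def] using \<tau>(2) by (intro holomorphic_intros)
      show "\<Psi> holomorphic_on \<phi> -` D" using ch by blast
    qed (auto simp: inv)
    then show "(\<lambda>z. \<Psi> (\<psi> z)) holomorphic_on D" by (simp add: o_def)
    show "(\<lambda>x. \<phi> (g x)) holomorphic_on {x. Im x > 0} \<inter> ball 0 r" unfolding \<phi>_def using ch by (intro holomorphic_intros) auto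
    fix z assume z: "z \<in> D \<inter> \<psi> -` U"
    then have z': "\<psi> z \<in> \<phi> -` D \<inter> U" by (simp add: inv)
    show "norm (\<Psi> (\<psi> z)) < r / 2" "\<phi> (g (\<Psi> (\<psi> z))) = z" using ch z' by (auto simp: inv)
    have "Im (\<Psi> (\<psi> z)) \<le> L * boundary_dist (\<phi> -` D) (\<psi> z)" using ch z' by blast
    also have "\<dots> \<le> L * boundary_dist D z" using ch bd by (intro mult_left_mono) auto
    finally show "Im (\<Psi> (\<psi> z)) \<le> L * boundary_dist D z" .
    fix w assume w: "w \<in> D \<inter> \<psi> -` U"
    then have "\<psi> w \<in> \<phi> -` D \<inter> U" by (simp add: inv)
    then have "dist (\<Psi> (\<psi> z)) (\<Psi> (\<psi> w)) \<le> L * dist (\<psi> z) (\<psi> w)" using ch z' by blast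
    then show "dist (\<Psi> (\<psi> z)) (\<Psi> (\<psi> w)) \<le> L * dist z w" by (simp add: iso)
  qed (use ch in \<open>auto simp: inv iso\<close>)
  moreover have "p \<in> \<psi> -` U" using U(1) by (simp add: \<psi>_def)
  ultimately show thesis using that by blast
qed

theorem theorem1p7:
  fixes D :: "complex set" and p :: complex
  assumes "open D" and "connected D"
    and "dini_smooth_boundary_point D p"
  shows "\<exists>U\<^sub>0. open U\<^sub>0 \<and> p \<in> U\<^sub>0 \<and>
    (\<forall>U V. open U \<and> open V \<and> p \<in> V \<and> relatively_compact_in V U \<and> U \<subseteq> U\<^sub>0 \<and> connected (D \<inter> U) \<longrightarrow>
      (\<exists>C>0. \<forall>z\<in>D \<inter> V. \<forall>w\<in>D \<inter> V.
         0 \<le> kobayashi_dist (D \<inter> U) z w - caratheodory_dist D z w \<and>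
         kobayashi_dist (D \<inter> U) z w - caratheodory_dist D z w
           \<le> C * dist z w * (dist z w + sqrt (boundary_dist D z) * sqrt (boundary_dist D w))))"
proof -
  obtain U\<^sub>0 \<Psi> g r L where p: "p \<in> U\<^sub>0" and chart: "boundary_chart D U\<^sub>0 \<Psi> g r L"
    using boundary_chart_at_dini_smooth_point[OF assms(1,3)] by blast
  note ch = chart[unfolded boundary_chart_def]
  show ?thesis
  proof (intro exI[of _ U\<^sub>0] conjI allI impI)
    show "open U\<^sub>0" using ch by blast
    show "p \<in> U\<^sub>0" by (rule p)
    fix U V assume UV: "open U \<and> open V \<and> p \<in> V \<and> relatively_compact_in V U \<and> U \<subseteq> U\<^sub>0 \<and> connected (D \<inter> U)"
    show "\<exists>C>0. \<forall>z\<in>D \<inter> V. \<forall>w\<in>D \<inter> V.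
         0 \<le> kobayashi_dist (D \<inter> U) z w - caratheodory_dist D z w \<and>
         kobayashi_dist (D \<inter> U) z w - caratheodory_dist D z w
           \<le> C * dist z w * (dist z w + sqrt (boundary_dist D z) * sqrt (boundary_dist D w))"
      by (rule localization_from_chart[where \<Psi> = \<Psi> and g = g and r = r and L = L and U\<^sub>0 = U\<^sub>0, OF assms(1)])
        (use ch UV in blast)+
  qed
qed

end
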